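(* Let $f:\mathcal{X}\to\mathbb{R}$ be a function with $\mathbb{E}[f(\theta)]=0$ for $\theta\sim\mathrm{Unif}(\mathcal{X})$. Let $G_n=(V_n,E_n)$ be a sequence of finite graphs (with $|V_n|=n$) converging locally--weakly to a random rooted graph $(G,o)$ which is infinite, locally finite, almost surely anchored--amenable and tame. Then for each $l\in\mathbb{N}$ there exists an estimator $\widehat{X}^{(l)}:\mathcal{Y}^{E_n}\times\mathcal{X}_\star^{V_n}\to\mathbb{R}^{n\times n}$ (one such map for each $n$), with runtime $O(n^2)$, such that the following holds. For almost every $\varepsilon>0$, $$\lim_{l\to\infty}\lim_{n\to\infty}\big\{\mathcal{R}_n(\widehat{X}^{(l)};f)-\mathcal{R}_n^{\mathrm{Bayes}}(f)\big\}=0.$$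
   Context: **Observation model.** $\mathcal{X}$ and $\mathcal{Y}$ are finite alphabets, $Q$ is a probability kernel from $\mathcal{X}\times\mathcal{X}$ to $\mathcal{Y}$, $\star\notin\mathcal{X}$ is an extra symbol and $\mathcal{X}_\star=\mathcal{X}\cup\{\star\}$. All graphs have a finite or countable vertex set, are connected and locally finite; edges are directed in an arbitrary way, i.e. $E$ consists of ordered pairs (distances, degrees, connectivity and boundaries refer to the underlying undirected graph). On a graph $G=(V,E)$: $\theta=(\theta_u)_{u\in V}$ are i.i.d. $\mathrm{Unif}(\mathcal{X})$; given $\theta$, the $Y_{uv}$, $(u,v)\in E$, are independent with $Y_{uv}\sim Q(\cdot\mid\theta_u,\theta_v)$; and, independently over vertices and of the rest, $\xi_u^{(\varepsilon)}=\theta_u$ with probability $\varepsilon$ and $\xi_u^{(\varepsilon)}=\star$ with probability $1-\varepsilon$ ($\varepsilon\in[0,1]$). Write $Y_G^{(\varepsilon)}=\{Y_{uv}:(u,v)\in E\}\cup\{\xi_u^{(\varepsilon)}:u\in V\}$. **Risk.** On $G_n$, $X_f$ is the $n\times n$ matrix with entries $(X_f)_{u,v}=f(\theta_u)f(\theta_v)$. An estimator $\widehat X$ is a function of $(Y_{uv})_{(u,v)\in E_n}$ and $(\xi^{(\varepsilon)}_u)_{u\in V_n}$, and its risk is $\mathcal{R}_n(\widehat X;f)=\frac1{n^2}\mathbb{E}\big[\|X_f-\widehat X\|_F^2\big]$ (Frobenius norm). $\mathcal{R}_n^{\mathrm{Bayes}}(f)$ is the minimal risk, achieved by the posterior expectation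 $\big(\mathbb{E}[f(\theta_u)f(\theta_v)\mid Y_{G_n}^{(\varepsilon)}]\big)_{u,v\in V_n}$. Both risks depend on $\varepsilon$. **Local--weak convergence.** A rooted graph $(G,o)$ is a graph with a distinguished vertex $o$; $(G,o)\equiv(G',o')$ if there is a bijection $\phi:V(G)\to V(G')$ with $\phi(o)=o'$ and $(u,v)\in E(G)\Leftrightarrow(\phi(u),\phi(v))\in E(G')$. $[G,o]_l$ is the rooted subgraph induced by the ball of radius $l$ around $o$. $(G_n,o_n)$ converges locally to $(G,o)$ if for every $l\ge0$, $[G_n,o_n]_l\equiv[G,o]_l$ for all large $n$; this gives the set $\mathcal{G}_*$ of $\equiv$-classes of rooted graphs a Polish topology. A sequence of finite graphs $(G_n)$ converges locally--weakly to a random rooted graph $(G,o)\sim\rho$ if the laws $\rho_{G_n}$ of $(G_n,o_n)$, with $o_n$ uniform in $V(G_n)$, converge weakly to $\rho$ as probability measures on $\mathcal{G}_*$. **Anchored--amenability.** For $S\subseteq V$, $\partial S=\{u\in S:\exists v\notin S,\ (u,v)\in E\}$. An infinite rooted graph $(G,o)$ is anchored--amenable if $\inf\{|\partial S|/|S|: S\subset V\text{ finite},\ o\in S\}=0$. **Tameness.** A probability measure $\rho$ on $\mathcal{G}_*$ is tame if it is supported on anchored--amenable rooted graphs and there is a sequence $S_k=S_k(G,o)$, $k\ge1$, of finite subsets of $V(G)$ containing $o$, chosen as measurable functions of $(G,o)$, with $|\partial S_k|/|S_k|\to0$ almost surely, such that for every $\eta>0$ there is $\delta>0$ with $$\limsup_{k\to\infty}\rho\Big((G,o):\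 \sum_{u\in V(G)}\frac{\mathbf 1_{o\in S_k(G,u)}}{|S_k(G,u)|}\le\delta\Big)\le\eta.$$ The random rooted graph $(G,o)$ is tame if its law is. *)

theory Defs
  imports "HOL-Probability.Probability" "HOL-Library.Landau_Symbols"
begin

section \<open>Graphs and local--weak convergence\<close>

text \<open>
  Vertex sets are finite or countable, so vertices are natural numbers. Edges are ordered pairs;
  connectivity, degrees, distances and boundaries use the underlying undirected relation
  \<open>und E\<close>. The isomorphisms respect edge directions.
\<close>

definition und :: "(nat \<times> nat) set \<Rightarrow> (nat \<times> nat) set" where
  "und E = E \<union> E\<inverse>"

definition graph :: "nat set \<Rightarrow> (nat \<times> nat) set \<Rightarrow> bool" where
  "graph V E \<longleftrightarrow> E \<subseteq> V \<times> V
     \<and> (\<forall>u\<in>V. \<forall>v\<in>V. (u, v) \<in> (und E)\<^sup>*)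
     \<and> (\<forall>u\<in>V. finite {v. (u, v) \<in> und E})"

datatype rgraph = RGraph (verts: "nat set") (edges: "(nat \<times> nat) set") (origin: nat)

definition rooted :: "rgraph \<Rightarrow> bool" where
  "rooted g \<longleftrightarrow> graph (verts g) (edges g) \<and> origin g \<in> verts g"

definition is_iso :: "(nat \<Rightarrow> nat) \<Rightarrow> rgraph \<Rightarrow> rgraph \<Rightarrow> bool" where
  "is_iso \<phi> g h \<longleftrightarrow> bij_betw \<phi> (verts g) (verts h) \<and> \<phi> (origin g) = origin h
     \<and> (\<forall>u\<in>verts g. \<forall>v\<in>verts g. (u, v) \<in> edges g \<longleftrightarrow> (\<phi> u, \<phi> v) \<in> edges h)"

definition isomorphic :: "rgraph \<Rightarrow> rgraph \<Rightarrow> bool" where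
  "isomorphic g h \<longleftrightarrow> (\<exists>\<phi>. is_iso \<phi> g h)"

definition ball_verts :: "nat \<Rightarrow> rgraph \<Rightarrow> nat set" where
  "ball_verts l g = {v. \<exists>k\<le>l. (origin g, v) \<in> und (edges g) ^^ k}"

definition rball :: "nat \<Rightarrow> rgraph \<Rightarrow> rgraph" where
  "rball l g =
     RGraph (ball_verts l g) (edges g \<inter> ball_verts l g \<times> ball_verts l g) (origin g)"

lemma isomorphic_refl: "isomorphic g g"
  unfolding isomorphic_def is_iso_def by (rule exI[of _ id]) auto

lemma is_iso_inv:
  assumes "is_iso \<phi> g h" "origin g \<in> verts g"
  shows "is_iso (inv_into (verts g) \<phi>) h g"
proof -
  let ?\<psi> = "inv_into (verts g) \<phi>"
  have bij: "bij_betw \<phi> (verts g) (verts h)" and r: "\<phi> (origin g) = origin h"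
    and e: "\<And>u v. u \<in> verts g \<Longrightarrow> v \<in> verts g \<Longrightarrow> (u, v) \<in> edges g \<longleftrightarrow> (\<phi> u, \<phi> v) \<in> edges h"
    using assms by (auto simp: is_iso_def)
  have 1: "?\<psi> (origin h) = origin g"
    using bij r assms(2) by (metis bij_betw_inv_into_left)
  have "(u, v) \<in> edges h \<longleftrightarrow> (?\<psi> u, ?\<psi> v) \<in> edges g" if "u \<in> verts h" "v \<in> verts h" for u v
  proof -
    have "?\<psi> u \<in> verts g" "?\<psi> v \<in> verts g"
      using bij_betw_apply[OF bij_betw_inv_into[OF bij]] that by blast+
    moreover have "\<phi> (?\<psi> u) = u" "\<phi> (?\<psi> v) = v"
      using bij_betw_inv_into_right[OF bij] that by blast+
    ultimately show ?thesis using e[of "?\<psi> u" "?\<psi> v"] by simp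
  qed
  then show ?thesis
    using 1 bij_betw_inv_into[OF bij] by (auto simp: is_iso_def)
qed

lemma isomorphic_sym: "isomorphic g h \<Longrightarrow> origin g \<in> verts g \<Longrightarrow> isomorphic h g"
  unfolding isomorphic_def using is_iso_inv by blast

lemma is_iso_comp:
  assumes p: "is_iso \<phi> g h" and q: "is_iso \<psi> h k"
  shows "is_iso (\<psi> \<circ> \<phi>) g k"
proof -
  have "bij_betw (\<psi> \<circ> \<phi>) (verts g) (verts k)"
    using p q by (auto simp: is_iso_def intro: bij_betw_trans)
  moreover have "\<phi> u \<in> verts h" if "u \<in> verts g" for u
    using p that by (auto simp: is_iso_def bij_betw_def)
  ultimately show ?thesis
    using p q by (auto simp: is_iso_def)
qed

lemma isomorphic_trans: "isomorphic g h \<Longrightarrow> isomorphic h k \<Longrightarrow> isomorphic g k"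
  unfolding isomorphic_def using is_iso_comp by blast

lemma origin_rball: "origin (rball l g) \<in> verts (rball l g)"
  by (auto simp: rball_def ball_verts_def intro!: exI[of _ 0])

lemma und_relpow_verts:
  assumes "rooted g" "(origin g, v) \<in> und (edges g) ^^ k"
  shows "v \<in> verts g"
  using assms by (cases k) (auto simp: rooted_def graph_def und_def)

lemma relpow_is_iso:
  assumes "is_iso \<phi> g h" "rooted g" "(origin g, v) \<in> und (edges g) ^^ k"
  shows "(origin h, \<phi> v) \<in> und (edges h) ^^ k"
  using assms(3)
proof (induction k arbitrary: v)
  case 0
  then show ?case using assms by (auto simp: is_iso_def)
next
  case (Suc k)
  then obtain w where w: "(origin g, w) \<in> und (edges g) ^^ k" "(w, v) \<in> und (edges g)" by auto
  have "w \<in> verts g" "v \<in> verts g"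
    using und_relpow_verts[OF assms(2)] w(1) Suc.prems by blast+
  then have "(\<phi> w, \<phi> v) \<in> und (edges h)"
    using w(2) assms(1) by (auto simp: und_def is_iso_def)
  then show ?case using Suc.IH[OF w(1)] by auto
qed

lemma ball_verts_subset: "rooted g \<Longrightarrow> ball_verts l g \<subseteq> verts g"
  using und_relpow_verts by (auto simp: ball_verts_def)

lemma is_iso_rball:
  assumes \<phi>: "is_iso \<phi> g h" and g: "rooted g" and h: "rooted h"
  shows "is_iso \<phi> (rball l g) (rball l h)"
proof -
  let ?\<psi> = "inv_into (verts g) \<phi>"
  have og: "origin g \<in> verts g" using g by (simp add: rooted_def)
  have bij: "bij_betw \<phi> (verts g) (verts h)" using \<phi> by (simp add: is_iso_def)
  have sub: "\<phi> ` ball_verts l g \<subseteq> ball_verts l h"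
    using relpow_is_iso[OF \<phi> g] by (fastforce simp: ball_verts_def)
  have sub': "?\<psi> ` ball_verts l h \<subseteq> ball_verts l g"
    using relpow_is_iso[OF is_iso_inv[OF \<phi> og] h] by (fastforce simp: ball_verts_def)
  have "ball_verts l h \<subseteq> \<phi> ` ball_verts l g"
  proof
    fix v assume v: "v \<in> ball_verts l h"
    then have "v \<in> verts h" using ball_verts_subset[OF h] by blast
    then have "\<phi> (?\<psi> v) = v" using bij by (simp add: bij_betw_inv_into_right)
    then show "v \<in> \<phi> ` ball_verts l g" using v sub' by force
  qed
  then have "bij_betw \<phi> (ball_verts l g) (ball_verts l h)"
    using sub bij ball_verts_subset[OF g, of l]
    by (auto simp: bij_betw_def inj_on_subset)
  then show ?thesis
    using \<phi> ball_verts_subset[OF g, of l] sub by (auto simp: is_iso_def rball_def)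
qed

quotient_type gstar = rgraph / partial: "\<lambda>g h. rooted g \<and> rooted h \<and> isomorphic g h"
  morphisms rep_gstar abs_gstar
proof (rule part_equivpI)
  define g where "g = RGraph {0} {} 0"
  have "rooted g" by (auto simp: g_def rooted_def graph_def und_def)
  then show "\<exists>g. rooted g \<and> rooted g \<and> isomorphic g g" using isomorphic_refl by blast
  show "symp (\<lambda>g h. rooted g \<and> rooted h \<and> isomorphic g h)"
    by (auto simp: symp_def rooted_def intro: isomorphic_sym)
  show "transp (\<lambda>g h. rooted g \<and> rooted h \<and> isomorphic g h)"
    by (auto simp: transp_def intro: isomorphic_trans)
qed

lift_definition same_ball :: "nat \<Rightarrow> gstar \<Rightarrow> gstar \<Rightarrow> bool" is
  "\<lambda>l g h. isomorphic (rball l g) (rball l h)"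
proof -
  fix l and g g' h h' :: rgraph
  assume a: "rooted g \<and> rooted g' \<and> isomorphic g g'" and b: "rooted h \<and> rooted h' \<and> isomorphic h h'"
  have "isomorphic (rball l g) (rball l g')" "isomorphic (rball l h) (rball l h')"
    using a b unfolding isomorphic_def by (meson is_iso_rball)+
  then show "isomorphic (rball l g) (rball l h) = isomorphic (rball l g') (rball l h')"
    by (meson isomorphic_sym isomorphic_trans origin_rball)
qed

lemma same_ball_refl: "same_ball l g g"
  by transfer (auto intro: isomorphic_refl)

lemma same_ball_sym: "same_ball l g h \<Longrightarrow> same_ball l h g"
  by transfer (meson isomorphic_sym origin_rball)

lemma same_ball_trans: "same_ball l g h \<Longrightarrow> same_ball l h k \<Longrightarrow> same_ball l g k"
  by transfer (auto intro: isomorphic_trans)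

instantiation gstar :: topological_space
begin

definition open_gstar :: "gstar set \<Rightarrow> bool" where
  "open_gstar = generate_topology (range (\<lambda>(l, g). {h. same_ball l g h}))"

instance
proof
  show "open (UNIV :: gstar set)"
    unfolding open_gstar_def by (rule generate_topology.UNIV)
  show "open (U \<inter> W)" if "open U" "open W" for U W :: "gstar set"
    using that unfolding open_gstar_def by (rule generate_topology.Int)
  show "open (\<Union>K)" if "\<forall>U\<in>K. open U" for K :: "gstar set set"
    using that unfolding open_gstar_def by (intro generate_topology.UN) auto
qed

end

text \<open>The topology is that of local convergence.\<close>

lemma tendsto_gstar_iff:
  "(X \<longlongrightarrow> g) F \<longleftrightarrow> (\<forall>l. eventually (\<lambda>n. same_ball l (X n) g) F)"
proof
  assume "(X \<longlongrightarrow> g) F"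
  show "\<forall>l. eventually (\<lambda>n. same_ball l (X n) g) F"
  proof
    fix l
    have "open {h. same_ball l g h}"
      unfolding open_gstar_def by (rule generate_topology.Basis) auto
    then have "eventually (\<lambda>n. X n \<in> {h. same_ball l g h}) F"
      by (rule topological_tendstoD[OF \<open>(X \<longlongrightarrow> g) F\<close>]) (simp add: same_ball_refl)
    then show "eventually (\<lambda>n. same_ball l (X n) g) F"
      by eventually_elim (auto intro: same_ball_sym)
  qed
next
  assume *: "\<forall>l. eventually (\<lambda>n. same_ball l (X n) g) F"
  show "(X \<longlongrightarrow> g) F"
  proof (rule topological_tendstoI)
    fix U :: "gstar set"
    assume "open U" "g \<in> U"
    then show "eventually (\<lambda>n. X n \<in> U) F"
      unfolding open_gstar_def
    proof (induction rule: generate_topology.induct)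
      case (Basis U)
      then obtain l g' where U: "U = {h. same_ball l g' h}" by auto
      from * have "eventually (\<lambda>n. same_ball l (X n) g) F" ..
      then show ?case
        by eventually_elim (use Basis U in \<open>auto intro: same_ball_trans same_ball_sym\<close>)
    next
      case (UN K)
      then obtain k where k: "k \<in> K" "g \<in> k" by auto
      with UN.IH have "eventually (\<lambda>n. X n \<in> k) F" by blast
      then show ?case by eventually_elim (use k in auto)
    qed (auto intro: eventually_conj)
  qed
qed

definition weakly_converges ::
    "(nat \<Rightarrow> 'a::topological_space measure) \<Rightarrow> 'a measure \<Rightarrow> bool" where
  "weakly_converges M N \<longleftrightarrow>
     (\<forall>h::'a \<Rightarrow> real. continuous_on UNIV h \<and> bounded (range h) \<longrightarrow>
        (\<lambda>n. \<integral>x. h x \<partial>M n) \<longlonglongrightarrow> (\<integral>x. h x \<partial>N))"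

definition root_law :: "nat \<Rightarrow> (nat \<times> nat) set \<Rightarrow> gstar measure" where
  "root_law n E = distr (measure_pmf (pmf_of_set {..<n})) borel
     (\<lambda>v. abs_gstar (RGraph {..<n} E v))"

definition locally_weakly_converges :: "(nat \<Rightarrow> (nat \<times> nat) set) \<Rightarrow> gstar measure \<Rightarrow> bool" where
  "locally_weakly_converges E \<rho> \<longleftrightarrow> weakly_converges (\<lambda>n. root_law n (E n)) \<rho>"


section \<open>Anchored amenability and tameness\<close>

definition boundary :: "rgraph \<Rightarrow> nat set \<Rightarrow> nat set" where
  "boundary g S = {u \<in> S. \<exists>v \<in> verts g - S. (u, v) \<in> und (edges g)}"

definition anchored_amenable :: "rgraph \<Rightarrow> bool" where
  "anchored_amenable g \<longleftrightarrow> infinite (verts g) \<and>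
     (INF S \<in> {S. S \<subseteq> verts g \<and> finite S \<and> origin g \<in> S}.
        real (card (boundary g S)) / real (card S)) = 0"

text \<open>
  A set-valued function \<open>S\<close> of rooted graphs is measurable if the indicator of
  \<open>v \<in> S(G, o)\<close> is a Borel function of the doubly rooted graph \<open>(G, o, v)\<close>. The
  \<open>\<sigma>\<close>-algebra below is the pull-back to labelled graphs of the Borel \<open>\<sigma>\<close>-algebra of the
  space of isomorphism classes of doubly rooted graphs. All its sets are closed under isomorphism,
  so a measurable \<open>S\<close> commutes with isomorphisms of rooted graphs, as it must in order that
  expressions such as \<open>\<bar>S(G, o)\<bar>\<close> be functions of the class of \<open>(G, o)\<close>.
\<close>

definition birooted_cylinder :: "nat \<Rightarrow> rgraph \<Rightarrow> nat \<Rightarrow> (rgraph \<times> nat) set" where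
  "birooted_cylinder l h w = {(g, v). rooted g \<and> v \<in> ball_verts l g \<and>
     (\<exists>\<phi>. is_iso \<phi> (rball l g) h \<and> \<phi> v = w)}"

definition birooted :: "(rgraph \<times> nat) measure" where
  "birooted = sigma {(g, v). rooted g \<and> v \<in> verts g}
     (range (\<lambda>(l, h, w). birooted_cylinder l h w))"

lemma birooted_cylinder_invariant:
  assumes "(g, v) \<in> birooted_cylinder l k w" "is_iso \<phi> g h" "rooted h"
  shows "(h, \<phi> v) \<in> birooted_cylinder l k w"
proof -
  from assms(1) obtain \<psi> where g: "rooted g" and v: "v \<in> ball_verts l g"
    and \<psi>: "is_iso \<psi> (rball l g) k" "\<psi> v = w"
    by (auto simp: birooted_cylinder_def)
  have b: "is_iso \<phi> (rball l g) (rball l h)"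
    by (rule is_iso_rball[OF assms(2) g assms(3)])
  then have bij: "bij_betw \<phi> (ball_verts l g) (ball_verts l h)"
    by (simp add: is_iso_def rball_def)
  have "is_iso (\<psi> \<circ> inv_into (ball_verts l g) \<phi>) (rball l h) k"
    using is_iso_comp[OF is_iso_inv[OF b] \<psi>(1)] origin_rball[of l g] by (simp add: rball_def)
  moreover have "(\<psi> \<circ> inv_into (ball_verts l g) \<phi>) (\<phi> v) = w"
    using bij_betw_inv_into_left[OF bij v] \<psi>(2) by simp
  moreover have "\<phi> v \<in> ball_verts l h"
    using bij_betw_apply[OF bij v] .
  ultimately show ?thesis
    using assms(3) by (auto simp: birooted_cylinder_def)
qed

lemma birooted_invariant:
  assumes "A \<in> sets birooted" "is_iso \<phi> g h" "rooted g" "rooted h" "v \<in> verts g"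
  shows "(g, v) \<in> A \<longleftrightarrow> (h, \<phi> v) \<in> A"
proof -
  have "A \<in> sigma_sets {(g, v). rooted g \<and> v \<in> verts g}
    (range (\<lambda>(l, h, w). birooted_cylinder l h w))"
    using assms(1) ball_verts_subset unfolding birooted_def
    by (subst (asm) sets_measure_of) (fastforce simp: birooted_cylinder_def)+
  then show ?thesis
  proof (induction rule: sigma_sets.induct)
    case (Basic A)
    then obtain l k w where A: "A = birooted_cylinder l k w" by auto
    have og: "origin g \<in> verts g" using assms(3) by (simp add: rooted_def)
    have "inv_into (verts g) \<phi> (\<phi> v) = v"
      using assms(2,5) bij_betw_inv_into_left unfolding is_iso_def by fast
    then show ?case
      using birooted_cylinder_invariant[OF _ assms(2,4)]
        birooted_cylinder_invariant[OF _ is_iso_inv[OF assms(2) og] assms(3), of "\<phi> v" l k w]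
      by (auto simp: A)
  next
    case (Compl A)
    have "\<phi> v \<in> verts h" using assms(2,5) by (auto simp: is_iso_def bij_betw_def)
    then show ?case using Compl assms by auto
  qed auto
qed

definition measurable_vertex_set :: "(rgraph \<Rightarrow> nat set) \<Rightarrow> bool" where
  "measurable_vertex_set S \<longleftrightarrow> {(g, v). rooted g \<and> v \<in> S g} \<in> sets birooted"

definition reroot :: "rgraph \<Rightarrow> nat \<Rightarrow> rgraph" where
  "reroot g u = RGraph (verts g) (edges g) u"

lemma measurable_vertex_set_equivariant:
  assumes "measurable_vertex_set S" "is_iso \<phi> g h" "rooted g" "rooted h" "v \<in> verts g"
  shows "v \<in> S g \<longleftrightarrow> \<phi> v \<in> S h"
  using birooted_invariant[OF _ assms(2-5)] assms(1,3,4)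
  by (fastforce simp: measurable_vertex_set_def)

definition received_mass :: "(rgraph \<Rightarrow> nat set) \<Rightarrow> rgraph \<Rightarrow> ennreal" where
  "received_mass S g = (\<integral>\<^sup>+ u. (if origin g \<in> S (reroot g u)
     then ennreal (1 / real (card (S (reroot g u)))) else 0) \<partial>count_space (verts g))"

text \<open>
  Properties of elements of \<^typ>\<open>gstar\<close> are evaluated at the representative
  \<^const>\<open>rep_gstar\<close>; they are all invariant under isomorphism.
\<close>

definition tame :: "gstar measure \<Rightarrow> bool" where
  "tame \<rho> \<longleftrightarrow> (AE g in \<rho>. anchored_amenable (rep_gstar g)) \<and>
     (\<exists>S :: nat \<Rightarrow> rgraph \<Rightarrow> nat set.
        (\<forall>k g. rooted g \<longrightarrow> finite (S k g) \<and> S k g \<subseteq> verts g \<and> origin g \<in> S k g) \<and>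
        (\<forall>k. measurable_vertex_set (S k)) \<and>
        (AE g in \<rho>. (\<lambda>k. real (card (boundary (rep_gstar g) (S k (rep_gstar g))))
                          / real (card (S k (rep_gstar g)))) \<longlonglongrightarrow> 0) \<and>
        (\<forall>\<eta>>0. \<exists>\<delta>>0.
           limsup (\<lambda>k. emeasure \<rho> {g. received_mass (S k) (rep_gstar g) \<le> ennreal \<delta>})
             \<le> ennreal \<eta>))"


section \<open>Observation model and risk\<close>

text \<open>
  The symbol \<open>\<star>\<close> is \<^const>\<open>None\<close>. Families indexed by vertices or edges take a default
  value outside the index set.
\<close>

type_synonym 'y edge_obs = "nat \<times> nat \<Rightarrow> 'y"
type_synonym 'x side_obs = "nat \<Rightarrow> 'x option"
type_synonym ('x, 'y) estimator = "'y edge_obs \<Rightarrow> 'x side_obs \<Rightarrow> nat \<Rightarrow> nat \<Rightarrow> real"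

definition obs_model :: "('x::finite \<Rightarrow> 'x \<Rightarrow> 'y pmf) \<Rightarrow> real \<Rightarrow> nat set \<Rightarrow> (nat \<times> nat) set \<Rightarrow>
    ((nat \<Rightarrow> 'x) \<times> 'y edge_obs \<times> 'x side_obs) pmf" where
  "obs_model Q \<epsilon> V E = do {
     \<theta> \<leftarrow> Pi_pmf V undefined (\<lambda>_. pmf_of_set UNIV);
     Y \<leftarrow> Pi_pmf E undefined (\<lambda>(u, v). Q (\<theta> u) (\<theta> v));
     \<xi> \<leftarrow> Pi_pmf V None (\<lambda>u. map_pmf (\<lambda>b. if b then Some (\<theta> u) else None) (bernoulli_pmf \<epsilon>));
     return_pmf (\<theta>, Y, \<xi>)
   }"

definition risk :: "('x::finite \<Rightarrow> 'x \<Rightarrow> 'y pmf) \<Rightarrow> ('x \<Rightarrow> real) \<Rightarrow> real \<Rightarrow> nat \<Rightarrow> (nat \<times> nat) set \<Rightarrow>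
    ('x, 'y) estimator \<Rightarrow> real" where
  "risk Q f \<epsilon> n E Xhat = 1 / (real n)\<^sup>2 *
     measure_pmf.expectation (obs_model Q \<epsilon> {..<n} E)
       (\<lambda>(\<theta>, Y, \<xi>). \<Sum>u<n. \<Sum>v<n. (f (\<theta> u) * f (\<theta> v) - Xhat Y \<xi> u v)\<^sup>2)"

definition bayes_risk :: "('x::finite \<Rightarrow> 'x \<Rightarrow> 'y pmf) \<Rightarrow> ('x \<Rightarrow> real) \<Rightarrow> real \<Rightarrow> nat \<Rightarrow>
    (nat \<times> nat) set \<Rightarrow> real" where
  "bayes_risk Q f \<epsilon> n E = (INF Xhat. risk Q f \<epsilon> n E Xhat)"


section \<open>Running time\<close>

text \<open>
  Time is counted on a real-arithmetic random access machine, programmed in a while language. There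
  are two memories, one of natural numbers and one of reals; cells are addressed by tuples of
  natural numbers and may be addressed indirectly. Natural numbers (used for addressing and control)
  can only be added, subtracted (truncated) and compared; reals can be added, subtracted,
  multiplied, divided and compared. There is no conversion from reals to natural numbers, and
  program constants are natural numbers. Each assignment and each test costs one step; expressions
  in a fixed program have bounded size, so this agrees with counting single operations up to a
  constant factor depending only on the program.
\<close>

datatype nexp = NConst nat | NCell "nexp list" | NPlus nexp nexp | NMinus nexp nexp

datatype rexp = RConst nat | RCell "nexp list" | RPlus rexp rexp | RMinus rexp rexp
  | RTimes rexp rexp | RDiv rexp rexp

datatype bexp = NLess nexp nexp | RLess rexp rexp | BNot bexp | BAnd bexp bexp

datatype com = Skip | NAssign "nexp list" nexp | RAssign "nexp list" rexp
  | Seq com com | If bexp com com | While bexp com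

type_synonym nmem = "nat list \<Rightarrow> nat"
type_synonym rmem = "nat list \<Rightarrow> real"
type_synonym mstate = "nmem \<times> rmem"

primrec nval :: "nmem \<Rightarrow> nexp \<Rightarrow> nat" where
  "nval m (NConst k) = k"
| "nval m (NCell as) = m (map (nval m) as)"
| "nval m (NPlus a b) = nval m a + nval m b"
| "nval m (NMinus a b) = nval m a - nval m b"

primrec rval :: "mstate \<Rightarrow> rexp \<Rightarrow> real" where
  "rval s (RConst k) = real k"
| "rval s (RCell as) = snd s (map (nval (fst s)) as)"
| "rval s (RPlus a b) = rval s a + rval s b"
| "rval s (RMinus a b) = rval s a - rval s b"
| "rval s (RTimes a b) = rval s a * rval s b"
| "rval s (RDiv a b) = rval s a / rval s b"

primrec bval :: "mstate \<Rightarrow> bexp \<Rightarrow> bool" where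
  "bval s (NLess a b) \<longleftrightarrow> nval (fst s) a < nval (fst s) b"
| "bval s (RLess a b) \<longleftrightarrow> rval s a < rval s b"
| "bval s (BNot b) \<longleftrightarrow> \<not> bval s b"
| "bval s (BAnd a b) \<longleftrightarrow> bval s a \<and> bval s b"

text \<open>\<open>exec c s t s'\<close>: started in \<open>s\<close>, \<open>c\<close> halts after \<open>t\<close> steps in \<open>s'\<close>.\<close>

inductive exec :: "com \<Rightarrow> mstate \<Rightarrow> nat \<Rightarrow> mstate \<Rightarrow> bool" where
  "exec Skip s 1 s"
| "exec (NAssign as e) (m, r) 1 (m(map (nval m) as := nval m e), r)"
| "exec (RAssign as e) (m, r) 1 (m, r(map (nval m) as := rval (m, r) e))"
| "exec c\<^sub>1 s\<^sub>1 t\<^sub>1 s\<^sub>2 \<Longrightarrow> exec c\<^sub>2 s\<^sub>2 t\<^sub>2 s\<^sub>3 \<Longrightarrow> exec (Seq c\<^sub>1 c\<^sub>2) s\<^sub>1 (t\<^sub>1 + t\<^sub>2) s\<^sub>3"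
| "bval s b \<Longrightarrow> exec c\<^sub>1 s t s' \<Longrightarrow> exec (If b c\<^sub>1 c\<^sub>2) s (1 + t) s'"
| "\<not> bval s b \<Longrightarrow> exec c\<^sub>2 s t s' \<Longrightarrow> exec (If b c\<^sub>1 c\<^sub>2) s (1 + t) s'"
| "\<not> bval s b \<Longrightarrow> exec (While b c) s 1 s"
| "bval s\<^sub>1 b \<Longrightarrow> exec c s\<^sub>1 t\<^sub>1 s\<^sub>2 \<Longrightarrow> exec (While b c) s\<^sub>2 t\<^sub>2 s\<^sub>3 \<Longrightarrow>
     exec (While b c) s\<^sub>1 (1 + t\<^sub>1 + t\<^sub>2) s\<^sub>3"

text \<open>
  The input consists of the number of vertices, the observations \<open>\<xi>\<close> (with \<open>0\<close> for \<open>\<star>\<close>), the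
  adjacency matrix, the observations \<open>Y\<close> on the edges, and the tables of \<open>f\<close> and \<open>Q\<close>.
  Symbols of a finite alphabet are numbered from \<open>0\<close>. All other cells are \<open>0\<close>. In particular
  nothing outside \<open>Y\<close> on \<open>E\<close> and \<open>\<xi>\<close> on \<open>{..<n}\<close> is visible.
\<close>

definition sym_code :: "'a::finite \<Rightarrow> nat" where
  "sym_code = to_nat_on UNIV"

definition sym_decode :: "nat \<Rightarrow> 'a::finite" where
  "sym_decode = from_nat_into UNIV"

definition input_nmem :: "nat \<Rightarrow> (nat \<times> nat) set \<Rightarrow> 'y::finite edge_obs \<Rightarrow> 'x::finite side_obs \<Rightarrow> nmem"
  where
  "input_nmem n E Y \<xi> = (\<lambda>a.
     if a = [0] then n
     else if \<exists>u<n. a = [0, u] then (case \<xi> (a ! 1) of None \<Rightarrow> 0 | Some x \<Rightarrow> Suc (sym_code x))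
     else if \<exists>(u, v)\<in>E. a = [0, u, v] then 1
     else if \<exists>(u, v)\<in>E. a = [1, u, v] then sym_code (Y (a ! 1, a ! 2))
     else 0)"

definition input_rmem :: "('x::finite \<Rightarrow> 'x \<Rightarrow> 'y::finite pmf) \<Rightarrow> ('x \<Rightarrow> real) \<Rightarrow> rmem" where
  "input_rmem Q f = (\<lambda>a.
     if \<exists>x<CARD('x). a = [0, x] then f (sym_decode (a ! 1))
     else if \<exists>x<CARD('x). \<exists>x'<CARD('x). \<exists>y<CARD('y). a = [0, x, x', y]
       then pmf (Q (sym_decode (a ! 1)) (sym_decode (a ! 2))) (sym_decode (a ! 3))
     else 0)"

text \<open>
  One program, not depending on \<open>n\<close>, computes the estimators for all \<open>n\<close>; the entry \<open>(u, v)\<close>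
  of the output matrix is found in the real cell \<open>[1, u, v]\<close>. The function \<open>T\<close> bounds the
  worst-case time over all observations.
\<close>

definition quadratic_time :: "('x::finite \<Rightarrow> 'x \<Rightarrow> 'y::finite pmf) \<Rightarrow> ('x \<Rightarrow> real) \<Rightarrow>
    (nat \<Rightarrow> (nat \<times> nat) set) \<Rightarrow> (nat \<Rightarrow> ('x, 'y) estimator) \<Rightarrow> bool" where
  "quadratic_time Q f E Xhat \<longleftrightarrow> (\<exists>c T.
     (\<lambda>n. real (T n)) \<in> O(\<lambda>n. (real n)\<^sup>2) \<and>
     (\<forall>n\<ge>1. \<forall>Y \<xi>. \<exists>t m r.
        exec c (input_nmem n (E n) Y \<xi>, input_rmem Q f) t (m, r) \<and> t \<le> T n \<and>
        (\<forall>u<n. \<forall>v<n. r [1, u, v] = Xhat n Y \<xi> u v)))"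

end

theory Submission
  imports Defs
begin

text \<open>
  Conditionally on the set \<open>A\<close> of vertices whose label is disclosed, the law of labels and edge
  observations does not involve \<open>\<epsilon>\<close>, and neither do the posterior laws; the parameter \<open>\<epsilon>\<close> is only the
  intensity of the random set \<open>A\<close>. The accuracy of a posterior mean is its mean square, averaged over \<open>A\<close>: the
  larger it is, the smaller the risk. As a function of \<open>\<epsilon>\<close> it is increasing, and its derivative is given by Russo's
  formula. All information theory takes place in the finite graphs \<open>G\<^sub>n\<close>; the limit graph only enters
  through averages of local functions.

  The estimator of \<open>f \<theta>\<^sub>u f \<theta>\<^sub>v\<close> is the product of the posterior means of \<open>f \<theta>\<^sub>u\<close> and of \<open>f \<theta>\<^sub>v\<close>, each given
  the observations in a ball of radius \<open>l\<close> (replaced by its centre if the ball has more than \<open>M\<^sub>l\<close>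
  vertices, which is rare and keeps the work per vertex linear in \<open>n\<close>).
  Most pairs of balls are disjoint, hence independent, and the risk tends to \<open>\<sigma>\<^sup>4 - q\<^sub>l(\<epsilon>)\<^sup>2\<close>, where
  \<open>\<sigma>\<^sup>2\<close> is the second moment of \<open>f\<close> and \<open>q\<^sub>l(\<epsilon>)\<close> the mean local accuracy at the root of the limit graph
  (\<open>local_risk_tendsto\<close>). As \<open>l\<close> grows, \<open>q\<^sub>l\<close> increases to some \<open>q(\<epsilon>)\<close>, and what has to be shown is that the
  Bayes risk is asymptotically at least \<open>\<sigma>\<^sup>4 - q(\<epsilon>)\<^sup>2\<close>.

  Two derivatives in \<open>\<epsilon>\<close> control the posterior given all observations. The first is that of the accuracy
  at \<open>u\<close>: it is a sum over \<open>v\<close> of the gains from disclosing the label of \<open>v\<close>, and such a gain dominates the squared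
  posterior covariance of \<open>f \<theta>\<^sub>u\<close> and \<open>f \<theta>\<^sub>v\<close> (\<open>covariance_le_accuracy_gain\<close>, \<open>decoupling\<close>). The accuracy is
  bounded, so most pairs are nearly uncorrelated. The second is that of an entropy
  difference attached to a region \<open>S\<close>: it dominates the sum over \<open>S\<close> of what the observations outside \<open>S\<close>
  add to the accuracy (\<open>region_gap\<close>), while the total variation of the entropy difference is at most
  \<open>\<bar>\<partial>S\<bar> ln \<bar>\<X>\<bar>\<close> (\<open>pot_total\<close>). If most vertices are covered by regions of bounded radius with small relative
  boundary, then in each interval \<open>[\<epsilon>, \<epsilon>']\<close> there is a point where both
  derivatives are small. Accuracies increase with \<open>\<epsilon>\<close>, so the Bayes risk at \<open>\<epsilon>\<close> is at least the risk of
  local estimators at \<open>\<epsilon>'\<close>, up to a small error (\<open>finite_volume_bound\<close>). Since the increasing function \<open>q\<close> is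
  continuous outside a countable set, \<open>\<epsilon>'\<close> can be sent to \<open>\<epsilon>\<close> for almost every \<open>\<epsilon>\<close>.

  The covering regions come from tameness. The sets \<open>S\<^sub>k\<close> are only measurable functions of the rooted
  graph, but each of them agrees outside an event of small probability with a function of a ball of
  finite radius (\<open>local_version\<close>), which can be transplanted to \<open>G\<^sub>n\<close>. The mass that a vertex receives may be spoiled by
  exceptional events at distant vertices; the mass transport principle, which holds for weak limits
  of finite graphs by double counting, shows that this is unlikely too (\<open>tame_local\<close>,
  \<open>finite_graph_regions\<close>).
\<close>

section \<open>Conditional expectation and entropy on a finite probability space\<close>

definition mean :: "'a pmf \<Rightarrow> ('a \<Rightarrow> real) \<Rightarrow> real" where
  "mean p g = (\<Sum>\<omega>\<in>set_pmf p. pmf p \<omega> * g \<omega>)"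

definition fibre_prob :: "'a pmf \<Rightarrow> ('a \<Rightarrow> 'z) \<Rightarrow> 'a \<Rightarrow> real" where
  "fibre_prob p Z \<omega> = mean p (\<lambda>\<omega>'. of_bool (Z \<omega>' = Z \<omega>))"

definition cond_mean :: "'a pmf \<Rightarrow> ('a \<Rightarrow> 'z) \<Rightarrow> ('a \<Rightarrow> real) \<Rightarrow> 'a \<Rightarrow> real" where
  "cond_mean p Z g \<omega> = mean p (\<lambda>\<omega>'. of_bool (Z \<omega>' = Z \<omega>) * g \<omega>') / fibre_prob p Z \<omega>"

text \<open>The accuracy of the best prediction of \<open>g\<close> from \<open>Z\<close>; its mean squared error is the second moment of \<open>g\<close>
  minus this.\<close>

definition msq :: "'a pmf \<Rightarrow> ('a \<Rightarrow> 'z) \<Rightarrow> ('a \<Rightarrow> real) \<Rightarrow> real" where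
  "msq p Z g = mean p (\<lambda>\<omega>. (cond_mean p Z g \<omega>)\<^sup>2)"

definition entropy :: "'a pmf \<Rightarrow> ('a \<Rightarrow> 'z) \<Rightarrow> real" where
  "entropy p Z = mean p (\<lambda>\<omega>. - ln (fibre_prob p Z \<omega>))"

text \<open>On the support of \<open>p\<close>, \<open>Z\<close> is a function of \<open>Z'\<close>.\<close>

definition coarser :: "'a pmf \<Rightarrow> ('a \<Rightarrow> 'z) \<Rightarrow> ('a \<Rightarrow> 'w) \<Rightarrow> bool" where
  "coarser p Z Z' \<longleftrightarrow> (\<forall>\<omega>\<in>set_pmf p. \<forall>\<omega>'\<in>set_pmf p. Z' \<omega> = Z' \<omega>' \<longrightarrow> Z \<omega> = Z \<omega>')"

lemma mean_expectation:
  assumes "finite (set_pmf p)"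
  shows "measure_pmf.expectation p g = mean p g"
  unfolding mean_def using integral_measure_pmf_real[OF assms, of p g]
  by (simp add: set_pmf_iff mult.commute)

lemma mean_map: "finite (set_pmf p) \<Longrightarrow> mean (map_pmf h p) g = mean p (\<lambda>x. g (h x))"
  using mean_expectation[of "map_pmf h p" g] mean_expectation[of p "\<lambda>x. g (h x)"] by simp

lemma mean_cong: "(\<And>\<omega>. \<omega> \<in> set_pmf p \<Longrightarrow> g \<omega> = h \<omega>) \<Longrightarrow> mean p g = mean p h"
  unfolding mean_def by (rule sum.cong) auto

lemma mean_add: "mean p (\<lambda>\<omega>. g \<omega> + h \<omega>) = mean p g + mean p h"
  by (simp add: mean_def algebra_simps sum.distrib)

lemma mean_diff: "mean p (\<lambda>\<omega>. g \<omega> - h \<omega>) = mean p g - mean p h"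
  by (simp add: mean_def algebra_simps sum_subtractf)

lemma mean_cmult: "mean p (\<lambda>\<omega>. c * g \<omega>) = c * mean p g"
  by (simp add: mean_def sum_distrib_left mult_ac)

lemma mean_mult_right: "mean p (\<lambda>\<omega>. g \<omega> * c) = mean p g * c"
  by (simp add: mean_def sum_distrib_right mult.assoc)

lemma mean_sum: "mean p (\<lambda>\<omega>. \<Sum>i\<in>I. g i \<omega>) = (\<Sum>i\<in>I. mean p (g i))"
  unfolding mean_def by (subst sum.swap) (simp add: sum_distrib_left)

lemma mean_mono: "(\<And>\<omega>. \<omega> \<in> set_pmf p \<Longrightarrow> g \<omega> \<le> h \<omega>) \<Longrightarrow> mean p g \<le> mean p h"
  unfolding mean_def by (intro sum_mono mult_left_mono) auto

lemma mean_nonneg: "(\<And>\<omega>. \<omega> \<in> set_pmf p \<Longrightarrow> 0 \<le> g \<omega>) \<Longrightarrow> 0 \<le> mean p g"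
  unfolding mean_def by (intro sum_nonneg mult_nonneg_nonneg) auto

lemma mean_const: "finite (set_pmf p) \<Longrightarrow> mean p (\<lambda>_. c) = c"
  using mean_expectation[of p "\<lambda>_. c"] by simp

lemma mean_swap: "mean p (\<lambda>\<omega>. mean q (g \<omega>)) = mean q (\<lambda>\<omega>'. mean p (\<lambda>\<omega>. g \<omega> \<omega>'))"
  unfolding mean_def sum_distrib_left by (subst sum.swap) (simp add: mult_ac)

lemma mean_point:
  assumes "finite (set_pmf p)" "\<omega> \<in> set_pmf p" "\<And>\<omega>. \<omega> \<in> set_pmf p \<Longrightarrow> 0 \<le> g \<omega>"
  shows "pmf p \<omega> * g \<omega> \<le> mean p g"
  unfolding mean_def by (rule member_le_sum[OF assms(2)]) (use assms in auto)

lemma fibre_prob_pos: "finite (set_pmf p) \<Longrightarrow> \<omega> \<in> set_pmf p \<Longrightarrow> 0 < fibre_prob p Z \<omega>"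
  using mean_point[of p \<omega> "\<lambda>\<omega>'. of_bool (Z \<omega>' = Z \<omega>)"] pmf_positive[of \<omega> p] unfolding fibre_prob_def
  by simp

lemma cond_mean_cong_fibre: "Z \<omega> = Z \<omega>' \<Longrightarrow> cond_mean p Z g \<omega> = cond_mean p Z g \<omega>'"
  by (simp add: cond_mean_def fibre_prob_def)

lemma coarserI:
  "(\<And>\<omega> \<omega>'. \<omega> \<in> set_pmf p \<Longrightarrow> \<omega>' \<in> set_pmf p \<Longrightarrow> Z' \<omega> = Z' \<omega>' \<Longrightarrow> Z \<omega> = Z \<omega>') \<Longrightarrow> coarser p Z Z'"
  unfolding coarser_def by (intro ballI impI)

lemma coarserD:
  assumes "coarser p Z Z'" "\<omega> \<in> set_pmf p" "\<omega>' \<in> set_pmf p" "Z' \<omega> = Z' \<omega>'"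
  shows "Z \<omega> = Z \<omega>'"
  by (rule assms(1)[unfolded coarser_def, rule_format, OF assms(2-4)])

lemma coarser_cond_mean: "coarser p Z Z' \<Longrightarrow> coarser p (cond_mean p Z g) Z'"
  by (rule coarserI, rule cond_mean_cong_fibre, rule coarserD)

lemma coarser_refl: "coarser p Z Z"
  by (simp add: coarser_def)

lemma coarser_trans: "coarser p Z Z' \<Longrightarrow> coarser p Z' Z'' \<Longrightarrow> coarser p Z Z''"
  by (rule coarserI, rule coarserD[of p Z Z'], assumption+, rule coarserD[of p Z' Z''])

lemma coarser_comp2:
  assumes "coarser p g Z" "coarser p h Z"
  shows "coarser p (\<lambda>\<omega>. k (g \<omega>) (h \<omega>)) Z"
proof (rule coarserI)
  fix \<omega> \<omega>' assume w: "\<omega> \<in> set_pmf p" "\<omega>' \<in> set_pmf p" "Z \<omega> = Z \<omega>'"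
  have "g \<omega> = g \<omega>'" "h \<omega> = h \<omega>'" by (rule coarserD[OF assms(1) w] coarserD[OF assms(2) w])+
  then show "k (g \<omega>) (h \<omega>) = k (g \<omega>') (h \<omega>')" by simp
qed

lemma cond_mean_tower:
  assumes "finite (set_pmf p)" "coarser p h Z"
  shows "mean p (\<lambda>\<omega>. cond_mean p Z g \<omega> * h \<omega>) = mean p (\<lambda>\<omega>. g \<omega> * h \<omega>)"
proof -
  let ?I = "\<lambda>\<omega> \<omega>'. of_bool (Z \<omega>' = Z \<omega>) :: real"
  have "mean p (\<lambda>\<omega>. cond_mean p Z g \<omega> * h \<omega>) = mean p (\<lambda>\<omega>. mean p (\<lambda>\<omega>'. ?I \<omega> \<omega>' * g \<omega>' * (h \<omega> / fibre_prob p Z \<omega>)))"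
    unfolding mean_mult_right by (simp add: cond_mean_def)
  also have "\<dots> = mean p (\<lambda>\<omega>'. mean p (\<lambda>\<omega>. ?I \<omega> \<omega>' * g \<omega>' * (h \<omega> / fibre_prob p Z \<omega>)))"
    by (rule mean_swap)
  also have "\<dots> = mean p (\<lambda>\<omega>'. mean p (\<lambda>\<omega>. ?I \<omega>' \<omega> * (g \<omega>' * h \<omega>' / fibre_prob p Z \<omega>')))"
  proof (intro mean_cong)
    fix \<omega> \<omega>' assume w: "\<omega>' \<in> set_pmf p" "\<omega> \<in> set_pmf p"
    show "?I \<omega> \<omega>' * g \<omega>' * (h \<omega> / fibre_prob p Z \<omega>) = ?I \<omega>' \<omega> * (g \<omega>' * h \<omega>' / fibre_prob p Z \<omega>')"
    proof (cases "Z \<omega>' = Z \<omega>")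
      case True
      then have "h \<omega>' = h \<omega>" "fibre_prob p Z \<omega>' = fibre_prob p Z \<omega>"
        using coarserD[OF assms(2) w] by (simp_all add: fibre_prob_def)
      then show ?thesis using True by simp
    next
      case False
      then have "Z \<omega> \<noteq> Z \<omega>'" by (rule not_sym)
      with False show ?thesis by simp
    qed
  qed
  also have "\<dots> = mean p (\<lambda>\<omega>'. fibre_prob p Z \<omega>' * (g \<omega>' * h \<omega>' / fibre_prob p Z \<omega>'))"
    unfolding mean_mult_right fibre_prob_def ..
  also have "\<dots> = mean p (\<lambda>\<omega>. g \<omega> * h \<omega>)"
  proof (rule mean_cong)
    fix \<omega> assume "\<omega> \<in> set_pmf p"
    then show "fibre_prob p Z \<omega> * (g \<omega> * h \<omega> / fibre_prob p Z \<omega>) = g \<omega> * h \<omega>"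
      using fibre_prob_pos[OF assms(1), of \<omega> Z] by simp
  qed
  finally show ?thesis .
qed

lemma msq_tower:
  assumes "finite (set_pmf p)"
  shows "msq p Z g = mean p (\<lambda>\<omega>. g \<omega> * cond_mean p Z g \<omega>)"
  using cond_mean_tower[OF assms coarser_cond_mean[OF coarser_refl], of Z g g]
  by (simp add: msq_def power2_eq_square)

lemma msq_diff:
  assumes fin: "finite (set_pmf p)" and "coarser p Z Z'"
  shows "mean p (\<lambda>\<omega>. (cond_mean p Z' g \<omega> - cond_mean p Z g \<omega>)\<^sup>2) = msq p Z' g - msq p Z g"
proof -
  have "mean p (\<lambda>\<omega>. (cond_mean p Z' g \<omega> - cond_mean p Z g \<omega>)\<^sup>2) =
    msq p Z' g - 2 * mean p (\<lambda>\<omega>. cond_mean p Z' g \<omega> * cond_mean p Z g \<omega>) + msq p Z g"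
    unfolding msq_def mean_cmult[symmetric] mean_diff[symmetric] mean_add[symmetric]
    by (intro mean_cong) (simp add: power2_diff)
  also have "mean p (\<lambda>\<omega>. cond_mean p Z' g \<omega> * cond_mean p Z g \<omega>) = msq p Z g"
    using cond_mean_tower[OF fin coarser_cond_mean[OF assms(2)], of g g] msq_tower[OF fin, of Z g] by simp
  finally show ?thesis by simp
qed

lemma msq_mono:
  assumes "finite (set_pmf p)" "coarser p Z Z'"
  shows "msq p Z g \<le> msq p Z' g"
  using msq_diff[OF assms, of g] mean_nonneg[of p "\<lambda>\<omega>. (cond_mean p Z' g \<omega> - cond_mean p Z g \<omega>)\<^sup>2"] by simp

lemma msq_nonneg: "0 \<le> msq p Z g"
  unfolding msq_def by (rule mean_nonneg) simp

lemma msq_cong: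
  assumes "\<And>\<omega> \<omega>'. \<omega> \<in> set_pmf p \<Longrightarrow> \<omega>' \<in> set_pmf p \<Longrightarrow> Z \<omega> = Z \<omega>' \<longleftrightarrow> Z' \<omega> = Z' \<omega>'"
  shows "msq p Z g = msq p Z' g"
proof -
  have "of_bool (Z \<omega>' = Z \<omega>) = (of_bool (Z' \<omega>' = Z' \<omega>) :: real)" if "\<omega> \<in> set_pmf p" "\<omega>' \<in> set_pmf p" for \<omega> \<omega>'
    using assms[OF that(2,1)] by simp
  then have "cond_mean p Z g \<omega> = cond_mean p Z' g \<omega>" if "\<omega> \<in> set_pmf p" for \<omega>
    unfolding cond_mean_def fibre_prob_def using that by (intro arg_cong2[where f = "(/)"] mean_cong) simp_all
  then show ?thesis unfolding msq_def by (intro mean_cong) simp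
qed

lemma cond_mean_id:
  assumes "finite (set_pmf p)" "coarser p g Z" "\<omega> \<in> set_pmf p"
  shows "cond_mean p Z g \<omega> = g \<omega>"
proof -
  have "mean p (\<lambda>\<omega>'. of_bool (Z \<omega>' = Z \<omega>) * g \<omega>') = mean p (\<lambda>\<omega>'. of_bool (Z \<omega>' = Z \<omega>) * g \<omega>)"
  proof (rule mean_cong)
    fix \<omega>' assume "\<omega>' \<in> set_pmf p"
    then show "of_bool (Z \<omega>' = Z \<omega>) * g \<omega>' = of_bool (Z \<omega>' = Z \<omega>) * g \<omega>"
      using coarserD[OF assms(2) _ assms(3), of \<omega>'] by (cases "Z \<omega>' = Z \<omega>") simp_all
  qed
  then show ?thesis
    using fibre_prob_pos[OF assms(1,3), of Z] by (simp add: cond_mean_def mean_mult_right fibre_prob_def[symmetric])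
qed

lemma msq_full:
  assumes "finite (set_pmf p)" "coarser p g Z"
  shows "msq p Z g = mean p (\<lambda>\<omega>. (g \<omega>)\<^sup>2)"
  unfolding msq_def using cond_mean_id[OF assms] by (intro mean_cong) simp

lemma msq_le_full:
  assumes "finite (set_pmf p)"
  shows "msq p Z g \<le> mean p (\<lambda>\<omega>. (g \<omega>)\<^sup>2)"
  using msq_mono[OF assms, of Z id g] msq_full[OF assms, of g id] by (auto simp: coarser_def)

lemma cond_mean_bound:
  assumes fin: "finite (set_pmf p)" and b: "\<And>\<omega>. \<omega> \<in> set_pmf p \<Longrightarrow> \<bar>g \<omega>\<bar> \<le> K" and "\<omega> \<in> set_pmf p"
  shows "\<bar>cond_mean p Z g \<omega>\<bar> \<le> K"
proof -
  let ?I = "\<lambda>\<omega>'. of_bool (Z \<omega>' = Z \<omega>) :: real"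
  have g: "- K \<le> g \<omega>'" "g \<omega>' \<le> K" if "\<omega>' \<in> set_pmf p" for \<omega>' using b[OF that] by auto
  have "mean p (\<lambda>\<omega>'. ?I \<omega>' * g \<omega>') \<le> mean p (\<lambda>\<omega>'. ?I \<omega>' * K)"
    by (intro mean_mono mult_left_mono g) auto
  moreover have "mean p (\<lambda>\<omega>'. ?I \<omega>' * (- K)) \<le> mean p (\<lambda>\<omega>'. ?I \<omega>' * g \<omega>')"
    by (intro mean_mono mult_left_mono g) auto
  ultimately have *: "mean p (\<lambda>\<omega>'. ?I \<omega>' * g \<omega>') \<le> fibre_prob p Z \<omega> * K"
    "fibre_prob p Z \<omega> * (- K) \<le> mean p (\<lambda>\<omega>'. ?I \<omega>' * g \<omega>')"
    unfolding mean_mult_right fibre_prob_def by auto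
  show ?thesis
    unfolding cond_mean_def abs_le_iff using * fibre_prob_pos[OF fin assms(3), of Z]
    by (simp add: divide_le_eq le_divide_eq minus_le_iff mult.commute)
qed

text \<open>Orthogonality of \<open>g - E[g | Z]\<close> to every function of \<open>Z\<close>: the conditional expectation is the
  best predictor.\<close>

lemma prediction_error_lower_bound:
  assumes fin: "finite (set_pmf p)" and h: "coarser p h Z"
  shows "mean p (\<lambda>\<omega>. (g \<omega>)\<^sup>2) - msq p Z g \<le> mean p (\<lambda>\<omega>. (g \<omega> - h \<omega>)\<^sup>2)"
proof -
  have "0 \<le> mean p (\<lambda>\<omega>. (cond_mean p Z g \<omega> - h \<omega>)\<^sup>2)" by (rule mean_nonneg) simp
  also have "\<dots> = msq p Z g - 2 * mean p (\<lambda>\<omega>. cond_mean p Z g \<omega> * h \<omega>) + mean p (\<lambda>\<omega>. (h \<omega>)\<^sup>2)"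
    unfolding msq_def mean_cmult[symmetric] mean_diff[symmetric] mean_add[symmetric]
    by (intro mean_cong) (simp add: power2_diff)
  also have "mean p (\<lambda>\<omega>. cond_mean p Z g \<omega> * h \<omega>) = mean p (\<lambda>\<omega>. g \<omega> * h \<omega>)"
    by (rule cond_mean_tower[OF fin h])
  finally have "2 * mean p (\<lambda>\<omega>. g \<omega> * h \<omega>) - mean p (\<lambda>\<omega>. (h \<omega>)\<^sup>2) \<le> msq p Z g" by simp
  moreover have "mean p (\<lambda>\<omega>. (g \<omega> - h \<omega>)\<^sup>2) =
      mean p (\<lambda>\<omega>. (g \<omega>)\<^sup>2) - 2 * mean p (\<lambda>\<omega>. g \<omega> * h \<omega>) + mean p (\<lambda>\<omega>. (h \<omega>)\<^sup>2)"
    unfolding mean_cmult[symmetric] mean_diff[symmetric] mean_add[symmetric]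
    by (intro mean_cong) (simp add: power2_diff)
  ultimately show ?thesis by simp
qed

text \<open>Conditionally on \<open>Z\<close>, the covariance of \<open>g\<close> and \<open>h\<close> is the covariance of \<open>h\<close> with the change of
  the prediction of \<open>g\<close> when \<open>h\<close> is disclosed. Hence a large average covariance makes the accuracy of
  the prediction of \<open>g\<close> jump.\<close>

lemma covariance_le_accuracy_gain:
  assumes fin: "finite (set_pmf p)" and ZZ': "coarser p Z Z'" and h: "coarser p h Z'"
    and K: "\<And>\<omega>. \<omega> \<in> set_pmf p \<Longrightarrow> \<bar>h \<omega>\<bar> \<le> K"
  shows "mean p (\<lambda>\<omega>. (cond_mean p Z (\<lambda>\<omega>. g \<omega> * h \<omega>) \<omega> - cond_mean p Z g \<omega> * cond_mean p Z h \<omega>)\<^sup>2)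
    \<le> K\<^sup>2 * (msq p Z' g - msq p Z g)"
proof -
  define d where "d \<omega> = cond_mean p Z (\<lambda>\<omega>. g \<omega> * h \<omega>) \<omega> - cond_mean p Z g \<omega> * cond_mean p Z h \<omega>" for \<omega>
  have dZ: "coarser p d Z"
    unfolding d_def
    by (intro coarser_comp2[where k = "(-)"] coarser_comp2[where k = "(*)"] coarser_cond_mean coarser_refl)
  have dgZ: "coarser p (\<lambda>\<omega>. d \<omega> * cond_mean p Z g \<omega>) Z"
    by (rule coarser_comp2[OF dZ coarser_cond_mean[OF coarser_refl]])
  have dhZ: "coarser p (\<lambda>\<omega>. d \<omega> * h \<omega>) Z'"
    by (rule coarser_comp2[OF coarser_trans[OF dZ ZZ'] h])
  have "mean p (\<lambda>\<omega>. (d \<omega>)\<^sup>2) = mean p (\<lambda>\<omega>. cond_mean p Z (\<lambda>\<omega>. g \<omega> * h \<omega>) \<omega> * d \<omega>) - mean p (\<lambda>\<omega>. cond_mean p Z h \<omega> * (d \<omega> * cond_mean p Z g \<omega>))"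
    unfolding mean_diff[symmetric] by (intro mean_cong) (simp add: d_def power2_eq_square algebra_simps)
  also have "\<dots> = mean p (\<lambda>\<omega>. g \<omega> * (d \<omega> * h \<omega>)) - mean p (\<lambda>\<omega>. h \<omega> * (d \<omega> * cond_mean p Z g \<omega>))"
    unfolding cond_mean_tower[OF fin dZ] cond_mean_tower[OF fin dgZ] by (simp add: mult_ac)
  also have "mean p (\<lambda>\<omega>. g \<omega> * (d \<omega> * h \<omega>)) = mean p (\<lambda>\<omega>. cond_mean p Z' g \<omega> * (d \<omega> * h \<omega>))"
    by (rule cond_mean_tower[OF fin dhZ, symmetric])
  also have "\<dots> - mean p (\<lambda>\<omega>. h \<omega> * (d \<omega> * cond_mean p Z g \<omega>)) = mean p (\<lambda>\<omega>. d \<omega> * (h \<omega> * (cond_mean p Z' g \<omega> - cond_mean p Z g \<omega>)))"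
    unfolding mean_diff[symmetric] by (intro mean_cong) (simp add: algebra_simps)
  also have "\<dots> \<le> mean p (\<lambda>\<omega>. (1/2) * (d \<omega>)\<^sup>2 + (K\<^sup>2/2) * (cond_mean p Z' g \<omega> - cond_mean p Z g \<omega>)\<^sup>2)"
  proof (rule mean_mono)
    fix \<omega> assume w: "\<omega> \<in> set_pmf p"
    let ?x = "cond_mean p Z' g \<omega> - cond_mean p Z g \<omega>"
    have "(h \<omega>)\<^sup>2 \<le> K\<^sup>2" using power_mono[OF K[OF w], of 2] by simp
    then have "(h \<omega> * ?x)\<^sup>2 \<le> K\<^sup>2 * ?x\<^sup>2" by (simp add: power_mult_distrib mult_right_mono)
    moreover have "0 \<le> (d \<omega> - h \<omega> * ?x)\<^sup>2" by simp
    ultimately show "d \<omega> * (h \<omega> * ?x) \<le> (1/2) * (d \<omega>)\<^sup>2 + (K\<^sup>2/2) * ?x\<^sup>2"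
      by (simp add: power2_diff)
  qed
  also have "\<dots> = (1/2) * mean p (\<lambda>\<omega>. (d \<omega>)\<^sup>2) + (K\<^sup>2/2) * (msq p Z' g - msq p Z g)"
    unfolding mean_add mean_cmult msq_diff[OF fin ZZ'] ..
  finally show ?thesis by (simp add: d_def)
qed

lemma entropy_mono:
  assumes fin: "finite (set_pmf p)" and "coarser p Z Z'"
  shows "entropy p Z \<le> entropy p Z'"
  unfolding entropy_def
proof (rule mean_mono)
  fix \<omega> assume w: "\<omega> \<in> set_pmf p"
  have "fibre_prob p Z' \<omega> \<le> fibre_prob p Z \<omega>"
    unfolding fibre_prob_def
  proof (rule mean_mono)
    fix \<omega>' assume "\<omega>' \<in> set_pmf p"
    then show "of_bool (Z' \<omega>' = Z' \<omega>) \<le> (of_bool (Z \<omega>' = Z \<omega>) :: real)"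
      using coarserD[OF assms(2) _ w, of \<omega>'] by (cases "Z' \<omega>' = Z' \<omega>") simp_all
  qed
  then show "- ln (fibre_prob p Z \<omega>) \<le> - ln (fibre_prob p Z' \<omega>)"
    using fibre_prob_pos[OF fin w, of Z'] by (simp add: ln_mono)
qed

lemma entropy_cong:
  assumes "\<And>\<omega> \<omega>'. \<omega> \<in> set_pmf p \<Longrightarrow> \<omega>' \<in> set_pmf p \<Longrightarrow> Z \<omega> = Z \<omega>' \<longleftrightarrow> Z' \<omega> = Z' \<omega>'"
  shows "entropy p Z = entropy p Z'"
proof -
  have "of_bool (Z \<omega>' = Z \<omega>) = (of_bool (Z' \<omega>' = Z' \<omega>) :: real)" if "\<omega> \<in> set_pmf p" "\<omega>' \<in> set_pmf p" for \<omega> \<omega>'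
    using assms[OF that(2,1)] by simp
  then have "fibre_prob p Z \<omega> = fibre_prob p Z' \<omega>" if "\<omega> \<in> set_pmf p" for \<omega>
    unfolding fibre_prob_def using that by (intro mean_cong) simp_all
  then show ?thesis unfolding entropy_def by (intro mean_cong) simp
qed

text \<open>Nonnegativity of the mutual information: \<open>- ln t \<ge> 1 - t\<close> for the density \<open>t\<close> of the product of the
  marginal laws with respect to the joint law.\<close>

lemma entropy_subadditive:
  assumes fin: "finite (set_pmf p)"
  shows "entropy p (\<lambda>\<omega>. (Z \<omega>, Z' \<omega>)) \<le> entropy p Z + entropy p Z'"
proof -
  let ?F = "fibre_prob p Z" and ?F' = "fibre_prob p Z'" and ?G = "fibre_prob p (\<lambda>\<omega>. (Z \<omega>, Z' \<omega>))"
  let ?I = "\<lambda>\<omega> \<omega>1 \<omega>2. of_bool (Z \<omega>2 = Z \<omega> \<and> Z' \<omega>1 = Z' \<omega>) :: real"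
  have "mean p (\<lambda>\<omega>. ?F \<omega> * ?F' \<omega> / ?G \<omega>) = mean p (\<lambda>\<omega>. mean p (\<lambda>\<omega>1. mean p (\<lambda>\<omega>2. ?I \<omega> \<omega>1 \<omega>2 / ?G \<omega>)))"
    unfolding fibre_prob_def[of p Z] fibre_prob_def[of p Z'] divide_inverse mean_mult_right[symmetric]
      mean_cmult[symmetric] by (simp add: of_bool_conj mult_ac)
  also have "\<dots> = mean p (\<lambda>\<omega>1. mean p (\<lambda>\<omega>. mean p (\<lambda>\<omega>2. ?I \<omega> \<omega>1 \<omega>2 / ?G \<omega>)))" by (rule mean_swap)
  also have "\<dots> = mean p (\<lambda>\<omega>1. mean p (\<lambda>\<omega>2. mean p (\<lambda>\<omega>. ?I \<omega> \<omega>1 \<omega>2 / ?G \<omega>)))" 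
    by (intro mean_cong mean_swap)
  also have "\<dots> \<le> mean p (\<lambda>\<omega>1. mean p (\<lambda>\<omega>2. 1))"
  proof (intro mean_mono)
    fix \<omega>1 \<omega>2 assume "\<omega>1 \<in> set_pmf p" "\<omega>2 \<in> set_pmf p"
    show "mean p (\<lambda>\<omega>. ?I \<omega> \<omega>1 \<omega>2 / ?G \<omega>) \<le> 1"
    proof (cases "\<exists>\<omega>0\<in>set_pmf p. Z \<omega>2 = Z \<omega>0 \<and> Z' \<omega>1 = Z' \<omega>0")
      case True
      then obtain \<omega>0 where w: "\<omega>0 \<in> set_pmf p" "Z \<omega>2 = Z \<omega>0" "Z' \<omega>1 = Z' \<omega>0" by blast
      have "mean p (\<lambda>\<omega>. ?I \<omega> \<omega>1 \<omega>2 / ?G \<omega>) = mean p (\<lambda>\<omega>. of_bool ((Z \<omega>, Z' \<omega>) = (Z \<omega>0, Z' \<omega>0)) * (1 / ?G \<omega>0))"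
      proof (rule mean_cong)
        fix \<omega>
        show "?I \<omega> \<omega>1 \<omega>2 / ?G \<omega> = of_bool ((Z \<omega>, Z' \<omega>) = (Z \<omega>0, Z' \<omega>0)) * (1 / ?G \<omega>0)"
          using w(2,3) by (cases "Z \<omega> = Z \<omega>0"; cases "Z' \<omega> = Z' \<omega>0") (auto simp: fibre_prob_def)
      qed
      also have "\<dots> = 1" unfolding mean_mult_right
        using fibre_prob_pos[OF fin w(1), of "\<lambda>\<omega>. (Z \<omega>, Z' \<omega>)"] by (simp add: fibre_prob_def)
      finally show ?thesis by simp
    next
      case False
      then have "mean p (\<lambda>\<omega>. ?I \<omega> \<omega>1 \<omega>2 / ?G \<omega>) = mean p (\<lambda>\<omega>. 0)" by (intro mean_cong) auto
      then show ?thesis using fin by (simp add: mean_const)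
    qed
  qed
  also have "\<dots> = 1" using fin by (simp add: mean_const)
  finally have *: "mean p (\<lambda>\<omega>. ?F \<omega> * ?F' \<omega> / ?G \<omega>) \<le> 1" .
  have "mean p (\<lambda>\<omega>. 1 - ?F \<omega> * ?F' \<omega> / ?G \<omega>) \<le> mean p (\<lambda>\<omega>. (- ln (?F \<omega>)) + (- ln (?F' \<omega>)) - (- ln (?G \<omega>)))"
  proof (rule mean_mono)
    fix \<omega> assume w: "\<omega> \<in> set_pmf p"
    have pos: "?F \<omega> > 0" "?F' \<omega> > 0" "?G \<omega> > 0" using fibre_prob_pos[OF fin w] by auto
    have "ln (?F \<omega> * ?F' \<omega> / ?G \<omega>) \<le> ?F \<omega> * ?F' \<omega> / ?G \<omega> - 1"
      by (rule ln_le_minus_one) (use pos in auto)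
    then show "1 - ?F \<omega> * ?F' \<omega> / ?G \<omega> \<le> (- ln (?F \<omega>)) + (- ln (?F' \<omega>)) - (- ln (?G \<omega>))"
      using pos by (simp add: ln_mult ln_div)
  qed
  then show ?thesis
    using * fin unfolding mean_diff mean_add entropy_def by (simp add: mean_const)
qed

text \<open>The loss of entropy of \<open>X\<close> in passing from \<open>Z\<close> to the finer \<open>Z'\<close> is the mean relative entropy of
  the two posteriors of \<open>X\<close>. It dominates the squared Hellinger distance because
  \<open>- ln t \<le> 2 (1 / sqrt t - 1)\<close>, hence the squared Euclidean distance, hence the change of every posterior mean.\<close>

lemma accuracy_gain_le_entropy_loss:
  fixes X :: "'a \<Rightarrow> 'x::finite" and f :: "'x \<Rightarrow> real"
  assumes fin: "finite (set_pmf p)" and ZZ': "coarser p Z Z'"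
  shows "msq p Z' (\<lambda>\<omega>. f (X \<omega>)) - msq p Z (\<lambda>\<omega>. f (X \<omega>))
    \<le> 4 * (\<Sum>x\<in>UNIV. (f x)\<^sup>2) * ((entropy p (\<lambda>\<omega>. (X \<omega>, Z \<omega>)) - entropy p Z) - (entropy p (\<lambda>\<omega>. (X \<omega>, Z' \<omega>)) - entropy p Z'))"
proof -
  define a where "a x \<omega> = cond_mean p Z' (\<lambda>\<omega>. of_bool (X \<omega> = x)) \<omega>" for x \<omega>
  define b where "b x \<omega> = cond_mean p Z (\<lambda>\<omega>. of_bool (X \<omega> = x)) \<omega>" for x \<omega>
  have fibre_prob_pair: "cond_mean p W (\<lambda>\<omega>. of_bool (X \<omega> = x)) \<omega> = fibre_prob p (\<lambda>\<omega>. (X \<omega>, W \<omega>)) \<omega> / fibre_prob p W \<omega>" if "X \<omega> = x"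
    for W :: "'a \<Rightarrow> 'w" and x \<omega>
  proof -
    have "mean p (\<lambda>\<omega>'. of_bool (W \<omega>' = W \<omega>) * of_bool (X \<omega>' = x)) = fibre_prob p (\<lambda>\<omega>. (X \<omega>, W \<omega>)) \<omega>"
      unfolding fibre_prob_def using that by (intro mean_cong) (simp add: of_bool_conj mult.commute)
    then show ?thesis unfolding cond_mean_def by simp
  qed
  have cond_mean_f: "cond_mean p W (\<lambda>\<omega>. f (X \<omega>)) \<omega> = (\<Sum>x\<in>UNIV. f x * cond_mean p W (\<lambda>\<omega>. of_bool (X \<omega> = x)) \<omega>)"
    for W :: "'a \<Rightarrow> 'w" and \<omega>
  proof -
    have "mean p (\<lambda>\<omega>'. of_bool (W \<omega>' = W \<omega>) * f (X \<omega>')) =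
        (\<Sum>x\<in>UNIV. f x * mean p (\<lambda>\<omega>'. of_bool (W \<omega>' = W \<omega>) * of_bool (X \<omega>' = x)))"
      unfolding mean_cmult[symmetric] mean_sum[symmetric]
      by (intro mean_cong) (simp add: of_bool_def if_distrib[where f = "\<lambda>t. _ * t"] cong: if_cong)
    then show ?thesis by (simp add: cond_mean_def sum_divide_distrib)
  qed
  have sum1: "(\<Sum>x\<in>UNIV. cond_mean p W (\<lambda>\<omega>. of_bool (X \<omega> = x)) \<omega>) = 1" if w: "\<omega> \<in> set_pmf p"
    for W :: "'a \<Rightarrow> 'w" and \<omega>
  proof -
    have "(\<Sum>x\<in>UNIV. mean p (\<lambda>\<omega>'. of_bool (W \<omega>' = W \<omega>) * of_bool (X \<omega>' = x))) = fibre_prob p W \<omega>"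
      unfolding mean_sum[symmetric] fibre_prob_def
      by (intro mean_cong) (simp add: of_bool_def if_distrib[where f = "\<lambda>t. _ * t"] cong: if_cong)
    then show ?thesis
      using fibre_prob_pos[OF fin w, of W] by (simp add: cond_mean_def sum_divide_distrib[symmetric])
  qed
  have nonneg: "0 \<le> cond_mean p W (\<lambda>\<omega>. of_bool (X \<omega> = x)) \<omega>" if w: "\<omega> \<in> set_pmf p"
    for W :: "'a \<Rightarrow> 'w" and \<omega> x
    unfolding cond_mean_def using fibre_prob_pos[OF fin w, of W]
    by (intro divide_nonneg_nonneg mean_nonneg) auto
  have pos: "0 < cond_mean p W (\<lambda>\<omega>. of_bool (X \<omega> = x)) \<omega>" if w: "\<omega> \<in> set_pmf p" and "X \<omega> = x"
    for W :: "'a \<Rightarrow> 'w" and \<omega> x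
    unfolding fibre_prob_pair[of \<omega> x W, OF that(2)]
    using fibre_prob_pos[OF fin w, of W] fibre_prob_pos[OF fin w, of "\<lambda>\<omega>. (X \<omega>, W \<omega>)"] by simp
  have e: "entropy p (\<lambda>\<omega>. (X \<omega>, W \<omega>)) - entropy p W = mean p (\<lambda>\<omega>. - ln (cond_mean p W (\<lambda>\<omega>'. of_bool (X \<omega>' = X \<omega>)) \<omega>))"
    for W :: "'a \<Rightarrow> 'w"
    unfolding entropy_def mean_diff[symmetric]
  proof (rule mean_cong)
    fix \<omega> assume w: "\<omega> \<in> set_pmf p"
    show "- ln (fibre_prob p (\<lambda>\<omega>. (X \<omega>, W \<omega>)) \<omega>) - - ln (fibre_prob p W \<omega>) = - ln (cond_mean p W (\<lambda>\<omega>'. of_bool (X \<omega>' = X \<omega>)) \<omega>)"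
      using fibre_prob_pos[OF fin w, of W] fibre_prob_pos[OF fin w, of "\<lambda>\<omega>. (X \<omega>, W \<omega>)"]
      by (simp add: fibre_prob_pair ln_div)
  qed
  let ?gap = "(entropy p (\<lambda>\<omega>. (X \<omega>, Z \<omega>)) - entropy p Z) - (entropy p (\<lambda>\<omega>. (X \<omega>, Z' \<omega>)) - entropy p Z')"
  have "?gap = mean p (\<lambda>\<omega>. ln (a (X \<omega>) \<omega>) - ln (b (X \<omega>) \<omega>))"
    unfolding e mean_diff[symmetric] by (simp add: a_def b_def)
  also have "\<dots> \<ge> mean p (\<lambda>\<omega>. 2 - 2 * sqrt (b (X \<omega>) \<omega> / a (X \<omega>) \<omega>))"
  proof (rule mean_mono)
    fix \<omega> assume w: "\<omega> \<in> set_pmf p"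
    have ab: "a (X \<omega>) \<omega> > 0" "b (X \<omega>) \<omega> > 0" using pos[OF w] by (auto simp: a_def b_def)
    have "ln (sqrt (b (X \<omega>) \<omega> / a (X \<omega>) \<omega>)) \<le> sqrt (b (X \<omega>) \<omega> / a (X \<omega>) \<omega>) - 1"
      by (rule ln_le_minus_one) (use ab in auto)
    then show "2 - 2 * sqrt (b (X \<omega>) \<omega> / a (X \<omega>) \<omega>) \<le> ln (a (X \<omega>) \<omega>) - ln (b (X \<omega>) \<omega>)"
      using ab by (simp add: ln_sqrt ln_div)
  qed
  also have "mean p (\<lambda>\<omega>. 2 - 2 * sqrt (b (X \<omega>) \<omega> / a (X \<omega>) \<omega>))
     = (\<Sum>x\<in>UNIV. mean p (\<lambda>\<omega>. of_bool (X \<omega> = x) * (2 - 2 * sqrt (b x \<omega> / a x \<omega>))))"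
    unfolding mean_sum[symmetric] by (intro mean_cong) (simp add: of_bool_def if_distrib[where f = "\<lambda>t. t * _"] cong: if_cong)
  also have "\<dots> = (\<Sum>x\<in>UNIV. mean p (\<lambda>\<omega>. a x \<omega> * (2 - 2 * sqrt (b x \<omega> / a x \<omega>))))"
  proof (intro sum.cong refl)
    fix x
    have "coarser p (\<lambda>\<omega>. 2 - 2 * sqrt (b x \<omega> / a x \<omega>)) Z'"
      unfolding a_def b_def
      by (rule coarser_comp2[where k = "\<lambda>s t. 2 - 2 * sqrt (s / t)", OF coarser_cond_mean[OF ZZ'] coarser_cond_mean[OF coarser_refl]])
    from cond_mean_tower[OF fin this, of "\<lambda>\<omega>. of_bool (X \<omega> = x)"]
    show "mean p (\<lambda>\<omega>. of_bool (X \<omega> = x) * (2 - 2 * sqrt (b x \<omega> / a x \<omega>))) = mean p (\<lambda>\<omega>. a x \<omega> * (2 - 2 * sqrt (b x \<omega> / a x \<omega>)))"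
      by (simp add: a_def)
  qed
  also have "\<dots> = mean p (\<lambda>\<omega>. \<Sum>x\<in>UNIV. a x \<omega> * (2 - 2 * sqrt (b x \<omega> / a x \<omega>)))"
    by (simp add: mean_sum)
  finally have gap: "mean p (\<lambda>\<omega>. \<Sum>x\<in>UNIV. a x \<omega> * (2 - 2 * sqrt (b x \<omega> / a x \<omega>))) \<le> ?gap" .
  have "msq p Z' (\<lambda>\<omega>. f (X \<omega>)) - msq p Z (\<lambda>\<omega>. f (X \<omega>))
      = mean p (\<lambda>\<omega>. (\<Sum>x\<in>UNIV. f x * (a x \<omega> - b x \<omega>))\<^sup>2)"
    unfolding msq_diff[OF fin ZZ', symmetric] cond_mean_f
    by (simp add: a_def b_def sum_subtractf algebra_simps)
  also have "\<dots> \<le> mean p (\<lambda>\<omega>. (4 * (\<Sum>x\<in>UNIV. (f x)\<^sup>2)) * (\<Sum>x\<in>UNIV. a x \<omega> * (2 - 2 * sqrt (b x \<omega> / a x \<omega>))))"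
  proof (rule mean_mono)
    fix \<omega> assume w: "\<omega> \<in> set_pmf p"
    have ab: "a x \<omega> \<ge> 0" "b x \<omega> \<ge> 0" for x using nonneg[OF w] by (auto simp: a_def b_def)
    have s: "(\<Sum>x\<in>UNIV. a x \<omega>) = 1" "(\<Sum>x\<in>UNIV. b x \<omega>) = 1"
      using sum1[OF w] by (auto simp: a_def b_def)
    have le1: "a x \<omega> \<le> 1" "b x \<omega> \<le> 1" for x
      using s ab member_le_sum[of x UNIV "\<lambda>x. a x \<omega>"] member_le_sum[of x UNIV "\<lambda>x. b x \<omega>"] by auto
    have pt: "(a x \<omega> - b x \<omega>)\<^sup>2 \<le> 4 * (a x \<omega> * (2 - 2 * sqrt (b x \<omega> / a x \<omega>)) + b x \<omega> - a x \<omega>)" for x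
    proof -
      define s t where "s = sqrt (a x \<omega>)" and "t = sqrt (b x \<omega>)"
      have st: "a x \<omega> = s\<^sup>2" "b x \<omega> = t\<^sup>2" "0 \<le> s" "0 \<le> t" "s \<le> 1" "t \<le> 1"
        using ab le1 by (auto simp: s_def t_def)
      have "s\<^sup>2 * sqrt (t\<^sup>2 / s\<^sup>2) = s * t"
        using st by (cases "s = 0") (auto simp: real_sqrt_divide power2_eq_square)
      then have 1: "s\<^sup>2 * (2 - 2 * sqrt (t\<^sup>2 / s\<^sup>2)) + t\<^sup>2 - s\<^sup>2 = (s - t)\<^sup>2"
        by (simp add: power2_diff algebra_simps)
      have "(s + t)\<^sup>2 \<le> 2\<^sup>2" using st by (intro power_mono) auto
      then have "(s - t)\<^sup>2 * (s + t)\<^sup>2 \<le> (s - t)\<^sup>2 * 4" by (intro mult_left_mono) auto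
      moreover have "s\<^sup>2 - t\<^sup>2 = (s - t) * (s + t)" by (simp add: power2_eq_square algebra_simps)
      ultimately have "(s\<^sup>2 - t\<^sup>2)\<^sup>2 \<le> 4 * (s - t)\<^sup>2" by (simp add: power_mult_distrib mult.commute)
      then show ?thesis unfolding st 1 .
    qed
    have "(\<Sum>x\<in>UNIV. f x * (a x \<omega> - b x \<omega>))\<^sup>2 \<le> (\<Sum>x\<in>UNIV. (f x)\<^sup>2) * (\<Sum>x\<in>UNIV. (a x \<omega> - b x \<omega>)\<^sup>2)"
      by (rule Cauchy_Schwarz_ineq_sum)
    also have "\<dots> \<le> (\<Sum>x\<in>UNIV. (f x)\<^sup>2) * (\<Sum>x\<in>UNIV. 4 * (a x \<omega> * (2 - 2 * sqrt (b x \<omega> / a x \<omega>)) + b x \<omega> - a x \<omega>))"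
      by (intro mult_left_mono sum_mono pt sum_nonneg) auto
    also have "(\<Sum>x\<in>UNIV. 4 * (a x \<omega> * (2 - 2 * sqrt (b x \<omega> / a x \<omega>)) + b x \<omega> - a x \<omega>))
        = 4 * (\<Sum>x\<in>UNIV. a x \<omega> * (2 - 2 * sqrt (b x \<omega> / a x \<omega>)))"
      by (simp add: sum_distrib_left[symmetric] sum.distrib sum_subtractf s)
    finally show "(\<Sum>x\<in>UNIV. f x * (a x \<omega> - b x \<omega>))\<^sup>2
        \<le> (4 * (\<Sum>x\<in>UNIV. (f x)\<^sup>2)) * (\<Sum>x\<in>UNIV. a x \<omega> * (2 - 2 * sqrt (b x \<omega> / a x \<omega>)))"
      by (simp add: mult_ac)
  qed
  also have "\<dots> \<le> (4 * (\<Sum>x\<in>UNIV. (f x)\<^sup>2)) * ?gap"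
    unfolding mean_cmult by (intro mult_left_mono gap mult_nonneg_nonneg sum_nonneg) auto
  finally show ?thesis .
qed

section \<open>Averages over a random set of vertices\<close>

text \<open>The mean of \<open>g\<close> at a random subset of \<open>V\<close> that contains each vertex independently with probability \<open>\<epsilon>\<close>.\<close>

definition bernoulli_mean :: "real \<Rightarrow> 'v set \<Rightarrow> ('v set \<Rightarrow> real) \<Rightarrow> real" where
  "bernoulli_mean \<epsilon> V g = (\<Sum>A\<in>Pow V. \<epsilon> ^ card A * (1 - \<epsilon>) ^ card (V - A) * g A)"

lemma bernoulli_mean_empty [simp]: "bernoulli_mean \<epsilon> {} g = g {}"
  by (simp add: bernoulli_mean_def)

lemma bernoulli_mean_cong: "(\<And>A. A \<subseteq> V \<Longrightarrow> g A = h A) \<Longrightarrow> bernoulli_mean \<epsilon> V g = bernoulli_mean \<epsilon> V h"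
  unfolding bernoulli_mean_def by (intro sum.cong) auto

lemma bernoulli_mean_insert:
  assumes "finite V" "v \<notin> V"
  shows "bernoulli_mean \<epsilon> (insert v V) g = \<epsilon> * bernoulli_mean \<epsilon> V (\<lambda>A. g (insert v A)) + (1 - \<epsilon>) * bernoulli_mean \<epsilon> V g"
proof -
  have inj: "inj_on (insert v) (Pow V)" using assms(2) by (fastforce simp: inj_on_def)
  have "bernoulli_mean \<epsilon> (insert v V) g =
     (\<Sum>A\<in>Pow V. \<epsilon> ^ card A * (1 - \<epsilon>) ^ card (insert v V - A) * g A) +
     (\<Sum>A\<in>Pow V. \<epsilon> ^ card (insert v A) * (1 - \<epsilon>) ^ card (insert v V - insert v A) * g (insert v A))"
    unfolding bernoulli_mean_def Pow_insert
    by (subst sum.union_disjoint) (use assms inj in \<open>auto simp: sum.reindex\<close>)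
  also have "(\<Sum>A\<in>Pow V. \<epsilon> ^ card A * (1 - \<epsilon>) ^ card (insert v V - A) * g A) = (1 - \<epsilon>) * bernoulli_mean \<epsilon> V g"
    unfolding bernoulli_mean_def sum_distrib_left
  proof (intro sum.cong refl)
    fix A assume "A \<in> Pow V"
    then have "insert v V - A = insert v (V - A)" "v \<notin> V - A" "finite (V - A)" using assms by auto
    then show "\<epsilon> ^ card A * (1 - \<epsilon>) ^ card (insert v V - A) * g A = (1 - \<epsilon>) * (\<epsilon> ^ card A * (1 - \<epsilon>) ^ card (V - A) * g A)"
      by simp
  qed
  also have "(\<Sum>A\<in>Pow V. \<epsilon> ^ card (insert v A) * (1 - \<epsilon>) ^ card (insert v V - insert v A) * g (insert v A))
      = \<epsilon> * bernoulli_mean \<epsilon> V (\<lambda>A. g (insert v A))"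
    unfolding bernoulli_mean_def sum_distrib_left
  proof (intro sum.cong refl)
    fix A assume "A \<in> Pow V"
    then have "insert v V - insert v A = V - A" "v \<notin> A" "finite A" using assms by (auto intro: finite_subset)
    then show "\<epsilon> ^ card (insert v A) * (1 - \<epsilon>) ^ card (insert v V - insert v A) * g (insert v A) =
        \<epsilon> * (\<epsilon> ^ card A * (1 - \<epsilon>) ^ card (V - A) * g (insert v A))" by simp
  qed
  finally show ?thesis by simp
qed

lemma bernoulli_mean_add: "bernoulli_mean \<epsilon> V (\<lambda>A. g A + h A) = bernoulli_mean \<epsilon> V g + bernoulli_mean \<epsilon> V h"
  by (simp add: bernoulli_mean_def algebra_simps sum.distrib)

lemma bernoulli_mean_diff: "bernoulli_mean \<epsilon> V (\<lambda>A. g A - h A) = bernoulli_mean \<epsilon> V g - bernoulli_mean \<epsilon> V h"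
  by (simp add: bernoulli_mean_def algebra_simps sum_subtractf)

lemma bernoulli_mean_cmult: "bernoulli_mean \<epsilon> V (\<lambda>A. c * g A) = c * bernoulli_mean \<epsilon> V g"
  by (simp add: bernoulli_mean_def sum_distrib_left mult_ac)

lemma bernoulli_mean_sum: "bernoulli_mean \<epsilon> V (\<lambda>A. \<Sum>i\<in>I. g i A) = (\<Sum>i\<in>I. bernoulli_mean \<epsilon> V (g i))"
  unfolding bernoulli_mean_def by (subst sum.swap) (simp add: sum_distrib_left)

lemma bernoulli_mean_mono:
  "0 \<le> \<epsilon> \<Longrightarrow> \<epsilon> \<le> 1 \<Longrightarrow> (\<And>A. A \<subseteq> V \<Longrightarrow> g A \<le> h A) \<Longrightarrow> bernoulli_mean \<epsilon> V g \<le> bernoulli_mean \<epsilon> V h"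
  unfolding bernoulli_mean_def by (intro sum_mono mult_left_mono mult_nonneg_nonneg) auto

lemma bernoulli_mean_const: "finite V \<Longrightarrow> bernoulli_mean \<epsilon> V (\<lambda>_. c) = c"
proof (induction V rule: finite_induct)
  case (insert v V) then show ?case by (simp add: bernoulli_mean_insert algebra_simps)
qed auto

lemma bernoulli_mean_0: "finite V \<Longrightarrow> bernoulli_mean 0 V g = g {}"
proof (induction V arbitrary: g rule: finite_induct)
  case (insert v V) then show ?case by (simp add: bernoulli_mean_insert)
qed auto

lemma bernoulli_mean_1: "finite V \<Longrightarrow> bernoulli_mean 1 V g = g V"
proof (induction V arbitrary: g rule: finite_induct)
  case (insert v V) then show ?case by (simp add: bernoulli_mean_insert)
qed auto

lemma bernoulli_mean_indep:
  assumes "finite V" "W \<inter> W' = {}"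
  shows "bernoulli_mean \<epsilon> V (\<lambda>A. g (A \<inter> W) * h (A \<inter> W')) = bernoulli_mean \<epsilon> V (\<lambda>A. g (A \<inter> W)) * bernoulli_mean \<epsilon> V (\<lambda>A. h (A \<inter> W'))"
  using assms
proof (induction V arbitrary: g h rule: finite_induct)
  case (insert v V)
  have e: "insert v A \<inter> U = (if v \<in> U then insert v (A \<inter> U) else A \<inter> U)" for A U by auto
  note IH = insert.IH[OF insert.prems]
  consider "v \<in> W" "v \<notin> W'" | "v \<notin> W" "v \<in> W'" | "v \<notin> W" "v \<notin> W'" using insert.prems by blast
  then show ?case
  proof cases
    case 1
    then show ?thesis using insert.hyps
      by (simp add: bernoulli_mean_insert e IH[of g h] IH[of "\<lambda>B. g (insert v B)" h]) (simp add: algebra_simps)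
  next
    case 2
    then show ?thesis using insert.hyps
      by (simp add: bernoulli_mean_insert e IH[of g h] IH[of g "\<lambda>B. h (insert v B)"]) (simp add: algebra_simps)
  next
    case 3
    then show ?thesis using insert.hyps
      by (simp add: bernoulli_mean_insert e IH[of g h]) (simp add: algebra_simps)
  qed
qed auto

lemma bernoulli_mean_marginal:
  assumes "finite V" "W \<subseteq> V"
  shows "bernoulli_mean \<epsilon> V (\<lambda>A. g (A \<inter> W)) = bernoulli_mean \<epsilon> W g"
  using assms
proof (induction V arbitrary: g W rule: finite_induct)
  case (insert v V)
  show ?case
  proof (cases "v \<in> W")
    case True
    define U where "U = W - {v}"
    have U: "U \<subseteq> V" "W = insert v U" "v \<notin> U" using insert True by (auto simp: U_def)
    have fU: "finite U" using U(1) insert.hyps(1) finite_subset by auto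
    have "bernoulli_mean \<epsilon> V (\<lambda>A. g (insert v A \<inter> W)) = bernoulli_mean \<epsilon> V (\<lambda>A. g (insert v (A \<inter> U)))"
      "bernoulli_mean \<epsilon> V (\<lambda>A. g (A \<inter> W)) = bernoulli_mean \<epsilon> V (\<lambda>A. g (A \<inter> U))"
      using insert.hyps U by (intro bernoulli_mean_cong arg_cong[where f = g]; blast)+
    then show ?thesis
      using insert.hyps insert.IH[OF U(1), of "\<lambda>A. g (insert v A)"] insert.IH[OF U(1), of g] fU U
      by (simp add: bernoulli_mean_insert)
  next
    case False
    then have W: "W \<subseteq> V" using insert.prems by auto
    have "bernoulli_mean \<epsilon> V (\<lambda>A. g (insert v A \<inter> W)) = bernoulli_mean \<epsilon> V (\<lambda>A. g (A \<inter> W))"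
      using False by (intro bernoulli_mean_cong arg_cong[where f = g]) auto
    then show ?thesis using insert.hyps insert.IH[OF W, of g] by (simp add: bernoulli_mean_insert algebra_simps)
  qed
qed auto

lemma bernoulli_mean_bij:
  assumes "finite W" "bij_betw \<phi> W W'"
  shows "bernoulli_mean \<epsilon> W' g = bernoulli_mean \<epsilon> W (\<lambda>A. g (\<phi> ` A))"
proof -
  have inj: "inj_on \<phi> W" and im: "W' = \<phi> ` W" using assms(2) by (auto simp: bij_betw_def)
  have P: "bij_betw (image \<phi>) (Pow W) (Pow W')" by (rule bij_betw_Pow[OF assms(2)])
  have "card (W' - \<phi> ` A) = card (W - A)" "card (\<phi> ` A) = card A" if "A \<subseteq> W" for A
  proof -
    have "W' - \<phi> ` A = \<phi> ` (W - A)" using inj im that by (auto simp: inj_on_def)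
    then show "card (W' - \<phi> ` A) = card (W - A)"
      using inj by (metis card_image inj_on_subset Diff_subset)
    show "card (\<phi> ` A) = card A" using inj that by (metis card_image inj_on_subset)
  qed
  then show ?thesis
    unfolding bernoulli_mean_def by (subst sum.reindex_bij_betw[OF P, symmetric]) (auto intro!: sum.cong)
qed

text \<open>Russo's formula. The two sets \<open>A \<union> {v}\<close> and \<open>A - {v}\<close> do not depend on whether \<open>v\<close> belongs to \<open>A\<close>, so the
  term of \<open>v\<close> is the derivative with respect to the intensity at \<open>v\<close> alone.\<close>

lemma bernoulli_mean_deriv:
  assumes "finite V"
  shows "((\<lambda>\<epsilon>. bernoulli_mean \<epsilon> V g) has_real_derivative (\<Sum>v\<in>V. bernoulli_mean \<epsilon> V (\<lambda>A. g (insert v A) - g (A - {v})))) (at \<epsilon>)"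
  using assms
proof (induction V arbitrary: g rule: finite_induct)
  case empty
  then show ?case by (simp add: bernoulli_mean_def)
next
  case (insert v V)
  have "((\<lambda>\<epsilon>. \<epsilon> * bernoulli_mean \<epsilon> V (\<lambda>A. g (insert v A)) + (1 - \<epsilon>) * bernoulli_mean \<epsilon> V g) has_real_derivative
     bernoulli_mean \<epsilon> V (\<lambda>A. g (insert v A)) - bernoulli_mean \<epsilon> V g
     + (\<epsilon> * (\<Sum>u\<in>V. bernoulli_mean \<epsilon> V (\<lambda>A. g (insert v (insert u A)) - g (insert v (A - {u}))))
     + (1 - \<epsilon>) * (\<Sum>u\<in>V. bernoulli_mean \<epsilon> V (\<lambda>A. g (insert u A) - g (A - {u}))))) (at \<epsilon>)"
    by (rule derivative_eq_intros insert.IH refl)+ (simp add: algebra_simps)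
  also have "bernoulli_mean \<epsilon> V (\<lambda>A. g (insert v A)) - bernoulli_mean \<epsilon> V g = bernoulli_mean \<epsilon> (insert v V) (\<lambda>A. g (insert v A) - g (A - {v}))"
  proof -
    have "bernoulli_mean \<epsilon> V (\<lambda>A. g (A - {v})) = bernoulli_mean \<epsilon> V g" "bernoulli_mean \<epsilon> V (\<lambda>A. g (insert v A - {v})) = bernoulli_mean \<epsilon> V g"
      using insert.hyps by (intro bernoulli_mean_cong arg_cong[where f = g]; blast)+
    then show ?thesis using insert.hyps by (simp add: bernoulli_mean_insert bernoulli_mean_diff algebra_simps)
  qed
  also have "\<epsilon> * (\<Sum>u\<in>V. bernoulli_mean \<epsilon> V (\<lambda>A. g (insert v (insert u A)) - g (insert v (A - {u}))))
     + (1 - \<epsilon>) * (\<Sum>u\<in>V. bernoulli_mean \<epsilon> V (\<lambda>A. g (insert u A) - g (A - {u})))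
     = (\<Sum>u\<in>V. bernoulli_mean \<epsilon> (insert v V) (\<lambda>A. g (insert u A) - g (A - {u})))"
    unfolding sum_distrib_left sum.distrib[symmetric]
  proof (intro sum.cong refl)
    fix u assume "u \<in> V"
    then have "insert v (A - {u}) = insert v A - {u}" for A using insert.hyps by auto
    then show "\<epsilon> * bernoulli_mean \<epsilon> V (\<lambda>A. g (insert v (insert u A)) - g (insert v (A - {u})))
      + (1 - \<epsilon>) * bernoulli_mean \<epsilon> V (\<lambda>A. g (insert u A) - g (A - {u}))
      = bernoulli_mean \<epsilon> (insert v V) (\<lambda>A. g (insert u A) - g (A - {u}))"
      using insert.hyps by (simp add: bernoulli_mean_insert insert_commute)
  qed
  finally show ?case
    using insert.hyps by (simp add: bernoulli_mean_insert[OF insert.hyps(1,2)])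
qed

lemma bernoulli_mean_increasing:
  assumes V: "finite V" and g: "\<And>A B. A \<subseteq> B \<Longrightarrow> B \<subseteq> V \<Longrightarrow> g A \<le> g B"
    and "0 \<le> \<epsilon>" "\<epsilon> \<le> \<epsilon>'" "\<epsilon>' \<le> 1"
  shows "bernoulli_mean \<epsilon> V g \<le> bernoulli_mean \<epsilon>' V g"
proof (rule DERIV_nonneg_imp_nondecreasing[OF assms(4)])
  fix x assume x: "\<epsilon> \<le> x" "x \<le> \<epsilon>'"
  have "0 \<le> bernoulli_mean x V (\<lambda>A. g (insert v A) - g (A - {v}))" if "v \<in> V" for v
    using bernoulli_mean_mono[of x V "\<lambda>_. 0" "\<lambda>A. g (insert v A) - g (A - {v})"] x assms that g
    by (auto simp: bernoulli_mean_const subset_insertI2 Diff_subset_conv subset_insertI)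
  then show "\<exists>y. ((\<lambda>\<epsilon>. bernoulli_mean \<epsilon> V g) has_real_derivative y) (at x) \<and> 0 \<le> y"
    using bernoulli_mean_deriv[OF V] by (blast intro: sum_nonneg)
qed

section \<open>The observation model\<close>

text \<open>The law of the labels and the edge observations. The disclosed labels are not part of it: they enter through
  the views below, with a deterministic set of vertices, which separates \<open>\<epsilon>\<close> from the information theory.\<close>

definition joint_pmf :: "('x::finite \<Rightarrow> 'x \<Rightarrow> 'y::finite pmf) \<Rightarrow> nat set \<Rightarrow> (nat \<times> nat) set \<Rightarrow>
    ((nat \<Rightarrow> 'x) \<times> 'y edge_obs) pmf" where
  "joint_pmf Q V E = do {
     \<theta> \<leftarrow> Pi_pmf V undefined (\<lambda>_. pmf_of_set UNIV);
     Y \<leftarrow> Pi_pmf E undefined (\<lambda>(u, v). Q (\<theta> u) (\<theta> v));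
     return_pmf (\<theta>, Y)
   }"

definition view :: "nat set \<Rightarrow> (nat \<times> nat) set \<Rightarrow> (nat \<Rightarrow> 'x) \<times> 'y edge_obs \<Rightarrow>
    (nat \<Rightarrow> 'x) \<times> 'y edge_obs" where
  "view A F \<omega> = (restrict (fst \<omega>) A, restrict (snd \<omega>) F)"

definition mask :: "nat set \<Rightarrow> (nat \<Rightarrow> 'x) \<Rightarrow> 'x side_obs" where
  "mask A \<theta> = (\<lambda>u. if u \<in> A then Some (\<theta> u) else None)"

lemma view_eq_iff:
  "view A F \<omega> = view A F \<omega>' \<longleftrightarrow> (\<forall>u\<in>A. fst \<omega> u = fst \<omega>' u) \<and> (\<forall>e\<in>F. snd \<omega> e = snd \<omega>' e)"
  unfolding view_def prod.inject restrict_def fun_eq_iff by auto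

lemma coarser_view: "A \<subseteq> A' \<Longrightarrow> F \<subseteq> F' \<Longrightarrow> coarser p (view A F) (view A' F')"
  unfolding coarser_def view_eq_iff by blast

lemma coarser_vertex: "u \<in> A \<Longrightarrow> coarser p (\<lambda>\<omega>. f (fst \<omega> u)) (view A F)"
  by (rule coarserI) (simp add: view_eq_iff)

lemma view_view: "A \<subseteq> W \<Longrightarrow> F \<subseteq> F' \<Longrightarrow> view A F (view W F' \<omega>) = view A F \<omega>"
  unfolding view_def by (auto simp: restrict_def fun_eq_iff)

lemma fst_view: "u \<in> A \<Longrightarrow> fst (view A F \<omega>) u = fst \<omega> u"
  by (simp add: view_def)

lemma mean_bind:
  assumes "finite (set_pmf p)" "\<And>x. x \<in> set_pmf p \<Longrightarrow> finite (set_pmf (q x))"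
  shows "mean (bind_pmf p q) g = mean p (\<lambda>x. mean (q x) g)"
proof -
  have fin: "finite (set_pmf (bind_pmf p q))" using assms by simp
  have "mean (bind_pmf p q) g = (\<Sum>x\<in>set_pmf p. pmf p x *\<^sub>R measure_pmf.expectation (q x) g)"
    unfolding mean_expectation[OF fin, symmetric] by (rule pmf_expectation_bind) (use assms in auto)
  also have "\<dots> = mean p (\<lambda>x. mean (q x) g)"
    unfolding mean_def[of p] by (intro sum.cong refl) (use assms in \<open>simp add: mean_expectation\<close>)
  finally show ?thesis .
qed

lemma mean_return: "mean (return_pmf x) g = g x"
  by (simp add: mean_def)

lemma finite_set_Pi_pmf:
  fixes p :: "'a \<Rightarrow> 'b::finite pmf"
  shows "finite A \<Longrightarrow> finite (set_pmf (Pi_pmf A d p))"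
  by (rule finite_subset[OF set_Pi_pmf_subset']) (auto intro!: finite_PiE_dflt)

lemma finite_joint_pmf: "finite V \<Longrightarrow> finite E \<Longrightarrow> finite (set_pmf (joint_pmf Q V E))"
  by (auto simp: joint_pmf_def intro!: finite_set_Pi_pmf)

lemma mean_joint_pmf:
  assumes "finite V" "finite E"
  shows "mean (joint_pmf Q V E) g = mean (Pi_pmf V undefined (\<lambda>_. pmf_of_set UNIV))
     (\<lambda>\<theta>. mean (Pi_pmf E undefined (\<lambda>(u, v). Q (\<theta> u) (\<theta> v))) (\<lambda>Y. g (\<theta>, Y)))"
  unfolding joint_pmf_def using assms by (simp add: mean_bind mean_return finite_set_Pi_pmf)

text \<open>An edge observation depends on the labels of its end points only, so the model on a subgraph is the
  restriction of the model on the graph.\<close>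

lemma joint_pmf_marginal:
  assumes fin: "finite V" "finite E" and W: "W \<subseteq> V" and F: "F \<subseteq> E" "F \<subseteq> W \<times> W"
  shows "map_pmf (view W F) (joint_pmf Q V E) = joint_pmf Q W F"
proof -
  let ?T = "Pi_pmf V undefined (\<lambda>_. pmf_of_set UNIV)"
  have "map_pmf (view W F) (joint_pmf Q V E) = ?T \<bind> (\<lambda>\<theta>. map_pmf (\<lambda>Y. (restrict \<theta> W, Y))
      (map_pmf (\<lambda>Y. restrict Y F) (Pi_pmf E undefined (\<lambda>(u, v). Q (\<theta> u) (\<theta> v)))))"
    by (simp add: joint_pmf_def map_bind_pmf view_def map_pmf_def bind_assoc_pmf bind_return_pmf)
  also have "\<dots> = ?T \<bind> (\<lambda>\<theta>. map_pmf (\<lambda>Y. (restrict \<theta> W, Y))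
      (Pi_pmf F undefined (\<lambda>(u, v). Q (restrict \<theta> W u) (restrict \<theta> W v))))"
  proof (intro bind_pmf_cong refl arg_cong2[where f = map_pmf])
    fix \<theta> :: "nat \<Rightarrow> 'a"
    have "map_pmf (\<lambda>Y. restrict Y F) (Pi_pmf E undefined (\<lambda>(u, v). Q (\<theta> u) (\<theta> v)))
        = Pi_pmf F undefined (\<lambda>(u, v). Q (\<theta> u) (\<theta> v))"
      unfolding restrict_def by (rule Pi_pmf_subset[OF fin(2) F(1), symmetric])
    also have "\<dots> = Pi_pmf F undefined (\<lambda>(u, v). Q (restrict \<theta> W u) (restrict \<theta> W v))"
      using F(2) by (intro Pi_pmf_cong) auto
    finally show "map_pmf (\<lambda>Y. restrict Y F) (Pi_pmf E undefined (\<lambda>(u, v). Q (\<theta> u) (\<theta> v))) = \<dots>" .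
  qed
  also have "\<dots> = map_pmf (\<lambda>\<theta>. restrict \<theta> W) ?T \<bind> (\<lambda>\<theta>. map_pmf (Pair \<theta>)
      (Pi_pmf F undefined (\<lambda>(u, v). Q (\<theta> u) (\<theta> v))))"
    by (simp add: bind_map_pmf)
  also have "map_pmf (\<lambda>\<theta>. restrict \<theta> W) ?T = Pi_pmf W undefined (\<lambda>_. pmf_of_set UNIV)"
    unfolding restrict_def by (rule Pi_pmf_subset[OF fin(1) W, symmetric])
  finally show ?thesis by (simp add: joint_pmf_def map_pmf_def)
qed

lemma mean_joint_pmf_marginal:
  assumes "finite V" "finite E" "W \<subseteq> V" "F \<subseteq> E" "F \<subseteq> W \<times> W"
  shows "mean (joint_pmf Q V E) (\<lambda>\<omega>. g (view W F \<omega>)) = mean (joint_pmf Q W F) g"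
  using mean_map[of "joint_pmf Q V E" "view W F" g] finite_joint_pmf[of V E Q] joint_pmf_marginal[OF assms, of Q] assms by simp

lemma joint_pmf_union:
  assumes fin: "finite W" "finite W'" "finite F" "finite F'"
    and disj: "W \<inter> W' = {}" and F: "F \<subseteq> W \<times> W" "F' \<subseteq> W' \<times> W'"
  shows "mean (joint_pmf Q (W \<union> W') (F \<union> F')) (\<lambda>\<omega>. g (view W F \<omega>) * h (view W' F' \<omega>))
    = mean (joint_pmf Q W F) g * mean (joint_pmf Q W' F') h"
proof -
  let ?T = "\<lambda>W. Pi_pmf W undefined (\<lambda>_. pmf_of_set UNIV) :: (nat \<Rightarrow> 'a) pmf"
  let ?Y = "\<lambda>F \<theta>. Pi_pmf F undefined (\<lambda>(u, v). Q (\<theta> u) (\<theta> v))"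
  let ?m = "\<lambda>W (a, b) x. if x \<in> W then a x else b x"
  have dF: "F \<inter> F' = {}" using F disj by blast
  have meanu: "mean (Pi_pmf (A \<union> B) undefined p) k = mean (Pi_pmf A undefined p) (\<lambda>a. mean (Pi_pmf B undefined p)
       (\<lambda>b. k (\<lambda>x. if x \<in> A then a x else b x)))"
    if "finite A" "finite B" "A \<inter> B = {}" for A B :: "'i set" and p :: "'i \<Rightarrow> 'j::finite pmf" and k
    unfolding Pi_pmf_union[OF that]
    by (simp add: pair_pmf_def map_bind_pmf mean_bind mean_return finite_set_Pi_pmf that)
  have gl: "mean (?Y (F \<union> F') (\<lambda>x. if x \<in> W then a x else b x)) (\<lambda>Y. g (view W F (\<lambda>x. if x \<in> W then a x else b x, Y))
        * h (view W' F' (\<lambda>x. if x \<in> W then a x else b x, Y)))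
     = mean (?Y F a) (\<lambda>Y. g (a, Y)) * mean (?Y F' b) (\<lambda>Y. h (b, Y))" (is "?l = _")
    if a: "a \<in> set_pmf (?T W)" and b: "b \<in> set_pmf (?T W')" for a b
  proof -
    let ?t = "\<lambda>x. if x \<in> W then a x else b x"
    have ea: "restrict ?t W = a" and eb: "restrict ?t W' = b"
      using a b set_Pi_pmf_subset[of W undefined] set_Pi_pmf_subset[of W' undefined] fin disj
      by (fastforce simp: fun_eq_iff)+
    have Ya: "?Y F ?t = ?Y F a" "?Y F' ?t = ?Y F' b"
      using F disj by (intro Pi_pmf_cong refl; fastforce)+
    have "?l = mean (?Y F a) (\<lambda>y. mean (?Y F' b) (\<lambda>y'. g (a, restrict (\<lambda>x. if x \<in> F then y x else y' x) F)
         * h (b, restrict (\<lambda>x. if x \<in> F then y x else y' x) F')))"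
      unfolding meanu[OF fin(3,4) dF] Ya view_def fst_conv snd_conv ea eb ..
    also have "\<dots> = mean (?Y F a) (\<lambda>y. mean (?Y F' b) (\<lambda>y'. g (a, y) * h (b, y')))"
    proof (intro mean_cong)
      fix y y' assume y: "y \<in> set_pmf (?Y F a)" and y': "y' \<in> set_pmf (?Y F' b)"
      have "restrict (\<lambda>x. if x \<in> F then y x else y' x) F = y"
        using y set_Pi_pmf_subset[OF fin(3), of undefined] by (fastforce simp: fun_eq_iff)
      moreover have "restrict (\<lambda>x. if x \<in> F then y x else y' x) F' = y'"
        using y' set_Pi_pmf_subset[OF fin(4), of undefined] dF by (fastforce simp: fun_eq_iff)
      ultimately show "g (a, restrict (\<lambda>x. if x \<in> F then y x else y' x) F)
         * h (b, restrict (\<lambda>x. if x \<in> F then y x else y' x) F') = g (a, y) * h (b, y')" by simp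
    qed
    finally show ?thesis by (simp add: mean_cmult mean_mult_right)
  qed
  have "mean (joint_pmf Q (W \<union> W') (F \<union> F')) (\<lambda>\<omega>. g (view W F \<omega>) * h (view W' F' \<omega>))
    = mean (?T W) (\<lambda>a. mean (?T W') (\<lambda>b. mean (?Y F a) (\<lambda>Y. g (a, Y)) * mean (?Y F' b) (\<lambda>Y. h (b, Y))))"
    using fin disj by (simp add: mean_joint_pmf meanu gl cong: mean_cong)
  also have "\<dots> = mean (joint_pmf Q W F) g * mean (joint_pmf Q W' F') h"
    using fin by (simp add: mean_joint_pmf mean_cmult mean_mult_right)
  finally show ?thesis .
qed

lemma mean_joint_pmf_indep:
  assumes fin: "finite V" "finite E" and W: "W \<subseteq> V" "W' \<subseteq> V" "W \<inter> W' = {}"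
    and F: "F \<subseteq> E" "F \<subseteq> W \<times> W" "F' \<subseteq> E" "F' \<subseteq> W' \<times> W'"
  shows "mean (joint_pmf Q V E) (\<lambda>\<omega>. g (view W F \<omega>) * h (view W' F' \<omega>))
    = mean (joint_pmf Q V E) (\<lambda>\<omega>. g (view W F \<omega>)) * mean (joint_pmf Q V E) (\<lambda>\<omega>. h (view W' F' \<omega>))"
proof -
  have "finite W" "finite W'" "finite F" "finite F'" using fin W F by (meson finite_subset)+
  note u = joint_pmf_union[OF this W(3) F(2,4), of Q g h]
  have "mean (joint_pmf Q V E) (\<lambda>\<omega>. (\<lambda>\<omega>. g (view W F \<omega>) * h (view W' F' \<omega>)) (view (W \<union> W') (F \<union> F') \<omega>))
      = mean (joint_pmf Q (W \<union> W') (F \<union> F')) (\<lambda>\<omega>. g (view W F \<omega>) * h (view W' F' \<omega>))"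
    by (rule mean_joint_pmf_marginal) (use assms in auto)
  then have "mean (joint_pmf Q V E) (\<lambda>\<omega>. g (view W F \<omega>) * h (view W' F' \<omega>))
      = mean (joint_pmf Q (W \<union> W') (F \<union> F')) (\<lambda>\<omega>. g (view W F \<omega>) * h (view W' F' \<omega>))"
    by (simp add: view_view)
  then show ?thesis
    using u mean_joint_pmf_marginal[OF fin W(1) F(1,2), of Q g] mean_joint_pmf_marginal[OF fin W(2) F(3,4), of Q h] by simp
qed

text \<open>Integrating out the edge observations leaves the likelihood.\<close>

lemma mean_joint_pmf_likelihood:
  fixes h :: "(nat \<Rightarrow> 'x::finite) \<Rightarrow> real"
  assumes fin: "finite W" "finite F"
  shows "mean (joint_pmf Q W F) (\<lambda>\<omega>. h (fst \<omega>) * of_bool (restrict (snd \<omega>) F = restrict Y F))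
    = (\<Sum>x\<in>PiE W (\<lambda>_. UNIV). h x * (\<Prod>(a, b)\<in>F. pmf (Q (x a) (x b)) (Y (a, b)))) / real CARD('x) ^ card W"
proof -
  have 1: "mean (Pi_pmf F undefined (\<lambda>(u, v). Q (\<theta> u) (\<theta> v))) (\<lambda>y. h \<theta> * of_bool (restrict y F = restrict Y F))
     = h \<theta> * (\<Prod>(a, b)\<in>F. pmf (Q (\<theta> a) (\<theta> b)) (Y (a, b)))" for \<theta> :: "nat \<Rightarrow> 'x"
  proof -
    let ?p = "Pi_pmf F undefined (\<lambda>(u, v). Q (\<theta> u) (\<theta> v))"
    have "mean ?p (\<lambda>y. of_bool (restrict y F = restrict Y F)) = mean ?p (\<lambda>y. of_bool (y = restrict Y F))"
    proof (rule mean_cong)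
      fix y assume "y \<in> set_pmf ?p"
      then have "restrict y F = y" using set_Pi_pmf_subset[OF fin(2), of undefined] by (fastforce simp: fun_eq_iff)
      then show "of_bool (restrict y F = restrict Y F) = (of_bool (y = restrict Y F) :: real)" by simp
    qed
    also have "\<dots> = pmf ?p (restrict Y F)"
      using finite_set_Pi_pmf[OF fin(2), of undefined "\<lambda>(u, v). Q (\<theta> u) (\<theta> v)"]
      by (simp add: mean_def of_bool_def if_distrib[where f = "\<lambda>t. _ * t"] set_pmf_iff cong: if_cong)
    also have "\<dots> = (\<Prod>(a, b)\<in>F. pmf (Q (\<theta> a) (\<theta> b)) (Y (a, b)))"
      by (subst pmf_Pi'[OF fin(2)]) (auto intro!: prod.cong)
    finally show ?thesis by (simp add: mean_cmult)
  qed
  have e: "PiE_dflt W undefined (\<lambda>_. UNIV) = PiE W (\<lambda>_. UNIV :: 'x set)"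
    by (auto simp: PiE_dflt_def PiE_def extensional_def)
  have finPiE: "finite (PiE W (\<lambda>_. UNIV :: 'x set))" using fin by (auto intro: finite_PiE)
  have neP: "PiE W (\<lambda>_. UNIV :: 'x set) \<noteq> {}" by (simp add: PiE_eq_empty_iff)
  have 2: "Pi_pmf W undefined (\<lambda>_. pmf_of_set (UNIV :: 'x set)) = pmf_of_set (PiE W (\<lambda>_. UNIV))"
    using Pi_pmf_of_set[OF fin(1), of "\<lambda>_. UNIV :: 'x set" undefined] by (simp add: e)
  have "mean (joint_pmf Q W F) (\<lambda>\<omega>. h (fst \<omega>) * of_bool (restrict (snd \<omega>) F = restrict Y F))
     = mean (pmf_of_set (PiE W (\<lambda>_. UNIV))) (\<lambda>\<theta>. h \<theta> * (\<Prod>(a, b)\<in>F. pmf (Q (\<theta> a) (\<theta> b)) (Y (a, b))))"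
    unfolding mean_joint_pmf[OF fin] fst_conv snd_conv 1 2 ..
  also have "\<dots> = (\<Sum>x\<in>PiE W (\<lambda>_. UNIV). h x * (\<Prod>(a, b)\<in>F. pmf (Q (x a) (x b)) (Y (a, b)))) / real CARD('x) ^ card W"
    unfolding mean_def using finPiE neP fin
    by (simp add: set_pmf_of_set sum_divide_distrib card_PiE)
  finally show ?thesis .
qed

subsection \<open>Invariance under isomorphism\<close>

lemma Pi_pmf_reindex:
  assumes "finite A" "inj_on \<phi> A"
  shows "Pi_pmf A d (\<lambda>x. p (\<phi> x)) = map_pmf (\<lambda>g x. if x \<in> A then g (\<phi> x) else d) (Pi_pmf (\<phi> ` A) d p)"
  using assms
proof (induction A rule: finite_induct)
  case (insert a A)
  have n: "\<phi> a \<notin> \<phi> ` A" using insert by auto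
  have 1: "Pi_pmf (insert a A) d (\<lambda>x. p (\<phi> x)) = p (\<phi> a) \<bind> (\<lambda>y. Pi_pmf (\<phi> ` A) d p \<bind>
     (\<lambda>g. return_pmf ((\<lambda>x. if x \<in> A then g (\<phi> x) else d)(a := y))))"
    using insert by (simp add: Pi_pmf_insert' bind_map_pmf)
  have 2: "(\<lambda>x. if x \<in> A then g (\<phi> x) else d)(a := y) = (\<lambda>x. if x \<in> insert a A then (g(\<phi> a := y)) (\<phi> x) else d)"
    for g y using n by (intro ext) (force simp: image_iff)
  show ?case unfolding 1 2 using insert n by (simp add: Pi_pmf_insert' map_bind_pmf)
qed auto

definition pull :: "(nat \<Rightarrow> nat) \<Rightarrow> nat set \<Rightarrow> (nat \<times> nat) set \<Rightarrow> (nat \<Rightarrow> 'x) \<times> 'y edge_obs \<Rightarrow>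
    (nat \<Rightarrow> 'x) \<times> 'y edge_obs" where
  "pull \<phi> W F \<omega> = (\<lambda>u. if u \<in> W then fst \<omega> (\<phi> u) else undefined,
     \<lambda>e. if e \<in> F then snd \<omega> (map_prod \<phi> \<phi> e) else undefined)"

lemma joint_pmf_iso:
  assumes fin: "finite W" "finite F" and F: "F \<subseteq> W \<times> W" and inj: "inj_on \<phi> W"
  shows "joint_pmf Q W F = map_pmf (pull \<phi> W F) (joint_pmf Q (\<phi> ` W) (map_prod \<phi> \<phi> ` F))"
proof -
  have injF: "inj_on (map_prod \<phi> \<phi>) F"
    by (rule inj_on_subset[OF map_prod_inj_on[OF inj inj] F])
  have "joint_pmf Q W F = Pi_pmf (\<phi> ` W) undefined (\<lambda>_. pmf_of_set UNIV) \<bind>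
     (\<lambda>\<theta>. Pi_pmf F undefined (\<lambda>(u, v). Q (if u \<in> W then \<theta> (\<phi> u) else undefined) (if v \<in> W then \<theta> (\<phi> v) else undefined)) \<bind>
       (\<lambda>Y. return_pmf (\<lambda>u. if u \<in> W then \<theta> (\<phi> u) else undefined, Y)))"
    unfolding joint_pmf_def Pi_pmf_reindex[OF fin(1) inj, of undefined "\<lambda>_. pmf_of_set UNIV"] bind_map_pmf ..
  also have "\<dots> = Pi_pmf (\<phi> ` W) undefined (\<lambda>_. pmf_of_set UNIV) \<bind>
     (\<lambda>\<theta>. Pi_pmf F undefined (\<lambda>e. (\<lambda>(u, v). Q (\<theta> u) (\<theta> v)) (map_prod \<phi> \<phi> e)) \<bind>
       (\<lambda>Y. return_pmf (\<lambda>u. if u \<in> W then \<theta> (\<phi> u) else undefined, Y)))"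
    using F by (intro bind_pmf_cong refl Pi_pmf_cong) auto
  also have "\<dots> = map_pmf (pull \<phi> W F) (joint_pmf Q (\<phi> ` W) (map_prod \<phi> \<phi> ` F))"
    unfolding Pi_pmf_reindex[OF fin(2) injF] joint_pmf_def
    by (simp only: bind_map_pmf map_bind_pmf pull_def map_return_pmf fst_conv snd_conv)
  finally show ?thesis .
qed

lemma msq_map:
  assumes "finite (set_pmf p)"
  shows "msq (map_pmf h p) Z g = msq p (\<lambda>\<omega>. Z (h \<omega>)) (\<lambda>\<omega>. g (h \<omega>))"
  using assms by (simp add: msq_def cond_mean_def fibre_prob_def mean_map)

text \<open>The accuracy of the prediction of \<open>f \<theta>\<^sub>u\<close> from the observations on a subgraph with vertices \<open>W\<close>
  and edges \<open>F\<close>.\<close>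

definition acc :: "('x::finite \<Rightarrow> 'x \<Rightarrow> 'y::finite pmf) \<Rightarrow> ('x \<Rightarrow> real) \<Rightarrow> real \<Rightarrow> nat set \<Rightarrow>
    (nat \<times> nat) set \<Rightarrow> nat \<Rightarrow> real" where
  "acc Q f \<epsilon> W F u = bernoulli_mean \<epsilon> W (\<lambda>A. msq (joint_pmf Q W F) (view A F) (\<lambda>\<omega>. f (fst \<omega> u)))"

lemma msq_joint_pmf_marginal:
  assumes "finite V" "finite E" "W \<subseteq> V" "F \<subseteq> E" "F \<subseteq> W \<times> W" "A \<subseteq> W" "u \<in> W"
  shows "msq (joint_pmf Q V E) (view A F) (\<lambda>\<omega>. f (fst \<omega> u)) = msq (joint_pmf Q W F) (view A F) (\<lambda>\<omega>. f (fst \<omega> u))"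
  unfolding joint_pmf_marginal[OF assms(1-5), symmetric] msq_map[OF finite_joint_pmf[OF assms(1,2)]]
  using assms by (simp add: view_view fst_view)

lemma acc_marginal:
  assumes "finite V" "finite E" "W \<subseteq> V" "F \<subseteq> E" "F \<subseteq> W \<times> W" "u \<in> W"
  shows "bernoulli_mean \<epsilon> V (\<lambda>A. msq (joint_pmf Q V E) (view (A \<inter> W) F) (\<lambda>\<omega>. f (fst \<omega> u))) = acc Q f \<epsilon> W F u"
  unfolding acc_def using assms
  by (subst bernoulli_mean_marginal[symmetric, of V W]) (auto intro!: bernoulli_mean_cong msq_joint_pmf_marginal)

lemma acc_iso:
  assumes fin: "finite W" "finite F" and F: "F \<subseteq> W \<times> W" and inj: "inj_on \<phi> W" and u: "u \<in> W"
  shows "acc Q f \<epsilon> W F u = acc Q f \<epsilon> (\<phi> ` W) (map_prod \<phi> \<phi> ` F) (\<phi> u)"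
proof -
  let ?p = "joint_pmf Q (\<phi> ` W) (map_prod \<phi> \<phi> ` F)"
  have finp: "finite (set_pmf ?p)" using fin by (intro finite_joint_pmf) auto
  have "msq (joint_pmf Q W F) (view A F) (\<lambda>\<omega>. f (fst \<omega> u)) =
     msq ?p (view (\<phi> ` A) (map_prod \<phi> \<phi> ` F)) (\<lambda>\<omega>. f (fst \<omega> (\<phi> u)))" if A: "A \<subseteq> W" for A
  proof -
    have "view A F (pull \<phi> W F \<omega>) = view A F (pull \<phi> W F \<omega>')
      \<longleftrightarrow> view (\<phi> ` A) (map_prod \<phi> \<phi> ` F) \<omega> = view (\<phi> ` A) (map_prod \<phi> \<phi> ` F) \<omega>'" for \<omega> \<omega>' :: "(nat \<Rightarrow> 'a) \<times> 'b edge_obs"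
      unfolding view_eq_iff pull_def using A by (auto simp: subset_iff)
    then have "msq ?p (\<lambda>\<omega>. view A F (pull \<phi> W F \<omega>)) (\<lambda>\<omega>. f (fst \<omega> (\<phi> u)))
       = msq ?p (view (\<phi> ` A) (map_prod \<phi> \<phi> ` F)) (\<lambda>\<omega>. f (fst \<omega> (\<phi> u)))"
      by (intro msq_cong) simp
    then show ?thesis
      unfolding joint_pmf_iso[OF fin F inj, of Q] msq_map[OF finp] using u by (simp add: pull_def)
  qed
  then show ?thesis
    unfolding acc_def using bernoulli_mean_bij[of W \<phi> "\<phi> ` W"] fin inj
    by (simp add: inj_on_imp_bij_betw cong: bernoulli_mean_cong)
qed

section \<open>Risks in a finite graph\<close>

subsection \<open>Averaging over the disclosed vertices\<close>

lemma mean_bernoulli_set: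
  assumes V: "finite V" and \<epsilon>: "0 \<le> \<epsilon>" "\<epsilon> \<le> 1"
  shows "mean (Pi_pmf V False (\<lambda>_. bernoulli_pmf \<epsilon>)) g = bernoulli_mean \<epsilon> V (\<lambda>A. g (\<lambda>u. u \<in> A))"
proof -
  let ?p = "Pi_pmf V False (\<lambda>_. bernoulli_pmf \<epsilon>)" and ?c = "\<lambda>A u. u \<in> A"
  have sub: "set_pmf ?p \<subseteq> ?c ` Pow V"
  proof
    fix b assume "b \<in> set_pmf ?p"
    then have "{u. b u} \<subseteq> V" using set_Pi_pmf_subset[OF V, of False] by fastforce
    moreover have "b = ?c {u. b u}" by simp
    ultimately show "b \<in> ?c ` Pow V" by blast
  qed
  have "mean ?p g = (\<Sum>b\<in>?c ` Pow V. pmf ?p b * g b)"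
    unfolding mean_def using V by (intro sum.mono_neutral_left sub) (auto simp: set_pmf_iff)
  also have "\<dots> = (\<Sum>A\<in>Pow V. pmf ?p (?c A) * g (?c A))"
    by (subst sum.reindex) (auto simp: inj_on_def fun_eq_iff)
  also have "\<dots> = bernoulli_mean \<epsilon> V (\<lambda>A. g (?c A))"
    unfolding bernoulli_mean_def
  proof (intro sum.cong refl arg_cong2[where f = "(*)"])
    fix A assume A: "A \<in> Pow V"
    have "pmf ?p (?c A) = (\<Prod>v\<in>V. if v \<in> A then \<epsilon> else 1 - \<epsilon>)"
      using V A \<epsilon> by (subst pmf_Pi') (auto intro!: prod.cong)
    also have "\<dots> = \<epsilon> ^ card A * (1 - \<epsilon>) ^ card (V - A)"
    proof -
      have "V \<inter> {v. v \<in> A} = A" "V \<inter> - {v. v \<in> A} = V - A" using A by auto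
      then show ?thesis using V by (simp add: prod.If_cases)
    qed
    finally show "pmf ?p (?c A) = \<epsilon> ^ card A * (1 - \<epsilon>) ^ card (V - A)" .
  qed
  finally show ?thesis .
qed

lemma mean_bernoulli_mean_swap: "mean p (\<lambda>\<omega>. bernoulli_mean \<epsilon> V (\<lambda>A. g A \<omega>)) = bernoulli_mean \<epsilon> V (\<lambda>A. mean p (g A))"
  unfolding bernoulli_mean_def by (simp add: mean_sum mean_cmult)

lemma expectation_obs_model:
  fixes Q :: "'x::finite \<Rightarrow> 'x \<Rightarrow> 'y::finite pmf"
  assumes fin: "finite V" "finite E" and \<epsilon>: "0 \<le> \<epsilon>" "\<epsilon> \<le> 1"
  shows "measure_pmf.expectation (obs_model Q \<epsilon> V E) (\<lambda>(\<theta>, Y, \<xi>). g \<theta> Y \<xi>)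
     = bernoulli_mean \<epsilon> V (\<lambda>A. mean (joint_pmf Q V E) (\<lambda>\<omega>. g (fst \<omega>) (snd \<omega>) (mask A (fst \<omega>))))"
proof -
  let ?T = "Pi_pmf V undefined (\<lambda>_. pmf_of_set UNIV) :: (nat \<Rightarrow> 'x) pmf"
  let ?Y = "\<lambda>\<theta>. Pi_pmf E undefined (\<lambda>(u, v). Q (\<theta> u) (\<theta> v))"
  let ?X = "\<lambda>\<theta>. Pi_pmf V None (\<lambda>u. map_pmf (\<lambda>b. if b then Some (\<theta> u) else None) (bernoulli_pmf \<epsilon>))"
  let ?B = "Pi_pmf V False (\<lambda>_. bernoulli_pmf \<epsilon>)"
  have finset: "finite (set_pmf (obs_model Q \<epsilon> V E))"
    unfolding obs_model_def using fin by (auto intro!: finite_set_Pi_pmf)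
  have X: "mean (?X \<theta>) h = bernoulli_mean \<epsilon> V (\<lambda>A. h (mask A \<theta>))" for \<theta> :: "nat \<Rightarrow> 'x" and h
  proof -
    have "?X \<theta> = map_pmf (\<lambda>b u. if u \<in> V then (if b u then Some (\<theta> u) else None) else None) ?B"
      unfolding map_pmf_def using fin(1)
      by (subst Pi_pmf_bind[where d' = False]) simp_all
    then have "mean (?X \<theta>) h = bernoulli_mean \<epsilon> V (\<lambda>A. h (\<lambda>u. if u \<in> V then (if u \<in> A then Some (\<theta> u) else None) else None))"
      using finite_set_Pi_pmf[OF fin(1), of False "\<lambda>_. bernoulli_pmf \<epsilon>"]
      by (simp add: mean_map mean_bernoulli_set[OF fin(1) \<epsilon>])
    also have "\<dots> = bernoulli_mean \<epsilon> V (\<lambda>A. h (mask A \<theta>))"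
      by (intro bernoulli_mean_cong arg_cong[where f = h]) (auto simp: mask_def fun_eq_iff)
    finally show ?thesis .
  qed
  have "measure_pmf.expectation (obs_model Q \<epsilon> V E) (\<lambda>(\<theta>, Y, \<xi>). g \<theta> Y \<xi>)
     = mean ?T (\<lambda>\<theta>. mean (?Y \<theta>) (\<lambda>Y. mean (?X \<theta>) (\<lambda>\<xi>. g \<theta> Y \<xi>)))"
    unfolding mean_expectation[OF finset] unfolding obs_model_def using fin
    by (simp add: mean_bind mean_return finite_set_Pi_pmf)
  also have "\<dots> = mean (joint_pmf Q V E) (\<lambda>\<omega>. bernoulli_mean \<epsilon> V (\<lambda>A. g (fst \<omega>) (snd \<omega>) (mask A (fst \<omega>))))"
    by (simp add: mean_joint_pmf[OF fin] X)
  finally show ?thesis unfolding mean_bernoulli_mean_swap .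
qed

subsection \<open>Posterior means on subgraphs\<close>

text \<open>Bayes' formula for the posterior mean of \<open>f \<theta>\<^sub>u\<close> given the observations on the graph \<open>(W, F)\<close>. The prior is
  uniform and cancels.\<close>

definition est :: "('x::finite \<Rightarrow> 'x \<Rightarrow> 'y::finite pmf) \<Rightarrow> ('x \<Rightarrow> real) \<Rightarrow> nat set \<Rightarrow> (nat \<times> nat) set \<Rightarrow>
    nat \<Rightarrow> 'y edge_obs \<Rightarrow> 'x side_obs \<Rightarrow> real" where
  "est Q f W F u Y \<xi> =
    (\<Sum>x\<in>PiE W (\<lambda>_. UNIV). of_bool (\<forall>w\<in>W. \<xi> w = None \<or> \<xi> w = Some (x w)) * f (x u)
       * (\<Prod>(a, b)\<in>F. pmf (Q (x a) (x b)) (Y (a, b))))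
    / (\<Sum>x\<in>PiE W (\<lambda>_. UNIV). of_bool (\<forall>w\<in>W. \<xi> w = None \<or> \<xi> w = Some (x w))
       * (\<Prod>(a, b)\<in>F. pmf (Q (x a) (x b)) (Y (a, b))))"

lemma fibre_likelihood:
  fixes Q :: "'x::finite \<Rightarrow> 'x \<Rightarrow> 'y::finite pmf" and h :: "(nat \<Rightarrow> 'x) \<Rightarrow> real"
  assumes fin: "finite V" "finite E" and W: "W \<subseteq> V" and F: "F \<subseteq> E" "F \<subseteq> W \<times> W" and B: "B \<subseteq> W"
    and h: "\<And>\<theta>. h (restrict \<theta> W) = h \<theta>"
  shows "mean (joint_pmf Q V E) (\<lambda>\<omega>'. of_bool (view B F \<omega>' = view B F \<omega>) * h (fst \<omega>'))
    = (\<Sum>x\<in>PiE W (\<lambda>_. UNIV). of_bool (\<forall>w\<in>B. x w = fst \<omega> w) * h x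
         * (\<Prod>(a, b)\<in>F. pmf (Q (x a) (x b)) (snd \<omega> (a, b)))) / real CARD('x) ^ card W"
proof -
  have finWF: "finite W" "finite F" using fin W F by (meson finite_subset)+
  have "mean (joint_pmf Q V E) (\<lambda>\<omega>'. of_bool (view B F \<omega>' = view B F \<omega>) * h (fst \<omega>'))
    = mean (joint_pmf Q V E) (\<lambda>\<omega>'. (\<lambda>\<omega>'. of_bool (view B F \<omega>' = view B F \<omega>) * h (fst \<omega>')) (view W F \<omega>'))"
    using B h by (simp add: view_view) (simp add: view_def)
  also have "\<dots> = mean (joint_pmf Q W F) (\<lambda>\<omega>'. of_bool (view B F \<omega>' = view B F \<omega>) * h (fst \<omega>'))"
    by (rule mean_joint_pmf_marginal[OF fin W F])
  also have "\<dots> = mean (joint_pmf Q W F) (\<lambda>\<omega>'. of_bool (\<forall>w\<in>B. fst \<omega>' w = fst \<omega> w) * h (fst \<omega>')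
       * of_bool (restrict (snd \<omega>') F = restrict (snd \<omega>) F))"
  proof (rule mean_cong)
    fix \<omega>' :: "(nat \<Rightarrow> 'x) \<times> 'y edge_obs"
    have "restrict (snd \<omega>') F = restrict (snd \<omega>) F \<longleftrightarrow> (\<forall>e\<in>F. snd \<omega>' e = snd \<omega> e)"
      unfolding restrict_def fun_eq_iff by auto
    then show "of_bool (view B F \<omega>' = view B F \<omega>) * h (fst \<omega>') = of_bool (\<forall>w\<in>B. fst \<omega>' w = fst \<omega> w) * h (fst \<omega>')
       * of_bool (restrict (snd \<omega>') F = restrict (snd \<omega>) F)"
      unfolding view_eq_iff by (simp add: of_bool_conj)
  qed
  also have "\<dots> = (\<Sum>x\<in>PiE W (\<lambda>_. UNIV). of_bool (\<forall>w\<in>B. x w = fst \<omega> w) * h x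
         * (\<Prod>(a, b)\<in>F. pmf (Q (x a) (x b)) (snd \<omega> (a, b)))) / real CARD('x) ^ card W"
    by (rule mean_joint_pmf_likelihood[OF finWF])
  finally show ?thesis .
qed

text \<open>The set of disclosed vertices is independent of the labels. So the posterior given \<open>\<xi>\<close> is the one given the
  labels on the fixed set \<open>A\<close>, and it is the same for all \<open>\<epsilon>\<close>.\<close>

lemma est_posterior:
  assumes fin: "finite V" "finite E" and W: "W \<subseteq> V" and F: "F \<subseteq> E" "F \<subseteq> W \<times> W" and u: "u \<in> W"
  shows "est Q f W F u (snd \<omega>) (mask A (fst \<omega>)) = cond_mean (joint_pmf Q V E) (view (A \<inter> W) F) (\<lambda>\<omega>. f (fst \<omega> u)) \<omega>"
proof -
  have c: "(\<forall>w\<in>W. mask A (fst \<omega>) w = None \<or> mask A (fst \<omega>) w = Some (x w)) \<longleftrightarrow> (\<forall>w\<in>A \<inter> W. x w = fst \<omega> w)" for x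
    by (auto simp: mask_def)
  note L = fibre_likelihood[OF fin W F, of "A \<inter> W" _ Q \<omega>]
  have 1: "mean (joint_pmf Q V E) (\<lambda>\<omega>'. of_bool (view (A \<inter> W) F \<omega>' = view (A \<inter> W) F \<omega>) * f (fst \<omega>' u))
    = (\<Sum>x\<in>PiE W (\<lambda>_. UNIV). of_bool (\<forall>w\<in>A \<inter> W. x w = fst \<omega> w) * f (x u)
         * (\<Prod>(a, b)\<in>F. pmf (Q (x a) (x b)) (snd \<omega> (a, b)))) / real CARD('a) ^ card W"
    by (rule L[of "\<lambda>\<theta>. f (\<theta> u)"]) (use u in auto)
  have 2: "fibre_prob (joint_pmf Q V E) (view (A \<inter> W) F) \<omega>
    = (\<Sum>x\<in>PiE W (\<lambda>_. UNIV). of_bool (\<forall>w\<in>A \<inter> W. x w = fst \<omega> w)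
         * (\<Prod>(a, b)\<in>F. pmf (Q (x a) (x b)) (snd \<omega> (a, b)))) / real CARD('a) ^ card W"
    using L[of "\<lambda>_. 1"] by (simp add: fibre_prob_def)
  show ?thesis unfolding est_def cond_mean_def c 1 2 by simp
qed

subsection \<open>Entropy of the observations\<close>

definition edge_entropy :: "('x::finite \<Rightarrow> 'x \<Rightarrow> 'y::finite pmf) \<Rightarrow> nat set \<Rightarrow> (nat \<times> nat) set \<Rightarrow> nat \<times> nat \<Rightarrow> real" where
  "edge_entropy Q V E e = mean (joint_pmf Q V E) (\<lambda>\<omega>. - ln (pmf (Q (fst \<omega> (fst e)) (fst \<omega> (snd e))) (snd \<omega> e)))"

text \<open>Given the labels on \<open>A\<close>, the edge observations in \<open>F\<close> are independent, and the chain rule splits the entropy into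
  one term per vertex and one per edge. That the edges of \<open>F\<close> have both ends in \<open>A\<close> is essential: otherwise
  the observations on them are dependent.\<close>

lemma entropy_view:
  fixes Q :: "'x::finite \<Rightarrow> 'x \<Rightarrow> 'y::finite pmf"
  assumes fin: "finite V" "finite E" and A: "A \<subseteq> V" and F: "F \<subseteq> E" "F \<subseteq> A \<times> A"
  shows "entropy (joint_pmf Q V E) (view A F) = real (card A) * ln CARD('x) + (\<Sum>e\<in>F. edge_entropy Q V E e)"
proof -
  let ?p = "joint_pmf Q V E"
  let ?q = "\<lambda>\<omega> e. pmf (Q (fst \<omega> (fst e)) (fst \<omega> (snd e))) (snd \<omega> e)"
  have finp: "finite (set_pmf ?p)" by (rule finite_joint_pmf[OF fin])
  have finA: "finite A" "finite F" using fin A F by (meson finite_subset)+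
  have fibre_prob: "fibre_prob ?p (view A F) \<omega> = (\<Prod>e\<in>F. ?q \<omega> e) / real CARD('x) ^ card A" for \<omega>
  proof -
    have "(\<Sum>x\<in>PiE A (\<lambda>_. UNIV). of_bool (\<forall>w\<in>A. x w = fst \<omega> w)
         * (\<Prod>(a, b)\<in>F. pmf (Q (x a) (x b)) (snd \<omega> (a, b))))
      = (\<Sum>x\<in>{restrict (fst \<omega>) A}. (\<Prod>(a, b)\<in>F. pmf (Q (x a) (x b)) (snd \<omega> (a, b))))"
    proof (rule sum.mono_neutral_cong_right)
      show "finite (PiE A (\<lambda>_. UNIV :: 'x set))" using finA by (auto intro: finite_PiE)
      show "{restrict (fst \<omega>) A} \<subseteq> PiE A (\<lambda>_. UNIV)" by auto
      show "\<forall>x\<in>PiE A (\<lambda>_. UNIV) - {restrict (fst \<omega>) A}. of_bool (\<forall>w\<in>A. x w = fst \<omega> w)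
         * (\<Prod>(a, b)\<in>F. pmf (Q (x a) (x b)) (snd \<omega> (a, b))) = 0"
      proof
        fix x assume x: "x \<in> PiE A (\<lambda>_. UNIV) - {restrict (fst \<omega>) A}"
        have "\<not> (\<forall>w\<in>A. x w = fst \<omega> w)"
        proof
          assume "\<forall>w\<in>A. x w = fst \<omega> w"
          then have "x = restrict (fst \<omega>) A"
            using x by (intro ext) (auto simp: PiE_def extensional_def restrict_def)
          then show False using x by simp
        qed
        then show "of_bool (\<forall>w\<in>A. x w = fst \<omega> w)
         * (\<Prod>(a, b)\<in>F. pmf (Q (x a) (x b)) (snd \<omega> (a, b))) = 0" by simp
      qed
    qed auto
    also have "\<dots> = (\<Prod>e\<in>F. ?q \<omega> e)"
      using F(2) by (auto intro!: prod.cong)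
    finally show ?thesis
      using fibre_likelihood[OF fin A F order.refl, of "\<lambda>_. 1" Q \<omega>] by (simp add: fibre_prob_def)
  qed
  have "entropy ?p (view A F) = mean ?p (\<lambda>\<omega>. real (card A) * ln CARD('x) + (\<Sum>e\<in>F. - ln (?q \<omega> e)))"
    unfolding entropy_def
  proof (rule mean_cong)
    fix \<omega> assume "\<omega> \<in> set_pmf ?p"
    then have "0 < fibre_prob ?p (view A F) \<omega>" by (rule fibre_prob_pos[OF finp])
    then have "(\<Prod>e\<in>F. ?q \<omega> e) \<noteq> 0" by (auto simp: fibre_prob)
    then have pos: "?q \<omega> e > 0" if "e \<in> F" for e
      using that finA by (auto simp: prod_zero_iff less_le)
    have "?q \<omega> e \<noteq> 0" if "e \<in> F" for e using pos[OF that] by (rule less_imp_neq[symmetric])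
    then have "ln (\<Prod>e\<in>F. ?q \<omega> e) = (\<Sum>e\<in>F. ln (?q \<omega> e))"
      by (rule ln_prod[OF finA(2)])
    moreover have "0 < (\<Prod>e\<in>F. ?q \<omega> e)" using pos by (rule prod_pos)
    ultimately show "- ln (fibre_prob ?p (view A F) \<omega>) = real (card A) * ln CARD('x) + (\<Sum>e\<in>F. - ln (?q \<omega> e))"
      by (simp add: fibre_prob ln_div ln_realpow sum_negf)
  qed
  then show ?thesis
    using finp by (simp add: mean_add mean_const mean_sum edge_entropy_def)
qed

definition induced :: "(nat \<times> nat) set \<Rightarrow> nat set \<Rightarrow> (nat \<times> nat) set" where
  "induced E W = E \<inter> W \<times> W"

locale finite_model =
  fixes Q :: "'x::finite \<Rightarrow> 'x \<Rightarrow> 'y::finite pmf" and f :: "'x \<Rightarrow> real"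
    and V :: "nat set" and E :: "(nat \<times> nat) set" and K :: real
  assumes finV: "finite V" and E: "E \<subseteq> V \<times> V" and V_ne: "V \<noteq> {}"
    and K: "\<And>x. \<bar>f x\<bar> \<le> K" and K1: "1 \<le> K"
begin

abbreviation "P \<equiv> joint_pmf Q V E"
abbreviation "fv u \<equiv> (\<lambda>\<omega> :: (nat \<Rightarrow> 'x) \<times> 'y edge_obs. f (fst \<omega> u))"
abbreviation "n \<equiv> real (card V)"

lemma finE: "finite E"
  using finV E by (meson finite_SigmaI finite_subset)

lemma finP: "finite (set_pmf P)"
  by (rule finite_joint_pmf[OF finV finE])

lemma n_pos: "0 < n"
  using finV V_ne by (simp add: card_gt_0_iff)

lemma fin_sub: "S \<subseteq> V \<Longrightarrow> finite S"
  using finV finite_subset by auto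

lemma induced_sub: "induced E S \<subseteq> E" "induced E S \<subseteq> S \<times> S"
  by (auto simp: induced_def)

lemma f_sq_le: "(f x)\<^sup>2 \<le> K\<^sup>2"
  using power_mono[OF K[of x], of 2] by simp

lemma msq_le_K: "msq P Z (fv u) \<le> K\<^sup>2"
proof -
  have "msq P Z (fv u) \<le> mean P (\<lambda>\<omega>. (fv u \<omega>)\<^sup>2)" by (rule msq_le_full[OF finP])
  also have "\<dots> \<le> mean P (\<lambda>\<omega>. K\<^sup>2)"
    by (intro mean_mono f_sq_le)
  finally show ?thesis by (simp add: mean_const[OF finP])
qed

lemma msq_gap_le: "msq P Z (fv u) - msq P Z' (fv u) \<le> K\<^sup>2"
  using msq_le_K[of Z u] msq_nonneg[of P Z' "fv u"] by linarith

subsection \<open>Almost all pairs of vertices decouple\<close>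

text \<open>By Russo's formula, the derivative in \<open>\<epsilon>\<close> of the accuracy of the prediction of \<open>f \<theta>\<^sub>u\<close> from all observations.\<close>

definition gain :: "real \<Rightarrow> nat \<Rightarrow> real" where
  "gain \<epsilon> u = (\<Sum>v\<in>V. bernoulli_mean \<epsilon> V (\<lambda>A. msq P (view (insert v A) E) (fv u) - msq P (view (A - {v}) E) (fv u)))"

lemma gain_deriv: "((\<lambda>\<epsilon>. bernoulli_mean \<epsilon> V (\<lambda>A. msq P (view A E) (fv u))) has_real_derivative gain \<epsilon> u) (at \<epsilon>)"
  unfolding gain_def by (rule bernoulli_mean_deriv[OF finV])

definition dcov :: "nat set \<Rightarrow> nat \<Rightarrow> nat \<Rightarrow> real" where
  "dcov A u v = mean P (\<lambda>\<omega>. (cond_mean P (view A E) (\<lambda>\<omega>. fv u \<omega> * fv v \<omega>) \<omega>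
      - cond_mean P (view A E) (fv u) \<omega> * cond_mean P (view A E) (fv v) \<omega>)\<^sup>2)"

text \<open>The posterior covariance with \<open>f \<theta>\<^sub>v\<close> is bounded by the gain from disclosing \<open>\<theta>\<^sub>v\<close>, and the sum of the gains is a
  derivative.\<close>

lemma decoupling:
  assumes "0 \<le> \<epsilon>" "\<epsilon> \<le> 1"
  shows "(\<Sum>v\<in>V. bernoulli_mean \<epsilon> V (\<lambda>A. dcov A u v)) \<le> K\<^sup>2 * gain \<epsilon> u"
  unfolding gain_def sum_distrib_left bernoulli_mean_cmult[symmetric]
proof (intro sum_mono bernoulli_mean_mono assms)
  fix v A assume "v \<in> V" "A \<subseteq> V"
  have "dcov A u v \<le> K\<^sup>2 * (msq P (view (insert v A) E) (fv u) - msq P (view A E) (fv u))"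
    unfolding dcov_def using K
    by (intro covariance_le_accuracy_gain[OF finP] coarser_view coarser_vertex) auto
  also have "\<dots> \<le> K\<^sup>2 * (msq P (view (insert v A) E) (fv u) - msq P (view (A - {v}) E) (fv u))"
    by (intro mult_left_mono diff_left_mono msq_mono[OF finP] coarser_view) auto
  finally show "dcov A u v \<le> \<dots>" .
qed

subsection \<open>A region with small boundary learns little from its exterior\<close>

definition bd :: "nat set \<Rightarrow> nat set" where
  "bd S = {u \<in> S. \<exists>v\<in>V - S. (u, v) \<in> und E}"

text \<open>The entropy of what is seen inside \<open>S\<close>, minus the entropy of all edge observations with the labels on \<open>A\<close> and
  outside \<open>S\<close>. When a vertex of \<open>S\<close> is disclosed, each entropy increases by the conditional entropy of its label;
  so the difference increases by what the exterior of \<open>S\<close> tells about this label.\<close>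

definition pot :: "nat set \<Rightarrow> nat set \<Rightarrow> real" where
  "pot S A = entropy P (view (A \<inter> S) (induced E S)) - entropy P (view (A \<union> (V - S)) E)"

definition dpot :: "real \<Rightarrow> nat set \<Rightarrow> real" where
  "dpot \<epsilon> S = (\<Sum>v\<in>V. bernoulli_mean \<epsilon> V (\<lambda>A. pot S (insert v A) - pot S (A - {v})))"

lemma dpot_deriv: "((\<lambda>\<epsilon>. bernoulli_mean \<epsilon> V (pot S)) has_real_derivative dpot \<epsilon> S) (at \<epsilon>)"
  unfolding dpot_def by (rule bernoulli_mean_deriv[OF finV])

definition fnorm :: real where "fnorm = 4 * (\<Sum>x\<in>UNIV. (f x)\<^sup>2)"

text \<open>The increment of the potential is the entropy that \<open>\<theta>\<^sub>v\<close> loses in passing from the view inside \<open>S\<close> to the view with the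
  labels outside \<open>S\<close>, and it dominates the gain in accuracy. The latter view is finer than the view of
  all observations if \<open>v \<notin> A\<close>; if \<open>v \<in> A\<close>, the label is known and the left hand side vanishes.\<close>

lemma pot_difference:
  assumes S: "S \<subseteq> V" and A: "A \<subseteq> V" and v: "v \<in> V"
  shows "of_bool (v \<in> S) * (msq P (view A E) (fv v) - msq P (view (A \<inter> S) (induced E S)) (fv v))
    \<le> fnorm * (pot S (insert v A) - pot S (A - {v}))"
proof (cases "v \<in> S")
  case False
  then have "insert v A \<inter> S = (A - {v}) \<inter> S" "insert v A \<union> (V - S) = (A - {v}) \<union> (V - S)" using v by auto
  then show ?thesis using False by (simp add: pot_def)
next
  case True
  let ?Z = "view ((A - {v}) \<inter> S) (induced E S)" and ?Z' = "view ((A - {v}) \<union> (V - S)) E"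
  have disclose: "entropy P (\<lambda>\<omega>. (fst \<omega> v, view B F \<omega>)) = entropy P (view (insert v B) F)" for B F
    by (intro entropy_cong) (auto simp: view_eq_iff)
  have sets: "insert v ((A - {v}) \<inter> S) = insert v A \<inter> S" "insert v ((A - {v}) \<union> (V - S)) = insert v A \<union> (V - S)"
    using True by auto
  have c: "coarser P ?Z ?Z'" by (intro coarser_view induced_sub) auto
  have "msq P ?Z' (fv v) - msq P ?Z (fv v)
    \<le> fnorm * ((entropy P (\<lambda>\<omega>. (fst \<omega> v, ?Z \<omega>)) - entropy P ?Z) - (entropy P (\<lambda>\<omega>. (fst \<omega> v, ?Z' \<omega>)) - entropy P ?Z'))"
    unfolding fnorm_def by (rule accuracy_gain_le_entropy_loss[OF finP c])
  also have "\<dots> = fnorm * (pot S (insert v A) - pot S (A - {v}))"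
    unfolding disclose sets pot_def by (simp add: algebra_simps)
  finally have 1: "msq P ?Z' (fv v) - msq P ?Z (fv v) \<le> \<dots>" .
  have "msq P (view A E) (fv v) - msq P (view (A \<inter> S) (induced E S)) (fv v) \<le> msq P ?Z' (fv v) - msq P ?Z (fv v)"
  proof (cases "v \<in> A")
    case vA: True
    have "msq P (view A E) (fv v) = msq P (view (A \<inter> S) (induced E S)) (fv v)"
      using vA True by (simp add: msq_full[OF finP coarser_vertex])
    then show ?thesis using msq_mono[OF finP c] by simp
  next
    case False
    then have "msq P (view A E) (fv v) \<le> msq P ?Z' (fv v)"
      by (intro msq_mono[OF finP] coarser_view) auto
    moreover have "A - {v} = A" using False by simp
    ultimately show ?thesis by simp
  qed
  then show ?thesis using 1 True by simp
qed

lemma region_gap: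
  assumes S: "S \<subseteq> V" and \<epsilon>: "0 \<le> \<epsilon>" "\<epsilon> \<le> 1"
  shows "(\<Sum>u\<in>S. bernoulli_mean \<epsilon> V (\<lambda>A. msq P (view A E) (fv u) - msq P (view (A \<inter> S) (induced E S)) (fv u)))
     \<le> fnorm * dpot \<epsilon> S"
proof -
  have "(\<Sum>u\<in>S. bernoulli_mean \<epsilon> V (\<lambda>A. msq P (view A E) (fv u) - msq P (view (A \<inter> S) (induced E S)) (fv u)))
    = (\<Sum>u\<in>V. bernoulli_mean \<epsilon> V (\<lambda>A. of_bool (u \<in> S) * (msq P (view A E) (fv u) - msq P (view (A \<inter> S) (induced E S)) (fv u))))"
    using S finV by (intro sum.mono_neutral_cong_left) (auto simp: bernoulli_mean_const)
  also have "\<dots> \<le> fnorm * dpot \<epsilon> S"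
    unfolding dpot_def sum_distrib_left bernoulli_mean_cmult[symmetric]
    by (intro sum_mono bernoulli_mean_mono \<epsilon> pot_difference S)
  finally show ?thesis .
qed

text \<open>By the chain rule all entropies are sums over vertices and edges, except for those that involve edges with undisclosed
  ends. Of the latter, the view of \<open>V - S\<close> is bounded by subadditivity after granting the labels on the boundary of \<open>S\<close>,
  which then contain the ends of all edges not inside \<open>S\<close>; the entropy of the edges inside \<open>S\<close> cancels. The labels granted are
  the whole cost.\<close>

lemma pot_total:
  assumes S: "S \<subseteq> V"
  shows "pot S V - pot S {} \<le> real (card (bd S)) * ln CARD('x)"
proof -
  let ?F = "induced E S" and ?C = "(V - S) \<union> bd S"
  have bdS: "bd S \<subseteq> S" by (auto simp: bd_def)
  have finS: "finite S" "finite (bd S)" "finite ?F"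
    using fin_sub[OF S] bdS finE by (auto simp: induced_def intro: finite_subset)
  have C: "?C \<subseteq> V" using S bdS by auto
  have EF: "E - ?F \<subseteq> ?C \<times> ?C"
  proof
    fix e assume e: "e \<in> E - ?F"
    obtain a b where ab: "e = (a, b)" by force
    have "(a, b) \<in> und E" "(b, a) \<in> und E" "a \<in> V" "b \<in> V" using e E ab by (auto simp: und_def)
    then show "e \<in> ?C \<times> ?C" using e ab by (auto simp: bd_def induced_def)
  qed
  have "entropy P (view (V - S) E) \<le> entropy P (\<lambda>\<omega>. (view {} ?F \<omega>, view ?C (E - ?F) \<omega>))"
    by (intro entropy_mono[OF finP] coarserI) (auto simp: view_eq_iff)
  also have "\<dots> \<le> entropy P (view {} ?F) + entropy P (view ?C (E - ?F))"
    by (rule entropy_subadditive[OF finP])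
  also have "entropy P (view ?C (E - ?F)) = real (card ?C) * ln CARD('x) + (\<Sum>e\<in>E - ?F. edge_entropy Q V E e)"
    by (rule entropy_view[OF finV finE C _ EF]) auto
  finally have 1: "entropy P (view (V - S) E) \<le> entropy P (view {} ?F) + real (card ?C) * ln CARD('x) + (\<Sum>e\<in>E - ?F. edge_entropy Q V E e)"
    by simp
  have 2: "entropy P (view V E) = n * ln CARD('x) + (\<Sum>e\<in>E. edge_entropy Q V E e)"
    by (rule entropy_view[OF finV finE _ _ E]) auto
  have 3: "entropy P (view S ?F) = real (card S) * ln CARD('x) + (\<Sum>e\<in>?F. edge_entropy Q V E e)"
    by (rule entropy_view[OF finV finE S induced_sub])
  have 4: "(\<Sum>e\<in>E. edge_entropy Q V E e) = (\<Sum>e\<in>?F. edge_entropy Q V E e) + (\<Sum>e\<in>E - ?F. edge_entropy Q V E e)"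
    using finE by (subst sum.subset_diff[of ?F]) (auto simp: induced_def)
  have "card ?C = card (V - S) + card (bd S)"
    using bdS finV finS by (intro card_Un_disjoint) auto
  moreover have "card V = card (V - S) + card S"
    using S finV finS by (simp add: card_Diff_subset card_mono)
  ultimately have 5: "real (card ?C) + real (card S) = n + real (card (bd S))" by linarith
  have "pot S V - pot S {} = entropy P (view S ?F) - entropy P (view V E) - entropy P (view {} ?F) + entropy P (view (V - S) E)"
    using S by (simp add: pot_def Int_absorb1 Un_absorb2)
  also have "\<dots> \<le> (real (card ?C) + real (card S) - n) * ln CARD('x)"
    using 1 unfolding 2 3 4 by (simp add: algebra_simps)
  also have "\<dots> = real (card (bd S)) * ln CARD('x)" unfolding 5 by simp
  finally show ?thesis .
qed

lemma dpot_nonneg: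
  assumes "S \<subseteq> V" "0 \<le> \<epsilon>" "\<epsilon> \<le> 1"
  shows "0 \<le> fnorm * dpot \<epsilon> S"
proof -
  have "0 \<le> (\<Sum>u\<in>S. bernoulli_mean \<epsilon> V (\<lambda>A. msq P (view A E) (fv u) - msq P (view (A \<inter> S) (induced E S)) (fv u)))"
  proof (rule sum_nonneg)
    fix u
    have "bernoulli_mean \<epsilon> V (\<lambda>_. 0) \<le> bernoulli_mean \<epsilon> V (\<lambda>A. msq P (view A E) (fv u) - msq P (view (A \<inter> S) (induced E S)) (fv u))"
      using assms by (intro bernoulli_mean_mono) (auto intro!: msq_mono[OF finP] coarser_view induced_sub)
    then show "0 \<le> bernoulli_mean \<epsilon> V (\<lambda>A. msq P (view A E) (fv u) - msq P (view (A \<inter> S) (induced E S)) (fv u))"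
      by (simp add: bernoulli_mean_const[OF finV])
  qed
  then show ?thesis using region_gap[OF assms] by simp
qed

subsection \<open>Disjoint neighbourhoods are independent\<close>

definition lpost :: "(nat \<Rightarrow> nat set) \<Rightarrow> nat set \<Rightarrow> nat \<Rightarrow> (nat \<Rightarrow> 'x) \<times> 'y edge_obs \<Rightarrow> real" where
  "lpost B A u = cond_mean P (view (A \<inter> B u) (induced E (B u))) (fv u)"

abbreviation lacc :: "(nat \<Rightarrow> nat set) \<Rightarrow> real \<Rightarrow> nat \<Rightarrow> real" where
  "lacc B \<epsilon> u \<equiv> acc Q f \<epsilon> (B u) (induced E (B u)) u"

definition overlaps :: "(nat \<Rightarrow> nat set) \<Rightarrow> real" where
  "overlaps B = real (card {(u, v) \<in> V \<times> V. B u \<inter> B v \<noteq> {}})"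

definition second_moment :: real where "second_moment = mean (pmf_of_set UNIV) (\<lambda>x. (f x)\<^sup>2)"

lemma abs_lpost: "\<omega> \<in> set_pmf P \<Longrightarrow> \<bar>lpost B A u \<omega>\<bar> \<le> K"
  unfolding lpost_def by (rule cond_mean_bound[OF finP]) (use K in auto)

lemma lpost_view: "lpost B A u (view (B u) (induced E (B u)) \<omega>) = lpost B A u \<omega>"
  unfolding lpost_def by (rule cond_mean_cong_fibre) (simp add: view_view)

lemma mean_vertex:
  assumes "u \<in> V"
  shows "mean P (\<lambda>\<omega>. g (fst \<omega> u)) = mean (pmf_of_set UNIV) g"
proof -
  let ?T = "Pi_pmf V undefined (\<lambda>_. pmf_of_set (UNIV :: 'x set))"
  have "mean P (\<lambda>\<omega>. g (fst \<omega> u)) = mean ?T (\<lambda>\<theta>. g (\<theta> u))"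
    by (simp add: mean_joint_pmf[OF finV finE] mean_const finite_set_Pi_pmf finE)
  also have "\<dots> = mean (map_pmf (\<lambda>\<theta>. \<theta> u) ?T) g"
    by (simp add: mean_map finite_set_Pi_pmf finV)
  also have "map_pmf (\<lambda>\<theta>. \<theta> u) ?T = pmf_of_set UNIV"
    using Pi_pmf_component[OF finV, of u undefined "\<lambda>_. pmf_of_set UNIV"] assms by simp
  finally show ?thesis .
qed

lemma mean_sq: "u \<in> V \<Longrightarrow> mean P (\<lambda>\<omega>. (fv u \<omega>)\<^sup>2) = second_moment"
  unfolding second_moment_def by (rule mean_vertex[of u "\<lambda>x. (f x)\<^sup>2"])

lemma second_moment_bounds: "0 \<le> second_moment" "second_moment \<le> K\<^sup>2"
proof -
  show "0 \<le> second_moment" unfolding second_moment_def by (rule mean_nonneg) simp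
  have "second_moment \<le> mean (pmf_of_set UNIV) (\<lambda>x :: 'x. K\<^sup>2)" unfolding second_moment_def
    by (intro mean_mono f_sq_le)
  then show "second_moment \<le> K\<^sup>2" by (simp add: mean_const)
qed

context
  fixes B :: "nat \<Rightarrow> nat set"
  assumes B: "\<And>u. u \<in> V \<Longrightarrow> u \<in> B u" "\<And>u. u \<in> V \<Longrightarrow> B u \<subseteq> V"
begin

lemma lacc_eq: "u \<in> V \<Longrightarrow> bernoulli_mean \<epsilon> V (\<lambda>A. msq P (view (A \<inter> B u) (induced E (B u))) (fv u)) = lacc B \<epsilon> u"
  by (rule acc_marginal[OF finV finE]) (use B induced_sub in auto)

lemma lacc_bounds:
  assumes "u \<in> V" "0 \<le> \<epsilon>" "\<epsilon> \<le> 1"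
  shows "0 \<le> lacc B \<epsilon> u" "lacc B \<epsilon> u \<le> second_moment"
proof -
  have "bernoulli_mean \<epsilon> V (\<lambda>A. 0) \<le> lacc B \<epsilon> u" "lacc B \<epsilon> u \<le> bernoulli_mean \<epsilon> V (\<lambda>A. second_moment)"
    unfolding lacc_eq[OF assms(1), symmetric] using assms
    by (auto intro!: bernoulli_mean_mono msq_nonneg msq_le_full[OF finP] simp: mean_sq[OF assms(1), symmetric])
  then show "0 \<le> lacc B \<epsilon> u" "lacc B \<epsilon> u \<le> second_moment" by (simp_all add: bernoulli_mean_const[OF finV])
qed

lemma lacc_increasing:
  assumes "u \<in> V" "0 \<le> \<epsilon>" "\<epsilon> \<le> \<epsilon>'" "\<epsilon>' \<le> 1"
  shows "lacc B \<epsilon> u \<le> lacc B \<epsilon>' u"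
  unfolding lacc_eq[OF assms(1), symmetric]
  by (rule bernoulli_mean_increasing[OF finV]) (use assms in \<open>auto intro!: msq_mono[OF finP] coarser_view\<close>)

lemma pair_indep:
  assumes uv: "u \<in> V" "v \<in> V" and disj: "B u \<inter> B v = {}"
  shows "mean P (\<lambda>\<omega>. g (fv u \<omega>) (lpost B A u \<omega>) * h (fv v \<omega>) (lpost B A v \<omega>))
    = mean P (\<lambda>\<omega>. g (fv u \<omega>) (lpost B A u \<omega>)) * mean P (\<lambda>\<omega>. h (fv v \<omega>) (lpost B A v \<omega>))"
proof -
  have fu: "fst (view (B w) F \<omega>) w = fst \<omega> w" if "w \<in> V" for w F and \<omega> :: "(nat \<Rightarrow> 'x) \<times> 'y edge_obs"
    using B(1)[OF that] by (rule fst_view)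
  show ?thesis
    using mean_joint_pmf_indep[OF finV finE B(2)[OF uv(1)] B(2)[OF uv(2)] disj induced_sub[of "B u"] induced_sub[of "B v"],
        of Q "\<lambda>\<omega>. g (fv u \<omega>) (lpost B A u \<omega>)" "\<lambda>\<omega>. h (fv v \<omega>) (lpost B A v \<omega>)"]
    by (simp add: fu uv lpost_view)
qed

lemma mean_lpost_sq: "mean P (\<lambda>\<omega>. (lpost B A u \<omega>)\<^sup>2) = msq P (view (A \<inter> B u) (induced E (B u))) (fv u)"
  by (simp add: lpost_def msq_def)

lemma bernoulli_mean_pair:
  assumes uv: "u \<in> V" "v \<in> V" and disj: "B u \<inter> B v = {}"
  shows "bernoulli_mean \<epsilon> V (\<lambda>A. msq P (view (A \<inter> B u) (induced E (B u))) (fv u) * msq P (view (A \<inter> B v) (induced E (B v))) (fv v))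
     = lacc B \<epsilon> u * lacc B \<epsilon> v"
  unfolding lacc_eq[OF uv(1), symmetric] lacc_eq[OF uv(2), symmetric]
  by (rule bernoulli_mean_indep[OF finV disj, of \<epsilon> "\<lambda>A. msq P (view A (induced E (B u))) (fv u)"
        "\<lambda>A. msq P (view A (induced E (B v))) (fv v)"])

lemma overlaps_sum:
  assumes "\<And>u v. u \<in> V \<Longrightarrow> v \<in> V \<Longrightarrow> g u v \<le> h u v + c * of_bool (B u \<inter> B v \<noteq> {})"
  shows "(\<Sum>u\<in>V. \<Sum>v\<in>V. g u v) \<le> (\<Sum>u\<in>V. \<Sum>v\<in>V. h u v) + c * overlaps B"
proof -
  have "(\<Sum>u\<in>V. \<Sum>v\<in>V. of_bool (B u \<inter> B v \<noteq> {})) = overlaps B"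
    unfolding overlaps_def sum.cartesian_product split_beta using finV
    by (subst sum_of_bool_eq) (auto intro!: arg_cong[where f = card])
  then have "(\<Sum>u\<in>V. \<Sum>v\<in>V. h u v) + c * overlaps B = (\<Sum>u\<in>V. \<Sum>v\<in>V. h u v + c * of_bool (B u \<inter> B v \<noteq> {}))"
    by (simp add: sum.distrib sum_distrib_left[symmetric])
  then show ?thesis using assms by (simp add: sum_mono)
qed

subsection \<open>The risk of the local estimator\<close>

definition local_risk :: "real \<Rightarrow> real" where
  "local_risk \<epsilon> = 1 / n\<^sup>2 * (\<Sum>u\<in>V. \<Sum>v\<in>V. bernoulli_mean \<epsilon> V (\<lambda>A. mean P (\<lambda>\<omega>. (fv u \<omega> * fv v \<omega> - lpost B A u \<omega> * lpost B A v \<omega>)\<^sup>2)))"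

text \<open>Disjoint neighbourhoods give independent predictions, and then the error factorizes; the other pairs
  are estimated trivially.\<close>

lemma local_risk_pair:
  assumes uv: "u \<in> V" "v \<in> V" and \<epsilon>: "0 \<le> \<epsilon>" "\<epsilon> \<le> 1"
  shows "\<bar>bernoulli_mean \<epsilon> V (\<lambda>A. mean P (\<lambda>\<omega>. (fv u \<omega> * fv v \<omega> - lpost B A u \<omega> * lpost B A v \<omega>)\<^sup>2))
    - (second_moment\<^sup>2 - lacc B \<epsilon> u * lacc B \<epsilon> v)\<bar> \<le> 4 * K ^ 4 * of_bool (B u \<inter> B v \<noteq> {})"
proof (cases "B u \<inter> B v = {}")
  case True
  have "mean P (\<lambda>\<omega>. (fv u \<omega> * fv v \<omega> - lpost B A u \<omega> * lpost B A v \<omega>)\<^sup>2)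
    = second_moment\<^sup>2 - msq P (view (A \<inter> B u) (induced E (B u))) (fv u) * msq P (view (A \<inter> B v) (induced E (B v))) (fv v)" for A
  proof -
    have "mean P (\<lambda>\<omega>. (fv u \<omega> * fv v \<omega> - lpost B A u \<omega> * lpost B A v \<omega>)\<^sup>2)
      = mean P (\<lambda>\<omega>. (fv u \<omega>)\<^sup>2 * (fv v \<omega>)\<^sup>2) - 2 * mean P (\<lambda>\<omega>. (fv u \<omega> * lpost B A u \<omega>) * (fv v \<omega> * lpost B A v \<omega>))
        + mean P (\<lambda>\<omega>. (lpost B A u \<omega>)\<^sup>2 * (lpost B A v \<omega>)\<^sup>2)"
      unfolding mean_cmult[symmetric] mean_diff[symmetric] mean_add[symmetric]
      by (intro mean_cong) (simp add: power2_diff power_mult_distrib mult_ac)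
    also have "mean P (\<lambda>\<omega>. (fv u \<omega>)\<^sup>2 * (fv v \<omega>)\<^sup>2) = second_moment * second_moment"
      using pair_indep[OF uv True, of "\<lambda>a b. a\<^sup>2" A "\<lambda>a b. a\<^sup>2"] by (simp add: mean_sq uv)
    also have "mean P (\<lambda>\<omega>. (fv u \<omega> * lpost B A u \<omega>) * (fv v \<omega> * lpost B A v \<omega>))
       = msq P (view (A \<inter> B u) (induced E (B u))) (fv u) * msq P (view (A \<inter> B v) (induced E (B v))) (fv v)"
      unfolding msq_tower[OF finP] lpost_def[symmetric]
      by (rule pair_indep[OF uv True, of "\<lambda>a b. a * b" A "\<lambda>a b. a * b"])
    also have "mean P (\<lambda>\<omega>. (lpost B A u \<omega>)\<^sup>2 * (lpost B A v \<omega>)\<^sup>2)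
       = msq P (view (A \<inter> B u) (induced E (B u))) (fv u) * msq P (view (A \<inter> B v) (induced E (B v))) (fv v)"
      unfolding mean_lpost_sq[symmetric]
      by (rule pair_indep[OF uv True, of "\<lambda>a b. b\<^sup>2" A "\<lambda>a b. b\<^sup>2"])
    finally show ?thesis by (simp add: power2_eq_square)
  qed
  then show ?thesis
    using True by (simp add: bernoulli_mean_diff bernoulli_mean_const[OF finV] bernoulli_mean_pair[OF uv True])
next
  case False
  have pt: "mean P (\<lambda>\<omega>. (fv u \<omega> * fv v \<omega> - lpost B A u \<omega> * lpost B A v \<omega>)\<^sup>2) \<le> 4 * K ^ 4" for A
  proof -
    have "mean P (\<lambda>\<omega>. (fv u \<omega> * fv v \<omega> - lpost B A u \<omega> * lpost B A v \<omega>)\<^sup>2) \<le> mean P (\<lambda>\<omega>. 4 * K ^ 4)"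
    proof (rule mean_mono)
      fix \<omega> assume w: "\<omega> \<in> set_pmf P"
      have "\<bar>fv u \<omega> * fv v \<omega> - lpost B A u \<omega> * lpost B A v \<omega>\<bar> \<le> \<bar>fv u \<omega>\<bar> * \<bar>fv v \<omega>\<bar> + \<bar>lpost B A u \<omega>\<bar> * \<bar>lpost B A v \<omega>\<bar>"
        unfolding abs_mult[symmetric] by (rule abs_triangle_ineq4)
      also have "\<dots> \<le> K * K + K * K"
        using K1 by (intro add_mono mult_mono K abs_lpost w) auto
      finally have "(fv u \<omega> * fv v \<omega> - lpost B A u \<omega> * lpost B A v \<omega>)\<^sup>2 \<le> (2 * K\<^sup>2)\<^sup>2"
        by (intro power2_le_iff_abs_le[THEN iffD2]) (simp_all add: power2_eq_square)
      then show "(fv u \<omega> * fv v \<omega> - lpost B A u \<omega> * lpost B A v \<omega>)\<^sup>2 \<le> 4 * K ^ 4"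
        by (simp add: power_mult_distrib flip: power_mult)
    qed
    then show ?thesis by (simp add: mean_const[OF finP])
  qed
  let ?b = "bernoulli_mean \<epsilon> V (\<lambda>A. mean P (\<lambda>\<omega>. (fv u \<omega> * fv v \<omega> - lpost B A u \<omega> * lpost B A v \<omega>)\<^sup>2))"
  have "?b \<le> bernoulli_mean \<epsilon> V (\<lambda>A. 4 * K ^ 4)" "bernoulli_mean \<epsilon> V (\<lambda>A. 0) \<le> ?b"
    using pt by (auto intro!: bernoulli_mean_mono \<epsilon> mean_nonneg)
  then have b: "0 \<le> ?b" "?b \<le> 4 * K ^ 4" by (simp_all add: bernoulli_mean_const[OF finV])
  have a: "0 \<le> lacc B \<epsilon> u * lacc B \<epsilon> v" "lacc B \<epsilon> u * lacc B \<epsilon> v \<le> second_moment\<^sup>2"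
    using lacc_bounds[OF uv(1) \<epsilon>] lacc_bounds[OF uv(2) \<epsilon>] by (auto simp: power2_eq_square intro!: mult_mono)
  have "second_moment\<^sup>2 \<le> (K\<^sup>2)\<^sup>2" using second_moment_bounds by (intro power_mono) auto
  then have "second_moment\<^sup>2 \<le> K ^ 4" by (simp flip: power_mult)
  moreover have "0 \<le> K ^ 4" by simp
  ultimately show ?thesis using a b False by (simp add: abs_le_iff)
qed

lemma double_sum_square: "(\<Sum>u\<in>V. \<Sum>v\<in>V. a u * a v) = (\<Sum>u\<in>V. a u :: real)\<^sup>2"
  by (simp add: power2_eq_square sum_product)

lemma local_risk_asymptotics:
  assumes \<epsilon>: "0 \<le> \<epsilon>" "\<epsilon> \<le> 1"
  shows "\<bar>local_risk \<epsilon> - (second_moment\<^sup>2 - ((\<Sum>u\<in>V. lacc B \<epsilon> u) / n)\<^sup>2)\<bar> \<le> 4 * K ^ 4 * overlaps B / n\<^sup>2"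
proof -
  let ?g = "\<lambda>u v. bernoulli_mean \<epsilon> V (\<lambda>A. mean P (\<lambda>\<omega>. (fv u \<omega> * fv v \<omega> - lpost B A u \<omega> * lpost B A v \<omega>)\<^sup>2))"
  let ?h = "\<lambda>u v. second_moment\<^sup>2 - lacc B \<epsilon> u * lacc B \<epsilon> v"
  define a where "a = (\<Sum>u\<in>V. lacc B \<epsilon> u)"
  define G where "G = (\<Sum>u\<in>V. \<Sum>v\<in>V. ?g u v)"
  define c where "c = 4 * K ^ 4"
  have p: "?g u v \<le> ?h u v + c * of_bool (B u \<inter> B v \<noteq> {})" "?h u v \<le> ?g u v + c * of_bool (B u \<inter> B v \<noteq> {})"
    if "u \<in> V" "v \<in> V" for u v
    using local_risk_pair[OF that \<epsilon>] unfolding c_def abs_le_iff by linarith+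
  have h: "(\<Sum>u\<in>V. \<Sum>v\<in>V. ?h u v) = n\<^sup>2 * second_moment\<^sup>2 - a\<^sup>2"
    unfolding sum_subtractf double_sum_square a_def by (simp add: power2_eq_square)
  have "G \<le> n\<^sup>2 * second_moment\<^sup>2 - a\<^sup>2 + c * overlaps B"
    unfolding G_def h[symmetric] by (rule overlaps_sum[of ?g ?h, OF p(1)])
  moreover have "n\<^sup>2 * second_moment\<^sup>2 - a\<^sup>2 \<le> G + c * overlaps B"
    unfolding G_def h[symmetric] by (rule overlaps_sum[of ?h ?g, OF p(2)])
  ultimately have "\<bar>G - (n\<^sup>2 * second_moment\<^sup>2 - a\<^sup>2)\<bar> / n\<^sup>2 \<le> c * overlaps B / n\<^sup>2"
    by (intro divide_right_mono) (simp_all add: abs_le_iff)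
  moreover have "\<bar>G - (n\<^sup>2 * second_moment\<^sup>2 - a\<^sup>2)\<bar> / n\<^sup>2 = \<bar>(G - (n\<^sup>2 * second_moment\<^sup>2 - a\<^sup>2)) / n\<^sup>2\<bar>"
    by (simp add: abs_divide)
  moreover have "(G - (n\<^sup>2 * second_moment\<^sup>2 - a\<^sup>2)) / n\<^sup>2 = 1 / n\<^sup>2 * G - (second_moment\<^sup>2 - (a / n)\<^sup>2)"
    using n_pos by (simp add: field_simps power_divide)
  ultimately show ?thesis unfolding local_risk_def a_def[symmetric] G_def[symmetric] c_def[symmetric] by simp
qed

end

subsection \<open>The Bayes risk\<close>

definition pair_acc :: "real \<Rightarrow> real" where
  "pair_acc \<epsilon> = 1 / n\<^sup>2 * (\<Sum>u\<in>V. \<Sum>v\<in>V. bernoulli_mean \<epsilon> V (\<lambda>A. msq P (view A E) (\<lambda>\<omega>. fv u \<omega> * fv v \<omega>)))"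

lemma pair_acc_increasing:
  assumes "0 \<le> \<epsilon>" "\<epsilon> \<le> \<epsilon>'" "\<epsilon>' \<le> 1"
  shows "pair_acc \<epsilon> \<le> pair_acc \<epsilon>'"
  unfolding pair_acc_def using assms
  by (intro mult_left_mono sum_mono bernoulli_mean_increasing[OF finV]) (auto intro!: msq_mono[OF finP] coarser_view)

lemma mean_pair_sq:
  assumes "u \<in> V" "v \<in> V"
  shows "second_moment\<^sup>2 \<le> mean P (\<lambda>\<omega>. (fv u \<omega> * fv v \<omega>)\<^sup>2)"
proof (cases "u = v")
  case False
  have "mean P (\<lambda>\<omega>. (\<lambda>\<omega>. (fv u \<omega>)\<^sup>2) (view {u} {} \<omega>) * (\<lambda>\<omega>. (fv v \<omega>)\<^sup>2) (view {v} {} \<omega>))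
    = mean P (\<lambda>\<omega>. (\<lambda>\<omega>. (fv u \<omega>)\<^sup>2) (view {u} {} \<omega>)) * mean P (\<lambda>\<omega>. (\<lambda>\<omega>. (fv v \<omega>)\<^sup>2) (view {v} {} \<omega>))"
    by (rule mean_joint_pmf_indep[OF finV finE]) (use assms False in auto)
  then show ?thesis using assms by (simp add: fst_view mean_sq power_mult_distrib) (simp add: power2_eq_square)
next
  case True
  have "0 \<le> mean P (\<lambda>\<omega>. ((fv u \<omega>)\<^sup>2 - second_moment)\<^sup>2)" by (rule mean_nonneg) simp
  also have "\<dots> = mean P (\<lambda>\<omega>. (fv u \<omega> * fv u \<omega>)\<^sup>2) - 2 * second_moment * mean P (\<lambda>\<omega>. (fv u \<omega>)\<^sup>2) + mean P (\<lambda>\<omega>. second_moment\<^sup>2)"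
    unfolding mean_cmult[symmetric] mean_diff[symmetric] mean_add[symmetric]
    by (intro mean_cong) (simp add: power2_diff power2_eq_square algebra_simps)
  also have "\<dots> = mean P (\<lambda>\<omega>. (fv u \<omega> * fv u \<omega>)\<^sup>2) - second_moment\<^sup>2"
    unfolding mean_sq[OF assms(1)] mean_const[OF finP] by (simp add: power2_eq_square)
  finally show ?thesis using True by simp
qed

lemma snd_outside:
  assumes "finite E" "\<omega> \<in> set_pmf (joint_pmf Q V E)" "e \<notin> E"
  shows "snd \<omega> e = undefined"
proof -
  obtain \<theta> where "snd \<omega> \<in> set_pmf (Pi_pmf E undefined (\<lambda>(u, v). Q (\<theta> u) (\<theta> v)))"
    using assms(2) unfolding joint_pmf_def set_bind_pmf by auto
  then show ?thesis
    using set_Pi_pmf_subset[OF assms(1), of undefined "\<lambda>(u, v). Q (\<theta> u) (\<theta> v)"] assms(3) by (cases e) auto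
qed

text \<open>An estimator is a function of the observations and so is no better than the posterior mean. The pairs \<open>u = v\<close> have a larger
  second moment than the others, whence an inequality rather than an identity.\<close>

lemma bayes_lower_bound:
  assumes \<epsilon>: "0 \<le> \<epsilon>" "\<epsilon> \<le> 1"
  shows "second_moment\<^sup>2 - pair_acc \<epsilon> \<le> 1 / n\<^sup>2 * (\<Sum>u\<in>V. \<Sum>v\<in>V. bernoulli_mean \<epsilon> V (\<lambda>A. mean P
     (\<lambda>\<omega>. (fv u \<omega> * fv v \<omega> - Xhat (snd \<omega>) (mask A (fst \<omega>)) u v)\<^sup>2)))" (is "_ \<le> 1 / n\<^sup>2 * ?R")
proof -
  let ?m = "\<lambda>u v A. msq P (view A E) (\<lambda>\<omega>. fv u \<omega> * fv v \<omega>)"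
  have "(\<Sum>u\<in>V. \<Sum>v\<in>V. second_moment\<^sup>2 - bernoulli_mean \<epsilon> V (?m u v)) \<le> ?R"
  proof (intro sum_mono)
    fix u v assume uv: "u \<in> V" "v \<in> V"
    have "second_moment\<^sup>2 - bernoulli_mean \<epsilon> V (?m u v) = bernoulli_mean \<epsilon> V (\<lambda>A. second_moment\<^sup>2 - ?m u v A)"
      by (simp add: bernoulli_mean_diff bernoulli_mean_const[OF finV])
    also have "\<dots> \<le> bernoulli_mean \<epsilon> V (\<lambda>A. mean P (\<lambda>\<omega>. (fv u \<omega> * fv v \<omega> - Xhat (snd \<omega>) (mask A (fst \<omega>)) u v)\<^sup>2))"
    proof (intro bernoulli_mean_mono \<epsilon>)
      fix A assume "A \<subseteq> V"
      have "coarser P (\<lambda>\<omega>. Xhat (snd \<omega>) (mask A (fst \<omega>)) u v) (view A E)"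
      proof (rule coarserI)
        fix \<omega> \<omega>' assume w: "\<omega> \<in> set_pmf P" "\<omega>' \<in> set_pmf P" and e: "view A E \<omega> = view A E \<omega>'"
        have "snd \<omega> = snd \<omega>'"
        proof (rule ext)
          fix e' show "snd \<omega> e' = snd \<omega>' e'"
            using e snd_outside[OF finE w(1), of e'] snd_outside[OF finE w(2), of e']
            by (cases "e' \<in> E") (simp_all add: view_eq_iff)
        qed
        moreover have "mask A (fst \<omega>) = mask A (fst \<omega>')"
          using e unfolding view_eq_iff by (auto simp: mask_def)
        ultimately show "Xhat (snd \<omega>) (mask A (fst \<omega>)) u v = Xhat (snd \<omega>') (mask A (fst \<omega>')) u v" by simp
      qed
      from prediction_error_lower_bound[OF finP this] mean_pair_sq[OF uv]
      show "second_moment\<^sup>2 - ?m u v A \<le> mean P (\<lambda>\<omega>. (fv u \<omega> * fv v \<omega> - Xhat (snd \<omega>) (mask A (fst \<omega>)) u v)\<^sup>2)"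
        by (meson diff_right_mono order.trans)
    qed
    finally show "second_moment\<^sup>2 - bernoulli_mean \<epsilon> V (?m u v) \<le> \<dots>" .
  qed
  then have "1 / n\<^sup>2 * (\<Sum>u\<in>V. \<Sum>v\<in>V. second_moment\<^sup>2 - bernoulli_mean \<epsilon> V (?m u v)) \<le> 1 / n\<^sup>2 * ?R"
    by (intro mult_left_mono) auto
  moreover have "1 / n\<^sup>2 * (\<Sum>u\<in>V. \<Sum>v\<in>V. second_moment\<^sup>2 - bernoulli_mean \<epsilon> V (?m u v)) = second_moment\<^sup>2 - pair_acc \<epsilon>"
    using n_pos by (simp add: pair_acc_def sum_subtractf field_simps power2_eq_square)
  ultimately show ?thesis by simp
qed

end

context finite_model
begin

subsection \<open>The global posterior is no better than the local ones\<close>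

text \<open>A posterior mean of a product is compared with the product of two local predictions; \<open>\<bar>z\<bar> \<le> t + z\<^sup>2 / t\<close> replaces the
  distances by their squares, whose means are differences of accuracies.\<close>

lemma product_perturbation:
  fixes a :: real
  assumes "\<bar>a\<bar> \<le> K\<^sup>2" "\<bar>x\<bar> \<le> K" "\<bar>y\<bar> \<le> K" "\<bar>x'\<bar> \<le> K" "\<bar>y'\<bar> \<le> K" and t: "0 < t"
  shows "a\<^sup>2 \<le> x'\<^sup>2 * y'\<^sup>2 + 2 * K ^ 3 * (3 * t + ((a - x * y)\<^sup>2 + (x - x')\<^sup>2 + (y - y')\<^sup>2) / t)"
proof -
  have K0: "0 \<le> K" using K1 by simp
  have le: "\<bar>z\<bar> \<le> t + z\<^sup>2 / t" for z :: real
  proof -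
    have "0 \<le> (\<bar>z\<bar> - t)\<^sup>2" by simp
    also have "\<dots> = z\<^sup>2 - 2 * (\<bar>z\<bar> * t) + t\<^sup>2" by (simp add: power2_diff)
    finally have "2 * (\<bar>z\<bar> * t) \<le> z\<^sup>2 + t\<^sup>2" by simp
    moreover have "0 \<le> \<bar>z\<bar> * t" using t by simp
    ultimately have "\<bar>z\<bar> * t \<le> t * t + z\<^sup>2" unfolding power2_eq_square by linarith
    then show ?thesis using t by (simp add: field_simps)
  qed
  have xy: "\<bar>x' * y'\<bar> \<le> K\<^sup>2" unfolding abs_mult power2_eq_square by (rule mult_mono[OF assms(4,5) K0 abs_ge_zero])
  have "a - x' * y' = (a - x * y) + (x - x') * y' + x * (y - y')" by (simp add: algebra_simps)
  then have "\<bar>a - x' * y'\<bar> \<le> \<bar>a - x * y\<bar> + \<bar>(x - x') * y'\<bar> + \<bar>x * (y - y')\<bar>" by linarith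
  also have "\<dots> \<le> K * \<bar>a - x * y\<bar> + \<bar>x - x'\<bar> * K + K * \<bar>y - y'\<bar>"
  proof (intro add_mono)
    show "\<bar>a - x * y\<bar> \<le> K * \<bar>a - x * y\<bar>" using mult_right_mono[OF K1, of "\<bar>a - x * y\<bar>"] by simp
    show "\<bar>(x - x') * y'\<bar> \<le> \<bar>x - x'\<bar> * K" unfolding abs_mult by (rule mult_left_mono[OF assms(5) abs_ge_zero])
    show "\<bar>x * (y - y')\<bar> \<le> K * \<bar>y - y'\<bar>" unfolding abs_mult by (rule mult_right_mono[OF assms(2) abs_ge_zero])
  qed
  also have "\<dots> = K * (\<bar>a - x * y\<bar> + \<bar>x - x'\<bar> + \<bar>y - y'\<bar>)" by (simp add: algebra_simps)
  also have "\<dots> \<le> K * ((t + (a - x * y)\<^sup>2 / t) + (t + (x - x')\<^sup>2 / t) + (t + (y - y')\<^sup>2 / t))"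
    by (intro mult_left_mono add_mono le K0)
  also have "\<dots> = K * (3 * t + ((a - x * y)\<^sup>2 + (x - x')\<^sup>2 + (y - y')\<^sup>2) / t)"
    by (simp add: add_divide_distrib)
  finally have 1: "\<bar>a - x' * y'\<bar> \<le> K * (3 * t + ((a - x * y)\<^sup>2 + (x - x')\<^sup>2 + (y - y')\<^sup>2) / t)" (is "_ \<le> ?X") .
  have "a\<^sup>2 - (x' * y')\<^sup>2 = (a - x' * y') * (a + x' * y')" by (simp add: power2_eq_square algebra_simps)
  also have "\<dots> \<le> \<bar>a - x' * y'\<bar> * \<bar>a + x' * y'\<bar>" unfolding abs_mult[symmetric] by (rule abs_ge_self)
  also have "\<dots> \<le> ?X * (2 * K\<^sup>2)"
  proof (rule mult_mono[OF 1])
    show "\<bar>a + x' * y'\<bar> \<le> 2 * K\<^sup>2" using xy assms(1) by linarith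
    show "0 \<le> ?X" using 1 abs_ge_zero[of "a - x' * y'"] by linarith
  qed simp
  also have "?X * (2 * K\<^sup>2) = 2 * K ^ 3 * (3 * t + ((a - x * y)\<^sup>2 + (x - x')\<^sup>2 + (y - y')\<^sup>2) / t)"
    by (simp add: power3_eq_cube power2_eq_square)
  finally show ?thesis by (simp add: power_mult_distrib)
qed

context
  fixes B :: "nat \<Rightarrow> nat set" and S :: "nat \<Rightarrow> nat set"
  assumes B: "\<And>u. u \<in> V \<Longrightarrow> u \<in> B u" "\<And>u. u \<in> V \<Longrightarrow> B u \<subseteq> V"
    and S: "\<And>r. r \<in> V \<Longrightarrow> r \<in> S r" "\<And>r. r \<in> V \<Longrightarrow> S r \<subseteq> V"
    and SB: "\<And>r u. r \<in> V \<Longrightarrow> u \<in> S r \<Longrightarrow> S r \<subseteq> B u"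
begin

text \<open>What the observations outside \<open>B u\<close> add to the accuracy at \<open>u\<close>.\<close>

definition lgap :: "real \<Rightarrow> nat \<Rightarrow> real" where
  "lgap \<epsilon> u = bernoulli_mean \<epsilon> V (\<lambda>A. msq P (view A E) (fv u) - msq P (view (A \<inter> B u) (induced E (B u))) (fv u))"

definition received :: "nat \<Rightarrow> real" where
  "received u = (\<Sum>r\<in>V. of_bool (u \<in> S r) / card (S r))"

lemma lgap_bounds:
  assumes "0 \<le> \<epsilon>" "\<epsilon> \<le> 1"
  shows "0 \<le> lgap \<epsilon> u" "lgap \<epsilon> u \<le> K\<^sup>2"
proof -
  have "bernoulli_mean \<epsilon> V (\<lambda>A. 0) \<le> lgap \<epsilon> u"
    unfolding lgap_def using assms
    by (intro bernoulli_mean_mono) (auto intro!: msq_mono[OF finP] coarser_view induced_sub)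
  moreover have "lgap \<epsilon> u \<le> bernoulli_mean \<epsilon> V (\<lambda>A. K\<^sup>2)"
    unfolding lgap_def using assms
    by (intro bernoulli_mean_mono msq_gap_le)
  ultimately show "0 \<le> lgap \<epsilon> u" "lgap \<epsilon> u \<le> K\<^sup>2" by (simp_all add: bernoulli_mean_const[OF finV])
qed

text \<open>Each \<open>r\<close> spreads a unit mass evenly over \<open>S r\<close>. Summing over \<open>r\<close> first turns the masses received into averages
  over the regions, where the potential bounds the gaps.\<close>

lemma received_lgap:
  assumes \<epsilon>: "0 \<le> \<epsilon>" "\<epsilon> \<le> 1"
  shows "(\<Sum>u\<in>V. received u * lgap \<epsilon> u) \<le> (\<Sum>r\<in>V. fnorm * dpot \<epsilon> (S r) / card (S r))"
proof -
  have "(\<Sum>u\<in>V. received u * lgap \<epsilon> u) = (\<Sum>r\<in>V. \<Sum>u\<in>V. of_bool (u \<in> S r) / card (S r) * lgap \<epsilon> u)"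
    unfolding received_def sum_distrib_right by (rule sum.swap)
  also have "\<dots> = (\<Sum>r\<in>V. (\<Sum>u\<in>S r. lgap \<epsilon> u) / card (S r))"
  proof (intro sum.cong refl)
    fix r assume r: "r \<in> V"
    have "(\<Sum>u\<in>V. of_bool (u \<in> S r) / card (S r) * lgap \<epsilon> u) = (\<Sum>u\<in>S r. of_bool (u \<in> S r) / card (S r) * lgap \<epsilon> u)"
      using S(2)[OF r] finV by (intro sum.mono_neutral_right) auto
    also have "\<dots> = (\<Sum>u\<in>S r. lgap \<epsilon> u) / card (S r)" by (simp add: sum_divide_distrib)
    finally show "(\<Sum>u\<in>V. of_bool (u \<in> S r) / card (S r) * lgap \<epsilon> u) = (\<Sum>u\<in>S r. lgap \<epsilon> u) / card (S r)" .
  qed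
  also have "\<dots> \<le> (\<Sum>r\<in>V. fnorm * dpot \<epsilon> (S r) / card (S r))"
  proof (intro sum_mono divide_right_mono)
    fix r assume r: "r \<in> V"
    have "(\<Sum>u\<in>S r. lgap \<epsilon> u) \<le> (\<Sum>u\<in>S r. bernoulli_mean \<epsilon> V (\<lambda>A. msq P (view A E) (fv u) - msq P (view (A \<inter> S r) (induced E (S r))) (fv u)))"
      unfolding lgap_def
    proof (intro sum_mono bernoulli_mean_mono \<epsilon> diff_left_mono msq_mono[OF finP] coarser_view)
      fix u A assume "u \<in> S r"
      then show "A \<inter> S r \<subseteq> A \<inter> B u" "induced E (S r) \<subseteq> induced E (B u)"
        using SB[OF r] by (auto simp: induced_def)
    qed
    also have "\<dots> \<le> fnorm * dpot \<epsilon> (S r)" by (rule region_gap[OF S(2)[OF r] \<epsilon>])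
    finally show "(\<Sum>u\<in>S r. lgap \<epsilon> u) \<le> fnorm * dpot \<epsilon> (S r)" .
  qed simp
  finally show ?thesis .
qed

text \<open>Vertices that receive little mass are few and are estimated trivially.\<close>

lemma sum_lgap:
  assumes \<epsilon>: "0 \<le> \<epsilon>" "\<epsilon> \<le> 1" and \<delta>: "0 < \<delta>"
  shows "(\<Sum>u\<in>V. lgap \<epsilon> u) \<le> K\<^sup>2 * card {u \<in> V. received u \<le> \<delta>} + (\<Sum>r\<in>V. fnorm * dpot \<epsilon> (S r) / card (S r)) / \<delta>"
proof -
  have "(\<Sum>u\<in>V. lgap \<epsilon> u) \<le> (\<Sum>u\<in>V. K\<^sup>2 * of_bool (received u \<le> \<delta>) + received u * lgap \<epsilon> u / \<delta>)"
  proof (rule sum_mono)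
    fix u assume "u \<in> V"
    have r0: "0 \<le> received u" unfolding received_def by (intro sum_nonneg) auto
    show "lgap \<epsilon> u \<le> K\<^sup>2 * of_bool (received u \<le> \<delta>) + received u * lgap \<epsilon> u / \<delta>"
    proof (cases "received u \<le> \<delta>")
      case True
      then show ?thesis using lgap_bounds[OF \<epsilon>, of u] r0 \<delta> by (simp add: add_increasing2)
    next
      case False
      then have "\<delta> * lgap \<epsilon> u \<le> received u * lgap \<epsilon> u"
        using lgap_bounds[OF \<epsilon>, of u] by (intro mult_right_mono) auto
      then show ?thesis using False \<delta> by (simp add: field_simps)
    qed
  qed
  also have "\<dots> = K\<^sup>2 * card {u \<in> V. received u \<le> \<delta>} + (\<Sum>u\<in>V. received u * lgap \<epsilon> u) / \<delta>"
    using finV by (simp add: sum.distrib sum_distrib_left[symmetric] sum_divide_distrib[symmetric] Int_def)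
  also have "\<dots> \<le> K\<^sup>2 * card {u \<in> V. received u \<le> \<delta>} + (\<Sum>r\<in>V. fnorm * dpot \<epsilon> (S r) / card (S r)) / \<delta>"
    using \<delta> by (intro add_left_mono divide_right_mono received_lgap \<epsilon>) auto
  finally show ?thesis .
qed

lemma pair_acc_pointwise:
  assumes uv: "u \<in> V" "v \<in> V" and \<epsilon>: "0 \<le> \<epsilon>" "\<epsilon> \<le> 1" and t: "0 < t"
  shows "bernoulli_mean \<epsilon> V (\<lambda>A. msq P (view A E) (\<lambda>\<omega>. fv u \<omega> * fv v \<omega>))
    \<le> (lacc B \<epsilon> u * lacc B \<epsilon> v + 2 * K ^ 3 * (3 * t + (bernoulli_mean \<epsilon> V (\<lambda>A. dcov A u v) + lgap \<epsilon> u + lgap \<epsilon> v) / t))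
      + K ^ 4 * of_bool (B u \<inter> B v \<noteq> {})"
proof -
  let ?l = "\<lambda>A. mean P (\<lambda>\<omega>. (lpost B A u \<omega>)\<^sup>2 * (lpost B A v \<omega>)\<^sup>2)"
  let ?d = "\<lambda>w A. msq P (view A E) (fv w) - msq P (view (A \<inter> B w) (induced E (B w))) (fv w)"
  have "bernoulli_mean \<epsilon> V (\<lambda>A. msq P (view A E) (\<lambda>\<omega>. fv u \<omega> * fv v \<omega>))
    \<le> bernoulli_mean \<epsilon> V (\<lambda>A. ?l A + 2 * K ^ 3 * (3 * t + (dcov A u v + ?d u A + ?d v A) * (1 / t)))"
  proof (intro bernoulli_mean_mono \<epsilon>)
    fix A assume "A \<subseteq> V"
    let ?a = "cond_mean P (view A E) (\<lambda>\<omega>. fv u \<omega> * fv v \<omega>)"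
    let ?m = "\<lambda>w. cond_mean P (view A E) (fv w)"
    have d: "mean P (\<lambda>\<omega>. (?m w \<omega> - lpost B A w \<omega>)\<^sup>2) = ?d w A" for w
      unfolding lpost_def by (intro msq_diff[OF finP] coarser_view induced_sub) auto
    have "msq P (view A E) (\<lambda>\<omega>. fv u \<omega> * fv v \<omega>) \<le> mean P (\<lambda>\<omega>. (lpost B A u \<omega>)\<^sup>2 * (lpost B A v \<omega>)\<^sup>2
       + 2 * K ^ 3 * (3 * t + ((?a \<omega> - ?m u \<omega> * ?m v \<omega>)\<^sup>2 + (?m u \<omega> - lpost B A u \<omega>)\<^sup>2 + (?m v \<omega> - lpost B A v \<omega>)\<^sup>2) * (1 / t)))"
      unfolding msq_def
    proof (rule mean_mono)
      fix \<omega> assume w: "\<omega> \<in> set_pmf P"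
      have m: "\<bar>?m w \<omega>\<bar> \<le> K" for w by (rule cond_mean_bound[OF finP _ w]) (rule K)
      have a: "\<bar>?a \<omega>\<bar> \<le> K\<^sup>2"
      proof (rule cond_mean_bound[OF finP _ w])
        fix \<omega>
        show "\<bar>fv u \<omega> * fv v \<omega>\<bar> \<le> K\<^sup>2"
          unfolding abs_mult power2_eq_square using K1 by (intro mult_mono K) auto
      qed
      show "(?a \<omega>)\<^sup>2 \<le> (lpost B A u \<omega>)\<^sup>2 * (lpost B A v \<omega>)\<^sup>2
       + 2 * K ^ 3 * (3 * t + ((?a \<omega> - ?m u \<omega> * ?m v \<omega>)\<^sup>2 + (?m u \<omega> - lpost B A u \<omega>)\<^sup>2 + (?m v \<omega> - lpost B A v \<omega>)\<^sup>2) * (1 / t))"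
        using product_perturbation[OF a m[of u] m[of v] abs_lpost[OF w, of B A u] abs_lpost[OF w, of B A v] t] by simp
    qed
    also have "\<dots> = ?l A + 2 * K ^ 3 * (3 * t + (dcov A u v + ?d u A + ?d v A) * (1 / t))"
      unfolding mean_add mean_cmult mean_mult_right d mean_const[OF finP] dcov_def ..
    finally show "msq P (view A E) (\<lambda>\<omega>. fv u \<omega> * fv v \<omega>) \<le> \<dots>" .
  qed
  also have "\<dots> = bernoulli_mean \<epsilon> V ?l + 2 * K ^ 3 * (3 * t + (bernoulli_mean \<epsilon> V (\<lambda>A. dcov A u v) + lgap \<epsilon> u + lgap \<epsilon> v) * (1 / t))"
    unfolding lgap_def mult.commute[of _ "1 / t"] bernoulli_mean_add bernoulli_mean_cmult bernoulli_mean_const[OF finV] ..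
  also have "bernoulli_mean \<epsilon> V ?l \<le> lacc B \<epsilon> u * lacc B \<epsilon> v + K ^ 4 * of_bool (B u \<inter> B v \<noteq> {})"
  proof (cases "B u \<inter> B v = {}")
    case True
    have "?l A = msq P (view (A \<inter> B u) (induced E (B u))) (fv u) * msq P (view (A \<inter> B v) (induced E (B v))) (fv v)" for A
      using pair_indep[OF B uv True, of "\<lambda>a b. b\<^sup>2" A "\<lambda>a b. b\<^sup>2"] by (simp add: lpost_def msq_def)
    then show ?thesis using True bernoulli_mean_pair[OF B uv True, of \<epsilon>] by simp
  next
    case False
    have "bernoulli_mean \<epsilon> V ?l \<le> bernoulli_mean \<epsilon> V (\<lambda>A. K ^ 4)"
    proof (intro bernoulli_mean_mono \<epsilon>)
      fix A
      have "?l A \<le> mean P (\<lambda>\<omega>. K\<^sup>2 * K\<^sup>2)"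
      proof (intro mean_mono mult_mono)
        fix \<omega> assume w: "\<omega> \<in> set_pmf P"
        show "(lpost B A u \<omega>)\<^sup>2 \<le> K\<^sup>2" "(lpost B A v \<omega>)\<^sup>2 \<le> K\<^sup>2"
          using power_mono[OF abs_lpost[OF w, of B A u], where n = 2] power_mono[OF abs_lpost[OF w, of B A v], where n = 2]
          by simp_all
      qed auto
      then show "?l A \<le> K ^ 4" by (simp add: mean_const[OF finP] flip: power_add)
    qed
    moreover have "0 \<le> lacc B \<epsilon> u * lacc B \<epsilon> v"
      using lacc_bounds[OF B uv(1) \<epsilon>] lacc_bounds[OF B uv(2) \<epsilon>] by simp
    ultimately show ?thesis using False by (simp add: bernoulli_mean_const[OF finV])
  qed
  finally show ?thesis by simp
qed

lemma pair_acc_bound: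
  assumes \<epsilon>: "0 \<le> \<epsilon>" "\<epsilon> \<le> 1" and t: "0 < t"
  shows "pair_acc \<epsilon> \<le> ((\<Sum>u\<in>V. lacc B \<epsilon> u) / n)\<^sup>2 + K ^ 4 * overlaps B / n\<^sup>2 + 6 * K ^ 3 * t
     + 2 * K ^ 3 / t * (K\<^sup>2 * (\<Sum>u\<in>V. gain \<epsilon> u) / n\<^sup>2 + 2 * (\<Sum>u\<in>V. lgap \<epsilon> u) / n)"
proof -
  define a where "a = (\<Sum>u\<in>V. lacc B \<epsilon> u)"
  define D where "D = (\<Sum>u\<in>V. \<Sum>v\<in>V. bernoulli_mean \<epsilon> V (\<lambda>A. dcov A u v))"
  define L where "L = (\<Sum>u\<in>V. lgap \<epsilon> u)"
  define c where "c = 2 * K ^ 3"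
  have c0: "0 \<le> c" using K1 by (simp add: c_def)
  have "(\<Sum>u\<in>V. \<Sum>v\<in>V. bernoulli_mean \<epsilon> V (\<lambda>A. msq P (view A E) (\<lambda>\<omega>. fv u \<omega> * fv v \<omega>)))
    \<le> (\<Sum>u\<in>V. \<Sum>v\<in>V. lacc B \<epsilon> u * lacc B \<epsilon> v + c * (3 * t + (bernoulli_mean \<epsilon> V (\<lambda>A. dcov A u v) + lgap \<epsilon> u + lgap \<epsilon> v) / t))
      + K ^ 4 * overlaps B"
    unfolding c_def by (rule overlaps_sum[OF B]) (simp_all add: pair_acc_pointwise[OF _ _ \<epsilon> t])
  also have "(\<Sum>u\<in>V. \<Sum>v\<in>V. lacc B \<epsilon> u * lacc B \<epsilon> v + c * (3 * t + (bernoulli_mean \<epsilon> V (\<lambda>A. dcov A u v) + lgap \<epsilon> u + lgap \<epsilon> v) / t))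
     = a\<^sup>2 + c * (3 * t * n\<^sup>2 + (D + 2 * n * L) / t)"
    unfolding sum.distrib sum_distrib_left[symmetric] sum_divide_distrib[symmetric] double_sum_square[OF B] a_def[symmetric]
      D_def[symmetric] sum_constant L_def[symmetric]
    by (simp add: sum_distrib_left[symmetric] sum_distrib_right[symmetric] L_def a_def power2_eq_square algebra_simps)
  also have "\<dots> \<le> a\<^sup>2 + c * (3 * t * n\<^sup>2 + (K\<^sup>2 * (\<Sum>u\<in>V. gain \<epsilon> u) + 2 * n * L) / t)"
  proof -
    have "D \<le> K\<^sup>2 * (\<Sum>u\<in>V. gain \<epsilon> u)"
      unfolding D_def sum_distrib_left by (intro sum_mono decoupling \<epsilon>)
    then show ?thesis using t c0 by (intro add_left_mono mult_left_mono divide_right_mono add_right_mono) auto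
  qed
  finally have "pair_acc \<epsilon> \<le> 1 / n\<^sup>2 * (a\<^sup>2 + c * (3 * t * n\<^sup>2 + (K\<^sup>2 * (\<Sum>u\<in>V. gain \<epsilon> u) + 2 * n * L) / t) + K ^ 4 * overlaps B)"
    unfolding pair_acc_def by (intro mult_left_mono) auto
  also have "\<dots> = (a / n)\<^sup>2 + K ^ 4 * overlaps B / n\<^sup>2 + 3 * c * t + c / t * (K\<^sup>2 * (\<Sum>u\<in>V. gain \<epsilon> u) / n\<^sup>2 + 2 * L / n)"
    using n_pos t by (simp add: field_simps power2_eq_square)
  finally show ?thesis by (simp add: a_def L_def c_def)
qed

text \<open>The excess of the global accuracy over the local one is a derivative in \<open>\<epsilon>\<close> of a function of
  small total variation, so it is small at some point of each interval; monotonicity in \<open>\<epsilon>\<close> carries the bound to the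
  left end point.\<close>

lemma finite_volume_bound:
  assumes \<epsilon>: "0 \<le> \<epsilon>" "\<epsilon> < \<epsilon>'" "\<epsilon>' \<le> 1" and t: "0 < t" and \<delta>: "0 < \<delta>"
  shows "pair_acc \<epsilon> \<le> ((\<Sum>u\<in>V. lacc B \<epsilon>' u) / n)\<^sup>2 + K ^ 4 * overlaps B / n\<^sup>2 + 6 * K ^ 3 * t
     + 2 * K ^ 3 / t * (2 * K\<^sup>2 * (card {u \<in> V. received u \<le> \<delta>} / n)
        + (K ^ 4 / n + 2 * fnorm * ln CARD('x) / \<delta> * ((\<Sum>r\<in>V. card (bd (S r)) / card (S r)) / n)) / (\<epsilon>' - \<epsilon>))"
proof -
  define T where "T x = K\<^sup>2 / n\<^sup>2 * (\<Sum>u\<in>V. bernoulli_mean x V (\<lambda>A. msq P (view A E) (fv u)))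
     + 2 / (\<delta> * n) * (\<Sum>r\<in>V. fnorm * bernoulli_mean x V (pot (S r)) / card (S r))" for x
  define T' where "T' x = K\<^sup>2 / n\<^sup>2 * (\<Sum>u\<in>V. gain x u)
     + 2 / (\<delta> * n) * (\<Sum>r\<in>V. fnorm * dpot x (S r) / card (S r))" for x
  have der: "(T has_real_derivative T' x) (at x)" for x
    unfolding T_def T'_def by (intro DERIV_add DERIV_cmult DERIV_sum DERIV_cdivide gain_deriv dpot_deriv)
  have T'0: "0 \<le> T' x" if x: "0 \<le> x" "x \<le> 1" for x
  proof -
    have "0 \<le> K\<^sup>2 * gain x u" for u
    proof -
      have "0 \<le> bernoulli_mean x V (\<lambda>A. dcov A u v)" for v
        using bernoulli_mean_mono[of x V "\<lambda>_. 0" "\<lambda>A. dcov A u v"] x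
        by (simp add: bernoulli_mean_const[OF finV] dcov_def mean_nonneg)
      then have "0 \<le> (\<Sum>v\<in>V. bernoulli_mean x V (\<lambda>A. dcov A u v))" by (rule sum_nonneg)
      then show ?thesis using decoupling[OF x, of u] by linarith
    qed
    then have "0 \<le> (\<Sum>u\<in>V. K\<^sup>2 * gain x u) / n\<^sup>2" by (intro divide_nonneg_nonneg sum_nonneg) auto
    moreover have "0 \<le> 2 / (\<delta> * n) * (\<Sum>r\<in>V. fnorm * dpot x (S r) / card (S r))"
      using \<delta> n_pos S x by (intro mult_nonneg_nonneg sum_nonneg divide_nonneg_nonneg dpot_nonneg) auto
    ultimately show ?thesis by (simp add: T'_def sum_distrib_left[symmetric])
  qed
  have mono: "T x \<le> T y" if "0 \<le> x" "x \<le> y" "y \<le> 1" for x y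
    by (rule DERIV_nonneg_imp_nondecreasing[OF that(2)]) (use der T'0 that in force)
  have total: "T 1 - T 0 \<le> K ^ 4 / n + 2 * fnorm * ln CARD('x) / \<delta> * ((\<Sum>r\<in>V. card (bd (S r)) / card (S r)) / n)"
  proof -
    have 1: "(\<Sum>u\<in>V. msq P (view V E) (fv u)) - (\<Sum>u\<in>V. msq P (view {} E) (fv u)) \<le> n * K\<^sup>2"
      unfolding sum_subtractf[symmetric]
      by (rule order.trans[OF sum_mono[of V _ "\<lambda>_. K\<^sup>2"]]) (rule msq_gap_le, simp)
    have f0: "0 \<le> fnorm" unfolding fnorm_def by (intro mult_nonneg_nonneg sum_nonneg) auto
    have 2: "(\<Sum>r\<in>V. fnorm * pot (S r) V / card (S r)) - (\<Sum>r\<in>V. fnorm * pot (S r) {} / card (S r))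
      \<le> (\<Sum>r\<in>V. fnorm * ln CARD('x) * (card (bd (S r)) / card (S r)))"
      unfolding sum_subtractf[symmetric]
    proof (rule sum_mono)
      fix r assume "r \<in> V"
      have "fnorm * pot (S r) V / card (S r) - fnorm * pot (S r) {} / card (S r) = fnorm * (pot (S r) V - pot (S r) {}) / card (S r)"
        by (simp add: algebra_simps diff_divide_distrib)
      also have "\<dots> \<le> fnorm * (card (bd (S r)) * ln CARD('x)) / card (S r)"
        by (intro divide_right_mono mult_left_mono pot_total S(2) \<open>r \<in> V\<close> f0) auto
      finally show "fnorm * pot (S r) V / card (S r) - fnorm * pot (S r) {} / card (S r) \<le> fnorm * ln CARD('x) * (card (bd (S r)) / card (S r))"
        by (simp add: mult_ac)
    qed
    have "T 1 - T 0 = K\<^sup>2 / n\<^sup>2 * ((\<Sum>u\<in>V. msq P (view V E) (fv u)) - (\<Sum>u\<in>V. msq P (view {} E) (fv u)))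
      + 2 / (\<delta> * n) * ((\<Sum>r\<in>V. fnorm * pot (S r) V / card (S r)) - (\<Sum>r\<in>V. fnorm * pot (S r) {} / card (S r)))"
      by (simp add: T_def bernoulli_mean_0[OF finV] bernoulli_mean_1[OF finV] right_diff_distrib)
    also have "\<dots> \<le> K\<^sup>2 / n\<^sup>2 * (n * K\<^sup>2) + 2 / (\<delta> * n) * (\<Sum>r\<in>V. fnorm * ln CARD('x) * (card (bd (S r)) / card (S r)))"
      using \<delta> n_pos by (intro add_mono mult_left_mono 1 2) auto
    also have "\<dots> = K ^ 4 / n + 2 * fnorm * ln CARD('x) / \<delta> * ((\<Sum>r\<in>V. card (bd (S r)) / card (S r)) / n)"
      unfolding sum_distrib_left[symmetric] using n_pos \<delta> by (simp add: field_simps power2_eq_square power4_eq_xxxx)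
    finally show ?thesis .
  qed
  obtain z where z: "\<epsilon> < z" "z < \<epsilon>'" and T: "T \<epsilon>' - T \<epsilon> = (\<epsilon>' - \<epsilon>) * T' z"
    using MVT2[OF \<epsilon>(2), of T T'] der by blast
  have z01: "0 \<le> z" "z \<le> 1" using z \<epsilon> by auto
  define R where "R = K ^ 4 / n + 2 * fnorm * ln CARD('x) / \<delta> * ((\<Sum>r\<in>V. card (bd (S r)) / card (S r)) / n)"
  have "(\<epsilon>' - \<epsilon>) * T' z \<le> R"
    using T total mono[of 0 \<epsilon>] mono[of \<epsilon>' 1] \<epsilon> by (simp add: R_def)
  then have Tz: "T' z \<le> R / (\<epsilon>' - \<epsilon>)" using \<epsilon> by (simp add: field_simps)
  define p where "p = real (card {u \<in> V. received u \<le> \<delta>}) / n"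
  define D where "D = (\<Sum>r\<in>V. fnorm * dpot z (S r) / card (S r))"
  have "2 * (\<Sum>u\<in>V. lgap z u) / n \<le> 2 * (K\<^sup>2 * card {u \<in> V. received u \<le> \<delta>} + D / \<delta>) / n"
    unfolding D_def using n_pos by (intro divide_right_mono mult_left_mono sum_lgap z01 \<delta>) auto
  also have "\<dots> = 2 * K\<^sup>2 * p + 2 / (\<delta> * n) * D"
    using n_pos \<delta> by (simp add: p_def field_simps)
  finally have "K\<^sup>2 * (\<Sum>u\<in>V. gain z u) / n\<^sup>2 + 2 * (\<Sum>u\<in>V. lgap z u) / n \<le> 2 * K\<^sup>2 * p + T' z"
    by (simp add: T'_def D_def)
  also have "\<dots> \<le> 2 * K\<^sup>2 * p + R / (\<epsilon>' - \<epsilon>)" using Tz by simp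
  finally have X: "K\<^sup>2 * (\<Sum>u\<in>V. gain z u) / n\<^sup>2 + 2 * (\<Sum>u\<in>V. lgap z u) / n \<le> 2 * K\<^sup>2 * p + R / (\<epsilon>' - \<epsilon>)" .
  have "pair_acc \<epsilon> \<le> pair_acc z" using z \<epsilon> by (intro pair_acc_increasing) auto
  also have "\<dots> \<le> ((\<Sum>u\<in>V. lacc B z u) / n)\<^sup>2 + K ^ 4 * overlaps B / n\<^sup>2 + 6 * K ^ 3 * t
     + 2 * K ^ 3 / t * (K\<^sup>2 * (\<Sum>u\<in>V. gain z u) / n\<^sup>2 + 2 * (\<Sum>u\<in>V. lgap z u) / n)"
    by (rule pair_acc_bound[OF z01 t])
  also have "\<dots> \<le> ((\<Sum>u\<in>V. lacc B \<epsilon>' u) / n)\<^sup>2 + K ^ 4 * overlaps B / n\<^sup>2 + 6 * K ^ 3 * t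
     + 2 * K ^ 3 / t * (2 * K\<^sup>2 * p + R / (\<epsilon>' - \<epsilon>))"
  proof -
    have "((\<Sum>u\<in>V. lacc B z u) / n)\<^sup>2 \<le> ((\<Sum>u\<in>V. lacc B \<epsilon>' u) / n)\<^sup>2"
      using n_pos z z01 \<epsilon>
      by (intro power_mono divide_right_mono sum_mono lacc_increasing[OF B] divide_nonneg_nonneg sum_nonneg lacc_bounds(1)[OF B]) auto
    moreover have "2 * K ^ 3 / t * (K\<^sup>2 * (\<Sum>u\<in>V. gain z u) / n\<^sup>2 + 2 * (\<Sum>u\<in>V. lgap z u) / n) \<le> 2 * K ^ 3 / t * (2 * K\<^sup>2 * p + R / (\<epsilon>' - \<epsilon>))"
      using t K1 by (intro mult_left_mono X) auto
    ultimately show ?thesis by linarith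
  qed
  finally show ?thesis by (simp add: p_def R_def)
qed

end

end

section \<open>Local functions of rooted graphs\<close>

lemma reroot_sel [simp]: "origin (reroot g u) = u" "verts (reroot g u) = verts g" "edges (reroot g u) = edges g"
  by (simp_all add: reroot_def)

lemma reroot_reroot [simp]: "reroot (reroot g u) v = reroot g v"
  by (simp add: reroot_def)

lemma reroot_origin [simp]: "reroot g (origin g) = g"
  by (simp add: reroot_def)

lemma rooted_reroot: "rooted g \<Longrightarrow> u \<in> verts g \<Longrightarrow> rooted (reroot g u)"
  by (simp add: rooted_def)

lemma relpow_und_sym: "(a, b) \<in> und E ^^ k \<longleftrightarrow> (b, a) \<in> und E ^^ k"
proof -
  have "(b, a) \<in> und E ^^ k" if "(a, b) \<in> und E ^^ k" for a b
    using that
  proof (induction k arbitrary: b)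
    case (Suc k)
    then obtain c where c: "(a, c) \<in> und E ^^ k" "(c, b) \<in> und E" by auto
    then have "(b, c) \<in> und E" by (auto simp: und_def)
    then show ?case using Suc.IH[OF c(1)] by (meson relpow_Suc_I2)
  qed auto
  then show ?thesis by blast
qed

lemma ball_verts_mono: "l \<le> l' \<Longrightarrow> ball_verts l g \<subseteq> ball_verts l' g"
  by (auto simp: ball_verts_def intro: order.trans)

lemma origin_in_ball [simp]: "origin g \<in> ball_verts l g"
  by (auto simp: ball_verts_def intro!: exI[of _ 0])

lemma ball_step:
  assumes "u \<in> ball_verts k g" "(u, v) \<in> und (edges g) ^^ j" "k + j \<le> l"
  shows "v \<in> ball_verts l g"
proof -
  obtain i where i: "i \<le> k" "(origin g, u) \<in> und (edges g) ^^ i" using assms(1) by (auto simp: ball_verts_def)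
  then have "(origin g, v) \<in> und (edges g) ^^ (i + j)" using assms(2) unfolding relpow_add by blast
  then show ?thesis using i assms(3) by (auto simp: ball_verts_def intro!: exI[of _ "i + j"])
qed

lemma ball_reroot_subset:
  assumes "u \<in> ball_verts k g" "k + s \<le> l"
  shows "ball_verts s (reroot g u) \<subseteq> ball_verts l g"
proof
  fix v assume "v \<in> ball_verts s (reroot g u)"
  then obtain j where "j \<le> s" "(u, v) \<in> und (edges g) ^^ j" by (auto simp: ball_verts_def)
  then show "v \<in> ball_verts l g" using assms by (intro ball_step[OF assms(1), of v j]) auto
qed

lemma ball_reroot_sym: "origin g \<in> ball_verts l (reroot g u) \<longleftrightarrow> u \<in> ball_verts l g"
  using relpow_und_sym by (fastforce simp: ball_verts_def)

lemma verts_ball: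
  assumes "rooted g" "v \<in> verts g"
  obtains l where "v \<in> ball_verts l g"
proof -
  have "(origin g, v) \<in> (und (edges g))\<^sup>*" using assms by (auto simp: rooted_def graph_def)
  then obtain k where "(origin g, v) \<in> und (edges g) ^^ k" by (auto simp: rtrancl_power)
  then show ?thesis using that[of k] by (auto simp: ball_verts_def)
qed

lemma ball_verts_Suc: "ball_verts (Suc l) g = ball_verts l g \<union> (\<Union>u\<in>ball_verts l g. {v. (u, v) \<in> und (edges g)})"
proof
  show "ball_verts (Suc l) g \<subseteq> ball_verts l g \<union> (\<Union>u\<in>ball_verts l g. {v. (u, v) \<in> und (edges g)})"
  proof
    fix v assume "v \<in> ball_verts (Suc l) g"
    then obtain k where k: "k \<le> Suc l" "(origin g, v) \<in> und (edges g) ^^ k" by (auto simp: ball_verts_def)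
    show "v \<in> ball_verts l g \<union> (\<Union>u\<in>ball_verts l g. {v. (u, v) \<in> und (edges g)})"
    proof (cases "k \<le> l")
      case True then show ?thesis using k by (auto simp: ball_verts_def)
    next
      case False
      then have "k = Suc l" using k by auto
      then show ?thesis using k(2) by (force simp: ball_verts_def)
    qed
  qed
  show "ball_verts l g \<union> (\<Union>u\<in>ball_verts l g. {v. (u, v) \<in> und (edges g)}) \<subseteq> ball_verts (Suc l) g"
    using ball_verts_mono[of l "Suc l" g] ball_step[of _ l g _ 1 "Suc l"] by auto
qed

lemma finite_ball: "rooted g \<Longrightarrow> finite (ball_verts l g)"
proof (induction l)
  case 0
  have "ball_verts 0 g = {origin g}" by (auto simp: ball_verts_def)
  then show ?case by simp
next
  case (Suc l)
  then show ?case
    using ball_verts_subset[OF Suc.prems, of l] unfolding ball_verts_Suc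
    by (auto simp: rooted_def graph_def)
qed

lemma rball_sel [simp]: "verts (rball l g) = ball_verts l g" "origin (rball l g) = origin g"
  by (simp_all add: rball_def)

lemma edges_rball: "edges (rball l g) = edges g \<inter> ball_verts l g \<times> ball_verts l g"
  by (simp add: rball_def)

lemma is_iso_ball_inv:
  assumes "is_iso \<phi> (rball r g) (rball r h)"
  shows "is_iso (inv_into (ball_verts r g) \<phi>) (rball r h) (rball r g)"
  using is_iso_inv[OF assms] by simp

lemma iso_path:
  assumes iso: "is_iso \<phi> (rball r g) (rball r h)" and u: "u \<in> ball_verts k g"
    and p: "(u, v) \<in> und (edges g) ^^ j" and kj: "k + j \<le> r"
  shows "(\<phi> u, \<phi> v) \<in> und (edges h) ^^ j"
  using p kj
proof (induction j arbitrary: v)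
  case (Suc j)
  then obtain w where w: "(u, w) \<in> und (edges g) ^^ j" "(w, v) \<in> und (edges g)" by auto
  have "w \<in> ball_verts r g" "v \<in> ball_verts r g"
    using ball_step[OF u w(1)] ball_step[OF u Suc.prems(1)] Suc.prems(2) by auto
  then have "(\<phi> w, \<phi> v) \<in> und (edges h)"
    using iso w(2) by (auto simp: is_iso_def edges_rball und_def)
  then show ?case using Suc.IH[OF w(1)] Suc.prems(2) by auto
qed simp

lemma iso_image:
  assumes iso: "is_iso \<phi> (rball r g) (rball r h)" and "k \<le> r"
  shows "\<phi> ` ball_verts k g = ball_verts k h"
proof -
  have sub: "\<phi> ` ball_verts k g \<subseteq> ball_verts k h" if "is_iso \<phi> (rball r g) (rball r h)" for \<phi> g h
  proof
    fix y assume "y \<in> \<phi> ` ball_verts k g"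
    then obtain j v where y: "y = \<phi> v" and j: "j \<le> k" "(origin g, v) \<in> und (edges g) ^^ j" by (auto simp: ball_verts_def)
    have "(\<phi> (origin g), \<phi> v) \<in> und (edges h) ^^ j"
      by (rule iso_path[OF that _ j(2), of 0]) (use j assms in auto)
    moreover have "\<phi> (origin g) = origin h" using that by (simp add: is_iso_def)
    ultimately show "y \<in> ball_verts k h" using y j by (auto simp: ball_verts_def)
  qed
  have bij: "bij_betw \<phi> (ball_verts r g) (ball_verts r h)" using iso by (simp add: is_iso_def)
  have "ball_verts k h \<subseteq> \<phi> ` ball_verts k g"
  proof
    fix y assume y: "y \<in> ball_verts k h"
    have "inv_into (ball_verts r g) \<phi> y \<in> ball_verts k g" using sub[OF is_iso_ball_inv[OF iso]] y by blast
    moreover have "\<phi> (inv_into (ball_verts r g) \<phi> y) = y"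
      using bij y ball_verts_mono[OF assms(2), of h] by (meson bij_betw_inv_into_right subsetD)
    ultimately show "y \<in> \<phi> ` ball_verts k g" by force
  qed
  then show ?thesis using sub[OF iso] by blast
qed

lemma iso_subball:
  assumes iso: "is_iso \<phi> (rball r g) (rball r h)" and u: "u \<in> ball_verts k g" and ks: "k + s \<le> r"
  shows "is_iso \<phi> (rball s (reroot g u)) (rball s (reroot h (\<phi> u)))"
proof -
  let ?\<psi> = "inv_into (ball_verts r g) \<phi>"
  let ?b = "ball_verts s (reroot g u)" and ?b' = "ball_verts s (reroot h (\<phi> u))"
  have bij: "bij_betw \<phi> (ball_verts r g) (ball_verts r h)" using iso by (simp add: is_iso_def)
  have \<phi>u: "\<phi> u \<in> ball_verts k h" using iso_image[OF iso, of k] u ks by auto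
  have ur: "u \<in> ball_verts r g" using u ball_verts_mono[of k r g] ks by auto
  have b: "?b \<subseteq> ball_verts r g" by (rule ball_reroot_subset[OF u ks])
  have b': "?b' \<subseteq> ball_verts r h" by (rule ball_reroot_subset[OF \<phi>u ks])
  have sub: "\<phi> ` ?b \<subseteq> ?b'"
  proof
    fix y assume "y \<in> \<phi> ` ?b"
    then obtain v j where "y = \<phi> v" "j \<le> s" "(u, v) \<in> und (edges g) ^^ j" by (auto simp: ball_verts_def)
    then show "y \<in> ?b'" using iso_path[OF iso u, of v j] ks by (auto simp: ball_verts_def)
  qed
  moreover have "?b' \<subseteq> \<phi> ` ?b"
  proof
    fix y assume y: "y \<in> ?b'"
    then obtain j where j: "j \<le> s" "(\<phi> u, y) \<in> und (edges h) ^^ j" by (auto simp: ball_verts_def)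
    have "(?\<psi> (\<phi> u), ?\<psi> y) \<in> und (edges g) ^^ j"
      by (rule iso_path[OF is_iso_ball_inv[OF iso] \<phi>u j(2)]) (use ks j in auto)
    then have "?\<psi> y \<in> ?b" using bij_betw_inv_into_left[OF bij ur] j by (auto simp: ball_verts_def)
    moreover have "\<phi> (?\<psi> y) = y" using bij b' y by (meson bij_betw_inv_into_right subsetD)
    ultimately show "y \<in> \<phi> ` ?b" by force
  qed
  ultimately have "bij_betw \<phi> ?b ?b'"
    using bij b by (auto simp: bij_betw_def inj_on_subset)
  moreover have "(a, c) \<in> edges (rball s (reroot g u)) \<longleftrightarrow> (\<phi> a, \<phi> c) \<in> edges (rball s (reroot h (\<phi> u)))"
    if ac: "a \<in> ?b" "c \<in> ?b" for a c
  proof -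
    have "a \<in> ball_verts r g" "c \<in> ball_verts r g" using ac b by auto
    then have "(a, c) \<in> edges g \<longleftrightarrow> (\<phi> a, \<phi> c) \<in> edges h"
      using iso iso_image[OF iso order.refl] by (auto simp: is_iso_def edges_rball)
    then show ?thesis using ac sub by (auto simp: edges_rball)
  qed
  ultimately show ?thesis by (simp add: is_iso_def)
qed

lemma iso_smaller: "is_iso \<phi> (rball r g) (rball r h) \<Longrightarrow> s \<le> r \<Longrightarrow> is_iso \<phi> (rball s g) (rball s h)"
  using iso_subball[of \<phi> r g h "origin g" 0 s] by (simp add: is_iso_def)

text \<open>These functions are continuous on the space of rooted graphs, so their averages over the finite graphs converge.\<close>

definition loc :: "nat \<Rightarrow> (rgraph \<Rightarrow> 'b) \<Rightarrow> bool" where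
  "loc r \<Phi> \<longleftrightarrow> (\<forall>g h \<phi>. rooted g \<longrightarrow> rooted h \<longrightarrow> is_iso \<phi> (rball r g) (rball r h) \<longrightarrow> \<Phi> g = \<Phi> h)"

lemma locI: "(\<And>g h \<phi>. rooted g \<Longrightarrow> rooted h \<Longrightarrow> is_iso \<phi> (rball r g) (rball r h) \<Longrightarrow> \<Phi> g = \<Phi> h) \<Longrightarrow> loc r \<Phi>"
  unfolding loc_def by blast

lemma locD: "loc r \<Phi> \<Longrightarrow> rooted g \<Longrightarrow> rooted h \<Longrightarrow> is_iso \<phi> (rball r g) (rball r h) \<Longrightarrow> \<Phi> g = \<Phi> h"
  unfolding loc_def by blast

lemma loc_comp: "loc r \<Phi> \<Longrightarrow> loc r (\<lambda>g. k (\<Phi> g))"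
  unfolding loc_def by metis

lemma loc_card_ball: "loc r (\<lambda>g. card (ball_verts r g))"
proof (rule locI)
  fix g h \<phi> assume "is_iso \<phi> (rball r g) (rball r h)"
  then show "card (ball_verts r g) = card (ball_verts r h)" by (auto simp: is_iso_def intro: bij_betw_same_card)
qed

lemma rooted_rep: "rooted (rep_gstar x)"
  using Quotient3_rep_reflp[OF Quotient3_gstar, of x] by simp

lemma abs_rep: "abs_gstar (rep_gstar x) = x"
  by (rule Quotient3_abs_rep[OF Quotient3_gstar])

lemma rep_abs_iso: "rooted g \<Longrightarrow> isomorphic (rep_gstar (abs_gstar g)) g"
  using Quotient3_rep_abs[OF Quotient3_gstar, of g] isomorphic_refl by simp

lemma rep_abs_obtain:
  assumes "rooted g"
  obtains \<phi> where "is_iso \<phi> (rep_gstar (abs_gstar g)) g"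
  using rep_abs_iso[OF assms] unfolding isomorphic_def by blast

lemma loc_rep_abs: "loc r \<Phi> \<Longrightarrow> rooted g \<Longrightarrow> \<Phi> (rep_gstar (abs_gstar g)) = \<Phi> g"
  by (metis rep_abs_obtain is_iso_rball locD rooted_rep)

lemma same_ball_rep: "same_ball r x y \<longleftrightarrow> isomorphic (rball r (rep_gstar x)) (rball r (rep_gstar y))"
  by (rule same_ball.rep_eq)

lemma open_same_ball: "open {y. same_ball r x y}"
  unfolding open_gstar_def by (rule generate_topology.Basis) auto

lemma open_loc:
  assumes "loc r \<Phi>"
  shows "open {x. \<Phi> (rep_gstar x) \<in> U}"
proof -
  have "\<Phi> (rep_gstar x) = \<Phi> (rep_gstar y)" if "same_ball r x y" for x y
    using that locD[OF assms rooted_rep rooted_rep] by (auto simp: same_ball_rep isomorphic_def)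
  then have "{x. \<Phi> (rep_gstar x) \<in> U} = (\<Union>x\<in>{x. \<Phi> (rep_gstar x) \<in> U}. {y. same_ball r x y})"
    using same_ball_refl by fastforce
  also have "open \<dots>" by (intro open_UN ballI open_same_ball)
  finally show ?thesis .
qed

lemma sets_loc: "loc r \<Phi> \<Longrightarrow> {x. \<Phi> (rep_gstar x) \<in> U} \<in> sets borel"
  by (rule borel_open[OF open_loc])

lemma borel_measurable_loc:
  fixes \<Phi> :: "rgraph \<Rightarrow> 'b::topological_space"
  shows "loc r \<Phi> \<Longrightarrow> (\<lambda>x. \<Phi> (rep_gstar x)) \<in> borel_measurable borel"
  by (rule borel_measurableI) (simp add: vimage_def sets_loc)

lemma continuous_loc:
  fixes \<Phi> :: "rgraph \<Rightarrow> 'b::topological_space"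
  shows "loc r \<Phi> \<Longrightarrow> continuous_on UNIV (\<lambda>x. \<Phi> (rep_gstar x))"
  by (simp add: continuous_on_open_vimage vimage_def open_loc)

lemma open_gstar_ball:
  assumes "open U" "x \<in> U"
  shows "\<exists>l. \<forall>y. same_ball l x y \<longrightarrow> y \<in> U"
proof (rule ccontr)
  assume "\<not> (\<exists>l. \<forall>y. same_ball l x y \<longrightarrow> y \<in> U)"
  then obtain y where y: "\<And>l. same_ball l x (y l)" "\<And>l. y l \<notin> U" by metis
  have "eventually (\<lambda>n. same_ball l (y n) x) sequentially" for l
  proof (rule eventually_sequentiallyI)
    fix n assume "l \<le> n"
    obtain \<phi> where "is_iso \<phi> (rball n (rep_gstar x)) (rball n (rep_gstar (y n)))"
      using y(1)[of n] by (auto simp: same_ball_rep isomorphic_def)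
    from iso_smaller[OF this \<open>l \<le> n\<close>] have "same_ball l x (y n)" by (auto simp: same_ball_rep isomorphic_def)
    then show "same_ball l (y n) x" by (rule same_ball_sym)
  qed
  then have "y \<longlonglongrightarrow> x" by (simp add: tendsto_gstar_iff)
  then have "eventually (\<lambda>n. y n \<in> U) sequentially" using assms by (rule topological_tendstoD)
  then show False using y(2) by (auto simp: eventually_sequentially)
qed

abbreviation gr :: "(nat \<Rightarrow> (nat \<times> nat) set) \<Rightarrow> nat \<Rightarrow> nat \<Rightarrow> rgraph" where
  "gr E n u \<equiv> RGraph {..<n} (E n) u"

locale weak_limit =
  fixes E :: "nat \<Rightarrow> (nat \<times> nat) set" and \<rho> :: "gstar measure"
  assumes graphs: "\<And>n. n \<ge> 1 \<Longrightarrow> graph {..<n} (E n)"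
    and prob: "prob_space \<rho>" and sets_rho: "sets \<rho> = sets borel"
    and conv: "locally_weakly_converges E \<rho>"
begin

sublocale prob_space \<rho> by (rule prob)

lemma space_rho: "space \<rho> = UNIV"
  using sets_eq_imp_space_eq[OF sets_rho] by simp

lemma rooted_gr: "u < n \<Longrightarrow> rooted (gr E n u)"
  using graphs[of n] by (auto simp: rooted_def)

lemma measurable_rho: "h \<in> borel_measurable borel \<Longrightarrow> h \<in> borel_measurable \<rho>"
  using measurable_cong_sets[OF sets_rho refl] by blast

lemma integrable_loc:
  fixes \<Phi> :: "rgraph \<Rightarrow> real"
  assumes "loc r \<Phi>" "\<And>g. rooted g \<Longrightarrow> \<bar>\<Phi> g\<bar> \<le> C"
  shows "integrable \<rho> (\<lambda>x. \<Phi> (rep_gstar x))"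
  by (rule integrable_const_bound[of _ C])
    (use assms rooted_rep measurable_rho[OF borel_measurable_loc] in auto)

lemma average_converges:
  fixes \<Phi> :: "rgraph \<Rightarrow> real"
  assumes loc: "loc r \<Phi>" and bound: "\<And>g. rooted g \<Longrightarrow> \<bar>\<Phi> g\<bar> \<le> C"
  shows "(\<lambda>n. (\<Sum>u<n. \<Phi> (gr E n u)) / n) \<longlonglongrightarrow> (\<integral>x. \<Phi> (rep_gstar x) \<partial>\<rho>)"
proof -
  let ?h = "\<lambda>x. \<Phi> (rep_gstar x)"
  have "bounded (range ?h)"
    unfolding bounded_iff using bound rooted_rep by auto
  then have lim: "(\<lambda>n. \<integral>x. ?h x \<partial>root_law n (E n)) \<longlonglongrightarrow> (\<integral>x. ?h x \<partial>\<rho>)"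
    using conv continuous_loc[OF loc] unfolding locally_weakly_converges_def weakly_converges_def by blast
  have "(\<integral>x. ?h x \<partial>root_law n (E n)) = (\<Sum>u<n. \<Phi> (gr E n u)) / n" if "n \<ge> 1" for n
  proof -
    have "(\<integral>x. ?h x \<partial>root_law n (E n)) = measure_pmf.expectation (pmf_of_set {..<n}) (\<lambda>u. ?h (abs_gstar (gr E n u)))"
      unfolding root_law_def by (rule integral_distr) (auto simp: borel_measurable_loc[OF loc])
    also have "\<dots> = (\<Sum>u<n. ?h (abs_gstar (gr E n u))) / n"
      using that by (subst integral_pmf_of_set) (auto simp: lessThan_empty_iff)
    also have "(\<Sum>u<n. ?h (abs_gstar (gr E n u))) = (\<Sum>u<n. \<Phi> (gr E n u))"
      by (intro sum.cong refl loc_rep_abs[OF loc] rooted_gr) auto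
    finally show ?thesis .
  qed
  then have "eventually (\<lambda>n. (\<integral>x. ?h x \<partial>root_law n (E n)) = (\<Sum>u<n. \<Phi> (gr E n u)) / n) sequentially"
    by (auto simp: eventually_sequentially)
  then show ?thesis using lim by (rule Lim_transform_eventually[rotated])
qed

lemma ball_size_tight:
  assumes "0 < \<eta>"
  shows "\<exists>N. prob {x. card (ball_verts r (rep_gstar x)) > N} < \<eta>"
proof -
  let ?B = "\<lambda>N. {x. card (ball_verts r (rep_gstar x)) > N}"
  have meas: "?B N \<in> sets \<rho>" for N
    using sets_loc[OF loc_card_ball, of r "{N<..}"] by (simp add: sets_rho)
  have "(\<lambda>N. prob (?B N)) \<longlonglongrightarrow> prob (\<Inter>N. ?B N)"
    by (rule finite_Lim_measure_decseq) (auto simp: meas decseq_def)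
  moreover have "(\<Inter>N. ?B N) = {}" by auto
  ultimately have "(\<lambda>N. prob (?B N)) \<longlonglongrightarrow> 0" by simp
  from order_tendstoD(2)[OF this assms] show ?thesis by (auto simp: eventually_sequentially)
qed

end

section \<open>Mass transport\<close>

definition birooted_verts :: "(rgraph \<times> nat) set" where
  "birooted_verts = {(g, v). rooted g \<and> v \<in> verts g}"

text \<open>Sets of pairs of a rooted graph and a vertex in the ball of radius \<open>r\<close> that are determined by this ball.\<close>

definition bloc :: "nat \<Rightarrow> (rgraph \<times> nat) set \<Rightarrow> bool" where
  "bloc r A \<longleftrightarrow> A \<subseteq> {(g, v). rooted g \<and> v \<in> ball_verts r g} \<and>
     (\<forall>g h \<phi> v. rooted g \<longrightarrow> rooted h \<longrightarrow> is_iso \<phi> (rball r g) (rball r h) \<longrightarrow> v \<in> ball_verts r g \<longrightarrow>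
        ((g, v) \<in> A \<longleftrightarrow> (h, \<phi> v) \<in> A))"

definition local_sets :: "(rgraph \<times> nat) set set" where
  "local_sets = {A. \<exists>r. bloc r A}"

definition floc :: "nat \<Rightarrow> (rgraph \<times> nat \<Rightarrow> ennreal) \<Rightarrow> bool" where
  "floc r F \<longleftrightarrow> (\<forall>g v. rooted g \<longrightarrow> v \<notin> ball_verts r g \<longrightarrow> F (g, v) = 0) \<and>
     (\<forall>g h \<phi> v. rooted g \<longrightarrow> rooted h \<longrightarrow> is_iso \<phi> (rball r g) (rball r h) \<longrightarrow> v \<in> ball_verts r g \<longrightarrow>
        F (g, v) = F (h, \<phi> v))"

lemma blocI:
  assumes "\<And>g v. (g, v) \<in> A \<Longrightarrow> rooted g \<and> v \<in> ball_verts r g"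
    and "\<And>g h \<phi> v. rooted g \<Longrightarrow> rooted h \<Longrightarrow> is_iso \<phi> (rball r g) (rball r h) \<Longrightarrow> v \<in> ball_verts r g \<Longrightarrow>
        (g, v) \<in> A \<longleftrightarrow> (h, \<phi> v) \<in> A"
  shows "bloc r A"
  unfolding bloc_def using assms by blast

lemma blocD1: "bloc r A \<Longrightarrow> (g, v) \<in> A \<Longrightarrow> rooted g \<and> v \<in> ball_verts r g"
  unfolding bloc_def by blast

lemma blocD2: "bloc r A \<Longrightarrow> rooted g \<Longrightarrow> rooted h \<Longrightarrow> is_iso \<phi> (rball r g) (rball r h) \<Longrightarrow> v \<in> ball_verts r g \<Longrightarrow>
   (g, v) \<in> A \<longleftrightarrow> (h, \<phi> v) \<in> A"
  unfolding bloc_def by blast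

lemma bloc_mono:
  assumes A: "bloc r A" and rs: "r \<le> s"
  shows "bloc s A"
proof (rule blocI)
  show "rooted g \<and> v \<in> ball_verts s g" if "(g, v) \<in> A" for g v
    using blocD1[OF A that] ball_verts_mono[OF rs, of g] by blast
  fix g h \<phi> v assume *: "rooted g" "rooted h" "is_iso \<phi> (rball s g) (rball s h)" "v \<in> ball_verts s g"
  show "(g, v) \<in> A \<longleftrightarrow> (h, \<phi> v) \<in> A"
  proof (cases "v \<in> ball_verts r g")
    case True
    then show ?thesis using blocD2[OF A *(1,2) iso_smaller[OF *(3) rs]] by blast
  next
    case False
    have inj: "inj_on \<phi> (ball_verts s g)" using *(3) by (simp add: is_iso_def bij_betw_def)
    have "\<phi> v \<notin> ball_verts r h"
    proof
      assume "\<phi> v \<in> ball_verts r h"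
      then obtain w where "w \<in> ball_verts r g" "\<phi> v = \<phi> w" using iso_image[OF *(3) rs] by auto
      then show False using inj *(4) ball_verts_mono[OF rs, of g] False by (metis inj_onD subsetD)
    qed
    then show ?thesis using False blocD1[OF A] by blast
  qed
qed

lemma bloc_Int: "bloc r A \<Longrightarrow> bloc r B \<Longrightarrow> bloc r (A \<inter> B)"
  unfolding bloc_def by blast

lemma bloc_Un: "bloc r A \<Longrightarrow> bloc r B \<Longrightarrow> bloc r (A \<union> B)"
  unfolding bloc_def by blast

lemma bloc_Diff: "bloc r A \<Longrightarrow> bloc r B \<Longrightarrow> bloc r (A - B)"
  unfolding bloc_def by blast

lemma local_sets_binary:
  assumes "A \<in> local_sets" "B \<in> local_sets"
  shows "A \<inter> B \<in> local_sets" "A \<union> B \<in> local_sets" "A - B \<in> local_sets"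
proof -
  obtain r s where "bloc r A" "bloc s B" using assms by (auto simp: local_sets_def)
  then have "bloc (max r s) A" "bloc (max r s) B" by (auto intro: bloc_mono)
  then show "A \<inter> B \<in> local_sets" "A \<union> B \<in> local_sets" "A - B \<in> local_sets"
    unfolding local_sets_def using bloc_Int bloc_Un bloc_Diff by blast+
qed

lemma empty_local: "{} \<in> local_sets"
  by (auto simp: local_sets_def bloc_def)

lemma local_sets_UN: "finite I \<Longrightarrow> (\<And>i. i \<in> I \<Longrightarrow> A i \<in> local_sets) \<Longrightarrow> (\<Union>i\<in>I. A i) \<in> local_sets"
  by (induction I rule: finite_induct) (auto intro: empty_local local_sets_binary)

lemma local_sets_subset: "local_sets \<subseteq> Pow birooted_verts"
  using ball_verts_subset by (fastforce simp: local_sets_def bloc_def birooted_verts_def)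

text \<open>The local sets form a ring, so a measurable set can be approximated by them; and the measurable sets include all
  equivariant measurable choices of vertex sets.\<close>

definition local_algebra :: "(rgraph \<times> nat) measure" where
  "local_algebra = sigma birooted_verts local_sets"

lemma space_local_algebra: "space local_algebra = birooted_verts"
  unfolding local_algebra_def by (rule space_measure_of[OF local_sets_subset])

lemma sets_local_algebra: "sets local_algebra = sigma_sets birooted_verts local_sets"
  unfolding local_algebra_def by (rule sets_measure_of[OF local_sets_subset])

lemma local_in_local_algebra: "A \<in> local_sets \<Longrightarrow> A \<in> sets local_algebra"
  unfolding sets_local_algebra by (rule sigma_sets.Basic)

lemma Int_stable_local: "Int_stable local_sets"
  by (auto simp: Int_stable_def local_sets_binary)

lemma bloc_cylinder: "bloc l (birooted_cylinder l k w)"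
proof (rule blocI)
  show "rooted g \<and> v \<in> ball_verts l g" if "(g, v) \<in> birooted_cylinder l k w" for g v
    using that by (auto simp: birooted_cylinder_def)
  have imp: "(h, \<phi> v) \<in> birooted_cylinder l k w"
    if gh: "rooted g" "rooted h" and iso: "is_iso \<phi> (rball l g) (rball l h)" and v: "v \<in> ball_verts l g"
      and cyl: "(g, v) \<in> birooted_cylinder l k w" for g h \<phi> v
  proof -
    obtain \<psi> where \<psi>: "is_iso \<psi> (rball l g) k" "\<psi> v = w"
      using cyl by (auto simp: birooted_cylinder_def)
    have bij: "bij_betw \<phi> (ball_verts l g) (ball_verts l h)" using iso by (simp add: is_iso_def)
    have "is_iso (\<psi> \<circ> inv_into (ball_verts l g) \<phi>) (rball l h) k"
      by (rule is_iso_comp[OF is_iso_ball_inv[OF iso] \<psi>(1)])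
    moreover have "(\<psi> \<circ> inv_into (ball_verts l g) \<phi>) (\<phi> v) = w"
      using bij_betw_inv_into_left[OF bij v] \<psi>(2) by simp
    moreover have "\<phi> v \<in> ball_verts l h" using bij_betw_apply[OF bij v] .
    ultimately show ?thesis using gh(2) by (auto simp: birooted_cylinder_def)
  qed
  fix g h \<phi> v assume *: "rooted g" "rooted h" "is_iso \<phi> (rball l g) (rball l h)" "v \<in> ball_verts l g"
  have bij: "bij_betw \<phi> (ball_verts l g) (ball_verts l h)" using *(3) by (simp add: is_iso_def)
  show "(g, v) \<in> birooted_cylinder l k w \<longleftrightarrow> (h, \<phi> v) \<in> birooted_cylinder l k w"
    using imp[OF *] imp[OF *(2,1) is_iso_ball_inv[OF *(3)] bij_betw_apply[OF bij *(4)]]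
      bij_betw_inv_into_left[OF bij *(4)] by auto
qed

lemma birooted_subset_local_algebra: "sets birooted \<subseteq> sets local_algebra"
proof -
  have "range (\<lambda>(l, h, w). birooted_cylinder l h w) \<subseteq> local_sets"
    unfolding local_sets_def using bloc_cylinder by auto
  then have "sigma_sets birooted_verts (range (\<lambda>(l, h, w). birooted_cylinder l h w)) \<subseteq> sets local_algebra"
    unfolding sets_local_algebra by (rule sigma_sets_mono')
  moreover have "sets birooted = sigma_sets birooted_verts (range (\<lambda>(l, h, w). birooted_cylinder l h w))"
    unfolding birooted_def birooted_verts_def using ball_verts_subset
    by (intro sets_measure_of) (fastforce simp: birooted_cylinder_def)
  ultimately show ?thesis by simp
qed

text \<open>The mass sent by the root, and the mass received by it.\<close>

definition sent :: "(rgraph \<times> nat \<Rightarrow> ennreal) \<Rightarrow> rgraph \<Rightarrow> ennreal" where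
  "sent F g = (\<integral>\<^sup>+ v. F (g, v) \<partial>count_space (verts g))"

definition recv :: "(rgraph \<times> nat \<Rightarrow> ennreal) \<Rightarrow> rgraph \<Rightarrow> ennreal" where
  "recv F g = (\<integral>\<^sup>+ u. F (reroot g u, origin g) \<partial>count_space (verts g))"

lemma flocD1: "floc r F \<Longrightarrow> rooted g \<Longrightarrow> v \<notin> ball_verts r g \<Longrightarrow> F (g, v) = 0"
  unfolding floc_def by blast

lemma flocD2: "floc r F \<Longrightarrow> rooted g \<Longrightarrow> rooted h \<Longrightarrow> is_iso \<phi> (rball r g) (rball r h) \<Longrightarrow> v \<in> ball_verts r g \<Longrightarrow>
   F (g, v) = F (h, \<phi> v)"
  unfolding floc_def by blast

lemma floc_indicator: "bloc r A \<Longrightarrow> floc r (indicator A)"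
  unfolding floc_def bloc_def indicator_def by auto

lemma sent_ball:
  assumes "floc r F" "rooted g"
  shows "sent F g = (\<integral>\<^sup>+ v. F (g, v) \<partial>count_space (ball_verts r g))"
  unfolding sent_def using flocD1[OF assms] ball_verts_subset[OF assms(2), of r]
  by (intro nn_integral_count_space_eq) auto

lemma recv_ball:
  assumes "floc r F" "rooted g"
  shows "recv F g = (\<integral>\<^sup>+ u. F (reroot g u, origin g) \<partial>count_space (ball_verts r g))"
proof -
  have "F (reroot g u, origin g) = 0" if "u \<in> verts g" "u \<notin> ball_verts r g" for u
    using flocD1[OF assms(1) rooted_reroot[OF assms(2) that(1)]] that(2) ball_reroot_sym by blast
  then show ?thesis
    unfolding recv_def using ball_verts_subset[OF assms(2), of r]
    by (intro nn_integral_count_space_eq) auto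
qed

lemma loc_sent: 
  assumes F: "floc r F"
  shows "loc r (sent F)"
proof (rule locI)
  fix g h \<phi> assume *: "rooted g" "rooted h" "is_iso \<phi> (rball r g) (rball r h)"
  have bij: "bij_betw \<phi> (ball_verts r g) (ball_verts r h)" using *(3) by (simp add: is_iso_def)
  have "sent F g = (\<integral>\<^sup>+ v. F (h, \<phi> v) \<partial>count_space (ball_verts r g))"
    unfolding sent_ball[OF F *(1)] by (intro nn_integral_cong) (use flocD2[OF F *] in auto)
  also have "\<dots> = sent F h"
    unfolding sent_ball[OF F *(2)] by (rule nn_integral_bij_count_space[OF bij])
  finally show "sent F g = sent F h" .
qed

lemma loc_recv: 
  assumes F: "floc r F"
  shows "loc (2 * r) (recv F)"
proof (rule locI)
  fix g h \<phi> assume *: "rooted g" "rooted h" "is_iso \<phi> (rball (2 * r) g) (rball (2 * r) h)"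
  have iso: "is_iso \<phi> (rball r g) (rball r h)" using iso_smaller[OF *(3)] by simp
  have bij: "bij_betw \<phi> (ball_verts r g) (ball_verts r h)" and o: "\<phi> (origin g) = origin h"
    using iso by (simp_all add: is_iso_def)
  have "recv F g = (\<integral>\<^sup>+ u. F (reroot h (\<phi> u), origin h) \<partial>count_space (ball_verts r g))"
    unfolding recv_ball[OF F *(1)]
  proof (intro nn_integral_cong)
    fix u assume "u \<in> space (count_space (ball_verts r g))"
    then have u: "u \<in> ball_verts r g" by simp
    have uv: "u \<in> verts g" "\<phi> u \<in> verts h"
      using u ball_verts_subset[OF *(1)] ball_verts_subset[OF *(2)] bij_betw_apply[OF bij u] by blast+
    have "is_iso \<phi> (rball r (reroot g u)) (rball r (reroot h (\<phi> u)))"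
      by (rule iso_subball[OF *(3) u]) simp
    from flocD2[OF F rooted_reroot[OF *(1) uv(1)] rooted_reroot[OF *(2) uv(2)] this, of "origin g"]
    show "F (reroot g u, origin g) = F (reroot h (\<phi> u), origin h)"
      using u o by (simp add: ball_reroot_sym)
  qed
  also have "\<dots> = recv F h"
    unfolding recv_ball[OF F *(2)] by (rule nn_integral_bij_count_space[OF bij])
  finally show "recv F g = recv F h" .
qed

lemma iso_mem_ball:
  assumes iso: "is_iso \<phi> (rball s g) (rball s h)" and "r \<le> s" and v: "v \<in> ball_verts s g"
  shows "v \<in> ball_verts r g \<longleftrightarrow> \<phi> v \<in> ball_verts r h"
proof -
  have inj: "inj_on \<phi> (ball_verts s g)" using iso by (simp add: is_iso_def bij_betw_def)
  have "\<phi> v \<in> \<phi> ` ball_verts r g \<longleftrightarrow> v \<in> ball_verts r g"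
    using inj_on_image_mem_iff[OF inj v ball_verts_mono[OF assms(2)]] .
  then show ?thesis unfolding iso_image[OF iso assms(2)] by simp
qed

lemma card_ball_iso: "is_iso \<phi> (rball r g) (rball r h) \<Longrightarrow> card (ball_verts r g) = card (ball_verts r h)"
  by (auto simp: is_iso_def intro: bij_betw_same_card)

definition section_at :: "(rgraph \<times> nat) set \<Rightarrow> rgraph \<Rightarrow> nat set" where
  "section_at A g = {v. (g, v) \<in> A}"

text \<open>Transport from \<open>g\<close> to \<open>v\<close> is only admitted over a bounded distance and if both ends have small balls. This bounds the mass sent
  as well as the mass received.\<close>

definition trunc :: "nat \<Rightarrow> nat \<Rightarrow> (rgraph \<times> nat) set" where
  "trunc r N = {(g, v). rooted g \<and> v \<in> ball_verts r g \<and> card (ball_verts r g) \<le> N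
      \<and> card (ball_verts r (reroot g v)) \<le> N}"

lemma bloc_trunc: "bloc (2 * r) (trunc r N)"
proof (rule blocI)
  show "rooted g \<and> v \<in> ball_verts (2 * r) g" if "(g, v) \<in> trunc r N" for g v
    using that ball_verts_mono[of r "2 * r" g] by (auto simp: trunc_def)
  fix g h \<phi> v assume *: "rooted g" "rooted h" "is_iso \<phi> (rball (2 * r) g) (rball (2 * r) h)" "v \<in> ball_verts (2 * r) g"
  have 1: "v \<in> ball_verts r g \<longleftrightarrow> \<phi> v \<in> ball_verts r h"
    by (rule iso_mem_ball[OF *(3) _ *(4)]) simp
  have 2: "card (ball_verts r g) = card (ball_verts r h)"
    by (rule card_ball_iso[OF iso_smaller[OF *(3)]]) simp
  have 3: "card (ball_verts r (reroot g v)) = card (ball_verts r (reroot h (\<phi> v)))" if "v \<in> ball_verts r g"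
    by (rule card_ball_iso[OF iso_subball[OF *(3) that]]) simp
  show "(g, v) \<in> trunc r N \<longleftrightarrow> (h, \<phi> v) \<in> trunc r N"
    unfolding trunc_def using * 1 2 3 by auto
qed

lemma count_indicator_ball:
  assumes "rooted g"
  shows "(\<integral>\<^sup>+ v. indicator (ball_verts r g) v \<partial>count_space (verts g)) = ennreal (card (ball_verts r g))"
  using ball_verts_subset[OF assms, of r] finite_ball[OF assms, of r]
  by (simp add: emeasure_count_space ennreal_of_nat_eq_real_of_nat)

lemma trunc_bound:
  assumes B: "B \<subseteq> trunc r N" and g: "rooted g"
  shows "sent (indicator B) g \<le> ennreal N" "recv (indicator B) g \<le> ennreal N"
proof -
  have "sent (indicator B) g \<le> ennreal N \<and> recv (indicator B) g \<le> ennreal N"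
  proof (cases "card (ball_verts r g) \<le> N")
    case True
    have "indicator B (g, v) \<le> (indicator (ball_verts r g) v :: ennreal)" for v
      using B by (auto simp: indicator_def trunc_def)
    then have "sent (indicator B) g \<le> ennreal (card (ball_verts r g))"
      unfolding sent_def count_indicator_ball[OF g, symmetric] by (intro nn_integral_mono)
    moreover have "indicator B (reroot g u, origin g) \<le> (indicator (ball_verts r g) u :: ennreal)" for u
      using B by (auto simp: indicator_def trunc_def ball_reroot_sym)
    then have "recv (indicator B) g \<le> ennreal (card (ball_verts r g))"
      unfolding recv_def count_indicator_ball[OF g, symmetric] by (intro nn_integral_mono)
    moreover have "ennreal (card (ball_verts r g)) \<le> ennreal N" using True by (simp add: ennreal_leI)
    ultimately show ?thesis by (meson order.trans)
  next
    case False
    have "indicator B (g, v) = (0 :: ennreal)" "indicator B (reroot g v, origin g) = (0 :: ennreal)" for v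
      using B False by (auto simp: indicator_def trunc_def)
    then show ?thesis by (simp add: sent_def recv_def)
  qed
  then show "sent (indicator B) g \<le> ennreal N" "recv (indicator B) g \<le> ennreal N" by auto
qed

lemma sent_UN:
  assumes "disjoint_family B"
  shows "sent (indicator (\<Union>i. B i)) g = (\<Sum>i. sent (indicator (B i)) g)"
    "recv (indicator (\<Union>i. B i)) g = (\<Sum>i. recv (indicator (B i)) g)"
  unfolding sent_def recv_def suminf_indicator[OF assms, symmetric] by (simp_all add: nn_integral_suminf)

lemma sent_mono: "(\<And>v. v \<in> verts g \<Longrightarrow> F (g, v) \<le> F' (g, v)) \<Longrightarrow> sent F g \<le> sent F' g"
  unfolding sent_def by (intro nn_integral_mono) auto

lemma sent_ge: "v \<in> verts g \<Longrightarrow> F (g, v) \<le> sent F g"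
  unfolding sent_def by (rule nn_integral_ge_point)

lemma sent_indicator_eq_0: "sent (indicator B) g = 0 \<longleftrightarrow> (\<forall>v\<in>verts g. (g, v) \<notin> B)"
  unfolding sent_def by (subst nn_integral_0_iff_AE) (auto simp: AE_count_space indicator_def)

context weak_limit
begin

text \<open>In a finite graph the total mass sent equals the total mass received. Both averages are averages of bounded local
  functions.\<close>

lemma mass_transport_bounded:
  assumes F: "floc r F" and C: "0 \<le> C"
    and bounds: "\<And>g. rooted g \<Longrightarrow> sent F g \<le> ennreal C" "\<And>g. rooted g \<Longrightarrow> recv F g \<le> ennreal C"
  shows "(\<integral>\<^sup>+ x. sent F (rep_gstar x) \<partial>\<rho>) = (\<integral>\<^sup>+ x. recv F (rep_gstar x) \<partial>\<rho>)"
proof -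
  define s where "s g = enn2real (sent F g)" for g
  define t where "t g = enn2real (recv F g)" for g
  have es: "sent F g = ennreal (s g)" and et: "recv F g = ennreal (t g)" if "rooted g" for g
    using bounds[OF that] unfolding s_def t_def by (auto simp: ennreal_enn2real_if top_unique)
  have s0: "0 \<le> s g" "0 \<le> t g" for g by (simp_all add: s_def t_def)
  have locs: "loc r s" "loc (2 * r) t"
    unfolding s_def[abs_def] t_def[abs_def]
    by (rule loc_comp[OF loc_sent[OF F], of enn2real], rule loc_comp[OF loc_recv[OF F], of enn2real])
  have bs: "\<bar>s g\<bar> \<le> C" "\<bar>t g\<bar> \<le> C" if "rooted g" for g
    using bounds[OF that] C unfolding es[OF that] et[OF that] by (simp_all add: s0)
  have "(\<Sum>u<n. s (gr E n u)) = (\<Sum>u<n. t (gr E n u))" for n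
  proof -
    have "ennreal (\<Sum>u<n. s (gr E n u)) = (\<Sum>u<n. ennreal (s (gr E n u)))"
      by (rule sum_ennreal[symmetric]) (rule s0)
    also have "\<dots> = (\<Sum>u<n. sent F (gr E n u))"
      by (intro sum.cong refl es[symmetric] rooted_gr) simp
    also have "\<dots> = (\<Sum>u<n. \<Sum>v<n. F (gr E n u, v))"
      by (simp add: sent_def nn_integral_count_space_finite)
    also have "\<dots> = (\<Sum>v<n. \<Sum>u<n. F (gr E n u, v))" by (rule sum.swap)
    also have "\<dots> = (\<Sum>v<n. recv F (gr E n v))"
      by (simp add: recv_def nn_integral_count_space_finite reroot_def)
    also have "\<dots> = (\<Sum>v<n. ennreal (t (gr E n v)))"
      by (intro sum.cong refl et rooted_gr) simp
    also have "\<dots> = ennreal (\<Sum>u<n. t (gr E n u))"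
      by (rule sum_ennreal) (rule s0)
    finally show ?thesis using s0 by (simp add: sum_nonneg)
  qed
  then have "(\<integral>x. s (rep_gstar x) \<partial>\<rho>) = (\<integral>x. t (rep_gstar x) \<partial>\<rho>)"
    using average_converges[OF locs(1) bs(1)] average_converges[OF locs(2) bs(2)] by (simp add: LIMSEQ_unique)
  moreover have "(\<integral>\<^sup>+ x. sent F (rep_gstar x) \<partial>\<rho>) = ennreal (\<integral>x. s (rep_gstar x) \<partial>\<rho>)"
    unfolding es[OF rooted_rep] by (rule nn_integral_eq_integral[OF integrable_loc[OF locs(1) bs(1)]]) (auto simp: s0)
  moreover have "(\<integral>\<^sup>+ x. recv F (rep_gstar x) \<partial>\<rho>) = ennreal (\<integral>x. t (rep_gstar x) \<partial>\<rho>)"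
    unfolding et[OF rooted_rep] by (rule nn_integral_eq_integral[OF integrable_loc[OF locs(2) bs(2)]]) (auto simp: s0)
  ultimately show ?thesis by simp
qed

definition transported :: "(rgraph \<times> nat \<Rightarrow> ennreal) \<Rightarrow> bool" where
  "transported F \<longleftrightarrow> (\<lambda>x. sent F (rep_gstar x)) \<in> borel_measurable borel \<and>
     (\<lambda>x. recv F (rep_gstar x)) \<in> borel_measurable borel \<and>
     (\<integral>\<^sup>+ x. sent F (rep_gstar x) \<partial>\<rho>) = (\<integral>\<^sup>+ x. recv F (rep_gstar x) \<partial>\<rho>)"

lemma transported_local:
  assumes "bloc s B" "B \<subseteq> trunc r N"
  shows "transported (indicator B)"
  unfolding transported_def
  using borel_measurable_loc[OF loc_sent[OF floc_indicator[OF assms(1)]]]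
    borel_measurable_loc[OF loc_recv[OF floc_indicator[OF assms(1)]]]
    mass_transport_bounded[OF floc_indicator[OF assms(1)] _ trunc_bound[OF assms(2)]] by simp

lemma transported_UN:
  fixes B :: "nat \<Rightarrow> (rgraph \<times> nat) set"
  assumes "disjoint_family B" "\<And>i. transported (indicator (B i))"
  shows "transported (indicator (\<Union>i. B i))"
proof -
  note t = assms(2)[unfolded transported_def]
  have m: "(\<lambda>x. sent (indicator (B i)) (rep_gstar x)) \<in> borel_measurable borel"
    "(\<lambda>x. recv (indicator (B i)) (rep_gstar x)) \<in> borel_measurable borel" for i using t by blast+
  show ?thesis
    unfolding transported_def sent_UN[OF assms(1)]
  proof (intro conjI borel_measurable_suminf_order m)
    show "(\<integral>\<^sup>+ x. (\<Sum>i. sent (indicator (B i)) (rep_gstar x)) \<partial>\<rho>) = (\<integral>\<^sup>+ x. (\<Sum>i. recv (indicator (B i)) (rep_gstar x)) \<partial>\<rho>)"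
      using t by (simp add: nn_integral_suminf measurable_rho m)
  qed
qed

text \<open>Dynkin's lemma. Complements require the subtraction of masses, which have to be finite: this is the reason for the
  truncation.\<close>

lemma transported_trunc:
  assumes A: "A \<in> sets local_algebra" and T: "T \<in> local_sets" "T \<subseteq> trunc r N"
  shows "transported (indicator (A \<inter> T))"
  using Int_stable_local local_sets_subset A[unfolded sets_local_algebra]
proof (induction rule: sigma_sets_induct_disjoint)
  case (basic A)
  then have "A \<inter> T \<in> local_sets" using T by (simp add: local_sets_binary)
  then show ?case using T by (auto simp: local_sets_def intro: transported_local)
next
  case empty
  then show ?case by (simp add: transported_def sent_def recv_def)
next
  case (compl A)
  let ?A = "A \<inter> T" and ?B = "(birooted_verts - A) \<inter> T"
  have AT: "?A \<subseteq> trunc r N" using T(2) by blast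
  have TT: "transported (indicator T)" using T by (auto simp: local_sets_def intro: transported_local)
  have "T \<subseteq> birooted_verts" using T(1) local_sets_subset by blast
  then have ind: "(indicator T p :: ennreal) = indicator ?B p + indicator ?A p" for p
    by (auto simp: indicator_def)
  have "sent (indicator T) g = sent (indicator ?B) g + sent (indicator ?A) g"
    "recv (indicator T) g = recv (indicator ?B) g + recv (indicator ?A) g" for g
    unfolding sent_def recv_def ind by (simp_all add: nn_integral_add)
  moreover have fin: "sent (indicator ?A) g \<noteq> top" "recv (indicator ?A) g \<noteq> top" if "rooted g" for g
    using trunc_bound[OF AT that] by (auto simp: top_unique)
  ultimately have eq: "sent (indicator ?B) g = sent (indicator T) g - sent (indicator ?A) g"
    "recv (indicator ?B) g = recv (indicator T) g - recv (indicator ?A) g" if "rooted g" for g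
    using that by (simp_all add: ennreal_add_diff_cancel_right)
  have meas: "(\<lambda>x. sent (indicator ?B) (rep_gstar x)) \<in> borel_measurable borel"
    "(\<lambda>x. recv (indicator ?B) (rep_gstar x)) \<in> borel_measurable borel"
    unfolding eq[OF rooted_rep] using TT compl.IH unfolding transported_def by (auto intro!: borel_measurable_minus_ennreal)
  have le: "sent (indicator ?A) g \<le> sent (indicator T) g" "recv (indicator ?A) g \<le> recv (indicator T) g" for g
    unfolding sent_def recv_def by (auto intro!: nn_integral_mono simp: indicator_def)
  have finint: "(\<integral>\<^sup>+ x. sent (indicator ?A) (rep_gstar x) \<partial>\<rho>) \<noteq> \<infinity>" "(\<integral>\<^sup>+ x. recv (indicator ?A) (rep_gstar x) \<partial>\<rho>) \<noteq> \<infinity>"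
  proof -
    have "(\<integral>\<^sup>+ x. sent (indicator ?A) (rep_gstar x) \<partial>\<rho>) \<le> (\<integral>\<^sup>+ x. ennreal N \<partial>\<rho>)"
      "(\<integral>\<^sup>+ x. recv (indicator ?A) (rep_gstar x) \<partial>\<rho>) \<le> (\<integral>\<^sup>+ x. ennreal N \<partial>\<rho>)"
      by (intro nn_integral_mono trunc_bound[OF AT] rooted_rep)+
    then show "(\<integral>\<^sup>+ x. sent (indicator ?A) (rep_gstar x) \<partial>\<rho>) \<noteq> \<infinity>" "(\<integral>\<^sup>+ x. recv (indicator ?A) (rep_gstar x) \<partial>\<rho>) \<noteq> \<infinity>"
      by (auto simp: emeasure_space_1 top_unique)
  qed
  have "(\<integral>\<^sup>+ x. sent (indicator ?B) (rep_gstar x) \<partial>\<rho>)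
    = (\<integral>\<^sup>+ x. sent (indicator T) (rep_gstar x) \<partial>\<rho>) - (\<integral>\<^sup>+ x. sent (indicator ?A) (rep_gstar x) \<partial>\<rho>)"
    unfolding eq[OF rooted_rep] using TT compl.IH finint le unfolding transported_def
    by (intro nn_integral_diff) (auto intro: measurable_rho)
  moreover have "(\<integral>\<^sup>+ x. recv (indicator ?B) (rep_gstar x) \<partial>\<rho>)
    = (\<integral>\<^sup>+ x. recv (indicator T) (rep_gstar x) \<partial>\<rho>) - (\<integral>\<^sup>+ x. recv (indicator ?A) (rep_gstar x) \<partial>\<rho>)"
    unfolding eq[OF rooted_rep] using TT compl.IH finint le unfolding transported_def
    by (intro nn_integral_diff) (auto intro: measurable_rho)
  ultimately show ?case using meas TT compl.IH by (simp add: transported_def)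
next
  case (union B)
  have "(\<Union>i. B i) \<inter> T = (\<Union>i. B i \<inter> T)" by auto
  moreover have "disjoint_family (\<lambda>i. B i \<inter> T)" using union.hyps(1) by (auto simp: disjoint_family_on_def)
  ultimately show ?case using transported_UN[of "\<lambda>i. B i \<inter> T"] union.IH by simp
qed

text \<open>Countably many truncation sets cover all pairs, and made disjoint they remain local.\<close>

lemma transported_indicator:
  assumes A: "A \<in> sets local_algebra"
  shows "transported (indicator A)"
proof -
  define D where "D i = (case prod_decode i of (r, N) \<Rightarrow> trunc r N)" for i
  have Dl: "D i \<in> local_sets" for i
    using bloc_trunc by (auto simp: D_def local_sets_def split: prod.split)
  have "disjointed D i \<in> local_sets" for i
    unfolding disjointed_def by (intro local_sets_binary local_sets_UN Dl) auto
  moreover have "disjointed D i \<subseteq> trunc (fst (prod_decode i)) (snd (prod_decode i))" for i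
    using disjointed_subset[of D i] by (auto simp: D_def split: prod.splits)
  ultimately have "transported (indicator (A \<inter> disjointed D i))" for i
    by (rule transported_trunc[OF A])
  moreover have "disjoint_family (\<lambda>i. A \<inter> disjointed D i)"
    using disjoint_family_disjointed[of D] by (auto simp: disjoint_family_on_def)
  ultimately have "transported (indicator (\<Union>i. A \<inter> disjointed D i))" by (intro transported_UN)
  moreover have "(\<Union>i. A \<inter> disjointed D i) = A"
  proof -
    have "birooted_verts \<subseteq> (\<Union>i. D i)"
    proof
      fix p assume "p \<in> birooted_verts"
      then obtain g v where p: "p = (g, v)" "rooted g" "v \<in> verts g" by (auto simp: birooted_verts_def)
      obtain r where "v \<in> ball_verts r g" using verts_ball[OF p(2,3)] .
      then have "p \<in> D (prod_encode (r, max (card (ball_verts r g)) (card (ball_verts r (reroot g v)))))"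
        using p by (simp add: D_def trunc_def)
      then show "p \<in> (\<Union>i. D i)" by blast
    qed
    moreover have "A \<subseteq> birooted_verts" using sets.sets_into_space[OF A] space_local_algebra by simp
    ultimately show ?thesis using UN_disjointed_eq[of D] by auto
  qed
  ultimately show ?thesis by simp
qed

theorem mass_transport:
  assumes "F \<in> borel_measurable local_algebra"
  shows "transported F"
  using assms
proof (induction rule: borel_measurable_induct)
  case (cong f g)
  have 1: "g (h, v) = f (h, v)" if "rooted h" "v \<in> verts h" for h v
    using cong.hyps(3)[of "(h, v)"] that by (simp add: space_local_algebra birooted_verts_def)
  have "sent g h = sent f h" "recv g h = recv f h" if h: "rooted h" for h
    unfolding sent_def recv_def using h
    by (auto intro!: nn_integral_cong 1 rooted_reroot simp: rooted_def)
  then show ?case using cong.IH rooted_rep by (simp add: transported_def)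
next
  case (set A)
  then show ?case by (rule transported_indicator)
next
  case (mult u c)
  have "sent (\<lambda>x. c * u x) g = c * sent u g" "recv (\<lambda>x. c * u x) g = c * recv u g" for g
    unfolding sent_def recv_def by (simp_all add: nn_integral_cmult)
  then show ?case using mult.IH by (auto simp: transported_def nn_integral_cmult measurable_rho)
next
  case (add u v)
  have "sent (\<lambda>x. v x + u x) g = sent v g + sent u g" "recv (\<lambda>x. v x + u x) g = recv v g + recv u g" for g
    unfolding sent_def recv_def by (simp_all add: nn_integral_add)
  then show ?case using add.IH by (auto simp: transported_def nn_integral_add measurable_rho)
next
  case (seq U)
  have sup: "sent (SUP i. U i) g = (SUP i. sent (U i) g)" "recv (SUP i. U i) g = (SUP i. recv (U i) g)" for g
    unfolding sent_def recv_def SUP_apply using seq.hyps(3)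
    by (auto intro!: nn_integral_monotone_convergence_SUP simp: incseq_def le_fun_def)
  have inc: "incseq (\<lambda>i x. sent (U i) (rep_gstar x))" "incseq (\<lambda>i x. recv (U i) (rep_gstar x))"
    unfolding sent_def recv_def using seq.hyps(3)
    by (auto intro!: nn_integral_mono simp: incseq_def le_fun_def)
  have "(\<integral>\<^sup>+ x. (SUP i. sent (U i) (rep_gstar x)) \<partial>\<rho>) = (SUP i. \<integral>\<^sup>+ x. sent (U i) (rep_gstar x) \<partial>\<rho>)"
    "(\<integral>\<^sup>+ x. (SUP i. recv (U i) (rep_gstar x)) \<partial>\<rho>) = (SUP i. \<integral>\<^sup>+ x. recv (U i) (rep_gstar x) \<partial>\<rho>)"
    using seq.IH by (intro nn_integral_monotone_convergence_SUP inc; auto simp: transported_def intro: measurable_rho)+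
  then show ?case
    unfolding transported_def sup using seq.IH unfolding transported_def
    by (intro conjI borel_measurable_SUP) simp_all
qed

lemma measurable_abs_gstar: "(\<lambda>p. abs_gstar (fst p)) \<in> measurable local_algebra (borel :: gstar measure)"
proof (rule borel_measurableI)
  fix U :: "gstar set" assume U: "open U"
  define B where "B l r = {(g, v). rooted g \<and> v \<in> ball_verts r g \<and> (\<forall>y. same_ball l (abs_gstar g) y \<longrightarrow> y \<in> U)}" for l r
  have "B l r \<in> sets local_algebra" for l r
  proof -
    have "bloc (max l r) (B l r)"
    proof (rule blocI)
      show "rooted g \<and> v \<in> ball_verts (max l r) g" if "(g, v) \<in> B l r" for g v
        using that ball_verts_mono[of r "max l r" g] by (auto simp: B_def)
      fix g h \<phi> v assume *: "rooted g" "rooted h" "is_iso \<phi> (rball (max l r) g) (rball (max l r) h)" "v \<in> ball_verts (max l r) g"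
      have "isomorphic (rball l g) (rball l h)"
        using iso_smaller[OF *(3), of l] by (auto simp: isomorphic_def)
      then have "same_ball l (abs_gstar g) (abs_gstar h)"
        using *(1,2) isomorphic_refl same_ball.abs_eq[of g h l] by simp
      then have "same_ball l (abs_gstar g) y \<longleftrightarrow> same_ball l (abs_gstar h) y" for y
        by (meson same_ball_sym same_ball_trans)
      then show "(g, v) \<in> B l r \<longleftrightarrow> (h, \<phi> v) \<in> B l r"
        using * iso_mem_ball[OF *(3) _ *(4), of r] by (simp add: B_def)
    qed
    then show ?thesis by (intro local_in_local_algebra) (auto simp: local_sets_def)
  qed
  then have "(\<Union>l. \<Union>r. B l r) \<in> sets local_algebra" by blast
  also have "(\<Union>l. \<Union>r. B l r) = (\<lambda>p. abs_gstar (fst p)) -` U \<inter> space local_algebra"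
  proof
    show "(\<Union>l. \<Union>r. B l r) \<subseteq> (\<lambda>p. abs_gstar (fst p)) -` U \<inter> space local_algebra"
      using same_ball_refl ball_verts_subset by (fastforce simp: B_def space_local_algebra birooted_verts_def)
    show "(\<lambda>p. abs_gstar (fst p)) -` U \<inter> space local_algebra \<subseteq> (\<Union>l. \<Union>r. B l r)"
    proof
      fix p assume p: "p \<in> (\<lambda>p. abs_gstar (fst p)) -` U \<inter> space local_algebra"
      then obtain g v where gv: "p = (g, v)" "rooted g" "v \<in> verts g" "abs_gstar g \<in> U"
        by (auto simp: space_local_algebra birooted_verts_def)
      obtain r where r: "v \<in> ball_verts r g" using verts_ball[OF gv(2,3)] .
      obtain l where "\<forall>y. same_ball l (abs_gstar g) y \<longrightarrow> y \<in> U" using open_gstar_ball[OF U gv(4)] by blast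
      then have "p \<in> B l r" using gv r by (simp add: B_def)
      then show "p \<in> (\<Union>l. \<Union>r. B l r)" by blast
    qed
  qed
  finally show "(\<lambda>p. abs_gstar (fst p)) -` U \<inter> space local_algebra \<in> sets local_algebra" .
qed

text \<open>The local sets form a ring that generates all measurable sets, so they approximate them for the measure that assigns to \<open>B\<close> the
  mean number of vertices \<open>v\<close> with \<open>(g, v)\<close> in \<open>B\<close>. This measure is infinite, and therefore restricted to \<open>D\<close>.\<close>

lemma local_approximation:
  assumes A: "A \<in> sets local_algebra" and D: "D \<in> local_sets" and N: "\<And>g. rooted g \<Longrightarrow> sent (indicator D) g \<le> ennreal N"
    and "0 < \<eta>"
  shows "\<exists>A'\<in>local_sets. A' \<subseteq> D \<and>
    (\<integral>\<^sup>+ x. sent (indicator ((A \<inter> D - A') \<union> (A' - A))) (rep_gstar x) \<partial>\<rho>) < ennreal \<eta>"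
proof -
  define m where "m B = (\<integral>\<^sup>+ x. sent (indicator (B \<inter> D)) (rep_gstar x) \<partial>\<rho>)" for B
  define \<mu> where "\<mu> = measure_of birooted_verts local_sets m"
  have DM: "D \<in> sets local_algebra" by (rule local_in_local_algebra[OF D])
  have sets\<mu>: "sets \<mu> = sets local_algebra" and space\<mu>: "space \<mu> = birooted_verts"
    unfolding \<mu>_def sets_local_algebra using local_sets_subset by (simp_all add: space_measure_of_conv)
  have em: "emeasure \<mu> B = m B" if "B \<in> sets local_algebra" for B
  proof (rule emeasure_measure_of[OF \<mu>_def local_sets_subset])
    show "positive (sets \<mu>) m" by (simp add: positive_def m_def sent_def)
    show "countably_additive (sets \<mu>) m"
    proof (rule countably_additiveI)
      fix B :: "nat \<Rightarrow> (rgraph \<times> nat) set" assume B: "range B \<subseteq> sets \<mu>" "disjoint_family B" "(\<Union>i. B i) \<in> sets \<mu>"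
      have dis: "disjoint_family (\<lambda>i. B i \<inter> D)" using B(2) by (auto simp: disjoint_family_on_def)
      have U: "(\<Union>i. B i) \<inter> D = (\<Union>i. B i \<inter> D)" by auto
      have "(\<lambda>x. sent (indicator (B i \<inter> D)) (rep_gstar x)) \<in> borel_measurable \<rho>" for i
        using transported_indicator[of "B i \<inter> D"] B(1) DM sets\<mu> by (auto simp: transported_def intro!: measurable_rho)
      then show "(\<Sum>i. m (B i)) = m (\<Union>i. B i)"
        unfolding m_def U sent_UN(1)[OF dis] by (simp add: nn_integral_suminf)
    qed
    show "B \<in> sets \<mu>" using that sets\<mu> by simp
  qed
  have "m birooted_verts \<le> (\<integral>\<^sup>+ x. ennreal N \<partial>\<rho>)"
    unfolding m_def
  proof (intro nn_integral_mono)
    fix x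
    have "sent (indicator (birooted_verts \<inter> D)) (rep_gstar x) \<le> sent (indicator D) (rep_gstar x)"
      by (intro sent_mono) (auto simp: indicator_def)
    then show "sent (indicator (birooted_verts \<inter> D)) (rep_gstar x) \<le> ennreal N" using N[OF rooted_rep] order.trans by blast
  qed
  then have fin: "m birooted_verts \<noteq> \<infinity>" by (auto simp: emeasure_space_1 top_unique)
  interpret \<mu>: finite_measure \<mu>
    by (rule finite_measureI) (use em[of birooted_verts] fin space\<mu> sets.top[of local_algebra] space_local_algebra in simp)
  let ?d = "\<lambda>A A'. (A - A') \<union> (A' - A)"
  have localS: "A' \<in> sets \<mu>" if "A' \<in> local_sets" for A' using that local_in_local_algebra sets\<mu> by simp
  have approx: "\<exists>A'\<in>local_sets. A' \<subseteq> D \<and> measure \<mu> (?d (A \<inter> D) A') < \<eta>"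
    if "A \<in> sigma_sets birooted_verts local_sets" "0 < \<eta>" for A \<eta>
    using that
  proof (induction arbitrary: \<eta> rule: sigma_sets.induct)
    case (Basic A)
    then show ?case using local_sets_binary(1)[OF Basic(1) D] by (intro bexI[of _ "A \<inter> D"]) auto
  next
    case Empty
    then show ?case by (intro bexI[of _ "{}"]) (auto simp: empty_local)
  next
    case (Compl A)
    then obtain A' where A': "A' \<in> local_sets" "A' \<subseteq> D" "measure \<mu> (?d (A \<inter> D) A') < \<eta>" by blast
    have "?d ((birooted_verts - A) \<inter> D) (D - A') = ?d (A \<inter> D) A'"
      using A'(2) D local_sets_subset by blast
    then show ?case using A' local_sets_binary(3)[OF D A'(1)] by (intro bexI[of _ "D - A'"]) auto
  next
    case (Union a)
    have aM: "a i \<inter> D \<in> sets \<mu>" for i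
      using Union.hyps[of i] DM sets\<mu> unfolding sets_local_algebra by (metis sets.Int sets_local_algebra)
    let ?P = "\<lambda>k. \<Union>i<k. a i \<inter> D" and ?U = "(\<Union>i. a i) \<inter> D"
    have U: "(\<Union>k. ?P k) = ?U" by auto
    have "(\<Union>i. a i \<inter> D) \<in> sets \<mu>" using aM by (intro sets.countable_UN) auto
    then have UM: "?U \<in> sets \<mu>" by simp
    have "(\<lambda>k. measure \<mu> (?P k)) \<longlonglongrightarrow> measure \<mu> (\<Union>k. ?P k)"
    proof (rule \<mu>.finite_Lim_measure_incseq)
      have "?P k \<in> sets \<mu>" for k by (intro sets.finite_UN) (auto simp: aM)
      then show "range ?P \<subseteq> sets \<mu>" by blast
      show "incseq ?P" unfolding incseq_def by (intro allI impI UN_mono) auto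
    qed
    then have "eventually (\<lambda>k. measure \<mu> ?U - \<eta> / 2 < measure \<mu> (?P k)) sequentially"
      unfolding U using Union.prems by (intro order_tendstoD(1)) auto
    then obtain k where k: "measure \<mu> ?U - \<eta> / 2 < measure \<mu> (?P k)" by (auto simp: eventually_sequentially)
    have "\<forall>i. \<exists>A'\<in>local_sets. A' \<subseteq> D \<and> measure \<mu> (?d (a i \<inter> D) A') < \<eta> / (2 * (real k + 1))"
      using Union.IH Union.prems by simp
    then obtain A' where A': "\<And>i. A' i \<in> local_sets" "\<And>i. A' i \<subseteq> D"
      "\<And>i. measure \<mu> (?d (a i \<inter> D) (A' i)) < \<eta> / (2 * (real k + 1))" by metis
    let ?A = "\<Union>i<k. A' i"
    have dM: "?d (a i \<inter> D) (A' i) \<in> sets \<mu>" for i using aM localS[OF A'(1)] by auto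
    have PM: "?P k \<in> sets \<mu>" by (intro sets.finite_UN aM) auto
    have "measure \<mu> (?d ?U ?A) \<le> measure \<mu> ((?U - ?P k) \<union> (\<Union>i<k. ?d (a i \<inter> D) (A' i)))"
    proof (rule \<mu>.finite_measure_mono)
      show "?d ?U ?A \<subseteq> (?U - ?P k) \<union> (\<Union>i<k. ?d (a i \<inter> D) (A' i))" using A'(2) by blast
      show "(?U - ?P k) \<union> (\<Union>i<k. ?d (a i \<inter> D) (A' i)) \<in> sets \<mu>"
        by (intro sets.Un sets.Diff UM PM sets.finite_UN dM) simp
    qed
    also have "\<dots> \<le> measure \<mu> (?U - ?P k) + measure \<mu> (\<Union>i<k. ?d (a i \<inter> D) (A' i))"
      by (intro measure_Un_le sets.Diff UM PM sets.finite_UN dM) simp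
    finally have 1: "measure \<mu> (?d ?U ?A) \<le> measure \<mu> (?U - ?P k) + measure \<mu> (\<Union>i<k. ?d (a i \<inter> D) (A' i))" .
    have 2: "measure \<mu> (?U - ?P k) = measure \<mu> ?U - measure \<mu> (?P k)"
      by (rule \<mu>.finite_measure_Diff[OF UM PM]) auto
    have "measure \<mu> (\<Union>i<k. ?d (a i \<inter> D) (A' i)) \<le> (\<Sum>i<k. measure \<mu> (?d (a i \<inter> D) (A' i)))"
      by (rule measure_UNION_le) (use dM in simp_all)
    also have "\<dots> \<le> (\<Sum>i<k. \<eta> / (2 * (real k + 1)))" by (intro sum_mono less_imp_le A')
    also have "\<dots> \<le> \<eta> / 2" using Union.prems by (simp add: field_simps)
    finally have "measure \<mu> (?d ?U ?A) < \<eta>" using 1 2 k by simp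
    moreover have "?A \<in> local_sets" by (intro local_sets_UN A') auto
    moreover have "?A \<subseteq> D" using A'(2) by auto
    ultimately show ?case by blast
  qed
  obtain A' where A': "A' \<in> local_sets" "A' \<subseteq> D" "measure \<mu> (?d (A \<inter> D) A') < \<eta>"
    using approx[OF A[unfolded sets_local_algebra] \<open>0 < \<eta>\<close>] by blast
  have XM: "?d (A \<inter> D) A' \<in> sets \<mu>" using A DM localS[OF A'(1)] sets\<mu> by auto
  have X: "?d (A \<inter> D) A' \<inter> D = (A \<inter> D - A') \<union> (A' - A)" using A'(2) by auto
  have "m (?d (A \<inter> D) A') < ennreal \<eta>"
    using A'(3) XM sets\<mu> em[symmetric] by (simp add: \<mu>.emeasure_eq_measure ennreal_lessI \<open>0 < \<eta>\<close>)
  then show ?thesis using A' unfolding m_def X by blast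
qed

text \<open>A finite vertex set lies in a large ball, and the ball has bounded size with high probability. Under these constraints
  the pairs \<open>(g, v)\<close> with \<open>v \<in> S g\<close> are approximated by a local set. The mean number of vertices on which the two differ is small, and a number that
  is not \<open>0\<close> is at least \<open>1\<close>; so with high probability they agree.\<close>

lemma local_version:
  assumes S: "\<And>g. rooted g \<Longrightarrow> finite (S g) \<and> S g \<subseteq> verts g \<and> origin g \<in> S g"
    and meas: "measurable_vertex_set S" and \<eta>: "0 < \<eta>"
  shows "\<exists>A'\<in>local_sets. (\<forall>g. rooted g \<longrightarrow> (g, origin g) \<in> A') \<and>
     {x. section_at A' (rep_gstar x) \<noteq> S (rep_gstar x)} \<in> sets borel \<and>
     prob {x. section_at A' (rep_gstar x) \<noteq> S (rep_gstar x)} < \<eta>"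
proof -
  define A where "A = {(g, v). rooted g \<and> v \<in> S g}"
  have AM: "A \<in> sets local_algebra"
    using meas birooted_subset_local_algebra unfolding measurable_vertex_set_def A_def by blast
  define D where "D j N = {(g, v). rooted g \<and> v \<in> ball_verts j g \<and> card (ball_verts j g) \<le> N}" for j N
  have DD: "bloc j (D j N)" for j N
  proof (rule blocI)
    fix g h \<phi> v assume *: "rooted g" "rooted h" "is_iso \<phi> (rball j g) (rball j h)" "v \<in> ball_verts j g"
    then show "(g, v) \<in> D j N \<longleftrightarrow> (h, \<phi> v) \<in> D j N"
      using iso_mem_ball[OF *(3) order.refl *(4)] card_ball_iso[OF *(3)] by (simp add: D_def)
  qed (auto simp: D_def)
  define D' where "D' j = {(g, v). rooted g \<and> v \<in> ball_verts j g}" for j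
  have DD': "bloc j (D' j)" for j
  proof (rule blocI)
    fix g h \<phi> v assume *: "rooted g" "rooted h" "is_iso \<phi> (rball j g) (rball j h)" "v \<in> ball_verts j g"
    then show "(g, v) \<in> D' j \<longleftrightarrow> (h, \<phi> v) \<in> D' j"
      using iso_mem_ball[OF *(3) order.refl *(4)] by (simp add: D'_def)
  qed (auto simp: D'_def)
  have nonempty_meas: "{x. sent (indicator B) (rep_gstar x) \<noteq> 0} \<in> sets borel" if "B \<in> sets local_algebra" for B
  proof -
    have "(\<lambda>x. sent (indicator B) (rep_gstar x)) \<in> borel_measurable borel"
      using transported_indicator[OF that] by (simp add: transported_def)
    from measurable_sets[OF this, of "- {0}"] show ?thesis by (simp add: vimage_def)
  qed
  define X where "X j = {x. sent (indicator (A - D' j)) (rep_gstar x) \<noteq> 0}" for j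
  have XM: "X j \<in> sets borel" for j
    unfolding X_def using AM local_in_local_algebra[of "D' j"] DD' by (intro nonempty_meas sets.Diff) (auto simp: local_sets_def)
  have Xiff: "x \<in> X j \<longleftrightarrow> \<not> S (rep_gstar x) \<subseteq> ball_verts j (rep_gstar x)" for x j
    using S[OF rooted_rep[of x]] rooted_rep[of x]
    unfolding X_def mem_Collect_eq sent_indicator_eq_0 A_def D'_def by auto
  have "(\<lambda>j. prob (X j)) \<longlonglongrightarrow> prob (\<Inter>j. X j)"
  proof (rule finite_Lim_measure_decseq)
    show "range X \<subseteq> events" using XM sets_rho by auto
    show "decseq X" unfolding decseq_def using ball_verts_mono Xiff by (meson order.trans subsetI)
  qed
  moreover have "(\<Inter>j. X j) = {}"
  proof -
    have "\<exists>j. x \<notin> X j" for x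
    proof -
      let ?g = "rep_gstar x"
      have "\<forall>v\<in>S ?g. \<exists>j. v \<in> ball_verts j ?g"
        using S[OF rooted_rep[of x]] verts_ball[OF rooted_rep[of x]] by (metis subsetD)
      then obtain j where j: "\<And>v. v \<in> S ?g \<Longrightarrow> v \<in> ball_verts (j v) ?g" by metis
      have "v \<in> ball_verts (Max (j ` S ?g)) ?g" if "v \<in> S ?g" for v
        using j[OF that] ball_verts_mono[of "j v" "Max (j ` S ?g)" ?g] S[OF rooted_rep[of x]] that by auto
      then show ?thesis using Xiff by blast
    qed
    then show ?thesis by blast
  qed
  ultimately have "(\<lambda>j. prob (X j)) \<longlonglongrightarrow> 0" by simp
  from order_tendstoD(2)[OF this, of "\<eta> / 3"] \<eta> obtain j where j: "prob (X j) < \<eta> / 3"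
    by (auto simp: eventually_sequentially)
  let ?Y = "\<lambda>N. {x. card (ball_verts j (rep_gstar x)) > N}"
  obtain N where N: "prob (?Y N) < \<eta> / 3" using ball_size_tight[of "\<eta> / 3" j] \<eta> by auto
  have YM: "?Y N \<in> sets borel" using sets_loc[OF loc_card_ball, of j "{N<..}"] by simp
  have sentD: "sent (indicator (D j N)) g \<le> ennreal N" if "rooted g" for g
  proof (cases "card (ball_verts j g) \<le> N")
    case True
    have "sent (indicator (D j N)) g \<le> ennreal (card (ball_verts j g))"
      unfolding sent_def count_indicator_ball[OF that, symmetric]
      by (intro nn_integral_mono) (auto simp: indicator_def D_def)
    then show ?thesis using True by (meson ennreal_leI of_nat_mono order.trans)
  next
    case False
    then have "sent (indicator (D j N)) g = 0" by (simp add: sent_indicator_eq_0 D_def)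
    then show ?thesis by simp
  qed
  have "D j N \<in> local_sets" using DD by (auto simp: local_sets_def)
  from local_approximation[OF AM this sentD, of "\<eta> / 3"] \<eta> obtain A' where A': "A' \<in> local_sets" "A' \<subseteq> D j N"
    "(\<integral>\<^sup>+ x. sent (indicator ((A \<inter> D j N - A') \<union> (A' - A))) (rep_gstar x) \<partial>\<rho>) < ennreal (\<eta> / 3)" by auto
  define B where "B = (A \<inter> D j N - A') \<union> (A' - A)"
  have BM: "B \<in> sets local_algebra"
    unfolding B_def using AM local_in_local_algebra[OF A'(1)] local_in_local_algebra[OF \<open>D j N \<in> local_sets\<close>] by auto
  let ?Z = "{x. sent (indicator B) (rep_gstar x) \<noteq> 0}"
  have ZM: "?Z \<in> sets borel" by (rule nonempty_meas[OF BM])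
  have "emeasure \<rho> ?Z = (\<integral>\<^sup>+ x. indicator ?Z x \<partial>\<rho>)" using ZM sets_rho by simp
  also have "\<dots> \<le> (\<integral>\<^sup>+ x. sent (indicator B) (rep_gstar x) \<partial>\<rho>)"
  proof (intro nn_integral_mono)
    fix x
    show "indicator ?Z x \<le> sent (indicator B) (rep_gstar x)"
    proof (cases "x \<in> ?Z")
      case True
      then obtain v where "v \<in> verts (rep_gstar x)" "(rep_gstar x, v) \<in> B" by (auto simp: sent_indicator_eq_0)
      then show ?thesis using sent_ge[of v "rep_gstar x" "indicator B"] True by (simp add: indicator_def)
    qed simp
  qed
  also have "\<dots> < ennreal (\<eta> / 3)" using A'(3) by (simp add: B_def)
  finally have Z: "prob ?Z < \<eta> / 3" using \<eta> by (simp add: emeasure_eq_measure ennreal_less_iff)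
  \<comment> \<open>The root is added so that the set is nonempty for every graph, also for exceptional ones.\<close>
  define A'' where "A'' = A' \<union> {(g, v). rooted g \<and> v = origin g}"
  have diag: "bloc 0 {(g, v). rooted g \<and> v = origin g}"
    by (rule blocI) (auto simp: is_iso_def ball_verts_def)
  have A''l: "A'' \<in> local_sets"
    unfolding A''_def using A'(1) diag by (intro local_sets_binary) (auto simp: local_sets_def)
  have sub: "{x. section_at A'' (rep_gstar x) \<noteq> S (rep_gstar x)} \<subseteq> X j \<union> ?Y N \<union> ?Z"
  proof
    fix x assume x: "x \<in> {x. section_at A'' (rep_gstar x) \<noteq> S (rep_gstar x)}"
    show "x \<in> X j \<union> ?Y N \<union> ?Z"
    proof (rule ccontr)
      let ?g = "rep_gstar x"
      assume n: "x \<notin> X j \<union> ?Y N \<union> ?Z"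
      then have 1: "S ?g \<subseteq> ball_verts j ?g" "card (ball_verts j ?g) \<le> N" and 2: "\<forall>v\<in>verts ?g. (?g, v) \<notin> B"
        using Xiff by (auto simp: sent_indicator_eq_0)
      have sv: "v \<in> verts ?g" if "(?g, v) \<in> A' \<or> v \<in> S ?g" for v
        using that S[OF rooted_rep[of x]] A'(2) ball_verts_subset[OF rooted_rep[of x], of j] by (auto simp: D_def)
      have eq: "(?g, v) \<in> A' \<longleftrightarrow> v \<in> S ?g" for v
      proof (cases "v \<in> verts ?g")
        case True
        then have nB: "(?g, v) \<notin> B" using 2 by blast
        have e: "(?g, v) \<in> A \<longleftrightarrow> v \<in> S ?g" using rooted_rep[of x] by (simp add: A_def)
        have d: "v \<in> S ?g \<Longrightarrow> (?g, v) \<in> D j N" using 1 rooted_rep[of x] by (auto simp: D_def)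
        show ?thesis using nB e d unfolding B_def by blast
      next
        case False
        then show ?thesis using sv[of v] by blast
      qed
      have "section_at A'' ?g = {v. (?g, v) \<in> A'} \<union> {origin ?g}"
        using rooted_rep[of x] by (auto simp: section_at_def A''_def)
      also have "\<dots> = S ?g" unfolding eq using S[OF rooted_rep[of x]] by (simp add: insert_absorb)
      finally have "section_at A'' ?g = S ?g" .
      then show False using x by simp
    qed
  qed
  have "A'' \<in> sets local_algebra" by (rule local_in_local_algebra[OF A''l])
  then have "{x. sent (indicator ((A'' - A) \<union> (A - A''))) (rep_gstar x) \<noteq> 0} \<in> sets borel"
    using AM by (intro nonempty_meas) auto
  also have "{x. sent (indicator ((A'' - A) \<union> (A - A''))) (rep_gstar x) \<noteq> 0}
     = {x. section_at A'' (rep_gstar x) \<noteq> S (rep_gstar x)}"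
  proof (intro Collect_cong)
    fix x
    let ?g = "rep_gstar x"
    have g: "rooted ?g" by (rule rooted_rep)
    have sv: "section_at A'' ?g \<subseteq> verts ?g"
      using A''l local_sets_subset by (auto simp: section_at_def birooted_verts_def)
    have "(\<forall>v\<in>verts ?g. (?g, v) \<notin> (A'' - A) \<union> (A - A'')) \<longleftrightarrow> (\<forall>v\<in>verts ?g. v \<in> section_at A'' ?g \<longleftrightarrow> v \<in> S ?g)"
      using g by (simp add: A_def section_at_def) blast
    also have "\<dots> \<longleftrightarrow> section_at A'' ?g = S ?g"
      using sv S[OF g] by (simp add: set_eq_iff subset_iff) blast
    finally show "sent (indicator ((A'' - A) \<union> (A - A''))) ?g \<noteq> 0 \<longleftrightarrow> section_at A'' ?g \<noteq> S ?g"
      unfolding sent_indicator_eq_0 by simp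
  qed
  finally have WM: "{x. section_at A'' (rep_gstar x) \<noteq> S (rep_gstar x)} \<in> sets borel" .
  have "prob {x. section_at A'' (rep_gstar x) \<noteq> S (rep_gstar x)} \<le> prob (X j \<union> ?Y N \<union> ?Z)"
    by (rule finite_measure_mono[OF sub]) (use XM YM ZM sets_rho in auto)
  also have "\<dots> \<le> prob (X j) + prob (?Y N) + prob ?Z"
    by (intro order.trans[OF measure_Un_le] add_right_mono measure_Un_le) (use XM YM ZM sets_rho in auto)
  also have "\<dots> < \<eta>" using j N Z by simp
  finally show ?thesis using A''l WM by (intro bexI[of _ A'']) (auto simp: A''_def)
qed

end

section \<open>Almost invariant regions in the finite graphs\<close>

text \<open>The root spreads a unit mass evenly over its set.\<close>

definition wgt :: "(rgraph \<times> nat) set \<Rightarrow> rgraph \<times> nat \<Rightarrow> ennreal" where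
  "wgt A p = indicator A p * ennreal (1 / card (section_at A (fst p)))"

definition boundary_ratio :: "(rgraph \<times> nat) set \<Rightarrow> rgraph \<Rightarrow> real" where
  "boundary_ratio A g = real (card (boundary g (section_at A g))) / real (card (section_at A g))"

lemma section_ball: "bloc r A \<Longrightarrow> section_at A g \<subseteq> ball_verts r g"
  using blocD1 by (auto simp: section_at_def)

lemma section_image:
  assumes A: "bloc r A" and gh: "rooted g" "rooted h" and iso: "is_iso \<phi> (rball r g) (rball r h)"
  shows "\<phi> ` section_at A g = section_at A h"
proof
  show "\<phi> ` section_at A g \<subseteq> section_at A h"
    using blocD2[OF A gh iso] section_ball[OF A, of g] by (auto simp: section_at_def)
  show "section_at A h \<subseteq> \<phi> ` section_at A g"
  proof
    fix w assume w: "w \<in> section_at A h"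
    then have "w \<in> \<phi> ` ball_verts r g" using section_ball[OF A] iso_image[OF iso order.refl] by blast
    then obtain v where "v \<in> ball_verts r g" "w = \<phi> v" by blast
    then show "w \<in> \<phi> ` section_at A g" using w blocD2[OF A gh iso] by (auto simp: section_at_def)
  qed
qed

lemma finite_section: "bloc r A \<Longrightarrow> rooted g \<Longrightarrow> finite (section_at A g)"
  using section_ball finite_ball finite_subset by metis

lemma section_card_iso:
  assumes A: "bloc r A" and gh: "rooted g" "rooted h" and iso: "is_iso \<phi> (rball r g) (rball r h)"
  shows "card (section_at A g) = card (section_at A h)"
proof -
  have "inj_on \<phi> (section_at A g)"
    using iso section_ball[OF A, of g] by (auto simp: is_iso_def bij_betw_def intro: inj_on_subset)
  then show ?thesis using card_image section_image[OF assms] by metis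
qed

lemma floc_wgt:
  assumes A: "bloc r A"
  shows "floc r (wgt A)"
  unfolding floc_def
proof (intro conjI allI impI)
  show "wgt A (g, v) = 0" if "rooted g" "v \<notin> ball_verts r g" for g v
    using that blocD1[OF A] by (auto simp: wgt_def indicator_def)
  fix g h \<phi> v assume *: "rooted g" "rooted h" "is_iso \<phi> (rball r g) (rball r h)" "v \<in> ball_verts r g"
  show "wgt A (g, v) = wgt A (h, \<phi> v)"
    using blocD2[OF A *] section_card_iso[OF A *(1-3)] by (simp add: wgt_def indicator_def)
qed

lemma loc_boundary_ratio:
  assumes A: "bloc r A"
  shows "loc (Suc r) (boundary_ratio A)"
proof (rule locI)
  have sub: "card (boundary g (section_at A g)) \<le> card (boundary h (section_at A h))"
    if gh: "rooted g" "rooted h" and iso: "is_iso \<phi> (rball (Suc r) g) (rball (Suc r) h)" for g h \<phi>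
  proof (rule card_inj_on_le)
    have isor: "is_iso \<phi> (rball r g) (rball r h)" using iso_smaller[OF iso] by simp
    have inj: "inj_on \<phi> (ball_verts (Suc r) g)" using iso by (simp add: is_iso_def bij_betw_def)
    have sb: "section_at A g \<subseteq> ball_verts (Suc r) g"
      using section_ball[OF A] ball_verts_mono[of r "Suc r" g] by fastforce
    show "inj_on \<phi> (boundary g (section_at A g))"
      by (rule inj_on_subset[OF inj]) (use sb in \<open>auto simp: boundary_def\<close>)
    show "finite (boundary h (section_at A h))"
      using finite_section[OF A gh(2)] by (rule finite_subset[rotated]) (auto simp: boundary_def)
    show "\<phi> ` boundary g (section_at A g) \<subseteq> boundary h (section_at A h)"
    proof
      fix y assume "y \<in> \<phi> ` boundary g (section_at A g)"
      then obtain u v where y: "y = \<phi> u" and u: "u \<in> section_at A g" and v: "v \<in> verts g - section_at A g"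
        and uv: "(u, v) \<in> und (edges g)" by (auto simp: boundary_def)
      have ub: "u \<in> ball_verts r g" using u section_ball[OF A] by blast
      have uv1: "(u, v) \<in> und (edges g) ^^ 1" using uv by simp
      have vb: "v \<in> ball_verts (Suc r) g" by (rule ball_step[OF ub uv1]) simp
      have "(\<phi> u, \<phi> v) \<in> und (edges h) ^^ 1" by (rule iso_path[OF iso ub uv1]) simp
      moreover have "\<phi> v \<in> ball_verts (Suc r) h" using vb iso_image[OF iso order.refl] by blast
      then have "\<phi> v \<in> verts h" using ball_verts_subset[OF gh(2)] by blast
      moreover have "\<phi> v \<notin> section_at A h"
      proof
        assume "\<phi> v \<in> section_at A h"
        then obtain w where "w \<in> section_at A g" "\<phi> v = \<phi> w" using section_image[OF A gh isor] by blast
        then show False using inj vb sb v by (metis DiffD2 inj_onD subsetD)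
      qed
      moreover have "\<phi> u \<in> section_at A h" using u section_image[OF A gh isor] by blast
      ultimately show "y \<in> boundary h (section_at A h)" using y by (auto simp: boundary_def)
    qed
  qed
  fix g h \<phi> assume *: "rooted g" "rooted h" "is_iso \<phi> (rball (Suc r) g) (rball (Suc r) h)"
  have "card (boundary g (section_at A g)) = card (boundary h (section_at A h))"
    using sub[OF *] sub[OF *(2,1) is_iso_ball_inv[OF *(3)]] by simp
  moreover have "card (section_at A g) = card (section_at A h)"
    by (rule section_card_iso[OF A *(1,2) iso_smaller[OF *(3)]]) simp
  ultimately show "boundary_ratio A g = boundary_ratio A h" by (simp add: boundary_ratio_def)
qed

lemma boundary_ratio_bounds: "0 \<le> boundary_ratio A g" "bloc r A \<Longrightarrow> rooted g \<Longrightarrow> \<bar>boundary_ratio A g\<bar> \<le> 1"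
proof -
  show "0 \<le> boundary_ratio A g" by (simp add: boundary_ratio_def)
  assume "bloc r A" "rooted g"
  then have "card (boundary g (section_at A g)) \<le> card (section_at A g)"
    by (intro card_mono finite_section) (auto simp: boundary_def)
  then show "\<bar>boundary_ratio A g\<bar> \<le> 1" by (auto simp: boundary_ratio_def divide_le_eq_1)
qed

lemma vertex_set_image:
  assumes S: "\<And>g. rooted g \<Longrightarrow> finite (S g) \<and> S g \<subseteq> verts g \<and> origin g \<in> S g"
    and meas: "measurable_vertex_set S" and iso: "is_iso \<phi> g h" and gh: "rooted g" "rooted h"
  shows "\<phi> ` S g = S h"
proof
  have bij: "bij_betw \<phi> (verts g) (verts h)" using iso by (simp add: is_iso_def)
  note eq = measurable_vertex_set_equivariant[OF meas iso gh]
  show "\<phi> ` S g \<subseteq> S h" using eq S[OF gh(1)] by blast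
  show "S h \<subseteq> \<phi> ` S g"
  proof
    fix w assume w: "w \<in> S h"
    then obtain v where "v \<in> verts g" "w = \<phi> v" using S[OF gh(2)] bij by (auto simp: bij_betw_def)
    then show "w \<in> \<phi> ` S g" using w eq by blast
  qed
qed

context weak_limit
begin

text \<open>The sets \<open>S\<^sub>k\<close> are replaced by local sets that differ from them on an event of probability below \<open>2\<^sup>-\<^sup>k\<close>. By the
  Borel--Cantelli lemma the boundary ratios still tend to \<open>0\<close>. The mass that the root fails to receive after the
  replacement comes from vertices for which the event occurs; by mass transport its mean is the mean of the
  mass sent by a root for which the event occurs, that is, the probability of the event.\<close>

lemma tame_local:
  assumes tame: "tame \<rho>" and \<eta>: "0 < \<eta>"
  shows "\<exists>\<delta>>0. \<forall>\<kappa>>0. \<exists>r A. bloc r A \<and> (\<forall>g. rooted g \<longrightarrow> (g, origin g) \<in> A) \<and>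
     prob {x. recv (wgt A) (rep_gstar x) \<le> ennreal \<delta>} \<le> \<eta> \<and> (\<integral>x. boundary_ratio A (rep_gstar x) \<partial>\<rho>) \<le> \<kappa>"
proof -
  obtain S :: "nat \<Rightarrow> rgraph \<Rightarrow> nat set" where
    S: "\<And>k g. rooted g \<Longrightarrow> finite (S k g) \<and> S k g \<subseteq> verts g \<and> origin g \<in> S k g"
    and meas: "\<And>k. measurable_vertex_set (S k)"
    and bdry: "AE x in \<rho>. (\<lambda>k. real (card (boundary (rep_gstar x) (S k (rep_gstar x)))) / real (card (S k (rep_gstar x)))) \<longlonglongrightarrow> 0"
    and mass: "\<forall>\<eta>>0. \<exists>\<delta>>0. limsup (\<lambda>k. emeasure \<rho> {x. received_mass (S k) (rep_gstar x) \<le> ennreal \<delta>}) \<le> ennreal \<eta>"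
    using tame unfolding tame_def by blast
  have "0 < \<eta> / 4" using \<eta> by simp
  then obtain \<delta> where \<delta>: "0 < \<delta>"
    and lims: "limsup (\<lambda>k. emeasure \<rho> {x. received_mass (S k) (rep_gstar x) \<le> ennreal \<delta>}) \<le> ennreal (\<eta> / 4)"
    using mass by blast
  define Bad where "Bad A k = {x. section_at A (rep_gstar x) \<noteq> S k (rep_gstar x)}" for A k
  have "\<forall>k. \<exists>A\<in>local_sets. (\<forall>g. rooted g \<longrightarrow> (g, origin g) \<in> A) \<and> Bad A k \<in> sets borel \<and> prob (Bad A k) < (1/2) ^ k"
    unfolding Bad_def using local_version[OF S meas] by simp
  then obtain A where Al: "\<And>k. A k \<in> local_sets" and Adiag: "\<And>k g. rooted g \<Longrightarrow> (g, origin g) \<in> A k"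
    and badM: "\<And>k. Bad (A k) k \<in> sets borel" and badP: "\<And>k. prob (Bad (A k) k) < (1/2) ^ k"
    by metis
  obtain r where r: "\<And>k. bloc (r k) (A k)" using Al unfolding local_sets_def mem_Collect_eq by metis
  have boundary_ratio_lim: "(\<lambda>k. \<integral>x. boundary_ratio (A k) (rep_gstar x) \<partial>\<rho>) \<longlonglongrightarrow> 0"
  proof -
    have "(\<lambda>k. \<integral>x. boundary_ratio (A k) (rep_gstar x) \<partial>\<rho>) \<longlonglongrightarrow> (\<integral>x. 0 \<partial>\<rho>)"
    proof (rule integral_dominated_convergence[where w = "\<lambda>_. 1"])
      show "(\<lambda>x. boundary_ratio (A k) (rep_gstar x)) \<in> borel_measurable \<rho>" for k
        by (rule measurable_rho[OF borel_measurable_loc[OF loc_boundary_ratio[OF r]]])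
      show "AE x in \<rho>. norm (boundary_ratio (A k) (rep_gstar x)) \<le> 1" for k
        using boundary_ratio_bounds(2)[OF r rooted_rep] by simp
      have "AE x in \<rho>. eventually (\<lambda>k. x \<in> space \<rho> - Bad (A k) k) sequentially"
      proof (rule borel_cantelli_AE1)
        show "Bad (A k) k \<in> sets \<rho>" for k using badM sets_rho by simp
        show "emeasure \<rho> (Bad (A k) k) < \<infinity>" for k by (simp add: emeasure_eq_measure)
        show "summable (\<lambda>k. prob (Bad (A k) k))"
          by (rule summable_comparison_test'[OF summable_geometric[of "1/2 :: real"], of 0])
            (auto intro: less_imp_le[OF badP])
      qed
      then show "AE x in \<rho>. (\<lambda>k. boundary_ratio (A k) (rep_gstar x)) \<longlonglongrightarrow> 0"
        using bdry
      proof eventually_elim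
        case (elim x)
        from elim(1) have "eventually (\<lambda>k. real (card (boundary (rep_gstar x) (S k (rep_gstar x)))) / real (card (S k (rep_gstar x)))
           = boundary_ratio (A k) (rep_gstar x)) sequentially"
          by eventually_elim (simp add: boundary_ratio_def Bad_def)
        then show ?case by (rule Lim_transform_eventually[OF elim(2)])
      qed
    qed auto
    then show ?thesis by simp
  qed
  define F0 where "F0 k p = (indicator {(g, v). rooted g \<and> v \<in> S k g} p :: ennreal)
      * ennreal (1 / real (card (S k (rep_gstar (abs_gstar (fst p))))))" for k p
  define F where "F k p = F0 k p * indicator (Bad (A k) k) (abs_gstar (fst p))" for k p
  have SA: "{(g, v). rooted g \<and> v \<in> S k g} \<in> sets local_algebra" for k
    using meas birooted_subset_local_algebra unfolding measurable_vertex_set_def by blast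
  have sentS: "sent (indicator {(g, v). rooted g \<and> v \<in> S k g}) g = ennreal (card (S k g))" if "rooted g" for k g
  proof -
    have "sent (indicator {(g, v). rooted g \<and> v \<in> S k g}) g = (\<integral>\<^sup>+ v. indicator (S k g) v \<partial>count_space (verts g))"
      unfolding sent_def using that by (intro nn_integral_cong) (simp add: indicator_def)
    then show ?thesis using S[OF that, of k] by (simp add: emeasure_count_space ennreal_of_nat_eq_real_of_nat)
  qed
  have psi: "(\<lambda>x. ennreal (1 / real (card (S k (rep_gstar x))))) \<in> borel_measurable borel" for k
  proof -
    have "(\<lambda>x. sent (indicator {(g, v). rooted g \<and> v \<in> S k g}) (rep_gstar x)) \<in> borel_measurable borel"
      using transported_indicator[OF SA] by (simp add: transported_def)
    then have "(\<lambda>x. ennreal (card (S k (rep_gstar x)))) \<in> borel_measurable borel"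
      by (simp add: sentS[OF rooted_rep])
    then have "(\<lambda>x. enn2real (ennreal (card (S k (rep_gstar x))))) \<in> borel_measurable borel" by measurable
    then have "(\<lambda>x. real (card (S k (rep_gstar x)))) \<in> borel_measurable borel" by simp
    then show ?thesis by measurable
  qed
  have F0M: "F0 k \<in> borel_measurable local_algebra" for k
    unfolding F0_def[abs_def]
    using measurable_compose[OF measurable_abs_gstar psi[of k]] SA[of k] by measurable
  have FM: "F k \<in> borel_measurable local_algebra" for k
  proof -
    have "(indicator (Bad (A k) k) :: gstar \<Rightarrow> ennreal) \<in> borel_measurable borel"
      by (rule borel_measurable_indicator[OF badM])
    from measurable_compose[OF measurable_abs_gstar this]
    show ?thesis unfolding F_def[abs_def] by (rule borel_measurable_times_ennreal[OF F0M])
  qed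
  have cardS: "card (S k (rep_gstar (abs_gstar h))) = card (S k h)" if h: "rooted h" for k h
  proof -
    obtain \<phi> where iso: "is_iso \<phi> (rep_gstar (abs_gstar h)) h" by (rule rep_abs_obtain[OF h])
    have "inj_on \<phi> (S k (rep_gstar (abs_gstar h)))"
      using iso S[OF rooted_rep, of k] by (auto simp: is_iso_def bij_betw_def intro: inj_on_subset)
    then show ?thesis using card_image[of \<phi> "S k (rep_gstar (abs_gstar h))"] vertex_set_image[OF S meas iso rooted_rep h, of k] by simp
  qed
  have good: "section_at (A k) h = S k h" if h: "rooted h" and "abs_gstar h \<notin> Bad (A k) k" for k h
  proof -
    obtain \<phi> where iso: "is_iso \<phi> (rep_gstar (abs_gstar h)) h" by (rule rep_abs_obtain[OF h])
    have "\<phi> ` S k (rep_gstar (abs_gstar h)) = S k h" by (rule vertex_set_image[OF S meas iso rooted_rep h])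
    moreover have "\<phi> ` section_at (A k) (rep_gstar (abs_gstar h)) = section_at (A k) h"
      by (rule section_image[OF r rooted_rep h is_iso_rball[OF iso rooted_rep h]])
    ultimately show ?thesis using that(2) by (simp add: Bad_def)
  qed
  have F0_eq: "F0 k (h, v) = (if v \<in> S k h then ennreal (1 / real (card (S k h))) else 0)" if "rooted h" for k h v
    using that by (simp add: F0_def cardS)
  have mass_eq: "received_mass (S k) g = recv (F0 k) g" if "rooted g" for k g
    unfolding received_mass_def recv_def
    by (intro nn_integral_cong) (simp add: F0_eq rooted_reroot[OF that])
  have split: "recv (F0 k) g \<le> recv (wgt (A k)) g + recv (F k) g" if g: "rooted g" for k g
  proof -
    have "recv (F0 k) g \<le> (\<integral>\<^sup>+ u. wgt (A k) (reroot g u, origin g) + F k (reroot g u, origin g) \<partial>count_space (verts g))"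
      unfolding recv_def
    proof (intro nn_integral_mono)
      fix u assume "u \<in> space (count_space (verts g))"
      then have h: "rooted (reroot g u)" using rooted_reroot[OF g] by simp
      show "F0 k (reroot g u, origin g) \<le> wgt (A k) (reroot g u, origin g) + F k (reroot g u, origin g)"
      proof (cases "abs_gstar (reroot g u) \<in> Bad (A k) k")
        case True
        then show ?thesis by (simp add: F_def)
      next
        case False
        have "section_at (A k) (reroot g u) = S k (reroot g u)" by (rule good[OF h False])
        moreover have "(reroot g u, origin g) \<in> A k \<longleftrightarrow> origin g \<in> section_at (A k) (reroot g u)"
          by (simp add: section_at_def)
        ultimately show ?thesis by (simp add: F0_eq[OF h] wgt_def indicator_def)
      qed
    qed
    also have "\<dots> = recv (wgt (A k)) g + recv (F k) g"
      unfolding recv_def by (rule nn_integral_add) auto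
    finally show ?thesis .
  qed
  have recvM: "(\<lambda>x. recv (F k) (rep_gstar x)) \<in> borel_measurable \<rho>" "(\<lambda>x. recv (F0 k) (rep_gstar x)) \<in> borel_measurable \<rho>"
    "(\<lambda>x. recv (wgt (A k)) (rep_gstar x)) \<in> borel_measurable \<rho>" for k
    using mass_transport[OF FM[of k]] mass_transport[OF F0M[of k]]
      borel_measurable_loc[OF loc_recv[OF floc_wgt[OF r[of k]]]]
    unfolding transported_def by (blast intro: measurable_rho)+
  have intF: "(\<integral>\<^sup>+ x. recv (F k) (rep_gstar x) \<partial>\<rho>) \<le> ennreal ((1/2) ^ k)" for k
  proof -
    have "(\<integral>\<^sup>+ x. recv (F k) (rep_gstar x) \<partial>\<rho>) = (\<integral>\<^sup>+ x. sent (F k) (rep_gstar x) \<partial>\<rho>)"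
      using mass_transport[OF FM] by (simp add: transported_def)
    also have "\<dots> = (\<integral>\<^sup>+ x. indicator (Bad (A k) k) x \<partial>\<rho>)"
    proof (intro nn_integral_cong)
      fix x
      let ?g = "rep_gstar x"
      have c: "card (S k ?g) > 0" using S[OF rooted_rep, of k x] by (auto simp: card_gt_0_iff)
      have "sent (F k) ?g = (\<integral>\<^sup>+ v. ennreal (1 / real (card (S k ?g))) * indicator (Bad (A k) k) x
          * indicator {(g, v). rooted g \<and> v \<in> S k g} (?g, v) \<partial>count_space (verts ?g))"
        unfolding sent_def F_def F0_def fst_conv abs_rep by (intro nn_integral_cong) (simp add: mult_ac)
      also have "\<dots> = ennreal (1 / real (card (S k ?g))) * indicator (Bad (A k) k) x * ennreal (card (S k ?g))"
        unfolding sentS[OF rooted_rep, symmetric] sent_def by (rule nn_integral_cmult) simp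
      also have "\<dots> = indicator (Bad (A k) k) x * (ennreal (1 / real (card (S k ?g))) * ennreal (card (S k ?g)))"
        by (simp add: mult_ac)
      also have "ennreal (1 / real (card (S k ?g))) * ennreal (card (S k ?g)) = 1"
        by (subst ennreal_mult[symmetric]) (use c in auto)
      finally show "sent (F k) ?g = indicator (Bad (A k) k) x" by simp
    qed
    also have "\<dots> = emeasure \<rho> (Bad (A k) k)" using badM sets_rho by simp
    also have "\<dots> \<le> ennreal ((1/2) ^ k)"
      unfolding emeasure_eq_measure by (rule ennreal_leI) (rule less_imp_le[OF badP])
    finally show ?thesis .
  qed
  have key: "prob {x. recv (wgt (A k)) (rep_gstar x) \<le> ennreal (\<delta> / 2)}
     \<le> prob {x. received_mass (S k) (rep_gstar x) \<le> ennreal \<delta>} + 2 / \<delta> * (1/2) ^ k" for k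
  proof -
    let ?W = "{x. recv (wgt (A k)) (rep_gstar x) \<le> ennreal (\<delta> / 2)}"
    let ?M = "{x. recv (F0 k) (rep_gstar x) \<le> ennreal \<delta>}"
    let ?N = "{x\<in>space \<rho>. 1 \<le> ennreal (2 / \<delta>) * recv (F k) (rep_gstar x)}"
    have MM: "?M \<in> sets \<rho>"
      using measurable_sets[OF recvM(2), of "{..ennreal \<delta>}" k] by (simp add: vimage_def space_rho)
    have NM: "?N \<in> sets \<rho>" using recvM(1)[of k] by measurable
    have sub: "?W \<subseteq> ?M \<union> ?N"
    proof
      fix x assume x: "x \<in> ?W"
      show "x \<in> ?M \<union> ?N"
      proof (cases "recv (F k) (rep_gstar x) \<le> ennreal (\<delta> / 2)")
        case True
        have "recv (F0 k) (rep_gstar x) \<le> ennreal (\<delta> / 2) + ennreal (\<delta> / 2)"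
          by (rule order.trans[OF split[OF rooted_rep] add_mono[OF _ True]]) (use x in simp)
        also have "\<dots> = ennreal \<delta>" by (subst ennreal_plus[symmetric]) (use \<delta> in auto)
        finally show ?thesis by simp
      next
        case False
        then have "ennreal (\<delta> / 2) \<le> recv (F k) (rep_gstar x)" by simp
        then have "ennreal (2 / \<delta>) * ennreal (\<delta> / 2) \<le> ennreal (2 / \<delta>) * recv (F k) (rep_gstar x)"
          by (rule mult_left_mono) simp
        moreover have "ennreal (2 / \<delta>) * ennreal (\<delta> / 2) = 1"
          by (subst ennreal_mult[symmetric]) (use \<delta> in auto)
        ultimately show ?thesis by (simp add: space_rho)
      qed
    qed
    have "emeasure \<rho> ?N \<le> ennreal (2 / \<delta>) * (\<integral>\<^sup>+ x. recv (F k) (rep_gstar x) * indicator (space \<rho>) x \<partial>\<rho>)"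
      using recvM(1)[of k] by (intro nn_integral_Markov_inequality) auto
    also have "(\<integral>\<^sup>+ x. recv (F k) (rep_gstar x) * indicator (space \<rho>) x \<partial>\<rho>) = (\<integral>\<^sup>+ x. recv (F k) (rep_gstar x) \<partial>\<rho>)"
      by (intro nn_integral_cong) (simp add: space_rho)
    also have "ennreal (2 / \<delta>) * \<dots> \<le> ennreal (2 / \<delta>) * ennreal ((1/2) ^ k)" by (intro mult_left_mono intF) simp
    also have "\<dots> = ennreal (2 / \<delta> * (1/2) ^ k)" by (subst ennreal_mult[symmetric]) (use \<delta> in auto)
    finally have N: "prob ?N \<le> 2 / \<delta> * (1/2) ^ k"
      using \<delta> by (simp add: emeasure_eq_measure ennreal_le_iff)
    have "prob ?W \<le> prob (?M \<union> ?N)" by (rule finite_measure_mono[OF sub]) (use MM NM in auto)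
    also have "\<dots> \<le> prob ?M + prob ?N" by (rule measure_Un_le[OF MM NM])
    finally show ?thesis using N by (simp add: mass_eq[OF rooted_rep])
  qed
  have "eventually (\<lambda>k. emeasure \<rho> {x. received_mass (S k) (rep_gstar x) \<le> ennreal \<delta>} < ennreal (\<eta> / 2)) sequentially"
  proof (rule Limsup_lessD)
    show "limsup (\<lambda>k. emeasure \<rho> {x. received_mass (S k) (rep_gstar x) \<le> ennreal \<delta>}) < ennreal (\<eta> / 2)"
      using lims by (rule order.strict_trans1) (use \<eta> in \<open>simp add: ennreal_less_iff\<close>)
  qed
  then have ev1: "eventually (\<lambda>k. prob {x. received_mass (S k) (rep_gstar x) \<le> ennreal \<delta>} < \<eta> / 2) sequentially"
    by eventually_elim (use \<eta> in \<open>simp add: emeasure_eq_measure ennreal_less_iff\<close>)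
  have "(\<lambda>k. 2 / \<delta> * (1/2 :: real) ^ k) \<longlonglongrightarrow> 2 / \<delta> * 0"
    by (intro tendsto_mult_left LIMSEQ_power_zero) simp
  then have ev2: "eventually (\<lambda>k. 2 / \<delta> * (1/2) ^ k < \<eta> / 2) sequentially"
    using \<eta> by (intro order_tendstoD(2)[where y = "2 / \<delta> * 0"]) auto
  show ?thesis
  proof (intro exI[of _ "\<delta> / 2"] conjI allI impI)
    show "0 < \<delta> / 2" using \<delta> by simp
    fix \<kappa> :: real assume \<kappa>: "0 < \<kappa>"
    have "eventually (\<lambda>k. (\<integral>x. boundary_ratio (A k) (rep_gstar x) \<partial>\<rho>) < \<kappa>) sequentially"
      using order_tendstoD(2)[OF boundary_ratio_lim \<kappa>] .
    then have "eventually (\<lambda>k. prob {x. recv (wgt (A k)) (rep_gstar x) \<le> ennreal (\<delta> / 2)} \<le> \<eta> \<and>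
        (\<integral>x. boundary_ratio (A k) (rep_gstar x) \<partial>\<rho>) \<le> \<kappa>) sequentially"
      using ev1 ev2
    proof eventually_elim
      case (elim k)
      then show ?case using key[of k] by simp
    qed
    then obtain k where "prob {x. recv (wgt (A k)) (rep_gstar x) \<le> ennreal (\<delta> / 2)} \<le> \<eta>"
        "(\<integral>x. boundary_ratio (A k) (rep_gstar x) \<partial>\<rho>) \<le> \<kappa>" by (auto simp: eventually_sequentially)
    then show "\<exists>r A. bloc r A \<and> (\<forall>g. rooted g \<longrightarrow> (g, origin g) \<in> A) \<and>
     prob {x. recv (wgt A) (rep_gstar x) \<le> ennreal (\<delta> / 2)} \<le> \<eta> \<and> (\<integral>x. boundary_ratio A (rep_gstar x) \<partial>\<rho>) \<le> \<kappa>"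
      using r[of k] Adiag[of _ k] by blast
  qed
qed

text \<open>Whether the root receives little mass, and the boundary ratio of its set, are local once the set is; so
  their averages in the finite graphs converge.\<close>

lemma finite_graph_regions:
  assumes tame: "tame \<rho>" and \<eta>: "0 < \<eta>"
  shows "\<exists>\<delta>>0. \<forall>\<kappa>>0. \<exists>R. eventually (\<lambda>n. \<exists>S.
     (\<forall>r<n. r \<in> S r \<and> S r \<subseteq> ball_verts R (gr E n r)) \<and>
     real (card {u \<in> {..<n}. (\<Sum>r<n. of_bool (u \<in> S r) / real (card (S r))) \<le> \<delta>}) / n \<le> \<eta> \<and>
     (\<Sum>r<n. real (card (boundary (gr E n r) (S r))) / real (card (S r))) / n \<le> \<kappa>) sequentially"
proof -
  obtain \<delta> where \<delta>: "0 < \<delta>" and loc: "\<And>\<kappa>. 0 < \<kappa> \<Longrightarrow> \<exists>r A. bloc r A \<and> (\<forall>g. rooted g \<longrightarrow> (g, origin g) \<in> A) \<and>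
     prob {x. recv (wgt A) (rep_gstar x) \<le> ennreal \<delta>} \<le> \<eta> / 2 \<and> (\<integral>x. boundary_ratio A (rep_gstar x) \<partial>\<rho>) \<le> \<kappa>"
    using tame_local[OF tame, of "\<eta> / 2"] \<eta> by auto
  show ?thesis
  proof (intro exI[of _ \<delta>] conjI \<delta> allI impI)
    fix \<kappa> :: real assume \<kappa>: "0 < \<kappa>"
    obtain r A where A: "bloc r A" and diag: "\<And>g. rooted g \<Longrightarrow> (g, origin g) \<in> A"
      and 1: "prob {x. recv (wgt A) (rep_gstar x) \<le> ennreal \<delta>} \<le> \<eta> / 2" and 2: "(\<integral>x. boundary_ratio A (rep_gstar x) \<partial>\<rho>) \<le> \<kappa> / 2"
      using loc[of "\<kappa> / 2"] \<kappa> by auto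
    define \<Phi> where "\<Phi> g = (of_bool (recv (wgt A) g \<le> ennreal \<delta>) :: real)" for g
    have loc\<Phi>: "loc (2 * r) \<Phi>"
      unfolding \<Phi>_def[abs_def] by (rule loc_comp[OF loc_recv[OF floc_wgt[OF A]], of "\<lambda>t. of_bool (t \<le> ennreal \<delta>)"])
    have lim1: "(\<lambda>n. (\<Sum>u<n. \<Phi> (gr E n u)) / n) \<longlonglongrightarrow> (\<integral>x. \<Phi> (rep_gstar x) \<partial>\<rho>)"
      by (rule average_converges[OF loc\<Phi>, of 1]) (simp add: \<Phi>_def)
    have prob\<Phi>: "(\<integral>x. \<Phi> (rep_gstar x) \<partial>\<rho>) = prob {x. recv (wgt A) (rep_gstar x) \<le> ennreal \<delta>}"
    proof -
      have "(\<integral>x. \<Phi> (rep_gstar x) \<partial>\<rho>) = (\<integral>x. indicator {x. recv (wgt A) (rep_gstar x) \<le> ennreal \<delta>} x \<partial>\<rho>)"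
        by (intro Bochner_Integration.integral_cong) (simp_all add: \<Phi>_def indicator_def)
      then show ?thesis by (simp add: space_rho)
    qed
    have ev1: "eventually (\<lambda>n. (\<Sum>u<n. \<Phi> (gr E n u)) / n < \<eta>) sequentially"
      by (rule order_tendstoD(2)[OF lim1]) (use 1 \<eta> in \<open>simp add: prob\<Phi>\<close>)
    have lim2: "(\<lambda>n. (\<Sum>u<n. boundary_ratio A (gr E n u)) / n) \<longlonglongrightarrow> (\<integral>x. boundary_ratio A (rep_gstar x) \<partial>\<rho>)"
      by (rule average_converges[OF loc_boundary_ratio[OF A], of 1]) (rule boundary_ratio_bounds(2)[OF A])
    have ev2: "eventually (\<lambda>n. (\<Sum>u<n. boundary_ratio A (gr E n u)) / n < \<kappa>) sequentially"
      by (rule order_tendstoD(2)[OF lim2]) (use 2 \<kappa> in simp)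
    show "\<exists>R. eventually (\<lambda>n. \<exists>S.
     (\<forall>r<n. r \<in> S r \<and> S r \<subseteq> ball_verts R (gr E n r)) \<and>
     real (card {u \<in> {..<n}. (\<Sum>r<n. of_bool (u \<in> S r) / real (card (S r))) \<le> \<delta>}) / n \<le> \<eta> \<and>
     (\<Sum>r<n. real (card (boundary (gr E n r) (S r))) / real (card (S r))) / n \<le> \<kappa>) sequentially"
    proof (rule exI[of _ r], use ev1 ev2 in eventually_elim)
      case (elim n)
      define S where "S u = section_at A (gr E n u)" for u
      have "\<Phi> (gr E n u) = of_bool ((\<Sum>v<n. of_bool (u \<in> S v) / real (card (S v))) \<le> \<delta>)" for u
      proof -
        have "recv (wgt A) (gr E n u) = (\<Sum>v<n. wgt A (gr E n v, u))"
          by (simp add: recv_def nn_integral_count_space_finite reroot_def)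
        also have "\<dots> = (\<Sum>v<n. ennreal (of_bool (u \<in> S v) / real (card (S v))))"
          by (intro sum.cong) (auto simp: wgt_def S_def section_at_def indicator_def)
        also have "\<dots> = ennreal (\<Sum>v<n. of_bool (u \<in> S v) / real (card (S v)))" by (rule sum_ennreal) simp
        finally show ?thesis using \<delta> by (simp add: \<Phi>_def ennreal_le_iff)
      qed
      then have "(\<Sum>u<n. \<Phi> (gr E n u)) = real (card {u \<in> {..<n}. (\<Sum>r<n. of_bool (u \<in> S r) / real (card (S r))) \<le> \<delta>})"
        by (simp add: Int_def)
      moreover have "u \<in> S u \<and> S u \<subseteq> ball_verts r (gr E n u)" if "u < n" for u
        using diag[OF rooted_gr[OF that]] section_ball[OF A] by (simp add: S_def section_at_def)
      ultimately show ?case using elim by (intro exI[of _ S]) (auto simp: boundary_ratio_def S_def)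
    qed
  qed
qed

end

section \<open>A quadratic time program\<close>

subsection \<open>Reasoning about running times\<close>

definition runs :: "com \<Rightarrow> mstate \<Rightarrow> nat \<Rightarrow> (mstate \<Rightarrow> bool) \<Rightarrow> bool" where
  "runs c s T R \<longleftrightarrow> (\<exists>t s'. exec c s t s' \<and> t \<le> T \<and> R s')"

lemma runs_weaken: "runs c s T R \<Longrightarrow> T \<le> T' \<Longrightarrow> (\<And>s'. R s' \<Longrightarrow> R' s') \<Longrightarrow> runs c s T' R'"
  unfolding runs_def by (meson order.trans)

lemma runs_Seq:
  assumes "runs c\<^sub>1 s T\<^sub>1 M" "\<And>s'. M s' \<Longrightarrow> runs c\<^sub>2 s' T\<^sub>2 R"
  shows "runs (Seq c\<^sub>1 c\<^sub>2) s (T\<^sub>1 + T\<^sub>2) R"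
proof -
  obtain t s' where 1: "exec c\<^sub>1 s t s'" "t \<le> T\<^sub>1" "M s'" using assms(1) by (auto simp: runs_def)
  obtain t' s'' where 2: "exec c\<^sub>2 s' t' s''" "t' \<le> T\<^sub>2" "R s''" using assms(2)[OF 1(3)] by (auto simp: runs_def)
  then show ?thesis
    unfolding runs_def using exec.intros(4)[OF 1(1) 2(1)] 1(2) by (intro exI[of _ "t + t'"] exI[of _ s'']) auto
qed

lemma runs_If:
  assumes "bval s b \<Longrightarrow> runs c\<^sub>1 s T R" "\<not> bval s b \<Longrightarrow> runs c\<^sub>2 s T R"
  shows "runs (If b c\<^sub>1 c\<^sub>2) s (1 + T) R"
proof (cases "bval s b")
  case True
  then obtain t s' where "exec c\<^sub>1 s t s'" "t \<le> T" "R s'" using assms(1) by (auto simp: runs_def)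
  then show ?thesis unfolding runs_def using exec.intros(5)[OF True] by (meson add_left_mono)
next
  case False
  then obtain t s' where "exec c\<^sub>2 s t s'" "t \<le> T" "R s'" using assms(2) by (auto simp: runs_def)
  then show ?thesis unfolding runs_def using exec.intros(6)[OF False] by (meson add_left_mono)
qed

text \<open>Programs without loops have a functional semantics and run in constant time.\<close>

primrec loop_free :: "com \<Rightarrow> bool" where
  "loop_free Skip = True"
| "loop_free (NAssign as e) = True"
| "loop_free (RAssign as e) = True"
| "loop_free (Seq c d) = (loop_free c \<and> loop_free d)"
| "loop_free (If b c d) = (loop_free c \<and> loop_free d)"
| "loop_free (While b c) = False"

primrec sem :: "com \<Rightarrow> mstate \<Rightarrow> mstate" where
  "sem Skip s = s"
| "sem (NAssign as e) s = ((fst s)(map (nval (fst s)) as := nval (fst s) e), snd s)"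
| "sem (RAssign as e) s = (fst s, (snd s)(map (nval (fst s)) as := rval s e))"
| "sem (Seq c d) s = sem d (sem c s)"
| "sem (If b c d) s = (if bval s b then sem c s else sem d s)"
| "sem (While b c) s = s"

primrec csize :: "com \<Rightarrow> nat" where
  "csize Skip = 1"
| "csize (NAssign as e) = 1"
| "csize (RAssign as e) = 1"
| "csize (Seq c d) = csize c + csize d"
| "csize (If b c d) = 1 + csize c + csize d"
| "csize (While b c) = 1"

lemma runs_loop_free: "loop_free c \<Longrightarrow> R (sem c s) \<Longrightarrow> runs c s (csize c) R"
proof (induction c arbitrary: s R)
  case Skip
  then show ?case unfolding runs_def using exec.intros(1)[of s] by (intro exI[of _ 1] exI[of _ s]) simp
next
  case (NAssign as e)
  then show ?case unfolding runs_def using exec.intros(2)[of as e "fst s" "snd s"]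
    by (intro exI[of _ 1] exI[of _ "sem (NAssign as e) s"]) simp
next
  case (RAssign as e)
  then show ?case unfolding runs_def using exec.intros(3)[of as e "fst s" "snd s"]
    by (intro exI[of _ 1] exI[of _ "sem (RAssign as e) s"]) simp
next
  case (Seq c d)
  have "runs c s (csize c) (\<lambda>s'. s' = sem c s)" using Seq by simp
  then show ?case unfolding csize.simps
    by (rule runs_Seq) (use Seq in simp)
next
  case (If b c d)
  have "runs (If b c d) s (1 + (csize c + csize d)) R"
  proof (rule runs_If)
    show "runs c s (csize c + csize d) R" if "bval s b"
      using If that by (intro runs_weaken[OF If.IH(1)]) auto
    show "runs d s (csize c + csize d) R" if "\<not> bval s b"
      using If that by (intro runs_weaken[OF If.IH(2)]) auto
  qed
  then show ?case by (simp add: add.assoc)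
qed simp

text \<open>The cell \<open>[0]\<close> holds the number of vertices.\<close>

definition for_loop :: "nat \<Rightarrow> com \<Rightarrow> com" where
  "for_loop i c = Seq (NAssign [NConst i] (NConst 0))
     (While (NLess (NCell [NConst i]) (NCell [NConst 0]))
       (Seq c (NAssign [NConst i] (NPlus (NCell [NConst i]) (NConst 1)))))"

definition set_cell :: "nat \<Rightarrow> nat \<Rightarrow> mstate \<Rightarrow> mstate" where
  "set_cell i j s = ((fst s)([i] := j), snd s)"

lemma runs_for_loop:
  assumes i: "i \<noteq> 0" and n: "fst s [0] = n"
    and start: "Inv 0 (set_cell i 0 s)"
    and step: "\<And>j s. j < n \<Longrightarrow> Inv j s \<Longrightarrow> fst s [i] = j \<Longrightarrow> fst s [0] = n \<Longrightarrow>
        runs c s T (\<lambda>s'. fst s' [i] = j \<and> fst s' [0] = n \<and> Inv (Suc j) (set_cell i (Suc j) s'))"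
  shows "runs (for_loop i c) s (n * (T + 2) + 2) (Inv n)"
proof -
  let ?b = "NLess (NCell [NConst i]) (NCell [NConst 0])"
  let ?c = "Seq c (NAssign [NConst i] (NPlus (NCell [NConst i]) (NConst 1)))"
  have loop: "runs (While ?b ?c) s ((n - j) * (T + 2) + 1) (Inv n)"
    if "j \<le> n" "Inv j s" "fst s [i] = j" "fst s [0] = n" for j s
    using that
  proof (induction "n - j" arbitrary: j s)
    case 0
    then have "j = n" by simp
    then have "\<not> bval s ?b" using 0 by simp
    then show ?case unfolding runs_def using exec.intros(7)[of s ?b ?c] 0(3) \<open>j = n\<close>
      by (intro exI[of _ 1] exI[of _ s]) simp
  next
    case (Suc k)
    then have jn: "j < n" by simp
    then have b: "bval s ?b" using Suc by simp
    obtain t s1 where 1: "exec c s t s1" "t \<le> T" "fst s1 [i] = j" "fst s1 [0] = n" "Inv (Suc j) (set_cell i (Suc j) s1)"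
      using step[OF jn Suc.prems(2-4)] by (auto simp: runs_def)
    have a: "exec (NAssign [NConst i] (NPlus (NCell [NConst i]) (NConst 1))) s1 1 (set_cell i (Suc j) s1)"
      using exec.intros(2)[of "[NConst i]" "NPlus (NCell [NConst i]) (NConst 1)" "fst s1" "snd s1"] 1(3)
      by (simp add: set_cell_def)
    have "runs (While ?b ?c) (set_cell i (Suc j) s1) ((n - Suc j) * (T + 2) + 1) (Inv n)"
      by (rule Suc.hyps(1)) (use Suc.hyps(2) jn 1 i in \<open>auto simp: set_cell_def\<close>)
    then obtain t2 s2 where 2: "exec (While ?b ?c) (set_cell i (Suc j) s1) t2 s2" "t2 \<le> (n - Suc j) * (T + 2) + 1" "Inv n s2"
      by (auto simp: runs_def)
    have "exec (While ?b ?c) s (1 + (t + 1) + t2) s2"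
      by (rule exec.intros(8)[OF b exec.intros(4)[OF 1(1) a] 2(1)])
    moreover have "1 + (t + 1) + t2 \<le> (n - j) * (T + 2) + 1"
    proof -
      have "n - j = Suc (n - Suc j)" using jn by simp
      then show ?thesis using 1(2) 2(2) by simp
    qed
    ultimately show ?case unfolding runs_def using 2(3)
      by (intro exI[of _ "1 + (t + 1) + t2"] exI[of _ s2] conjI)
  qed
  have "runs (for_loop i c) s (1 + ((n - 0) * (T + 2) + 1)) (Inv n)"
    unfolding for_loop_def
  proof (rule runs_Seq)
    show "runs (NAssign [NConst i] (NConst 0)) s 1 (\<lambda>s'. s' = set_cell i 0 s)"
      using runs_loop_free[of "NAssign [NConst i] (NConst 0)" "\<lambda>s'. s' = set_cell i 0 s" s]
      by (simp add: set_cell_def)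
    show "runs (While ?b ?c) s' ((n - 0) * (T + 2) + 1) (Inv n)" if "s' = set_cell i 0 s" for s'
      by (rule loop) (use that start i n in \<open>auto simp: set_cell_def\<close>)
  qed
  then show ?thesis by (simp add: add.commute)
qed

definition seqs :: "com list \<Rightarrow> com" where
  "seqs cs = foldr Seq cs Skip"

lemma seqs_simps [simp]: "seqs [] = Skip" "seqs (c # cs) = Seq c (seqs cs)"
  by (simp_all add: seqs_def)

lemma loop_free_seqs: "(\<And>c. c \<in> set cs \<Longrightarrow> loop_free c) \<Longrightarrow> loop_free (seqs cs)"
  by (induction cs) auto

text \<open>A sequence of commands, each transforming an abstract value \<open>x\<close> represented by the state.\<close>

lemma runs_seqs:
  assumes "I x s"
    and "\<And>j x s. j \<in> set js \<Longrightarrow> I x s \<Longrightarrow> runs (c j) s T (I (step j x))"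
  shows "runs (seqs (map c js)) s (length js * T + 1) (I (fold step js x))"
  using assms
proof (induction js arbitrary: x s)
  case Nil
  then show ?case using runs_loop_free[of Skip "I x" s] by simp
next
  case (Cons j js)
  have "runs (seqs (map c (j # js))) s (T + (length js * T + 1)) (I (fold step (j # js) x))"
    unfolding list.map seqs_simps fold_Cons o_def
  proof (rule runs_Seq)
    show "runs (c j) s T (I (step j x))" using Cons.prems by simp
    show "runs (seqs (map c js)) s' (length js * T + 1) (I (fold step js (step j x)))" if "I (step j x) s'" for s'
      by (rule Cons.IH[OF that]) (use Cons.prems in simp)
  qed
  then show ?case by (simp add: add.assoc)
qed

subsection \<open>Exploring a neighbourhood\<close>

text \<open>The vertex being processed is in cell \<open>[2]\<close>, and \<open>[3]\<close> is the variable of the inner loop. For the vertex \<open>u\<close>, the cells \<open>[5, u, k]\<close>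
  list the vertices found, \<open>[6, u]\<close> is their number, \<open>[4, u, v]\<close> marks that \<open>v\<close> has been found, \<open>[7, u]\<close> is the number
  at the beginning of the current round, and \<open>[8, u]\<close> the length of the final list. The cells are not reused for other
  vertices, so no time is spent on clearing marks.\<close>

abbreviation (input) cU :: nexp where "cU \<equiv> NCell [NConst 2]"
abbreviation (input) cV :: nexp where "cV \<equiv> NCell [NConst 3]"
abbreviation (input) cL :: "nat \<Rightarrow> nexp" where "cL j \<equiv> NCell [NConst 5, cU, NConst j]"
abbreviation (input) cCount :: nexp where "cCount \<equiv> NCell [NConst 6, cU]"

text \<open>Appends the unmarked neighbours of the \<open>j\<close>-th vertex of the list.\<close>

definition scan :: "nat \<Rightarrow> com" where
  "scan j = for_loop 3
     (If (BAnd (NLess (NConst 0) (NPlus (NCell [NConst 0, cL j, cV]) (NCell [NConst 0, cV, cL j])))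
               (NLess (NCell [NConst 4, cU, cV]) (NConst 1)))
        (Seq (NAssign [NConst 4, cU, cV] (NConst 1))
          (Seq (NAssign [NConst 5, cU, cCount] cV)
            (NAssign [NConst 6, cU] (NPlus cCount (NConst 1)))))
        Skip)"

text \<open>One layer of breadth-first search, over the first \<open>M\<close> entries only. Vertices can be missed only if the list has more
  than \<open>M\<close> entries, and then the exploration returns the vertex alone.\<close>

definition round :: "nat \<Rightarrow> com" where
  "round M = Seq (NAssign [NConst 7, cU] cCount)
     (seqs (map (\<lambda>j. If (NLess (NConst j) (NCell [NConst 7, cU])) (scan j) Skip) [0..<M]))"

definition explore :: "nat \<Rightarrow> nat \<Rightarrow> com" where
  "explore l M =
     Seq (NAssign [NConst 5, cU, NConst 0] cU)
       (Seq (NAssign [NConst 4, cU, cU] (NConst 1))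
         (Seq (NAssign [NConst 6, cU] (NConst 1))
           (Seq (seqs (map (\<lambda>_. round M) [0..<l]))
             (If (NLess (NConst M) cCount) (NAssign [NConst 8, cU] (NConst 1)) (NAssign [NConst 8, cU] cCount)))))"

text \<open>The effect of these commands on the list.\<close>

definition ext_list :: "nat \<Rightarrow> (nat \<Rightarrow> nat \<Rightarrow> bool) \<Rightarrow> nat \<Rightarrow> nat list \<Rightarrow> nat list" where
  "ext_list n A w xs = xs @ filter (\<lambda>v. A w v \<and> v \<notin> set xs) [0..<n]"

definition round_list :: "nat \<Rightarrow> (nat \<Rightarrow> nat \<Rightarrow> bool) \<Rightarrow> nat \<Rightarrow> nat list \<Rightarrow> nat list" where
  "round_list n A M xs = fold (\<lambda>j ys. if j < length xs then ext_list n A (xs ! j) ys else ys) [0..<M] xs"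

definition bfs_list :: "nat \<Rightarrow> (nat \<Rightarrow> nat \<Rightarrow> bool) \<Rightarrow> nat \<Rightarrow> nat \<Rightarrow> nat \<Rightarrow> nat list" where
  "bfs_list n A M l u = (round_list n A M ^^ l) [u]"

definition near_list :: "nat \<Rightarrow> (nat \<Rightarrow> nat \<Rightarrow> bool) \<Rightarrow> nat \<Rightarrow> nat \<Rightarrow> nat \<Rightarrow> nat list" where
  "near_list n A l M u = (let xs = bfs_list n A M l u in if length xs \<le> M then xs else [u])"

lemma ext_list_prefix: "\<exists>zs. ext_list n A w xs = xs @ zs"
  by (simp add: ext_list_def)

text \<open>\<open>m0\<close> and \<open>r0\<close> are the initial memories; \<open>G u\<close> is the number that the program is to leave in the real cell \<open>[5, u]\<close>.\<close>

locale memory =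
  fixes m0 :: nmem and r0 :: rmem and n :: nat and G :: "nat \<Rightarrow> real"
  assumes n: "m0 [0] = n"
begin

definition adj :: "nat \<Rightarrow> nat \<Rightarrow> bool" where
  "adj a b \<longleftrightarrow> 0 < m0 [0, a, b] + m0 [0, b, a]"

text \<open>The invariant at the vertex \<open>u\<close>: the input is intact, the results for smaller vertices are in place and the marks
  of larger vertices are blank.\<close>

definition rows :: "nat \<Rightarrow> mstate \<Rightarrow> bool" where
  "rows u s \<longleftrightarrow> (\<forall>a. fst s (0 # a) = m0 (0 # a)) \<and> (\<forall>a. fst s (1 # a) = m0 (1 # a)) \<and>
     (\<forall>a. snd s (0 # a) = r0 (0 # a)) \<and> (\<forall>u'<u. snd s [5, u'] = G u') \<and>
     (\<forall>u'>u. \<forall>v. fst s [4, u', v] = 0) \<and> fst s [2] = u"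

text \<open>The list found so far is \<open>xs\<close>, and it had length \<open>c\<close> when the current round began.\<close>

definition repr :: "nat \<Rightarrow> nat \<Rightarrow> nat list \<Rightarrow> mstate \<Rightarrow> bool" where
  "repr u c xs s \<longleftrightarrow> rows u s \<and> fst s [7, u] = c \<and> fst s [6, u] = length xs \<and>
     (\<forall>k<length xs. fst s [5, u, k] = xs ! k) \<and> (\<forall>v. fst s [4, u, v] = of_bool (v \<in> set xs))"

lemma runs_scan:
  assumes s: "repr u c xs s" and j: "j < length xs" and w: "xs ! j = w"
  shows "runs (scan j) s (n * 7 + 2) (repr u c (ext_list n adj w xs))"
proof -
  let ?P = "\<lambda>v. adj w v \<and> v \<notin> set xs"
  let ?I = "\<lambda>i. repr u c (xs @ filter ?P [0..<i])"
  have "runs (scan j) s (n * (5 + 2) + 2) (?I n)"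
    unfolding scan_def
  proof (rule runs_for_loop)
    show "fst s [0] = n" using s n by (simp add: repr_def rows_def)
    show "?I 0 (set_cell 3 0 s)" using s by (simp add: repr_def rows_def set_cell_def)
    fix i s assume i: "i < n" and I: "?I i s" and s3: "fst s [3] = i" and s0: "fst s [0] = n"
    let ?ys = "xs @ filter ?P [0..<i]"
    let ?c = "If (BAnd (NLess (NConst 0) (NPlus (NCell [NConst 0, cL j, cV]) (NCell [NConst 0, cV, cL j])))
               (NLess (NCell [NConst 4, cU, cV]) (NConst 1)))
        (Seq (NAssign [NConst 4, cU, cV] (NConst 1))
          (Seq (NAssign [NConst 5, cU, cCount] cV)
            (NAssign [NConst 6, cU] (NPlus cCount (NConst 1)))))
        Skip"
    have s2: "fst s [2] = u" and cnt: "fst s [6, u] = length ?ys" and Lj: "fst s [5, u, j] = w"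
      and mark: "fst s [4, u, i] = of_bool (i \<in> set ?ys)"
      and inp: "\<And>a. fst s (0 # a) = m0 (0 # a)"
      using I j w unfolding repr_def rows_def by (auto simp: nth_append)
    have b: "0 < fst s [0, w, i] + fst s [0, i, w] \<and> fst s [4, u, i] < 1 \<longleftrightarrow> ?P i"
      using mark by (auto simp: adj_def inp)
    have lists: "xs @ filter ?P [0..<Suc i] = (if ?P i then ?ys @ [i] else ?ys)" by simp
    let ?R = "\<lambda>s'. fst s' [3] = i \<and> fst s' [0] = n \<and> ?I (Suc i) (set_cell 3 (Suc i) s')"
    have R: "?R (sem ?c s)"
    proof (cases "?P i")
      case False
      then have "\<not> (0 < fst s [0, w, i] + fst s [0, i, w] \<and> fst s [4, u, i] < 1)" using b by blast
      then have "sem ?c s = s" using s2 s3 Lj by auto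
      moreover have "?I (Suc i) (set_cell 3 (Suc i) s)"
        using I False unfolding lists repr_def rows_def set_cell_def by simp
      ultimately show ?thesis using s3 s0 by metis
    next
      case True
      then have e: "sem ?c s = ((fst s)([4, u, i] := 1, [5, u, length ?ys] := i, [6, u] := Suc (length ?ys)), snd s)"
        using b s2 s3 Lj cnt by simp
      have ys: "xs @ filter ?P [0..<Suc i] = ?ys @ [i]" unfolding lists using True by simp
      have "repr u c (?ys @ [i]) (set_cell 3 (Suc i) (sem ?c s))"
      proof -
        let ?s = "set_cell 3 (Suc i) (sem ?c s)"
        have "rows u ?s" using I unfolding e repr_def rows_def set_cell_def by simp
        moreover have "fst ?s [7, u] = c" using I unfolding e repr_def set_cell_def by simp
        moreover have "fst ?s [6, u] = length (?ys @ [i])" unfolding e set_cell_def by simp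
        moreover have "fst ?s [5, u, k] = (?ys @ [i]) ! k" if "k < length (?ys @ [i])" for k
        proof (cases "k = length ?ys")
          case True
          then have "(?ys @ [i]) ! k = i" by (metis nth_append_length)
          then show ?thesis unfolding e set_cell_def using True by simp
        next
          case False
          then have k: "k < length ?ys" using that by simp
          then have "(?ys @ [i]) ! k = ?ys ! k" by (simp only: nth_append if_True)
          moreover have "fst s [5, u, k] = ?ys ! k" using I k unfolding repr_def by blast
          ultimately show ?thesis unfolding e set_cell_def using k by simp
        qed
        moreover have "fst ?s [4, u, v] = of_bool (v \<in> set (?ys @ [i]))" for v
        proof -
          have "fst s [4, u, v] = of_bool (v \<in> set ?ys)" using I unfolding repr_def by blast
          then show ?thesis unfolding e set_cell_def by simp
        qed
        ultimately show ?thesis unfolding repr_def by blast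
      qed
      then have "?I (Suc i) (set_cell 3 (Suc i) (sem ?c s))" unfolding ys .
      moreover have "fst (sem ?c s) [3] = i" "fst (sem ?c s) [0] = n" unfolding e using s3 s0 by simp_all
      ultimately show ?thesis by blast
    qed
    have "runs ?c s (csize ?c) ?R" by (rule runs_loop_free) (simp, rule R)
    then show "runs ?c s 5 ?R"
    proof (rule runs_weaken)
      show "csize ?c \<le> 5" by simp
    qed
  qed simp
  then show ?thesis by (simp add: ext_list_def)
qed

lemma runs_round:
  assumes s: "repr u c xs s"
  shows "runs (round M) s (M * (n * 7 + 3) + 2) (\<lambda>s'. \<exists>c. repr u c (round_list n adj M xs) s')"
proof -
  let ?step = "\<lambda>j ys. if j < length xs then ext_list n adj (xs ! j) ys else ys"
  let ?I = "\<lambda>ys s. repr u (length xs) ys s \<and> (\<exists>zs. ys = xs @ zs)"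
  have "runs (round M) s (1 + (length [0..<M] * (1 + (n * 7 + 2)) + 1)) (?I (fold ?step [0..<M] xs))"
    unfolding round_def
  proof (rule runs_Seq)
    show "runs (NAssign [NConst 7, cU] cCount) s 1 (?I xs)"
      using runs_loop_free[of "NAssign [NConst 7, cU] cCount" "?I xs" s] s
      by (simp add: repr_def rows_def)
    fix s assume "?I xs s"
    then show "runs (seqs (map (\<lambda>j. If (NLess (NConst j) (NCell [NConst 7, cU])) (scan j) Skip) [0..<M])) s
       (length [0..<M] * (1 + (n * 7 + 2)) + 1) (?I (fold ?step [0..<M] xs))"
    proof (rule runs_seqs)
      fix j ys s assume I: "?I ys s"
      show "runs (If (NLess (NConst j) (NCell [NConst 7, cU])) (scan j) Skip) s (1 + (n * 7 + 2)) (?I (?step j ys))"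
      proof (rule runs_If)
        have b: "bval s (NLess (NConst j) (NCell [NConst 7, cU])) \<longleftrightarrow> j < length xs"
          using I by (simp add: repr_def rows_def)
        show "runs (scan j) s (n * 7 + 2) (?I (?step j ys))" if "bval s (NLess (NConst j) (NCell [NConst 7, cU]))"
        proof -
          have j: "j < length xs" using that b by simp
          obtain zs where zs: "ys = xs @ zs" using I by blast
          have "runs (scan j) s (n * 7 + 2) (repr u (length xs) (ext_list n adj (xs ! j) ys))"
            by (rule runs_scan) (use I j zs in \<open>auto simp: nth_append\<close>)
          then show ?thesis
            by (rule runs_weaken) (use j zs in \<open>auto simp: ext_list_def\<close>)
        qed
        show "runs Skip s (n * 7 + 2) (?I (?step j ys))" if "\<not> bval s (NLess (NConst j) (NCell [NConst 7, cU]))"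
          by (rule runs_weaken[OF runs_loop_free[of Skip "?I (?step j ys)" s]]) (use that b I in auto)
      qed
    qed
  qed
  then show ?thesis by (rule runs_weaken) (auto simp: round_list_def algebra_simps)
qed

definition explored :: "nat \<Rightarrow> nat list \<Rightarrow> mstate \<Rightarrow> bool" where
  "explored u xs s \<longleftrightarrow> rows u s \<and> fst s [8, u] = length xs \<and> (\<forall>k<length xs. fst s [5, u, k] = xs ! k)"

lemma round_list_prefix: "\<exists>zs. round_list n adj M xs = xs @ zs"
proof -
  have "\<exists>zs. fold (\<lambda>j ys. if j < length xs then ext_list n adj (xs ! j) ys else ys) js ys = ys @ zs" for js ys
  proof (induction js arbitrary: ys)
    case (Cons j js)
    obtain z1 where z1: "(if j < length xs then ext_list n adj (xs ! j) ys else ys) = ys @ z1"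
      using ext_list_prefix[of n adj "xs ! j" ys] by (cases "j < length xs") auto
    obtain z2 where "fold (\<lambda>j ys. if j < length xs then ext_list n adj (xs ! j) ys else ys) js (ys @ z1) = (ys @ z1) @ z2"
      using Cons.IH by blast
    then show ?case using z1 by (auto simp: append_assoc)
  qed simp
  then show ?thesis unfolding round_list_def by blast
qed

lemma bfs_list_prefix: "\<exists>zs. bfs_list n adj M l u = u # zs"
proof (induction l)
  case (Suc l)
  then obtain zs where "bfs_list n adj M l u = u # zs" by blast
  then show ?case using round_list_prefix[of M "u # zs"] by (auto simp: bfs_list_def)
qed (simp add: bfs_list_def)

lemma runs_explore:
  assumes s: "rows u s" and fresh: "\<And>v. fst s [4, u, v] = 0" and M: "1 \<le> M"
  shows "runs (explore l M) s (l * (M * (n * 7 + 3) + 2) + 7) (explored u (near_list n adj l M u))"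
proof -
  let ?I = "\<lambda>xs s. \<exists>c. repr u c xs s"
  let ?xs = "bfs_list n adj M l u"
  let ?T = "M * (n * 7 + 3) + 2"
  let ?R = "explored u (near_list n adj l M u)"
  have fold_eq: "fold (\<lambda>_. round_list n adj M) js xs = (round_list n adj M ^^ length js) xs" for js :: "nat list" and xs
    by (induction js arbitrary: xs) (simp_all add: funpow_swap1)
  have r: "runs (seqs (map (\<lambda>_. round M) [0..<l])) s (length [0..<l] * ?T + 1) (?I ?xs)" if "?I [u] s" for s
  proof -
    have "runs (seqs (map (\<lambda>_. round M) [0..<l])) s (length [0..<l] * ?T + 1) (?I (fold (\<lambda>_. round_list n adj M) [0..<l] [u]))"
    proof (rule runs_seqs[where I = ?I and x = "[u]"])
      show "?I [u] s" by (rule that)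
      show "runs (round M) s ?T (?I (round_list n adj M xs))" if "?I xs s" for xs s
        using that runs_round by blast
    qed
    then show ?thesis by (simp add: fold_eq bfs_list_def)
  qed
  obtain zs where zs: "?xs = u # zs" using bfs_list_prefix by blast
  have fin: "runs (If (NLess (NConst M) cCount) (NAssign [NConst 8, cU] (NConst 1)) (NAssign [NConst 8, cU] cCount)) s 3 ?R"
    if I: "?I ?xs s" for s
  proof -
    obtain c where c: "repr u c ?xs s" using I by blast
    have "?R (sem (If (NLess (NConst M) cCount) (NAssign [NConst 8, cU] (NConst 1)) (NAssign [NConst 8, cU] cCount)) s)"
      using c zs unfolding repr_def rows_def explored_def near_list_def Let_def by (auto simp: not_less)
    then have "runs (If (NLess (NConst M) cCount) (NAssign [NConst 8, cU] (NConst 1)) (NAssign [NConst 8, cU] cCount)) s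
       (csize (If (NLess (NConst M) cCount) (NAssign [NConst 8, cU] (NConst 1)) (NAssign [NConst 8, cU] cCount))) ?R"
      by (rule runs_loop_free[rotated]) simp
    then show ?thesis by (rule runs_weaken) simp_all
  qed
  let ?s1 = "sem (NAssign [NConst 5, cU, NConst 0] cU) s"
  let ?s2 = "sem (NAssign [NConst 4, cU, cU] (NConst 1)) ?s1"
  let ?s3 = "sem (NAssign [NConst 6, cU] (NConst 1)) ?s2"
  have "repr u (fst s [7, u]) [u] ?s3"
    using s fresh unfolding repr_def rows_def by auto
  then have s3: "?I [u] ?s3" by blast
  have "runs (explore l M) s (1 + (1 + (1 + ((length [0..<l] * ?T + 1) + 3)))) ?R"
    unfolding explore_def
  proof (intro runs_Seq)
    show "runs (NAssign [NConst 5, cU, NConst 0] cU) s 1 (\<lambda>s'. s' = ?s1)"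
      using runs_loop_free[of "NAssign [NConst 5, cU, NConst 0] cU" "\<lambda>s'. s' = ?s1" s] by simp
    show "runs (NAssign [NConst 4, cU, cU] (NConst 1)) s' 1 (\<lambda>s'. s' = ?s2)" if "s' = ?s1" for s'
      using runs_loop_free[of "NAssign [NConst 4, cU, cU] (NConst 1)" "\<lambda>s'. s' = ?s2" ?s1] that by simp
    show "runs (NAssign [NConst 6, cU] (NConst 1)) s' 1 (\<lambda>s'. s' = ?s3)" if "s' = ?s2" for s'
      using runs_loop_free[of "NAssign [NConst 6, cU] (NConst 1)" "\<lambda>s'. s' = ?s3" ?s2] that by simp
    show "runs (seqs (map (\<lambda>_. round M) [0..<l])) s' (length [0..<l] * ?T + 1) (?I ?xs)" if "s' = ?s3" for s'
      using r s3 that by simp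
  qed (use fin in auto)
  then show ?thesis by (rule runs_weaken) auto
qed

end

subsection \<open>Computing a posterior mean\<close>

definition nEq :: "nexp \<Rightarrow> nat \<Rightarrow> bexp" where
  "nEq a k = BAnd (BNot (NLess a (NConst k))) (BNot (NLess (NConst k) a))"

lemma bval_nEq [simp]: "bval s (nEq a k) \<longleftrightarrow> nval (fst s) a = k"
  by (auto simp: nEq_def)

text \<open>For a labelling \<open>cs\<close> of the list, the real cell \<open>[4]\<close> is its weight, the product of the likelihoods of the edge
  observations, or \<open>0\<close> if \<open>cs\<close> contradicts a disclosed label. A disclosed label is stored as the successor of its code. The cells \<open>[2]\<close> and \<open>[3]\<close>
  accumulate the numerator and the denominator of Bayes' formula.\<close>

definition cons_com :: "nat list \<Rightarrow> nat \<Rightarrow> com" where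
  "cons_com cs i = If (BAnd (NLess (NConst 0) (NCell [NConst 0, cL i])) (BNot (nEq (NCell [NConst 0, cL i]) (Suc (cs ! i)))))
     (RAssign [NConst 4] (RConst 0)) Skip"

definition edge_com :: "nat list \<Rightarrow> nat \<times> nat \<Rightarrow> com" where
  "edge_com cs e = If (NLess (NConst 0) (NCell [NConst 0, cL (fst e), cL (snd e)]))
     (RAssign [NConst 4] (RTimes (RCell [NConst 4])
        (RCell [NConst 0, NConst (cs ! fst e), NConst (cs ! snd e), NCell [NConst 1, cL (fst e), cL (snd e)]]))) Skip"

definition term_com :: "nat \<Rightarrow> nat list \<Rightarrow> com" where
  "term_com m cs = Seq (RAssign [NConst 4] (RConst 1))
    (Seq (seqs (map (cons_com cs) [0..<m]))
      (Seq (seqs (map (edge_com cs) (List.product [0..<m] [0..<m])))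
        (Seq (RAssign [NConst 2] (RPlus (RCell [NConst 2]) (RTimes (RCell [NConst 4]) (RCell [NConst 0, NConst (cs ! 0)]))))
          (RAssign [NConst 3] (RPlus (RCell [NConst 3]) (RCell [NConst 4]))))))"

definition post_com :: "nat \<Rightarrow> nat \<Rightarrow> com" where
  "post_com k m = Seq (RAssign [NConst 2] (RConst 0)) (Seq (RAssign [NConst 3] (RConst 0))
     (Seq (seqs (map (term_com m) (List.n_lists m [0..<k])))
       (RAssign [NConst 5, cU] (RDiv (RCell [NConst 2]) (RCell [NConst 3])))))"

text \<open>For each possible length \<open>m\<close> of the list, the sum over the \<open>k\<^sup>m\<close> labellings is written out. So this part of the program takes
  a time that depends on \<open>k\<close> and \<open>M\<close> only.\<close>

definition posts_com :: "nat \<Rightarrow> nat \<Rightarrow> com" where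
  "posts_com k M = seqs (map (\<lambda>m. If (nEq (NCell [NConst 8, cU]) m) (post_com k m) Skip) [1..<Suc M])"

definition row_com :: "nat \<Rightarrow> nat \<Rightarrow> nat \<Rightarrow> com" where
  "row_com k l M = Seq (explore l M) (posts_com k M)"

definition output_com :: com where
  "output_com = for_loop 2 (for_loop 3 (RAssign [NConst 1, cU, cV] (RTimes (RCell [NConst 5, cU]) (RCell [NConst 5, cV]))))"

definition local_program :: "nat \<Rightarrow> nat \<Rightarrow> nat \<Rightarrow> com" where
  "local_program k l M = Seq (for_loop 2 (row_com k l M)) output_com"

lemma loop_free_posts: "loop_free (posts_com k M)"
  unfolding posts_com_def post_com_def term_com_def cons_com_def edge_com_def
  by (intro loop_free_seqs) (auto intro!: loop_free_seqs)

context memory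
begin

definition incons :: "nat list \<Rightarrow> nat list \<Rightarrow> nat \<Rightarrow> bool" where
  "incons xs cs i \<longleftrightarrow> 0 < m0 [0, xs ! i] \<and> m0 [0, xs ! i] \<noteq> Suc (cs ! i)"

definition edge_fac :: "nat list \<Rightarrow> nat list \<Rightarrow> nat \<times> nat \<Rightarrow> real" where
  "edge_fac xs cs e = (if 0 < m0 [0, xs ! fst e, xs ! snd e]
     then r0 [0, cs ! fst e, cs ! snd e, m0 [1, xs ! fst e, xs ! snd e]] else 1)"

definition weight :: "nat list \<Rightarrow> nat list \<Rightarrow> real" where
  "weight xs cs = (if \<exists>i\<in>{0..<length xs}. incons xs cs i then 0 else 1)
     * prod_list (map (edge_fac xs cs) (List.product [0..<length xs] [0..<length xs]))"

definition cell_est :: "nat \<Rightarrow> nat list \<Rightarrow> real" where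
  "cell_est k xs = (\<Sum>cs\<leftarrow>List.n_lists (length xs) [0..<k]. weight xs cs * r0 [0, cs ! 0])
     / (\<Sum>cs\<leftarrow>List.n_lists (length xs) [0..<k]. weight xs cs)"

context
  fixes mm :: nmem and u :: nat and xs :: "nat list"
  assumes U: "mm [2] = u" and L: "\<And>i. i < length xs \<Longrightarrow> mm [5, u, i] = xs ! i"
    and in0: "\<And>a. mm (0 # a) = m0 (0 # a)" and in1: "\<And>a. mm (1 # a) = m0 (1 # a)"
begin

lemma sem_cons:
  assumes "\<And>i. i \<in> set js \<Longrightarrow> i < length xs"
  shows "sem (seqs (map (cons_com cs) js)) (mm, r) = (mm, if \<exists>i\<in>set js. incons xs cs i then r([4] := 0) else r)"
  using assms
proof (induction js arbitrary: r)
  case (Cons i js)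
  have "sem (cons_com cs i) (mm, r) = (mm, if incons xs cs i then r([4] := 0) else r)"
    using Cons.prems[of i] by (simp add: cons_com_def incons_def U L in0)
  then show ?case using Cons by auto
qed simp

lemma sem_edges:
  assumes "\<And>e. e \<in> set ps \<Longrightarrow> fst e < length xs \<and> snd e < length xs"
    and "\<And>a. r (0 # a) = r0 (0 # a)"
  shows "sem (seqs (map (edge_com cs) ps)) (mm, r) = (mm, r([4] := r [4] * prod_list (map (edge_fac xs cs) ps)))"
  using assms
proof (induction ps arbitrary: r)
  case (Cons e ps)
  have 1: "sem (edge_com cs e) (mm, r) = (mm, r([4] := r [4] * edge_fac xs cs e))"
    using Cons.prems(1)[of e] by (simp add: edge_com_def edge_fac_def U L in0 in1[simplified] Cons.prems(2))
  have "sem (seqs (map (edge_com cs) ps)) (mm, r([4] := r [4] * edge_fac xs cs e))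
     = (mm, (r([4] := r [4] * edge_fac xs cs e))([4] := (r([4] := r [4] * edge_fac xs cs e)) [4] * prod_list (map (edge_fac xs cs) ps)))"
    by (rule Cons.IH) (use Cons.prems in auto)
  then show ?case by (simp add: 1 mult.assoc fun_eq_iff)
qed simp

lemma sem_term:
  assumes r: "\<And>a. r (0 # a) = r0 (0 # a)"
  shows "sem (term_com (length xs) cs) (mm, r) = (mm, r([4] := weight xs cs,
     [2] := r [2] + weight xs cs * r0 [0, cs ! 0], [3] := r [3] + weight xs cs))"
proof -
  let ?c = "if \<exists>i\<in>{0..<length xs}. incons xs cs i then 0 else 1 :: real"
  have 1: "sem (seqs (map (cons_com cs) [0..<length xs])) (mm, r([4] := 1)) = (mm, r([4] := ?c))"
    by (subst sem_cons) auto
  have 2: "sem (seqs (map (edge_com cs) (List.product [0..<length xs] [0..<length xs]))) (mm, r([4] := ?c))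
    = (mm, r([4] := weight xs cs))"
    by (subst sem_edges) (auto simp: r weight_def)
  show ?thesis unfolding term_com_def sem.simps using 1 2 by (simp add: r)
qed

lemma sem_terms:
  assumes r: "\<And>a. r (0 # a) = r0 (0 # a)"
  shows "\<exists>w. sem (seqs (map (term_com (length xs)) css)) (mm, r) = (mm, r([4] := w,
     [2] := r [2] + (\<Sum>cs\<leftarrow>css. weight xs cs * r0 [0, cs ! 0]), [3] := r [3] + (\<Sum>cs\<leftarrow>css. weight xs cs)))"
  using r
proof (induction css arbitrary: r)
  case Nil
  show ?case by (rule exI[of _ "r [4]"]) simp
next
  case (Cons cs css)
  let ?r = "r([4] := weight xs cs, [2] := r [2] + weight xs cs * r0 [0, cs ! 0], [3] := r [3] + weight xs cs)"
  have 1: "sem (term_com (length xs) cs) (mm, r) = (mm, ?r)" by (rule sem_term[OF Cons.prems])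
  have "?r (0 # a) = r0 (0 # a)" for a using Cons.prems by simp
  from Cons.IH[of ?r, OF this] obtain w where w: "sem (seqs (map (term_com (length xs)) css)) (mm, ?r) = (mm, ?r([4] := w,
     [2] := ?r [2] + (\<Sum>cs\<leftarrow>css. weight xs cs * r0 [0, cs ! 0]), [3] := ?r [3] + (\<Sum>cs\<leftarrow>css. weight xs cs)))"
    by (elim exE)
  have "?r([4] := w, [2] := ?r [2] + (\<Sum>cs\<leftarrow>css. weight xs cs * r0 [0, cs ! 0]), [3] := ?r [3] + (\<Sum>cs\<leftarrow>css. weight xs cs))
    = r([4] := w, [2] := r [2] + (\<Sum>cs\<leftarrow>cs # css. weight xs cs * r0 [0, cs ! 0]), [3] := r [3] + (\<Sum>cs\<leftarrow>cs # css. weight xs cs))"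
    by (simp add: fun_eq_iff add.assoc)
  then have "sem (seqs (map (term_com (length xs)) (cs # css))) (mm, r) = (mm, r([4] := w,
     [2] := r [2] + (\<Sum>cs\<leftarrow>cs # css. weight xs cs * r0 [0, cs ! 0]), [3] := r [3] + (\<Sum>cs\<leftarrow>cs # css. weight xs cs)))"
    unfolding list.map seqs_simps sem.simps 1 w by simp
  then show ?case by blast
qed

lemma sem_post:
  assumes r: "\<And>a. r (0 # a) = r0 (0 # a)"
  shows "\<exists>w a b. sem (post_com k (length xs)) (mm, r) = (mm, r([4] := w, [2] := a, [3] := b, [5, u] := cell_est k xs))"
proof -
  obtain w where w: "sem (seqs (map (term_com (length xs)) (List.n_lists (length xs) [0..<k]))) (mm, r([2] := 0, [3] := 0))
    = (mm, (r([2] := 0, [3] := 0))([4] := w,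
     [2] := (r([2] := 0, [3] := 0)) [2] + (\<Sum>cs\<leftarrow>List.n_lists (length xs) [0..<k]. weight xs cs * r0 [0, cs ! 0]),
     [3] := (r([2] := 0, [3] := 0)) [3] + (\<Sum>cs\<leftarrow>List.n_lists (length xs) [0..<k]. weight xs cs)))"
    using sem_terms[of "r([2] := 0, [3] := 0)" "List.n_lists (length xs) [0..<k]"] r by auto
  have 0: "sem (RAssign [NConst 3] (RConst 0)) (sem (RAssign [NConst 2] (RConst 0)) (mm, r)) = (mm, r([2] := 0, [3] := 0))" by simp
  show ?thesis
    unfolding post_com_def sem.simps(4) 0 w
    by (rule exI[of _ w], rule exI[of _ "\<Sum>cs\<leftarrow>List.n_lists (length xs) [0..<k]. weight xs cs * r0 [0, cs ! 0]"],
        rule exI[of _ "\<Sum>cs\<leftarrow>List.n_lists (length xs) [0..<k]. weight xs cs"])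
      (simp add: U cell_est_def fun_eq_iff)
qed

lemma sem_posts:
  assumes r: "\<And>a. r (0 # a) = r0 (0 # a)" and len: "mm [8, u] = length xs" "1 \<le> length xs" "length xs \<le> M"
  shows "\<exists>w a b. sem (posts_com k M) (mm, r) = (mm, r([4] := w, [2] := a, [3] := b, [5, u] := cell_est k xs))"
proof -
  let ?c = "\<lambda>m. If (nEq (NCell [NConst 8, cU]) m) (post_com k m) Skip"
  have skip: "sem (seqs (map ?c ms)) (mm, r) = (mm, r)" if "length xs \<notin> set ms" for ms r
    using that by (induction ms) (auto simp: U len)
  have fire: "sem (seqs (map ?c ms)) (mm, r) = sem (post_com k (length xs)) (mm, r)"
    if "length xs \<in> set ms" "distinct ms" for ms
    using that
  proof (induction ms)
    case (Cons m ms)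
    show ?case
    proof (cases "m = length xs")
      case True
      then have "sem (?c m) (mm, r) = sem (post_com k (length xs)) (mm, r)" by (simp add: U len)
      moreover obtain w a b where "sem (post_com k (length xs)) (mm, r) = (mm, r([4] := w, [2] := a, [3] := b, [5, u] := cell_est k xs))"
        using sem_post[OF r] by blast
      ultimately show ?thesis using skip[of ms] True Cons.prems by simp
    next
      case False
      then have "sem (?c m) (mm, r) = (mm, r)" by (simp add: U len)
      then show ?thesis using Cons False by simp
    qed
  qed simp
  have "sem (posts_com k M) (mm, r) = sem (post_com k (length xs)) (mm, r)"
    unfolding posts_com_def by (rule fire) (use len in auto)
  then show ?thesis using sem_post[OF r] by simp
qed

end

definition row_time :: "nat \<Rightarrow> nat \<Rightarrow> nat \<Rightarrow> nat" where
  "row_time k l M = l * (M * (n * 7 + 3) + 2) + 7 + csize (posts_com k M)"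

lemma runs_row:
  assumes s: "rows u s" and fresh: "\<And>v. fst s [4, u, v] = 0" and M: "1 \<le> M"
    and G: "G u = cell_est k (near_list n adj l M u)"
  shows "runs (row_com k l M) s (row_time k l M)
    (\<lambda>s'. fst s' [2] = u \<and> fst s' [0] = n \<and> (rows (Suc u) (set_cell 2 (Suc u) s') \<and> (\<forall>v. fst s' [4, Suc u, v] = 0)))"
proof -
  let ?xs = "near_list n adj l M u"
  let ?R = "\<lambda>s'. fst s' [2] = u \<and> fst s' [0] = n \<and> (rows (Suc u) (set_cell 2 (Suc u) s') \<and> (\<forall>v. fst s' [4, Suc u, v] = 0))"
  have post: "runs (posts_com k M) s (csize (posts_com k M)) ?R" if e: "explored u ?xs s" for s
  proof -
  have len: "1 \<le> length ?xs" "length ?xs \<le> M"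
    using bfs_list_prefix[of M l u] M by (auto simp: near_list_def Let_def)
  have "\<exists>w a b. sem (posts_com k M) (fst s, snd s) = (fst s, (snd s)([4] := w, [2] := a, [3] := b, [5, u] := cell_est k ?xs))"
    by (rule sem_posts) (use e len in \<open>auto simp: explored_def rows_def\<close>)
  then obtain w a b where p: "sem (posts_com k M) s = (fst s, (snd s)([4] := w, [2] := a, [3] := b, [5, u] := cell_est k ?xs))"
    by auto
  have r: "rows u s" using e by (simp add: explored_def)
  have "rows (Suc u) (set_cell 2 (Suc u) (sem (posts_com k M) s))"
    using r G unfolding p rows_def set_cell_def by (auto simp: less_Suc_eq)
  moreover have "fst (sem (posts_com k M) s) [2] = u" "fst (sem (posts_com k M) s) [0] = n"
    "\<And>v. fst (sem (posts_com k M) s) [4, Suc u, v] = 0"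
    using r n unfolding p rows_def by auto
  ultimately have "?R (sem (posts_com k M) s)" by blast
  then show ?thesis
    by (rule runs_loop_free[OF loop_free_posts])
  qed
  have "runs (row_com k l M) s ((l * (M * (n * 7 + 3) + 2) + 7) + csize (posts_com k M)) ?R"
    unfolding row_com_def by (rule runs_Seq[OF runs_explore[OF s fresh M] post])
  then show ?thesis by (simp add: row_time_def)
qed

lemma runs_output:
  assumes s0: "fst s [0] = n" and G: "\<And>u. u < n \<Longrightarrow> snd s [5, u] = G u"
  shows "runs output_com s (n * ((n * 3 + 2) + 2) + 2) (\<lambda>s'. \<forall>u<n. \<forall>v<n. snd s' [1, u, v] = G u * G v)"
proof -
  let ?J = "\<lambda>u (s :: mstate). (\<forall>u'<n. snd s [5, u'] = G u') \<and> (\<forall>u'<u. \<forall>v<n. snd s [1, u', v] = G u' * G v)"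
  let ?c = "RAssign [NConst 1, cU, cV] (RTimes (RCell [NConst 5, cU]) (RCell [NConst 5, cV]))"
  have "runs output_com s (n * ((n * 3 + 2) + 2) + 2) (?J n)"
    unfolding output_com_def
  proof (rule runs_for_loop[where Inv = ?J])
    show "?J 0 (set_cell 2 0 s)" using G by (simp add: set_cell_def)
    fix u and s :: mstate assume u: "u < n" and J: "?J u s" and s2: "fst s [2] = u" and s0: "fst s [0] = n"
    let ?I = "\<lambda>v (s :: mstate). ?J u s \<and> fst s [2] = u \<and> fst s [0] = n \<and> (\<forall>v'<v. snd s [1, u, v'] = G u * G v')"
    have "runs (for_loop 3 ?c) s (n * (1 + 2) + 2) (?I n)"
    proof (rule runs_for_loop[where Inv = ?I])
      show "?I 0 (set_cell 3 0 s)" using J s2 s0 by (simp add: set_cell_def)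
      fix v and s :: mstate assume v: "v < n" and I: "?I v s" and s3: "fst s [3] = v"
      have "?I (Suc v) (set_cell 3 (Suc v) (sem ?c s)) \<and> fst (sem ?c s) [3] = v"
        using I s3 u v by (auto simp: set_cell_def less_Suc_eq)
      then have "runs ?c s (csize ?c) (\<lambda>s'. fst s' [3] = v \<and> fst s' [0] = n \<and> ?I (Suc v) (set_cell 3 (Suc v) s'))"
        by (intro runs_loop_free) (use I in auto)
      then show "runs ?c s 1 (\<lambda>s'. fst s' [3] = v \<and> fst s' [0] = n \<and> ?I (Suc v) (set_cell 3 (Suc v) s'))" by simp
    qed (use s0 in auto)
    then show "runs (for_loop 3 ?c) s (n * 3 + 2) (\<lambda>s'. fst s' [2] = u \<and> fst s' [0] = n \<and> ?J (Suc u) (set_cell 2 (Suc u) s'))"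
      by (rule runs_weaken) (auto simp: set_cell_def less_Suc_eq)
  qed (use s0 in auto)
  then show ?thesis by (rule runs_weaken) auto
qed

lemma runs_local_program:
  assumes fresh: "\<And>u v. m0 [4, u, v] = 0" and M: "1 \<le> M"
    and G: "\<And>u. u < n \<Longrightarrow> G u = cell_est k (near_list n adj l M u)"
  shows "runs (local_program k l M) (m0, r0) ((n * (row_time k l M + 2) + 2) + (n * ((n * 3 + 2) + 2) + 2))
    (\<lambda>s'. \<forall>u<n. \<forall>v<n. snd s' [1, u, v] = G u * G v)"
  unfolding local_program_def
proof (rule runs_Seq)
  show "runs (for_loop 2 (row_com k l M)) (m0, r0) (n * (row_time k l M + 2) + 2) (\<lambda>s. rows n s \<and> (\<forall>v. fst s [4, n, v] = 0))"
  proof (rule runs_for_loop)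
    show "rows 0 (set_cell 2 0 (m0, r0)) \<and> (\<forall>v. fst (set_cell 2 0 (m0, r0)) [4, 0, v] = 0)"
      using fresh by (simp add: rows_def set_cell_def)
    fix u s assume u: "u < n" and I: "rows u s \<and> (\<forall>v. fst s [4, u, v] = 0)"
    have "runs (row_com k l M) s (row_time k l M)
      (\<lambda>s'. fst s' [2] = u \<and> fst s' [0] = n \<and> (rows (Suc u) (set_cell 2 (Suc u) s') \<and> (\<forall>v. fst s' [4, Suc u, v] = 0)))"
      by (rule runs_row[OF _ _ M G[OF u]]) (use I in auto)
    then show "runs (row_com k l M) s (row_time k l M)
      (\<lambda>s'. fst s' [2] = u \<and> fst s' [0] = n \<and> (rows (Suc u) (set_cell 2 (Suc u) s') \<and>
         (\<forall>v. fst (set_cell 2 (Suc u) s') [4, Suc u, v] = 0)))"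
      by (rule runs_weaken) (auto simp: set_cell_def)
  qed (use n in auto)
  fix s assume "rows n s \<and> (\<forall>v. fst s [4, n, v] = 0)"
  then show "runs output_com s (n * ((n * 3 + 2) + 2) + 2) (\<lambda>s'. \<forall>u<n. \<forall>v<n. snd s' [1, u, v] = G u * G v)"
    using n by (intro runs_output) (auto simp: rows_def)
qed

end

subsection \<open>Correctness of the exploration\<close>

lemma set_ext_list: "set (ext_list n A w xs) = set xs \<union> {v. v < n \<and> A w v}"
  by (auto simp: ext_list_def)

lemma distinct_ext_list: "distinct xs \<Longrightarrow> distinct (ext_list n A w xs)"
  by (auto simp: ext_list_def)

lemma round_list_properties:
  assumes "distinct xs"
  shows "distinct (round_list n A M xs)"
    "set (round_list n A M xs) = set xs \<union> {v. v < n \<and> (\<exists>j. j < M \<and> j < length xs \<and> A (xs ! j) v)}"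
proof -
  have *: "distinct (fold (\<lambda>j ys. if j < length xs then ext_list n A (xs ! j) ys else ys) js ys) \<and>
    set (fold (\<lambda>j ys. if j < length xs then ext_list n A (xs ! j) ys else ys) js ys)
      = set ys \<union> {v. v < n \<and> (\<exists>j\<in>set js. j < length xs \<and> A (xs ! j) v)}" if "distinct ys" for js ys
    using that
  proof (induction js arbitrary: ys)
    case (Cons j js)
    have "distinct (if j < length xs then ext_list n A (xs ! j) ys else ys)"
      using Cons.prems by (simp add: distinct_ext_list)
    from Cons.IH[OF this] show ?case by (auto simp: set_ext_list)
  qed auto
  from *[OF assms, of "[0..<M]"]
  show "distinct (round_list n A M xs)"
    "set (round_list n A M xs) = set xs \<union> {v. v < n \<and> (\<exists>j. j < M \<and> j < length xs \<and> A (xs ! j) v)}"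
    unfolding round_list_def by auto
qed

section \<open>The program computes local posterior means\<close>

definition capped :: "nat \<Rightarrow> nat \<Rightarrow> rgraph \<Rightarrow> nat set" where
  "capped l M g = (if card (ball_verts l g) \<le> M then ball_verts l g else {origin g})"

text \<open>As long as the list has at most \<open>M\<close> entries, all of them are scanned in every round.\<close>

lemma bfs_list_ball:
  fixes u :: nat
  assumes E: "E \<subseteq> {..<n} \<times> {..<n}" and A: "\<And>a b. A a b \<longleftrightarrow> (a, b) \<in> und E"
  defines "g \<equiv> RGraph {..<n} E u"
  shows "distinct (bfs_list n A M r u) \<and> set (bfs_list n A M r u) \<subseteq> ball_verts r g \<and>
     (length (bfs_list n A M r u) \<le> M \<longrightarrow> set (bfs_list n A M r u) = ball_verts r g)"
proof (induction r)
  case 0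
  show ?case by (auto simp: bfs_list_def ball_verts_def g_def)
next
  case (Suc r)
  let ?xs = "bfs_list n A M r u" and ?ys = "bfs_list n A M (Suc r) u"
  have ys: "?ys = round_list n A M ?xs" by (simp add: bfs_list_def)
  have d: "distinct ?xs" and sub: "set ?xs \<subseteq> ball_verts r g" and eq: "length ?xs \<le> M \<Longrightarrow> set ?xs = ball_verts r g"
    using Suc by auto
  note props = round_list_properties[OF d, of n A M]
  have ball: "ball_verts (Suc r) g = ball_verts r g \<union> {v. v < n \<and> (\<exists>w\<in>ball_verts r g. A w v)}"
    unfolding ball_verts_Suc A using E by (auto simp: g_def und_def)
  have 1: "set ?ys \<subseteq> ball_verts (Suc r) g"
    unfolding ys props(2) ball using sub by (auto dest: nth_mem)
  have "set ?ys = ball_verts (Suc r) g" if len: "length ?ys \<le> M"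
  proof -
    have "length ?xs \<le> length ?ys"
      unfolding ys distinct_card[OF d, symmetric] distinct_card[OF props(1), symmetric]
      by (rule card_mono) (auto simp: props(2))
    then have l: "length ?xs \<le> M" using len by simp
    have "(\<exists>j. j < M \<and> j < length ?xs \<and> A (?xs ! j) v) \<longleftrightarrow> (\<exists>w\<in>set ?xs. A w v)" for v
      using l by (metis in_set_conv_nth order.strict_trans2)
    then show ?thesis unfolding ys props(2) ball eq[OF l, symmetric] by simp
  qed
  then show ?case using 1 props(1) ys by simp
qed

lemma near_list_capped:
  assumes E: "E \<subseteq> {..<n} \<times> {..<n}" and A: "\<And>a b. A a b \<longleftrightarrow> (a, b) \<in> und E"
    and g: "rooted (RGraph {..<n} E u)"
  shows "distinct (near_list n A l M u) \<and> set (near_list n A l M u) = capped l M (RGraph {..<n} E u)"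
proof -
  let ?xs = "bfs_list n A M l u" and ?B = "ball_verts l (RGraph {..<n} E u)"
  have b: "distinct ?xs" "set ?xs \<subseteq> ?B" "length ?xs \<le> M \<Longrightarrow> set ?xs = ?B"
    using bfs_list_ball[OF E A, of M l u] by auto
  have c: "card (set ?xs) = length ?xs" by (rule distinct_card[OF b(1)])
  have "length ?xs \<le> card ?B" unfolding c[symmetric] by (rule card_mono[OF finite_ball[OF g] b(2)])
  then show ?thesis using b c by (auto simp: near_list_def Let_def capped_def)
qed

lemma sym_decode_code [simp]: "sym_decode (sym_code (x :: 'a::finite)) = x"
  unfolding sym_decode_def sym_code_def by (rule from_nat_into_to_nat_on) (auto simp: countable_finite)

lemma sym_code_less: "sym_code (x :: 'a::finite) < CARD('a)"
  using bij_betw_apply[OF to_nat_on_finite[of "UNIV :: 'a set"], of x] by (simp add: sym_code_def)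

lemma sym_code_eq [simp]: "sym_code x = sym_code y \<longleftrightarrow> x = (y :: 'a::finite)"
  by (metis sym_decode_code)

lemma sym_code_decode:
  assumes "k < CARD('a::finite)"
  shows "sym_code (sym_decode k :: 'a) = k"
  unfolding sym_decode_def sym_code_def using to_nat_on_finite[of "UNIV :: 'a set"] assms
  by (intro to_nat_on_from_nat_into) (auto simp: bij_betw_def)

lemma input_cells:
  "input_nmem n E Y \<xi> [0] = n"
  "w < n \<Longrightarrow> input_nmem n E Y \<xi> [0, w] = (case \<xi> w of None \<Rightarrow> 0 | Some x \<Rightarrow> Suc (sym_code x))"
  "input_nmem n E Y \<xi> [0, a, b] = of_bool ((a, b) \<in> E)"
  "(a, b) \<in> E \<Longrightarrow> input_nmem n E Y \<xi> [1, a, b] = sym_code (Y (a, b))"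
  "input_nmem n E Y \<xi> [4, a, b] = 0"
  by (auto simp: input_nmem_def)

lemma input_rcells:
  fixes Q :: "'x::finite \<Rightarrow> 'x \<Rightarrow> 'y::finite pmf"
  shows "input_rmem Q f [0, sym_code x] = f x"
    "input_rmem Q f [0, sym_code x, sym_code x', sym_code y] = pmf (Q x x') y"
  using sym_code_less[of x] sym_code_less[of x'] sym_code_less[of y] by (auto simp: input_rmem_def)

text \<open>The labellings of the list are enumerated through the codes of the labels; its first entry is the vertex whose
  label is predicted.\<close>

lemma cell_est_eq_est:
  fixes Q :: "'x::finite \<Rightarrow> 'x \<Rightarrow> 'y::finite pmf" and f :: "'x \<Rightarrow> real"
  assumes xs: "distinct xs" "xs \<noteq> []" "set xs \<subseteq> {..<n}"
  shows "memory.cell_est (input_nmem n E Y \<xi>) (input_rmem Q f) CARD('x) xs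
    = est Q f (set xs) (induced E (set xs)) (xs ! 0) Y \<xi>"
proof -
  interpret memory "input_nmem n E Y \<xi>" "input_rmem Q f" n "\<lambda>_. 0"
    by unfold_locales (simp add: input_cells)
  let ?W = "set xs" and ?m = "length xs" and ?X = "PiE (set xs) (\<lambda>_. UNIV :: 'x set)"
  let ?L = "List.n_lists ?m [0..<CARD('x)]"
  define \<Phi> where "\<Phi> x = map (\<lambda>w. sym_code (x w)) xs" for x :: "nat \<Rightarrow> 'x"
  have \<Phi>nth: "\<Phi> x ! i = sym_code (x (xs ! i))" if "i < ?m" for x i using that by (simp add: \<Phi>_def)
  have bij: "bij_betw \<Phi> ?X (set ?L)"
    unfolding bij_betw_def
  proof
    show "inj_on \<Phi> ?X"
    proof (rule inj_onI)
      fix x y assume xy: "x \<in> ?X" "y \<in> ?X" and "\<Phi> x = \<Phi> y"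
      then have "\<forall>w\<in>?W. x w = y w" by (simp add: \<Phi>_def)
      then show "x = y" using xy by (auto intro: PiE_ext)
    qed
    show "\<Phi> ` ?X = set ?L"
    proof
      show "\<Phi> ` ?X \<subseteq> set ?L" by (auto simp: set_n_lists \<Phi>_def sym_code_less)
      show "set ?L \<subseteq> \<Phi> ` ?X"
      proof
        fix cs assume "cs \<in> set ?L"
        then have cs: "length cs = ?m" "\<And>i. i < ?m \<Longrightarrow> cs ! i < CARD('x)"
          by (auto simp: set_n_lists subset_iff)
        define x where "x = (\<lambda>w\<in>?W. sym_decode (cs ! (THE i. i < ?m \<and> xs ! i = w)) :: 'x)"
        have the: "(THE j. j < ?m \<and> xs ! j = xs ! i) = i" if "i < ?m" for i
          using that xs(1) by (intro the_equality) (auto simp: nth_eq_iff_index_eq)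
        have "\<Phi> x = cs"
        proof (rule nth_equalityI)
          show "length (\<Phi> x) = length cs" by (simp add: \<Phi>_def cs)
          fix i assume "i < length (\<Phi> x)"
          then have i: "i < ?m" by (simp add: \<Phi>_def)
          have "x (xs ! i) = sym_decode (cs ! i)" using i by (simp add: x_def the)
          then show "\<Phi> x ! i = cs ! i" by (simp add: \<Phi>nth[OF i] sym_code_decode[OF cs(2)[OF i]])
        qed
        moreover have "x \<in> ?X" by (simp add: x_def)
        ultimately show "cs \<in> \<Phi> ` ?X" by blast
      qed
    qed
  qed
  have sums: "(\<Sum>cs\<leftarrow>?L. h cs) = (\<Sum>x\<in>?X. h (\<Phi> x))" for h :: "nat list \<Rightarrow> real"
  proof -
    have "(\<Sum>cs\<leftarrow>?L. h cs) = (\<Sum>cs\<in>set ?L. h cs)"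
      by (rule sum_list_distinct_conv_sum_set) (simp add: distinct_n_lists)
    then show ?thesis using sum.reindex_bij_betw[OF bij, of h] by simp
  qed
  have inc: "(\<exists>i\<in>{0..<?m}. incons xs (\<Phi> x) i) \<longleftrightarrow> \<not> (\<forall>w\<in>?W. \<xi> w = None \<or> \<xi> w = Some (x w))" for x
  proof -
    have "incons xs (\<Phi> x) i \<longleftrightarrow> \<not> (\<xi> (xs ! i) = None \<or> \<xi> (xs ! i) = Some (x (xs ! i)))" if "i < ?m" for i
    proof -
      have "xs ! i < n" using xs(3) that nth_mem by blast
      then show ?thesis using that by (auto simp: incons_def input_cells(2) \<Phi>nth split: option.split)
    qed
    then show ?thesis unfolding all_set_conv_all_nth by auto
  qed
  have prod: "prod_list (map (edge_fac xs (\<Phi> x)) (List.product [0..<?m] [0..<?m]))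
      = (\<Prod>(a, b)\<in>induced E ?W. pmf (Q (x a) (x b)) (Y (a, b)))" for x
  proof -
    let ?h = "\<lambda>e. if e \<in> E then pmf (Q (x (fst e)) (x (snd e))) (Y e) else 1"
    have "prod_list (map (edge_fac xs (\<Phi> x)) (List.product [0..<?m] [0..<?m]))
      = (\<Prod>e\<in>{0..<?m} \<times> {0..<?m}. edge_fac xs (\<Phi> x) e)"
      by (subst prod.distinct_set_conv_list[symmetric]) (auto simp: distinct_product)
    also have "\<dots> = (\<Prod>e\<in>{0..<?m} \<times> {0..<?m}. ?h (map_prod ((!) xs) ((!) xs) e))"
      by (intro prod.cong) (auto simp: edge_fac_def input_cells(3) input_cells(4)[unfolded One_nat_def] \<Phi>nth input_rcells)
    also have "\<dots> = (\<Prod>e\<in>?W \<times> ?W. ?h e)"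
    proof (rule prod.reindex_bij_betw)
      have "bij_betw ((!) xs) {0..<?m} ?W" using bij_betw_nth[OF xs(1), of "{0..<?m}" ?W] by (simp add: lessThan_atLeast0)
      then show "bij_betw (map_prod ((!) xs) ((!) xs)) ({0..<?m} \<times> {0..<?m}) (?W \<times> ?W)"
        by (auto simp: bij_betw_def map_prod_inj_on map_prod_surj_on)
    qed
    also have "\<dots> = (\<Prod>e\<in>induced E ?W. pmf (Q (x (fst e)) (x (snd e))) (Y e))"
      unfolding induced_def by (subst prod.inter_filter[symmetric]) (auto intro!: prod.cong)
    finally show ?thesis by (simp add: split_beta)
  qed
  have w: "weight xs (\<Phi> x) = of_bool (\<forall>w\<in>?W. \<xi> w = None \<or> \<xi> w = Some (x w))
      * (\<Prod>(a, b)\<in>induced E ?W. pmf (Q (x a) (x b)) (Y (a, b)))" for x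
    unfolding weight_def inc prod by simp
  have f: "input_rmem Q f [0, \<Phi> x ! 0] = f (x (xs ! 0))" for x
    using xs(2) by (simp add: \<Phi>nth input_rcells)
  show ?thesis
    unfolding cell_est_def sums w f est_def by (simp add: mult_ac)
qed

text \<open>For each vertex at most \<open>l M\<close> rows of length \<open>n\<close> are scanned, and the posterior mean takes bounded time; the products
  fill a matrix with \<open>n\<^sup>2\<close> entries.\<close>

lemma quadratic_time_capped:
  fixes Q :: "'x::finite \<Rightarrow> 'x \<Rightarrow> 'y::finite pmf" and f :: "'x \<Rightarrow> real" and l M :: nat
    and E :: "nat \<Rightarrow> (nat \<times> nat) set"
  assumes graphs: "\<And>n. n \<ge> 1 \<Longrightarrow> graph {..<n} (E n)" and M: "1 \<le> M"
  defines "e \<equiv> \<lambda>n Y \<xi> u. est Q f (capped l M (gr E n u)) (induced (E n) (capped l M (gr E n u))) u Y \<xi>"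
  shows "quadratic_time Q f E (\<lambda>n Y \<xi> u v. e n Y \<xi> u * e n Y \<xi> v)"
proof -
  define a where "a = l * M * 7 + 3"
  define b where "b = l * (M * 3 + 2) + 13 + csize (posts_com CARD('x) M)"
  define T where "T n = a * n ^ 2 + b * n + 4" for n :: nat
  have "(\<lambda>n. real (T n)) \<in> O(\<lambda>n. (real n)\<^sup>2)"
  proof (rule bigoI)
    have "T n \<le> (a + b + 4) * n ^ 2" if "1 \<le> n" for n
    proof -
      have "n \<le> n ^ 2" "1 \<le> n ^ 2" using that by (auto simp: power2_eq_square)
      then have "4 \<le> 4 * n ^ 2" "b * n \<le> b * n ^ 2" by (simp, intro mult_le_mono2)
      then show ?thesis unfolding T_def add_mult_distrib by linarith
    qed
    then have "norm (real (T n)) \<le> real (a + b + 4) * norm ((real n)\<^sup>2)" if "1 \<le> n" for n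
      using that by (simp del: of_nat_add of_nat_mult of_nat_power add: of_nat_mult[symmetric] of_nat_power[symmetric])
    then show "eventually (\<lambda>n. norm (real (T n)) \<le> real (a + b + 4) * norm ((real n)\<^sup>2)) sequentially"
      by (auto simp: eventually_sequentially)
  qed
  moreover have "\<exists>t m r. exec (local_program CARD('x) l M) (input_nmem n (E n) Y \<xi>, input_rmem Q f) t (m, r) \<and> t \<le> T n \<and>
        (\<forall>u<n. \<forall>v<n. r [1, u, v] = e n Y \<xi> u * e n Y \<xi> v)" if n1: "1 \<le> n" for n Y \<xi>
  proof -
    interpret memory "input_nmem n (E n) Y \<xi>" "input_rmem Q f" n "e n Y \<xi>"
      by unfold_locales (simp add: input_cells)
    have En: "E n \<subseteq> {..<n} \<times> {..<n}" using graphs[OF n1] by (simp add: graph_def)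
    have A: "adj a b \<longleftrightarrow> (a, b) \<in> und (E n)" for a b
      by (auto simp: adj_def input_cells und_def)
    have "runs (local_program CARD('x) l M) (input_nmem n (E n) Y \<xi>, input_rmem Q f)
      ((n * (row_time CARD('x) l M + 2) + 2) + (n * ((n * 3 + 2) + 2) + 2))
      (\<lambda>s'. \<forall>u<n. \<forall>v<n. snd s' [1, u, v] = e n Y \<xi> u * e n Y \<xi> v)"
    proof (rule runs_local_program[OF input_cells(5) M])
      fix u assume u: "u < n"
      have g: "rooted (gr E n u)" using graphs[OF n1] u by (simp add: rooted_def)
      let ?xs = "near_list n adj l M u"
      have xs: "distinct ?xs" "set ?xs = capped l M (gr E n u)"
        using near_list_capped[OF En A g, of l M] by auto
      have hd: "?xs \<noteq> []" "?xs ! 0 = u" using bfs_list_prefix[of M l u] by (auto simp: near_list_def Let_def)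
      have "set ?xs \<subseteq> {..<n}"
        unfolding xs(2) capped_def using ball_verts_subset[OF g, of l] u by auto
      from cell_est_eq_est[OF xs(1) hd(1) this, of "E n" Y \<xi> Q f]
      show "e n Y \<xi> u = cell_est CARD('x) ?xs" unfolding e_def xs(2) hd(2) by simp
    qed
    moreover have "(n * (row_time CARD('x) l M + 2) + 2) + (n * ((n * 3 + 2) + 2) + 2) = T n"
      unfolding T_def a_def b_def row_time_def by (simp add: algebra_simps power2_eq_square)
    ultimately show ?thesis by (auto simp: runs_def)
  qed
  ultimately show ?thesis unfolding quadratic_time_def by blast
qed

section \<open>Asymptotics of the risks\<close>

lemma acc_bounds:
  assumes "finite W" "finite F" "0 \<le> \<epsilon>" "\<epsilon> \<le> 1" and K: "\<And>x. \<bar>f x\<bar> \<le> K"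
  shows "0 \<le> acc Q f \<epsilon> W F u" "acc Q f \<epsilon> W F u \<le> K\<^sup>2"
proof -
  note finp = finite_joint_pmf[OF assms(1,2), of Q]
  have m: "msq (joint_pmf Q W F) Z (\<lambda>\<omega>. f (fst \<omega> u)) \<le> K\<^sup>2" for Z :: "_ \<Rightarrow> (nat \<Rightarrow> 'a) \<times> 'b edge_obs"
  proof -
    have "msq (joint_pmf Q W F) Z (\<lambda>\<omega>. f (fst \<omega> u)) \<le> mean (joint_pmf Q W F) (\<lambda>\<omega>. (f (fst \<omega> u))\<^sup>2)" by (rule msq_le_full[OF finp])
    also have "\<dots> \<le> mean (joint_pmf Q W F) (\<lambda>\<omega>. K\<^sup>2)"
    proof (rule mean_mono)
      fix \<omega> :: "(nat \<Rightarrow> 'a) \<times> 'b edge_obs"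
      show "(f (fst \<omega> u))\<^sup>2 \<le> K\<^sup>2" using power_mono[OF K[of "fst \<omega> u"], of 2] by simp
    qed
    finally show ?thesis by (simp add: mean_const[OF finp])
  qed
  have "bernoulli_mean \<epsilon> W (\<lambda>A. 0) \<le> acc Q f \<epsilon> W F u" "acc Q f \<epsilon> W F u \<le> bernoulli_mean \<epsilon> W (\<lambda>A. K\<^sup>2)"
    unfolding acc_def using assms m by (auto intro!: bernoulli_mean_mono msq_nonneg)
  then show "0 \<le> acc Q f \<epsilon> W F u" "acc Q f \<epsilon> W F u \<le> K\<^sup>2" using assms(1) by (simp_all add: bernoulli_mean_const)
qed

definition vertex_acc :: "('x::finite \<Rightarrow> 'x \<Rightarrow> 'y::finite pmf) \<Rightarrow> ('x \<Rightarrow> real) \<Rightarrow> real \<Rightarrow> (rgraph \<Rightarrow> nat set) \<Rightarrow> rgraph \<Rightarrow> real" where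
  "vertex_acc Q f \<epsilon> W g = acc Q f \<epsilon> (W g) (induced (edges g) (W g)) (origin g)"

text \<open>Neighbourhoods of the root that are determined by the ball of radius \<open>l\<close>.\<close>

definition local_nbh :: "nat \<Rightarrow> (rgraph \<Rightarrow> nat set) \<Rightarrow> bool" where
  "local_nbh l W \<longleftrightarrow> (\<forall>g. rooted g \<longrightarrow> W g \<subseteq> ball_verts l g \<and> origin g \<in> W g) \<and>
     (\<forall>g h \<phi>. rooted g \<longrightarrow> rooted h \<longrightarrow> is_iso \<phi> (rball l g) (rball l h) \<longrightarrow> \<phi> ` W g = W h)"

lemma local_nbh_ball: "local_nbh l (ball_verts l)"
  unfolding local_nbh_def using iso_image by simp

lemma local_nbh_capped: "local_nbh l (capped l M)"
  unfolding local_nbh_def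
proof (intro conjI allI impI)
  fix g h \<phi> assume iso: "is_iso \<phi> (rball l g) (rball l h)"
  show "\<phi> ` capped l M g = capped l M h"
    using iso_image[OF iso order.refl] card_ball_iso[OF iso] iso by (simp add: capped_def is_iso_def)
qed (auto simp: capped_def)

lemma finite_local_nbh: "local_nbh l W \<Longrightarrow> rooted g \<Longrightarrow> finite (W g)"
  unfolding local_nbh_def using finite_ball finite_subset by metis

lemma finite_induced: "finite W \<Longrightarrow> finite (induced E W)"
  unfolding induced_def by simp

lemma vertex_acc_bounds:
  assumes "local_nbh l W" "rooted g" "0 \<le> \<epsilon>" "\<epsilon> \<le> 1" "\<And>x. \<bar>f x\<bar> \<le> K"
  shows "0 \<le> vertex_acc Q f \<epsilon> W g" "vertex_acc Q f \<epsilon> W g \<le> K\<^sup>2"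
  unfolding vertex_acc_def
  using acc_bounds[OF finite_local_nbh[OF assms(1,2)] finite_induced[OF finite_local_nbh[OF assms(1,2)]] assms(3,4), of f K] assms(5)
  by simp_all

lemma loc_vertex_acc:
  assumes W: "local_nbh l W"
  shows "loc l (vertex_acc Q f \<epsilon> W)"
proof (rule locI)
  fix g h \<phi> assume *: "rooted g" "rooted h" "is_iso \<phi> (rball l g) (rball l h)"
  have Wg: "W g \<subseteq> ball_verts l g" "origin g \<in> W g" and Wh: "\<phi> ` W g = W h"
    using W * unfolding local_nbh_def by blast+
  have inj: "inj_on \<phi> (W g)" using *(3) Wg(1) by (auto simp: is_iso_def bij_betw_def intro: inj_on_subset)
  have o: "\<phi> (origin g) = origin h" using *(3) by (simp add: is_iso_def)
  have edge: "(a, b) \<in> edges g \<longleftrightarrow> (\<phi> a, \<phi> b) \<in> edges h" if "a \<in> W g" "b \<in> W g" for a b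
  proof -
    have "a \<in> ball_verts l g" "b \<in> ball_verts l g" using that Wg(1) by blast+
    moreover from this have "\<phi> a \<in> ball_verts l h" "\<phi> b \<in> ball_verts l h"
      using iso_image[OF *(3) order.refl] by blast+
    ultimately show ?thesis using *(3) by (simp add: is_iso_def edges_rball)
  qed
  have "map_prod \<phi> \<phi> ` induced (edges g) (W g) = induced (edges h) (W h)"
    unfolding induced_def Wh[symmetric] using edge by (auto simp: image_iff)
  then show "vertex_acc Q f \<epsilon> W g = vertex_acc Q f \<epsilon> W h"
    using acc_iso[OF finite_local_nbh[OF W *(1)] finite_induced[OF finite_local_nbh[OF W *(1)]] _ inj Wg(2), of "edges g" Q f \<epsilon>]
    unfolding vertex_acc_def Wh o by (simp add: induced_def)
qed

lemma (in finite_model) acc_subset_mono: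
  assumes "W \<subseteq> W'" "W' \<subseteq> V" "u \<in> W" "0 \<le> \<epsilon>" "\<epsilon> \<le> 1"
  shows "acc Q f \<epsilon> W (induced E W) u \<le> acc Q f \<epsilon> W' (induced E W') u"
proof -
  have "W \<subseteq> V" "u \<in> W'" using assms by auto
  note m = acc_marginal[OF finV finE this(1) induced_sub assms(3), symmetric]
    acc_marginal[OF finV finE assms(2) induced_sub this(2), symmetric]
  have "induced E W \<subseteq> induced E W'" using assms(1) by (auto simp: induced_def)
  then show ?thesis
    unfolding m using assms by (intro bernoulli_mean_mono msq_mono[OF finP] coarser_view) auto
qed

locale estimation = weak_limit E \<rho> for E :: "nat \<Rightarrow> (nat \<times> nat) set" and \<rho> :: "gstar measure" +
  fixes Q :: "'x::finite \<Rightarrow> 'x \<Rightarrow> 'y::finite pmf" and f :: "'x \<Rightarrow> real"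
  assumes tame: "tame \<rho>"
begin

text \<open>At least \<open>1\<close>, so that higher powers dominate lower ones.\<close>

definition K :: real where "K = 1 + (\<Sum>x\<in>UNIV. \<bar>f x\<bar>)"

lemma K: "\<bar>f x\<bar> \<le> K" "1 \<le> K"
proof -
  have "\<bar>f x\<bar> \<le> (\<Sum>x\<in>UNIV. \<bar>f x\<bar>)" by (rule member_le_sum) auto
  then show "\<bar>f x\<bar> \<le> K" by (simp add: K_def)
  show "1 \<le> K" by (simp add: K_def sum_nonneg)
qed

lemma model: "1 \<le> n \<Longrightarrow> finite_model f {..<n} (E n) K"
  using graphs[of n] K by unfold_locales (auto simp: graph_def lessThan_empty_iff)

abbreviation "pacc n \<epsilon> \<equiv> finite_model.pair_acc Q f {..<n} (E n) \<epsilon>"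
abbreviation "s2 \<equiv> finite_model.second_moment f"

definition nb :: "(rgraph \<Rightarrow> nat set) \<Rightarrow> nat \<Rightarrow> nat \<Rightarrow> nat set" where
  "nb W n u = W (gr E n u)"

lemma nb_props:
  assumes "local_nbh l W" "u < n"
  shows "u \<in> nb W n u" "nb W n u \<subseteq> {..<n}" "nb W n u \<subseteq> ball_verts l (gr E n u)"
  using assms rooted_gr[OF assms(2)] ball_verts_subset[OF rooted_gr[OF assms(2)], of l]
  unfolding nb_def local_nbh_def by fastforce+

definition avg :: "(rgraph \<Rightarrow> nat set) \<Rightarrow> nat \<Rightarrow> real \<Rightarrow> real" where
  "avg W n \<epsilon> = (\<Sum>u<n. acc Q f \<epsilon> (nb W n u) (induced (E n) (nb W n u)) u) / n"

definition lim_acc :: "(rgraph \<Rightarrow> nat set) \<Rightarrow> real \<Rightarrow> real" where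
  "lim_acc W \<epsilon> = (\<integral>x. vertex_acc Q f \<epsilon> W (rep_gstar x) \<partial>\<rho>)"

lemma avg_tendsto:
  assumes "local_nbh l W" "0 \<le> \<epsilon>" "\<epsilon> \<le> 1"
  shows "(\<lambda>n. avg W n \<epsilon>) \<longlonglongrightarrow> lim_acc W \<epsilon>"
proof -
  have b: "\<bar>vertex_acc Q f \<epsilon> W g\<bar> \<le> K\<^sup>2" if "rooted g" for g
    using vertex_acc_bounds[OF assms(1) that assms(2,3) K(1), of Q] by simp
  show ?thesis
    using average_converges[OF loc_vertex_acc[OF assms(1)] b]
    unfolding avg_def lim_acc_def nb_def vertex_acc_def by simp
qed

subsection \<open>Few pairs of vertices are close\<close>

text \<open>If the neighbourhoods of \<open>u\<close> and \<open>v\<close> meet, then \<open>v\<close> is in the ball of radius \<open>2 l\<close> around \<open>u\<close>; and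
  the sizes of these balls are tight.\<close>

lemma overlaps_tendsto:
  assumes W: "local_nbh l W"
  shows "(\<lambda>n. finite_model.overlaps {..<n} (nb W n) / (real n)\<^sup>2) \<longlonglongrightarrow> 0"
proof (rule LIMSEQ_I)
  fix \<eta> :: real assume \<eta>: "0 < \<eta>"
  obtain N where N: "prob {x. card (ball_verts (2 * l) (rep_gstar x)) > N} < \<eta> / 2"
    using ball_size_tight[of "\<eta> / 2" "2 * l"] \<eta> by auto
  define \<Phi> where "\<Phi> g = (of_bool (card (ball_verts (2 * l) g) > N) :: real)" for g
  have loc\<Phi>: "loc (2 * l) \<Phi>"
    unfolding \<Phi>_def[abs_def] by (rule loc_comp[OF loc_card_ball, where k = "\<lambda>k. of_bool (k > N)"])
  have "(\<lambda>n. (\<Sum>u<n. \<Phi> (gr E n u)) / n) \<longlonglongrightarrow> (\<integral>x. \<Phi> (rep_gstar x) \<partial>\<rho>)"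
    by (rule average_converges[OF loc\<Phi>, of 1]) (simp add: \<Phi>_def)
  moreover have "(\<integral>x. \<Phi> (rep_gstar x) \<partial>\<rho>) = prob {x. card (ball_verts (2 * l) (rep_gstar x)) > N}"
  proof -
    have "(\<integral>x. \<Phi> (rep_gstar x) \<partial>\<rho>) = (\<integral>x. indicator {x. card (ball_verts (2 * l) (rep_gstar x)) > N} x \<partial>\<rho>)"
      by (intro Bochner_Integration.integral_cong) (simp_all add: \<Phi>_def indicator_def)
    then show ?thesis by (simp add: space_rho)
  qed
  ultimately have lim: "(\<lambda>n. (\<Sum>u<n. \<Phi> (gr E n u)) / n) \<longlonglongrightarrow> prob {x. card (ball_verts (2 * l) (rep_gstar x)) > N}" by simp
  have ev1: "eventually (\<lambda>n. (\<Sum>u<n. \<Phi> (gr E n u)) / n < \<eta> / 2) sequentially"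
    by (rule order_tendstoD(2)[OF lim N])
  have ev2: "eventually (\<lambda>n. real N / real n < \<eta> / 2) sequentially"
    by (rule order_tendstoD(2)[OF lim_const_over_n]) (use \<eta> in simp)
  have "eventually (\<lambda>n. norm (finite_model.overlaps {..<n} (nb W n) / (real n)\<^sup>2 - 0) < \<eta>) sequentially"
    using ev1 ev2 eventually_ge_at_top[of 1]
  proof eventually_elim
    case (elim n)
    interpret finite_model Q f "{..<n}" "E n" K by (rule model) (use elim in simp)
    have "overlaps (nb W n) = (\<Sum>u<n. real (card {v \<in> {..<n}. nb W n u \<inter> nb W n v \<noteq> {}}))"
    proof -
      have "{(u, v) \<in> {..<n} \<times> {..<n}. nb W n u \<inter> nb W n v \<noteq> {}} = Sigma {..<n} (\<lambda>u. {v \<in> {..<n}. nb W n u \<inter> nb W n v \<noteq> {}})"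
        by auto
      then show ?thesis unfolding overlaps_def by simp
    qed
    also have "\<dots> \<le> (\<Sum>u<n. N + n * \<Phi> (gr E n u))"
    proof (rule sum_mono)
      fix u assume "u \<in> {..<n}"
      then have u: "u < n" by simp
      have sub: "{v \<in> {..<n}. nb W n u \<inter> nb W n v \<noteq> {}} \<subseteq> ball_verts (2 * l) (gr E n u)"
      proof
        fix v assume "v \<in> {v \<in> {..<n}. nb W n u \<inter> nb W n v \<noteq> {}}"
        then obtain w where v: "v < n" and w: "w \<in> nb W n u" "w \<in> nb W n v" by auto
        have wu: "w \<in> ball_verts l (gr E n u)" using nb_props(3)[OF W u] w by blast
        have "w \<in> ball_verts l (reroot (gr E n w) v)" using nb_props(3)[OF W v] w by (auto simp: reroot_def)
        then have "v \<in> ball_verts l (gr E n w)" using ball_reroot_sym[of "gr E n w" l v] by simp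
        then have "v \<in> ball_verts l (reroot (gr E n u) w)" by (simp add: reroot_def)
        then show "v \<in> ball_verts (2 * l) (gr E n u)" using ball_reroot_subset[OF wu, of l "2 * l"] by auto
      qed
      show "real (card {v \<in> {..<n}. nb W n u \<inter> nb W n v \<noteq> {}}) \<le> N + n * \<Phi> (gr E n u)"
      proof (cases "card (ball_verts (2 * l) (gr E n u)) > N")
        case True
        have "card {v \<in> {..<n}. nb W n u \<inter> nb W n v \<noteq> {}} \<le> card {..<n}" by (rule card_mono) auto
        then show ?thesis using True by (simp add: \<Phi>_def)
      next
        case False
        then have "card {v \<in> {..<n}. nb W n u \<inter> nb W n v \<noteq> {}} \<le> N"
          using card_mono[OF finite_ball[OF rooted_gr[OF u]] sub] by simp
        then show ?thesis using False by (simp add: \<Phi>_def)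
      qed
    qed
    also have "\<dots> = n * N + n * (\<Sum>u<n. \<Phi> (gr E n u))" by (simp add: sum.distrib sum_distrib_left)
    finally have "overlaps (nb W n) / (real n)\<^sup>2 \<le> (n * N + n * (\<Sum>u<n. \<Phi> (gr E n u))) / (real n)\<^sup>2"
      by (intro divide_right_mono) auto
    also have "\<dots> = N / n + (\<Sum>u<n. \<Phi> (gr E n u)) / n"
      using elim by (simp add: field_simps power2_eq_square)
    also have "\<dots> < \<eta>" using elim(1,2) by linarith
    finally show ?case by (simp add: overlaps_def)
  qed
  then show "\<exists>no. \<forall>n\<ge>no. norm (finite_model.overlaps {..<n} (nb W n) / (real n)\<^sup>2 - 0) < \<eta>"
    by (simp add: eventually_sequentially)
qed

subsection \<open>Risks\<close>

definition local_est :: "(rgraph \<Rightarrow> nat set) \<Rightarrow> nat \<Rightarrow> ('x, 'y) estimator" where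
  "local_est W n Y \<xi> u v = est Q f (nb W n u) (induced (E n) (nb W n u)) u Y \<xi> * est Q f (nb W n v) (induced (E n) (nb W n v)) v Y \<xi>"

lemma risk_eq:
  assumes n: "1 \<le> n" and \<epsilon>: "0 \<le> \<epsilon>" "\<epsilon> \<le> 1"
  shows "risk Q f \<epsilon> n (E n) Xhat = 1 / (real n)\<^sup>2 * (\<Sum>u<n. \<Sum>v<n. bernoulli_mean \<epsilon> {..<n} (\<lambda>A. mean (joint_pmf Q {..<n} (E n))
     (\<lambda>\<omega>. (f (fst \<omega> u) * f (fst \<omega> v) - Xhat (snd \<omega>) (mask A (fst \<omega>)) u v)\<^sup>2)))"
proof -
  interpret finite_model Q f "{..<n}" "E n" K by (rule model[OF n])
  show ?thesis
    unfolding risk_def expectation_obs_model[OF finV finE \<epsilon>, of Q "\<lambda>\<theta> Y \<xi>. \<Sum>u<n. \<Sum>v<n. (f (\<theta> u) * f (\<theta> v) - Xhat Y \<xi> u v)\<^sup>2"]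
      mean_sum bernoulli_mean_sum ..
qed

lemma risk_lower:
  assumes n: "1 \<le> n" and \<epsilon>: "0 \<le> \<epsilon>" "\<epsilon> \<le> 1"
  shows "s2\<^sup>2 - pacc n \<epsilon> \<le> risk Q f \<epsilon> n (E n) Xhat"
proof -
  interpret finite_model Q f "{..<n}" "E n" K by (rule model[OF n])
  show ?thesis using bayes_lower_bound[OF \<epsilon>, of Xhat] by (simp add: risk_eq[OF n \<epsilon>])
qed

lemma bayes_bounds:
  assumes n: "1 \<le> n" and \<epsilon>: "0 \<le> \<epsilon>" "\<epsilon> \<le> 1"
  shows "s2\<^sup>2 - pacc n \<epsilon> \<le> bayes_risk Q f \<epsilon> n (E n)" "bayes_risk Q f \<epsilon> n (E n) \<le> risk Q f \<epsilon> n (E n) Xhat"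
proof -
  show "s2\<^sup>2 - pacc n \<epsilon> \<le> bayes_risk Q f \<epsilon> n (E n)"
    unfolding bayes_risk_def by (intro cINF_greatest) (auto intro: risk_lower[OF assms])
  show "bayes_risk Q f \<epsilon> n (E n) \<le> risk Q f \<epsilon> n (E n) Xhat"
    unfolding bayes_risk_def
    by (intro cINF_lower bdd_belowI2[of _ "s2\<^sup>2 - pacc n \<epsilon>"]) (auto intro: risk_lower[OF assms])
qed

lemma local_risk_tendsto:
  assumes W: "local_nbh l W" and \<epsilon>: "0 \<le> \<epsilon>" "\<epsilon> \<le> 1"
  shows "(\<lambda>n. risk Q f \<epsilon> n (E n) (local_est W n)) \<longlonglongrightarrow> s2\<^sup>2 - (lim_acc W \<epsilon>)\<^sup>2"
proof -
  have close: "\<bar>risk Q f \<epsilon> n (E n) (local_est W n) - (s2\<^sup>2 - (avg W n \<epsilon>)\<^sup>2)\<bar>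
     \<le> 4 * K ^ 4 * (finite_model.overlaps {..<n} (nb W n) / (real n)\<^sup>2)" if n: "1 \<le> n" for n
  proof -
    interpret finite_model Q f "{..<n}" "E n" K by (rule model[OF n])
    have B: "u \<in> nb W n u" "nb W n u \<subseteq> {..<n}" if "u \<in> {..<n}" for u using nb_props[OF W, of u n] that by auto
    have ld: "local_risk (nb W n) \<epsilon> = 1 / (real (card {..<n}))\<^sup>2 * (\<Sum>u<n. \<Sum>v<n. bernoulli_mean \<epsilon> {..<n} (\<lambda>A. mean P
        (\<lambda>\<omega>. (fv u \<omega> * fv v \<omega> - lpost (nb W n) A u \<omega> * lpost (nb W n) A v \<omega>)\<^sup>2)))"
      by (rule local_risk_def) (fact B)+
    have "risk Q f \<epsilon> n (E n) (local_est W n) = local_risk (nb W n) \<epsilon>"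
      unfolding risk_eq[OF n \<epsilon>] ld card_lessThan
    proof (intro arg_cong2[where f = "(*)"] refl sum.cong bernoulli_mean_cong mean_cong)
      fix u v A and \<omega> :: "(nat \<Rightarrow> 'x) \<times> 'y edge_obs"
      assume uv: "u \<in> {..<n}" "v \<in> {..<n}"
      have e: "est Q f (nb W n w) (induced (E n) (nb W n w)) w (snd \<omega>) (mask A (fst \<omega>)) = lpost (nb W n) A w \<omega>"
        if "w \<in> {..<n}" for w
        unfolding lpost_def by (rule est_posterior[OF finV finE B(2)[OF that] induced_sub B(1)[OF that]])
      show "(f (fst \<omega> u) * f (fst \<omega> v) - local_est W n (snd \<omega>) (mask A (fst \<omega>)) u v)\<^sup>2
        = (fv u \<omega> * fv v \<omega> - lpost (nb W n) A u \<omega> * lpost (nb W n) A v \<omega>)\<^sup>2"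
        unfolding local_est_def e[OF uv(1)] e[OF uv(2)] ..
    qed
    then show ?thesis using local_risk_asymptotics[OF B \<epsilon>] by (simp add: avg_def)
  qed
  have lim: "(\<lambda>n. s2\<^sup>2 - (avg W n \<epsilon>)\<^sup>2) \<longlonglongrightarrow> s2\<^sup>2 - (lim_acc W \<epsilon>)\<^sup>2"
    by (intro tendsto_intros avg_tendsto[OF W \<epsilon>])
  have "(\<lambda>n. 4 * K ^ 4 * (finite_model.overlaps {..<n} (nb W n) / (real n)\<^sup>2)) \<longlonglongrightarrow> 4 * K ^ 4 * 0"
    by (intro tendsto_mult_left overlaps_tendsto[OF W])
  then have z: "(\<lambda>n. 4 * K ^ 4 * (finite_model.overlaps {..<n} (nb W n) / (real n)\<^sup>2)) \<longlonglongrightarrow> 0" by simp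
  have "(\<lambda>n. risk Q f \<epsilon> n (E n) (local_est W n) - (s2\<^sup>2 - (avg W n \<epsilon>)\<^sup>2)) \<longlonglongrightarrow> 0"
    by (rule Lim_null_comparison[OF _ z]) (use close in \<open>auto simp: eventually_sequentially intro!: exI[of _ 1]\<close>)
  from tendsto_add[OF this lim] show ?thesis by simp
qed

subsection \<open>Large radii\<close>

lemma lim_acc_bounds:
  assumes W: "local_nbh l W" and \<epsilon>: "0 \<le> \<epsilon>" "\<epsilon> \<le> 1"
  shows "0 \<le> lim_acc W \<epsilon>" "lim_acc W \<epsilon> \<le> K\<^sup>2"
proof -
  note b = vertex_acc_bounds[OF W _ \<epsilon> K(1), where Q = Q]
  have "integrable \<rho> (\<lambda>x. vertex_acc Q f \<epsilon> W (rep_gstar x))"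
    by (rule integrable_loc[OF loc_vertex_acc[OF W], of _ _ _ "K\<^sup>2"]) (use b in \<open>simp add: abs_le_iff\<close>)
  then show "lim_acc W \<epsilon> \<le> K\<^sup>2"
    unfolding lim_acc_def by (rule integral_le_const) (use b(2) rooted_rep in simp)
  show "0 \<le> lim_acc W \<epsilon>"
    unfolding lim_acc_def by (rule Bochner_Integration.integral_nonneg) (use b(1) rooted_rep in simp)
qed

lemma lim_acc_radius_mono:
  assumes "l \<le> l'" and \<epsilon>: "0 \<le> \<epsilon>" "\<epsilon> \<le> 1"
  shows "lim_acc (ball_verts l) \<epsilon> \<le> lim_acc (ball_verts l') \<epsilon>"
proof (rule LIMSEQ_le[OF avg_tendsto[OF local_nbh_ball \<epsilon>] avg_tendsto[OF local_nbh_ball \<epsilon>]], intro exI[of _ 1] allI impI)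
  fix n :: nat assume n: "1 \<le> n"
  interpret finite_model Q f "{..<n}" "E n" K by (rule model[OF n])
  show "avg (ball_verts l) n \<epsilon> \<le> avg (ball_verts l') n \<epsilon>"
    unfolding avg_def
  proof (intro divide_right_mono sum_mono acc_subset_mono \<epsilon>)
    fix u assume "u \<in> {..<n}"
    then have u: "u < n" by simp
    show "nb (ball_verts l) n u \<subseteq> nb (ball_verts l') n u"
      unfolding nb_def ball_verts_def using order.trans[OF _ assms(1)] by blast
    show "nb (ball_verts l') n u \<subseteq> {..<n}" "u \<in> nb (ball_verts l) n u"
      using nb_props[OF local_nbh_ball u] by auto
  qed simp
qed

lemma lim_acc_mono:
  assumes W: "local_nbh l W" and \<epsilon>: "0 \<le> \<epsilon>" "\<epsilon> \<le> \<epsilon>'" "\<epsilon>' \<le> 1"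
  shows "lim_acc W \<epsilon> \<le> lim_acc W \<epsilon>'"
proof -
  have "avg W n \<epsilon> \<le> avg W n \<epsilon>'" if n: "1 \<le> n" for n
  proof -
    interpret finite_model Q f "{..<n}" "E n" K by (rule model[OF n])
    show ?thesis
      unfolding avg_def
    proof (intro divide_right_mono sum_mono)
      fix u assume u: "u \<in> {..<n}"
      show "lacc (nb W n) \<epsilon> u \<le> lacc (nb W n) \<epsilon>' u"
        by (rule lacc_increasing) (use nb_props[OF W] u \<epsilon> in auto)
    qed simp
  qed
  moreover have "0 \<le> \<epsilon>'" "\<epsilon> \<le> 1" using \<epsilon> by auto
  ultimately show ?thesis
    using LIMSEQ_le[OF avg_tendsto[OF W] avg_tendsto[OF W], of \<epsilon> \<epsilon>'] \<epsilon> by blast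
qed

definition lim_acc_inf :: "real \<Rightarrow> real" where
  "lim_acc_inf \<epsilon> = (SUP l. lim_acc (ball_verts l) \<epsilon>)"

context
  fixes \<epsilon> :: real
  assumes \<epsilon>: "0 \<le> \<epsilon>" "\<epsilon> \<le> 1"
begin

lemma bdd_lim_acc: "bdd_above (range (\<lambda>l. lim_acc (ball_verts l) \<epsilon>))"
  using lim_acc_bounds(2)[OF local_nbh_ball \<epsilon>] by (intro bdd_aboveI2)

lemma lim_acc_le_inf: "lim_acc (ball_verts l) \<epsilon> \<le> lim_acc_inf \<epsilon>"
  unfolding lim_acc_inf_def by (rule cSUP_upper[OF _ bdd_lim_acc]) simp

lemma lim_acc_inf_nonneg: "0 \<le> lim_acc_inf \<epsilon>"
  using lim_acc_bounds(1)[OF local_nbh_ball \<epsilon>] lim_acc_le_inf order.trans by blast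

lemma lim_acc_tendsto: "(\<lambda>l. lim_acc (ball_verts l) \<epsilon>) \<longlonglongrightarrow> lim_acc_inf \<epsilon>"
  unfolding lim_acc_inf_def
  by (rule LIMSEQ_incseq_SUP[OF bdd_lim_acc]) (simp add: incseq_def lim_acc_radius_mono \<epsilon>)

end

lemma lim_acc_inf_mono: "mono_on {0..1} lim_acc_inf"
proof (rule mono_onI)
  fix \<epsilon> \<epsilon>' :: real assume *: "\<epsilon> \<in> {0..1}" "\<epsilon>' \<in> {0..1}" "\<epsilon> \<le> \<epsilon>'"
  show "lim_acc_inf \<epsilon> \<le> lim_acc_inf \<epsilon>'"
    by (rule LIMSEQ_le[OF lim_acc_tendsto lim_acc_tendsto]) (use * lim_acc_mono[OF local_nbh_ball] in auto)
qed

definition cap :: "nat \<Rightarrow> nat" where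
  "cap l = (SOME M. 1 \<le> M \<and> prob {x. card (ball_verts l (rep_gstar x)) > M} < 1 / (real l + 1))"

lemma cap: "1 \<le> cap l" "prob {x. card (ball_verts l (rep_gstar x)) > cap l} < 1 / (real l + 1)"
proof -
  obtain N where N: "prob {x. card (ball_verts l (rep_gstar x)) > N} < 1 / (real l + 1)"
    using ball_size_tight[of "1 / (real l + 1)" l] by auto
  have "{x. card (ball_verts l (rep_gstar x)) > N} \<in> sets borel"
    using continuous_loc[OF loc_card_ball, of l] open_vimage[of "{N<..}" "\<lambda>x. card (ball_verts l (rep_gstar x))"]
    by (auto simp: vimage_def)
  then have "{x. card (ball_verts l (rep_gstar x)) > N} \<in> events" by (simp add: sets_rho)
  then have "prob {x. card (ball_verts l (rep_gstar x)) > max 1 N} \<le> prob {x. card (ball_verts l (rep_gstar x)) > N}"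
    by (rule finite_measure_mono[rotated]) auto
  with N have "\<exists>M. 1 \<le> M \<and> prob {x. card (ball_verts l (rep_gstar x)) > M} < 1 / (real l + 1)"
    by (intro exI[of _ "max 1 N"]) auto
  from someI_ex[OF this] show "1 \<le> cap l" "prob {x. card (ball_verts l (rep_gstar x)) > cap l} < 1 / (real l + 1)"
    unfolding cap_def by auto
qed

lemma capped_close:
  assumes \<epsilon>: "0 \<le> \<epsilon>" "\<epsilon> \<le> 1"
  shows "\<bar>lim_acc (capped l (cap l)) \<epsilon> - lim_acc (ball_verts l) \<epsilon>\<bar> \<le> K\<^sup>2 / (real l + 1)"
proof -
  let ?a = "\<lambda>W x. vertex_acc Q f \<epsilon> W (rep_gstar x)"
  let ?i = "\<lambda>g. of_bool (card (ball_verts l g) > cap l) :: real"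
  have b: "0 \<le> ?a W x" "?a W x \<le> K\<^sup>2" if "local_nbh l W" for W x
    using vertex_acc_bounds[where f = f, OF that rooted_rep \<epsilon> K(1)] by blast+
  have int: "integrable \<rho> (?a W)" if "local_nbh l W" for W
    by (rule integrable_loc[OF loc_vertex_acc[OF that], of _ _ _ "K\<^sup>2"])
      (use vertex_acc_bounds[OF that _ \<epsilon> K(1), where Q = Q] in \<open>simp add: abs_le_iff\<close>)
  have inti: "integrable \<rho> (\<lambda>x. ?i (rep_gstar x))"
  proof (rule integrable_loc[of l _ 1])
    show "loc l ?i" by (rule loc_comp[OF loc_card_ball, where k = "\<lambda>k. of_bool (k > cap l)"])
  qed simp
  have "\<bar>lim_acc (capped l (cap l)) \<epsilon> - lim_acc (ball_verts l) \<epsilon>\<bar> = \<bar>\<integral>x. ?a (capped l (cap l)) x - ?a (ball_verts l) x \<partial>\<rho>\<bar>"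
    unfolding lim_acc_def by (subst Bochner_Integration.integral_diff[OF int[OF local_nbh_capped] int[OF local_nbh_ball]]) simp
  also have "\<dots> \<le> (\<integral>x. \<bar>?a (capped l (cap l)) x - ?a (ball_verts l) x\<bar> \<partial>\<rho>)" by (rule integral_abs_bound)
  also have "\<dots> \<le> (\<integral>x. K\<^sup>2 * ?i (rep_gstar x) \<partial>\<rho>)"
  proof (rule integral_mono)
    fix x
    show "\<bar>?a (capped l (cap l)) x - ?a (ball_verts l) x\<bar> \<le> K\<^sup>2 * ?i (rep_gstar x)"
    proof (cases "card (ball_verts l (rep_gstar x)) > cap l")
      case True
      then show ?thesis using b[OF local_nbh_capped, of "cap l" x] b[OF local_nbh_ball, of x] by (simp add: abs_le_iff)
    next
      case False
      then have "capped l (cap l) (rep_gstar x) = ball_verts l (rep_gstar x)" by (simp add: capped_def)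
      then show ?thesis by (simp add: vertex_acc_def)
    qed
  qed (use int[OF local_nbh_capped] int[OF local_nbh_ball] inti in auto)
  also have "\<dots> = (\<integral>x. K\<^sup>2 * indicator {x. card (ball_verts l (rep_gstar x)) > cap l} x \<partial>\<rho>)"
    by (intro Bochner_Integration.integral_cong) (simp_all add: indicator_def)
  also have "\<dots> = K\<^sup>2 * prob {x. card (ball_verts l (rep_gstar x)) > cap l}" by (simp add: space_rho)
  also have "\<dots> \<le> K\<^sup>2 * (1 / (real l + 1))" by (intro mult_left_mono less_imp_le[OF cap(2)]) simp
  finally show ?thesis by simp
qed

lemma capped_tendsto:
  assumes \<epsilon>: "0 \<le> \<epsilon>" "\<epsilon> \<le> 1"
  shows "(\<lambda>l. lim_acc (capped l (cap l)) \<epsilon>) \<longlonglongrightarrow> lim_acc_inf \<epsilon>"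
proof -
  have "(\<lambda>l. K\<^sup>2 * inverse (real (Suc l))) \<longlonglongrightarrow> K\<^sup>2 * 0"
    by (intro tendsto_mult_left LIMSEQ_inverse_real_of_nat)
  then have z: "(\<lambda>l. K\<^sup>2 / (real l + 1)) \<longlonglongrightarrow> 0" by (simp add: divide_inverse add.commute)
  have "(\<lambda>l. lim_acc (capped l (cap l)) \<epsilon> - lim_acc (ball_verts l) \<epsilon>) \<longlonglongrightarrow> 0"
    by (rule Lim_null_comparison[OF _ z]) (simp add: capped_close[OF \<epsilon>])
  from tendsto_add[OF this lim_acc_tendsto[OF \<epsilon>]] show ?thesis by simp
qed

subsection \<open>The Bayes risk\<close>

text \<open>The finite volume bound is applied with regions inside balls of radius \<open>R\<close>; a region that contains \<open>u\<close> is then inside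
  the ball of radius \<open>2 R\<close> around \<open>u\<close>. Of the total error \<open>c\<close>, one quarter pays for replacing \<open>\<epsilon>'\<close> by \<open>\<epsilon>\<close>, one for the terms
  that vanish with \<open>n\<close>, one for \<open>t\<close>, and one eighth each for the vertices receiving little mass and for the boundaries.\<close>

lemma pair_acc_upper:
  assumes \<epsilon>: "0 \<le> \<epsilon>"
    and right: "\<And>c. 0 < c \<Longrightarrow> \<exists>\<epsilon>'. \<epsilon> < \<epsilon>' \<and> \<epsilon>' \<le> 1 \<and> lim_acc_inf \<epsilon>' \<le> lim_acc_inf \<epsilon> + c"
    and c: "0 < c"
  shows "eventually (\<lambda>n. pacc n \<epsilon> \<le> (lim_acc_inf \<epsilon>)\<^sup>2 + c) sequentially"
proof -
  define q where "q = lim_acc_inf \<epsilon>"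
  have \<epsilon>1: "\<epsilon> \<le> 1" using right[of 1] by auto
  have q0: "0 \<le> q" unfolding q_def by (rule lim_acc_inf_nonneg[OF \<epsilon> \<epsilon>1])
  \<comment> \<open>Chosen such that \<open>(q + c1)\<^sup>2 \<le> q\<^sup>2 + c / 4\<close>.\<close>
  define c1 where "c1 = min 1 (c / (4 * (2 * q + 1)))"
  have c1: "0 < c1" "c1 \<le> 1" "(2 * q + 1) * c1 \<le> c / 4"
  proof -
    show "0 < c1" "c1 \<le> 1" using c q0 by (simp_all add: c1_def)
    define m where "m = 2 * q + 1"
    have m: "0 < m" using q0 by (simp add: m_def)
    have "m * c1 \<le> m * (c / (4 * m))"
      using m by (intro mult_left_mono) (auto simp: c1_def m_def)
    then show "(2 * q + 1) * c1 \<le> c / 4" using m by (simp add: m_def[symmetric])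
  qed
  obtain \<epsilon>' where \<epsilon>': "\<epsilon> < \<epsilon>'" "\<epsilon>' \<le> 1" and q': "lim_acc_inf \<epsilon>' \<le> q + c1"
    using right[OF c1(1)] by (auto simp: q_def)
  have \<epsilon>'0: "0 \<le> \<epsilon>'" using \<epsilon> \<epsilon>' by simp
  have K0: "0 < K" using K(2) by simp
  define t where "t = c / (24 * K ^ 3)"
  have t: "0 < t" "6 * K ^ 3 * t = c / 4" using c K0 by (simp_all add: t_def)
  define a where "a = 2 * K ^ 3 / t"
  have a: "0 < a" using t K0 by (simp add: a_def)
  define \<eta> where "\<eta> = c / (16 * a * K\<^sup>2)"
  have \<eta>: "0 < \<eta>" "a * (2 * K\<^sup>2 * \<eta>) = c / 8" using a c K0 by (simp_all add: \<eta>_def)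
  obtain \<delta> where \<delta>: "0 < \<delta>" and regions: "\<And>\<kappa>. 0 < \<kappa> \<Longrightarrow> \<exists>R. eventually (\<lambda>n. \<exists>S.
     (\<forall>r<n. r \<in> S r \<and> S r \<subseteq> ball_verts R (gr E n r)) \<and>
     real (card {u \<in> {..<n}. (\<Sum>r<n. of_bool (u \<in> S r) / real (card (S r))) \<le> \<delta>}) / n \<le> \<eta> \<and>
     (\<Sum>r<n. real (card (boundary (gr E n r) (S r))) / real (card (S r))) / n \<le> \<kappa>) sequentially"
    using finite_graph_regions[OF tame \<eta>(1)] by blast
  define D where "D = 2 * finite_model.fnorm f * ln CARD('x) / \<delta>"
  have D0: "0 \<le> D"
  proof -
    interpret finite_model Q f "{..<1}" "E 1" K by (rule model) simp
    have "0 \<le> fnorm" unfolding fnorm_def by (intro mult_nonneg_nonneg sum_nonneg) auto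
    moreover have "0 \<le> ln (real CARD('x))" using zero_less_card_finite[where 'a = 'x] by (intro ln_ge_zero) simp
    ultimately show ?thesis using \<delta> by (simp add: D_def)
  qed
  define \<kappa> where "\<kappa> = c * (\<epsilon>' - \<epsilon>) / (8 * a * (D + 1))"
  have \<kappa>: "0 < \<kappa>" "a * (D * \<kappa> / (\<epsilon>' - \<epsilon>)) \<le> c / 8"
  proof -
    show "0 < \<kappa>" using a c D0 \<epsilon>' by (simp add: \<kappa>_def)
    have "a * (D * \<kappa> / (\<epsilon>' - \<epsilon>)) = c / 8 * (D / (D + 1))"
    proof -
      define s m where "s = \<epsilon>' - \<epsilon>" and "m = D + 1"
      have "s \<noteq> 0" "m \<noteq> 0" "a \<noteq> 0" using a D0 \<epsilon>' by (auto simp: s_def m_def)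
      then show ?thesis unfolding \<kappa>_def s_def[symmetric] m_def[symmetric] by (simp add: field_simps)
    qed
    also have "\<dots> \<le> c / 8 * 1" using c D0 by (intro mult_left_mono) auto
    finally show "a * (D * \<kappa> / (\<epsilon>' - \<epsilon>)) \<le> c / 8" by simp
  qed
  obtain R where R: "eventually (\<lambda>n. \<exists>S.
     (\<forall>r<n. r \<in> S r \<and> S r \<subseteq> ball_verts R (gr E n r)) \<and>
     real (card {u \<in> {..<n}. (\<Sum>r<n. of_bool (u \<in> S r) / real (card (S r))) \<le> \<delta>}) / n \<le> \<eta> \<and>
     (\<Sum>r<n. real (card (boundary (gr E n r) (S r))) / real (card (S r))) / n \<le> \<kappa>) sequentially"
    using regions[OF \<kappa>(1)] by blast
  let ?B = "nb (ball_verts (2 * R))"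
  define X where "X n = (avg (ball_verts (2 * R)) n \<epsilon>')\<^sup>2 + K ^ 4 * (finite_model.overlaps {..<n} (?B n) / (real n)\<^sup>2)
     + a * (K ^ 4 / (\<epsilon>' - \<epsilon>)) * (1 / real n)" for n
  have "X \<longlonglongrightarrow> (lim_acc (ball_verts (2 * R)) \<epsilon>')\<^sup>2 + K ^ 4 * 0 + a * (K ^ 4 / (\<epsilon>' - \<epsilon>)) * 0"
    unfolding X_def[abs_def]
    by (intro tendsto_add tendsto_mult tendsto_power tendsto_const avg_tendsto[OF local_nbh_ball \<epsilon>'0 \<epsilon>'(2)]
        overlaps_tendsto[OF local_nbh_ball] lim_const_over_n)
  moreover have "(lim_acc (ball_verts (2 * R)) \<epsilon>')\<^sup>2 < q\<^sup>2 + c / 2"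
  proof -
    have "lim_acc (ball_verts (2 * R)) \<epsilon>' \<le> q + c1" using lim_acc_le_inf[OF \<epsilon>'0 \<epsilon>'(2)] q' order.trans by blast
    then have "(lim_acc (ball_verts (2 * R)) \<epsilon>')\<^sup>2 \<le> (q + c1)\<^sup>2"
      by (rule power_mono) (rule lim_acc_bounds(1)[OF local_nbh_ball \<epsilon>'0 \<epsilon>'(2)])
    also have "\<dots> = q\<^sup>2 + 2 * q * c1 + c1 * c1" by (simp add: power2_eq_square algebra_simps)
    also have "\<dots> \<le> q\<^sup>2 + 2 * q * c1 + 1 * c1" using c1 by (intro add_left_mono mult_right_mono) auto
    also have "\<dots> = q\<^sup>2 + (2 * q + 1) * c1" by (simp add: algebra_simps)
    finally show ?thesis using c1(3) c by linarith
  qed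
  ultimately have "eventually (\<lambda>n. X n < q\<^sup>2 + c / 2) sequentially"
    by (intro order_tendstoD(2)) auto
  then show ?thesis
    using R eventually_ge_at_top[of 1]
  proof eventually_elim
    case (elim n)
    have n: "1 \<le> n" using elim by simp
    interpret finite_model Q f "{..<n}" "E n" K by (rule model[OF n])
    obtain S where S: "\<And>r. r < n \<Longrightarrow> r \<in> S r" "\<And>r. r < n \<Longrightarrow> S r \<subseteq> ball_verts R (gr E n r)"
      and few: "real (card {u \<in> {..<n}. (\<Sum>r<n. of_bool (u \<in> S r) / real (card (S r))) \<le> \<delta>}) / n \<le> \<eta>"
      and bdry: "(\<Sum>r<n. real (card (boundary (gr E n r) (S r))) / real (card (S r))) / n \<le> \<kappa>"
      using elim(2) by blast
    define p where "p = real (card {u \<in> {..<n}. (\<Sum>r<n. of_bool (u \<in> S r) / real (card (S r))) \<le> \<delta>}) / n"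
    define b where "b = (\<Sum>r<n. real (card (boundary (gr E n r) (S r))) / real (card (S r))) / n"
    have sub: "S r \<subseteq> ?B n u" if r: "r < n" and u: "u \<in> S r" for r u
    proof -
      have "u \<in> ball_verts R (reroot (gr E n u) r)" using S(2)[OF r] u by (auto simp: reroot_def)
      then have "r \<in> ball_verts R (gr E n u)" using ball_reroot_sym[of "gr E n u" R r] by simp
      then have "ball_verts R (reroot (gr E n u) r) \<subseteq> ball_verts (2 * R) (gr E n u)"
        by (rule ball_reroot_subset) simp
      then show ?thesis using S(2)[OF r] by (auto simp: reroot_def nb_def)
    qed
    have SV: "S r \<subseteq> {..<n}" if "r < n" for r
      using S(2)[OF that] ball_verts_subset[OF rooted_gr[OF that], of R] by auto
    have "pair_acc \<epsilon> \<le> ((\<Sum>u\<in>{..<n}. lacc (?B n) \<epsilon>' u) / real (card {..<n}))\<^sup>2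
     + K ^ 4 * overlaps (?B n) / (real (card {..<n}))\<^sup>2 + 6 * K ^ 3 * t
     + 2 * K ^ 3 / t * (2 * K\<^sup>2 * (card {u \<in> {..<n}. received S u \<le> \<delta>} / real (card {..<n}))
        + (K ^ 4 / real (card {..<n}) + 2 * fnorm * ln CARD('x) / \<delta> * ((\<Sum>r\<in>{..<n}. card (bd (S r)) / card (S r)) / real (card {..<n}))) / (\<epsilon>' - \<epsilon>))"
      by (rule finite_volume_bound) (use nb_props[OF local_nbh_ball] S(1) SV sub \<epsilon> \<epsilon>' t(1) \<delta> in auto)
    moreover have "card {u \<in> {..<n}. received S u \<le> \<delta>} / real (card {..<n}) = p"
    proof -
      have "received S u = (\<Sum>r<n. of_bool (u \<in> S r) / real (card (S r)))" for u
        by (rule received_def[where B = "?B n"]) (use nb_props[OF local_nbh_ball] S(1) SV sub in auto)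
      then show ?thesis by (simp add: p_def)
    qed
    moreover have "(\<Sum>r\<in>{..<n}. card (bd (S r)) / card (S r)) / real (card {..<n}) = b"
      by (simp add: b_def bd_def boundary_def)
    ultimately have "pair_acc \<epsilon> \<le> (avg (ball_verts (2 * R)) n \<epsilon>')\<^sup>2 + K ^ 4 * overlaps (?B n) / (real n)\<^sup>2 + c / 4
       + a * (2 * K\<^sup>2 * p + (K ^ 4 / real n + D * b) / (\<epsilon>' - \<epsilon>))"
      by (simp only: avg_def card_lessThan t(2) a_def[symmetric] D_def[symmetric])
    also have "\<dots> = X n + c / 4 + a * (2 * K\<^sup>2 * p) + a * (D * b / (\<epsilon>' - \<epsilon>))"
      by (simp add: X_def distrib_left add_divide_distrib)
    also have "\<dots> \<le> X n + c / 4 + c / 8 + c / 8"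
    proof (intro add_mono order.refl)
      have "a * (2 * K\<^sup>2 * p) \<le> a * (2 * K\<^sup>2 * \<eta>)"
        using few a by (intro mult_left_mono) (auto simp: p_def)
      then show "a * (2 * K\<^sup>2 * p) \<le> c / 8" using \<eta>(2) by simp
      have "a * (D * b / (\<epsilon>' - \<epsilon>)) \<le> a * (D * \<kappa> / (\<epsilon>' - \<epsilon>))"
        using bdry a D0 \<epsilon>' by (intro mult_left_mono divide_right_mono) (auto simp: b_def)
      then show "a * (D * b / (\<epsilon>' - \<epsilon>)) \<le> c / 8" using \<kappa>(2) by (rule order.trans)
    qed
    also have "\<dots> \<le> q\<^sup>2 + c" using elim(1) by simp
    finally show ?case by (simp add: q_def)
  qed
qed

text \<open>The lower bound is the preceding lemma. For the upper bound, the Bayes risk is compared with the risk of a local estimator with a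
  large radius.\<close>

lemma bayes_risk_tendsto:
  assumes \<epsilon>: "0 \<le> \<epsilon>" "\<epsilon> \<le> 1"
    and right: "\<And>c. 0 < c \<Longrightarrow> \<exists>\<epsilon>'. \<epsilon> < \<epsilon>' \<and> \<epsilon>' \<le> 1 \<and> lim_acc_inf \<epsilon>' \<le> lim_acc_inf \<epsilon> + c"
  shows "(\<lambda>n. bayes_risk Q f \<epsilon> n (E n)) \<longlonglongrightarrow> s2\<^sup>2 - (lim_acc_inf \<epsilon>)\<^sup>2"
proof (rule order_tendstoI)
  fix y assume y: "y < s2\<^sup>2 - (lim_acc_inf \<epsilon>)\<^sup>2"
  define c where "c = (s2\<^sup>2 - (lim_acc_inf \<epsilon>)\<^sup>2 - y) / 2"
  have c: "0 < c" using y by (simp add: c_def)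
  have "eventually (\<lambda>n. pacc n \<epsilon> \<le> (lim_acc_inf \<epsilon>)\<^sup>2 + c) sequentially"
    by (rule pair_acc_upper[OF \<epsilon>(1)], erule right, rule c)
  then show "eventually (\<lambda>n. y < bayes_risk Q f \<epsilon> n (E n)) sequentially"
    using eventually_ge_at_top[of 1]
  proof eventually_elim
    case (elim n)
    have "2 * c = s2\<^sup>2 - (lim_acc_inf \<epsilon>)\<^sup>2 - y" unfolding c_def by simp
    then show ?case using bayes_bounds(1)[OF elim(2) \<epsilon>] elim(1) c by linarith
  qed
next
  fix y assume y: "s2\<^sup>2 - (lim_acc_inf \<epsilon>)\<^sup>2 < y"
  have "(\<lambda>l. s2\<^sup>2 - (lim_acc (ball_verts l) \<epsilon>)\<^sup>2) \<longlonglongrightarrow> s2\<^sup>2 - (lim_acc_inf \<epsilon>)\<^sup>2"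
    by (intro tendsto_intros lim_acc_tendsto \<epsilon>)
  from order_tendstoD(2)[OF this y] obtain l where l: "s2\<^sup>2 - (lim_acc (ball_verts l) \<epsilon>)\<^sup>2 < y"
    by (auto simp: eventually_sequentially)
  from order_tendstoD(2)[OF local_risk_tendsto[OF local_nbh_ball \<epsilon>] l] eventually_ge_at_top[of 1]
  show "eventually (\<lambda>n. bayes_risk Q f \<epsilon> n (E n) < y) sequentially"
  proof eventually_elim
    case (elim n)
    then show ?case using bayes_bounds(2)[OF elim(2) \<epsilon>, of "local_est (ball_verts l) n"] by linarith
  qed
qed

text \<open>A monotone function has at most countably many discontinuities.\<close>

lemma right_continuity_points:
  "AE \<epsilon> in lborel. 0 < \<epsilon> \<and> \<epsilon> \<le> 1 \<longrightarrow>
     (\<forall>c>0. \<exists>\<epsilon>'. \<epsilon> < \<epsilon>' \<and> \<epsilon>' \<le> 1 \<and> lim_acc_inf \<epsilon>' \<le> lim_acc_inf \<epsilon> + c)"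
proof -
  define N where "N = insert 1 {\<epsilon> \<in> {0..1}. \<not> continuous (at \<epsilon> within {0..1}) lim_acc_inf}"
  have "countable N" unfolding N_def using mono_on_ctble_discont[OF lim_acc_inf_mono] by simp
  then have "N \<in> null_sets lborel" by (rule countable_imp_null_set_lborel)
  then have "AE \<epsilon> in lborel. \<epsilon> \<notin> N" by (rule AE_not_in)
  then show ?thesis
  proof (rule eventually_mono, intro impI allI)
    fix \<epsilon> c :: real assume N: "\<epsilon> \<notin> N" and \<epsilon>: "0 < \<epsilon> \<and> \<epsilon> \<le> 1" and c: "0 < c"
    then have "continuous (at \<epsilon> within {0..1}) lim_acc_inf" by (auto simp: N_def)
    then obtain d where d: "0 < d" and near: "\<And>x. x \<in> {0..1} \<Longrightarrow> dist x \<epsilon> < d \<Longrightarrow> dist (lim_acc_inf x) (lim_acc_inf \<epsilon>) < c"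
      using c unfolding continuous_within_eps_delta by blast
    define \<epsilon>' where "\<epsilon>' = min 1 (\<epsilon> + d / 2)"
    have "\<epsilon> < \<epsilon>'" "\<epsilon>' \<le> 1" using N \<epsilon> d by (auto simp: \<epsilon>'_def N_def)
    moreover have "\<bar>lim_acc_inf \<epsilon>' - lim_acc_inf \<epsilon>\<bar> < c"
    proof -
      have "\<epsilon>' \<le> \<epsilon> + d / 2" by (simp add: \<epsilon>'_def)
      then have "dist \<epsilon>' \<epsilon> < d" using \<open>\<epsilon> < \<epsilon>'\<close> d by (simp add: dist_real_def)
      then show ?thesis using near[of \<epsilon>'] \<epsilon> \<open>\<epsilon> < \<epsilon>'\<close> \<open>\<epsilon>' \<le> 1\<close> by (simp add: dist_real_def)
    qed
    then have "lim_acc_inf \<epsilon>' \<le> lim_acc_inf \<epsilon> + c" by linarith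
    ultimately show "\<exists>\<epsilon>'. \<epsilon> < \<epsilon>' \<and> \<epsilon>' \<le> 1 \<and> lim_acc_inf \<epsilon>' \<le> lim_acc_inf \<epsilon> + c" by blast
  qed
qed

theorem local_estimators_optimal:
  "AE \<epsilon> in lborel. 0 < \<epsilon> \<and> \<epsilon> \<le> 1 \<longrightarrow>
     (\<exists>L. (\<forall>l. (\<lambda>n. risk Q f \<epsilon> n (E n) (local_est (capped l (cap l)) n) - bayes_risk Q f \<epsilon> n (E n)) \<longlonglongrightarrow> L l) \<and> L \<longlonglongrightarrow> 0)"
  using right_continuity_points
proof (rule eventually_mono, intro impI)
  fix \<epsilon> :: real
  assume right: "0 < \<epsilon> \<and> \<epsilon> \<le> 1 \<longrightarrow> (\<forall>c>0. \<exists>\<epsilon>'. \<epsilon> < \<epsilon>' \<and> \<epsilon>' \<le> 1 \<and> lim_acc_inf \<epsilon>' \<le> lim_acc_inf \<epsilon> + c)"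
    and "0 < \<epsilon> \<and> \<epsilon> \<le> 1"
  then have \<epsilon>: "0 \<le> \<epsilon>" "\<epsilon> \<le> 1" and right: "\<And>c. 0 < c \<Longrightarrow> \<exists>\<epsilon>'. \<epsilon> < \<epsilon>' \<and> \<epsilon>' \<le> 1 \<and> lim_acc_inf \<epsilon>' \<le> lim_acc_inf \<epsilon> + c"
    by auto
  have bayes: "(\<lambda>n. bayes_risk Q f \<epsilon> n (E n)) \<longlonglongrightarrow> s2\<^sup>2 - (lim_acc_inf \<epsilon>)\<^sup>2"
    by (rule bayes_risk_tendsto[OF \<epsilon>], erule right)
  define L where "L l = (s2\<^sup>2 - (lim_acc (capped l (cap l)) \<epsilon>)\<^sup>2) - (s2\<^sup>2 - (lim_acc_inf \<epsilon>)\<^sup>2)" for l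
  have "(\<lambda>n. risk Q f \<epsilon> n (E n) (local_est (capped l (cap l)) n) - bayes_risk Q f \<epsilon> n (E n)) \<longlonglongrightarrow> L l" for l
    unfolding L_def by (intro tendsto_diff local_risk_tendsto[OF local_nbh_capped \<epsilon>] bayes)
  moreover have "L \<longlonglongrightarrow> (s2\<^sup>2 - (lim_acc_inf \<epsilon>)\<^sup>2) - (s2\<^sup>2 - (lim_acc_inf \<epsilon>)\<^sup>2)"
    unfolding L_def[abs_def] by (intro tendsto_intros capped_tendsto \<epsilon>)
  ultimately show "\<exists>L. (\<forall>l. (\<lambda>n. risk Q f \<epsilon> n (E n) (local_est (capped l (cap l)) n) - bayes_risk Q f \<epsilon> n (E n)) \<longlonglongrightarrow> L l) \<and> L \<longlonglongrightarrow> 0"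
    by auto
qed

end

theorem theoremA:
  fixes Q :: "'x::finite \<Rightarrow> 'x \<Rightarrow> 'y::finite pmf"
    and f :: "'x \<Rightarrow> real"
    and E :: "nat \<Rightarrow> (nat \<times> nat) set"
    and \<rho> :: "gstar measure"
  assumes "measure_pmf.expectation (pmf_of_set UNIV) f = 0"
    and "\<And>n. n \<ge> 1 \<Longrightarrow> graph {..<n} (E n)"
    and "prob_space \<rho>" and "sets \<rho> = sets borel"
    and "locally_weakly_converges E \<rho>"
    and "AE g in \<rho>. infinite (verts (rep_gstar g))"
    and "AE g in \<rho>. anchored_amenable (rep_gstar g)"
    and "tame \<rho>"
  shows "\<exists>Xhat :: nat \<Rightarrow> nat \<Rightarrow> ('x, 'y) estimator.
    (\<forall>l. quadratic_time Q f E (Xhat l)) \<and>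
    (AE \<epsilon> in lborel. 0 < \<epsilon> \<and> \<epsilon> \<le> 1 \<longrightarrow>
      (\<exists>L. (\<forall>l. (\<lambda>n. risk Q f \<epsilon> n (E n) (Xhat l n) - bayes_risk Q f \<epsilon> n (E n)) \<longlonglongrightarrow> L l)
           \<and> L \<longlonglongrightarrow> 0))"
proof -
  have "weak_limit E \<rho>" by (intro weak_limit.intro assms)
  then interpret estimation E \<rho> Q f
    by (intro estimation.intro estimation_axioms.intro assms)
  have "quadratic_time Q f E (local_est (capped l (cap l)))" for l
    using quadratic_time_capped[OF graphs cap(1), where Q = Q and f = f]
    unfolding local_est_def[abs_def] nb_def[abs_def] .
  then show ?thesis
    using local_estimators_optimal by (intro exI[of _ "\<lambda>l. local_est (capped l (cap l))"]) simp
qed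

end
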